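(* Let $\Omega\subset\mathbb{R}^N$ be a bounded domain with Lipschitz boundary, let $1<q<p<N$, let $T:W_0^{1,p}(\Omega)\to W^{1,p}(\Omega)$ be a continuous map, and let $f:\Omega\times\mathbb{R}\times\mathbb{R}^N\to\mathbb{R}$ be a Carathéodory function. Assume: (1) There exist constants $a_1\ge 0$, $a_2\ge 0$, $\alpha\in(0,p^*-1)$, $\beta\in\left(0,\frac{p}{(p^* )'}\right)$ and a function $\sigma\in L^{r'}(\Omega)$ with $r\in[1,p^* )$ such that $|f(x,s,\xi)|\le \sigma(x)+a_1|s|^\alpha+a_2|\xi|^\beta$ for almost all $x\in\Omega$, all $s\in\mathbb{R}$ and all $\xi\in\mathbb{R}^N$. (2) There exist constants $K_1,K_2,K_3\ge 0$ with $a_1K_1S_{\frac{p^*}{p^*-\alpha}}+a_2K_2S_{\frac{p}{p-\beta}}<1$ such that $\|T(u)\|_{p^*}^\alpha\le K_1\|\nabla u\|_p^{p-1}+K_3$ and $\|\nabla T(u)\|_p^\beta\le K_2\|\nabla u\|_p^{p-1}+K_3$ for all $u\in W_0^{1,p}(\Omega)$. Then there exists a strong generalized solution $u\in W_0^{1,p}(\Omega)$ to the Dirichlet problem $-\Delta_p u+\Delta_q u=f(x,T(u),\nabla T(u))$ in $\Omega$, $u=0$ on $\partial\Omega$; that is, there exist $u\in W_0^{1,p}(\Omega)$ and a sequence $\{u_n\}_{n\in\mathbb{N}}$ in $W_0^{1,p}(\Omega)$ such that (a) $u_n\rightharpoonup u$ weakly in $W_0^{1,p}(\Omega)$ as $n\to\infty$;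 (b) $-\Delta_p u_n+\Delta_q u_n-f(\cdot,T(u_n)(\cdot),\nabla T(u_n)(\cdot))\rightharpoonup 0$ weakly in $W^{-1,p'}(\Omega)$ as $n\to\infty$; (c) $\lim_{n\to\infty}\langle-\Delta_p u_n+\Delta_q u_n,u_n-u\rangle=0$.
   Context: For $r\in(1,+\infty)$, $r'=r/(r-1)$ (and $r'=\infty$ if $r=1$). $p^*=\frac{Np}{N-p}$. $\|\cdot\|_r$ is the norm of $L^r(\Omega)$, and $W_0^{1,p}(\Omega)$ carries the norm $\|u\|=\|\nabla u\|_p$. For $1\le r\le p^*$, $S_r$ denotes a positive constant such that $\|u\|_r\le S_r\|\nabla u\|_p$ for all $u\in W_0^{1,p}(\Omega)$ (Sobolev embedding constant). A Carathéodory function $f(x,s,\xi)$ is measurable in $x$ and continuous in $(s,\xi)$. $W^{-1,p'}(\Omega)$ is the dual of $W_0^{1,p}(\Omega)$ with duality pairing $\langle\cdot,\cdot\rangle$. The operators are $\langle-\Delta_p u,v\rangle=\int_\Omega|\nabla u|^{p-2}\nabla u\cdot\nabla v\,dx$ and $\langle\Delta_q u,v\rangle=-\int_\Omega|\nabla u|^{q-2}\nabla u\cdot\nabla v\,dx$; since $q<p$, $-\Delta_p+\Delta_q:W_0^{1,p}(\Omega)\to W^{-1,p'}(\Omega)$ is well defined. The function $f(\cdot,T(u),\nabla T(u))$ is regarded as the element $v\mapsto\int_\Omega f(x,T(u),\nabla T(u))\,v\,dx$ of $W^{-1,p'}(\Omega)$. *)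

theory Defs
  imports "HOL-Analysis.Analysis" "HOL-Probability.Essential_Supremum"
begin

(* Elements of Lebesgue and Sobolev spaces are represented by functions on the whole space, of
   which only the values on Omega up to null sets matter; accordingly the "norms" below are
   seminorms on representatives.  A map that is continuous for these seminorms automatically
   respects almost-everywhere equality. *)

section \<open>Lebesgue spaces\<close>

text \<open>Power with a positive real exponent on $[0,\infty]$.\<close>

definition ennreal_powr :: "ennreal \<Rightarrow> real \<Rightarrow> ennreal" where
  "ennreal_powr x a = (if x = top then top else ennreal (enn2real x powr a))"

text \<open>The norm is $[0,\infty]$-valued, so that an upper bound on it by a finite quantity includes
  membership in the space.\<close>

definition Lnorm :: "'a::euclidean_space set \<Rightarrow> ereal \<Rightarrow> ('a \<Rightarrow> 'b::euclidean_space) \<Rightarrow> ennreal" where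
  "Lnorm \<Omega> r u =
     (if r = \<infinity> then esssup (lebesgue_on \<Omega>) (\<lambda>x. ennreal (norm (u x)))
      else ennreal_powr (\<integral>\<^sup>+ x. ennreal (norm (u x) powr real_of_ereal r) \<partial>lebesgue_on \<Omega>)
             (1 / real_of_ereal r))"

definition Lspace :: "'a::euclidean_space set \<Rightarrow> ereal \<Rightarrow> ('a \<Rightarrow> 'b::euclidean_space) set" where
  "Lspace \<Omega> r = {u \<in> borel_measurable (lebesgue_on \<Omega>). Lnorm \<Omega> r u < top}"

definition conj_exp :: "real \<Rightarrow> ereal" where
  "conj_exp r = (if r = 1 then \<infinity> else ereal (r / (r - 1)))"

definition crit_exp :: "real \<Rightarrow> real \<Rightarrow> real" where
  "crit_exp N p = N * p / (N - p)"


section \<open>Domains and test functions\<close>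

text \<open>Near each boundary point the set is, in coordinates with vertical direction \<open>e\<close>, the strict
  epigraph of a Lipschitz function \<open>h\<close> on the hyperplane orthogonal to \<open>e\<close>.\<close>

definition lipschitz_boundary :: "'a::euclidean_space set \<Rightarrow> bool" where
  "lipschitz_boundary \<Omega> \<longleftrightarrow>
     (\<forall>x\<in>frontier \<Omega>. \<exists>\<rho>>0. \<exists>e h L. norm e = 1 \<and> L-lipschitz_on {y. y \<bullet> e = 0} (h :: 'a \<Rightarrow> real) \<and>
        \<Omega> \<inter> ball x \<rho> = {y \<in> ball x \<rho>. h (y - (y \<bullet> e) *\<^sub>R e) < y \<bullet> e})"

definition bounded_lipschitz_domain :: "'a::euclidean_space set \<Rightarrow> bool" where
  "bounded_lipschitz_domain \<Omega> \<longleftrightarrow>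
     open \<Omega> \<and> connected \<Omega> \<and> \<Omega> \<noteq> {} \<and> bounded \<Omega> \<and> lipschitz_boundary \<Omega>"

fun iter_partial :: "'a::euclidean_space list \<Rightarrow> ('a \<Rightarrow> real) \<Rightarrow> 'a \<Rightarrow> real" where
  "iter_partial [] \<phi> = \<phi>"
| "iter_partial (i # is) \<phi> = (\<lambda>x. frechet_derivative (iter_partial is \<phi>) (at x) i)"

text \<open>Differentiability of all iterated partial derivatives is the same as $C^\infty$: each of
  them is then also continuous.\<close>

definition smooth_fun :: "('a::euclidean_space \<Rightarrow> real) \<Rightarrow> bool" where
  "smooth_fun \<phi> \<longleftrightarrow>
     (\<forall>is. set is \<subseteq> Basis \<longrightarrow> (\<forall>x. iter_partial is \<phi> differentiable (at x)))"

definition test_functions :: "'a::euclidean_space set \<Rightarrow> ('a \<Rightarrow> real) set" where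
  "test_functions \<Omega> =
     {\<phi>. smooth_fun \<phi> \<and> compact (closure {x. \<phi> x \<noteq> 0}) \<and> closure {x. \<phi> x \<noteq> 0} \<subseteq> \<Omega>}"


section \<open>Sobolev spaces\<close>

definition locally_integrable :: "'a::euclidean_space set \<Rightarrow> ('a \<Rightarrow> 'b::euclidean_space) \<Rightarrow> bool" where
  "locally_integrable \<Omega> u \<longleftrightarrow> (\<forall>K. compact K \<and> K \<subseteq> \<Omega> \<longrightarrow> integrable (lebesgue_on K) u)"

definition is_weak_gradient :: "'a::euclidean_space set \<Rightarrow> ('a \<Rightarrow> real) \<Rightarrow> ('a \<Rightarrow> 'a) \<Rightarrow> bool" where
  "is_weak_gradient \<Omega> u g \<longleftrightarrow> locally_integrable \<Omega> u \<and> locally_integrable \<Omega> g \<and>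
     (\<forall>\<phi>\<in>test_functions \<Omega>. \<forall>i\<in>Basis.
        (LINT x|lebesgue_on \<Omega>. u x * frechet_derivative \<phi> (at x) i) =
        - (LINT x|lebesgue_on \<Omega>. (g x \<bullet> i) * \<phi> x))"

text \<open>A representative of the weak gradient, which is unique up to null sets.\<close>

definition wgrad :: "'a::euclidean_space set \<Rightarrow> ('a \<Rightarrow> real) \<Rightarrow> 'a \<Rightarrow> 'a" where
  "wgrad \<Omega> u = (SOME g. is_weak_gradient \<Omega> u g)"

definition W1 :: "'a::euclidean_space set \<Rightarrow> real \<Rightarrow> ('a \<Rightarrow> real) set" where
  "W1 \<Omega> p = {u \<in> Lspace \<Omega> p. \<exists>g\<in>Lspace \<Omega> p. is_weak_gradient \<Omega> u g}"

definition W1_norm :: "'a::euclidean_space set \<Rightarrow> real \<Rightarrow> ('a \<Rightarrow> real) \<Rightarrow> real" where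
  "W1_norm \<Omega> p u = enn2real (Lnorm \<Omega> p u) + enn2real (Lnorm \<Omega> p (wgrad \<Omega> u))"

definition W10 :: "'a::euclidean_space set \<Rightarrow> real \<Rightarrow> ('a \<Rightarrow> real) set" where
  "W10 \<Omega> p = {u \<in> W1 \<Omega> p. \<exists>\<phi>. (\<forall>n::nat. \<phi> n \<in> test_functions \<Omega>) \<and>
                 (\<lambda>n. W1_norm \<Omega> p (\<lambda>x. \<phi> n x - u x)) \<longlonglongrightarrow> 0}"

definition W10_norm :: "'a::euclidean_space set \<Rightarrow> real \<Rightarrow> ('a \<Rightarrow> real) \<Rightarrow> real" where
  "W10_norm \<Omega> p u = enn2real (Lnorm \<Omega> p (wgrad \<Omega> u))"

text \<open>A choice of constants for all embeddings of $W_0^{1,p}$ into $L^r$, $1 \le r \le p^*$.\<close>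

definition sobolev_constants :: "'a::euclidean_space set \<Rightarrow> real \<Rightarrow> (real \<Rightarrow> real) \<Rightarrow> bool" where
  "sobolev_constants \<Omega> p S \<longleftrightarrow>
     (\<forall>r. 1 \<le> r \<and> r \<le> crit_exp (real DIM('a)) p \<longrightarrow>
        S r > 0 \<and> (\<forall>u\<in>W10 \<Omega> p. Lnorm \<Omega> r u \<le> ennreal (S r) * Lnorm \<Omega> p (wgrad \<Omega> u)))"


section \<open>Continuity, duality and weak convergence in seminormed function spaces\<close>

definition seminorm_continuous ::
  "('a \<Rightarrow> real) set \<Rightarrow> (('a \<Rightarrow> real) \<Rightarrow> real) \<Rightarrow> (('b \<Rightarrow> real) \<Rightarrow> real) \<Rightarrow>
   (('a \<Rightarrow> real) \<Rightarrow> ('b \<Rightarrow> real)) \<Rightarrow> bool" where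
  "seminorm_continuous X nX nY T \<longleftrightarrow>
     (\<forall>u\<in>X. \<forall>\<epsilon>>0. \<exists>\<delta>>0. \<forall>v\<in>X.
        nX (\<lambda>x. v x - u x) < \<delta> \<longrightarrow> nY (\<lambda>x. T v x - T u x) < \<epsilon>)"

text \<open>The dual is again a set of real-valued functions (their values outside \<open>X\<close> are irrelevant and
  not seen by the dual norm), so both constructions can be iterated, giving the bidual.\<close>

definition dual_space ::
  "('b \<Rightarrow> real) set \<Rightarrow> (('b \<Rightarrow> real) \<Rightarrow> real) \<Rightarrow> (('b \<Rightarrow> real) \<Rightarrow> real) set" where
  "dual_space X nrm = {l.
     (\<forall>u\<in>X. \<forall>v\<in>X. l (\<lambda>x. u x + v x) = l u + l v) \<and>
     (\<forall>c. \<forall>u\<in>X. l (\<lambda>x. c * u x) = c * l u) \<and>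
     (\<exists>C. \<forall>u\<in>X. \<bar>l u\<bar> \<le> C * nrm u)}"

definition dual_norm ::
  "('b \<Rightarrow> real) set \<Rightarrow> (('b \<Rightarrow> real) \<Rightarrow> real) \<Rightarrow> (('b \<Rightarrow> real) \<Rightarrow> real) \<Rightarrow> real" where
  "dual_norm X nrm l = (SUP u\<in>{u \<in> X. nrm u \<le> 1}. \<bar>l u\<bar>)"

definition weakly_converges ::
  "('b \<Rightarrow> real) set \<Rightarrow> (('b \<Rightarrow> real) \<Rightarrow> real) \<Rightarrow> (nat \<Rightarrow> 'b \<Rightarrow> real) \<Rightarrow> ('b \<Rightarrow> real) \<Rightarrow> bool" where
  "weakly_converges X nrm U u \<longleftrightarrow>
     (\<forall>n. U n \<in> X) \<and> u \<in> X \<and> (\<forall>l\<in>dual_space X nrm. (\<lambda>n. l (U n)) \<longlonglongrightarrow> l u)"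

definition Wdual :: "'a::euclidean_space set \<Rightarrow> real \<Rightarrow> (('a \<Rightarrow> real) \<Rightarrow> real) set" where
  "Wdual \<Omega> p = dual_space (W10 \<Omega> p) (W10_norm \<Omega> p)"

definition Wdual_norm :: "'a::euclidean_space set \<Rightarrow> real \<Rightarrow> (('a \<Rightarrow> real) \<Rightarrow> real) \<Rightarrow> real" where
  "Wdual_norm \<Omega> p = dual_norm (W10 \<Omega> p) (W10_norm \<Omega> p)"


section \<open>The Dirichlet problem\<close>

definition caratheodory :: "'a::euclidean_space set \<Rightarrow> ('a \<Rightarrow> real \<Rightarrow> 'a \<Rightarrow> real) \<Rightarrow> bool" where
  "caratheodory \<Omega> f \<longleftrightarrow>
     (\<forall>s \<xi>. (\<lambda>x. f x s \<xi>) \<in> borel_measurable (lebesgue_on \<Omega>)) \<and>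
     (AE x in lebesgue_on \<Omega>. continuous_on UNIV (\<lambda>(s, \<xi>). f x s \<xi>))"

text \<open>\<open>plaplacian \<Omega> s u v\<close> is $\langle\Delta_s u, v\rangle$.\<close>

definition plaplacian ::
  "'a::euclidean_space set \<Rightarrow> real \<Rightarrow> ('a \<Rightarrow> real) \<Rightarrow> ('a \<Rightarrow> real) \<Rightarrow> real" where
  "plaplacian \<Omega> s u v =
     - (LINT x|lebesgue_on \<Omega>. norm (wgrad \<Omega> u x) powr (s - 2) * (wgrad \<Omega> u x \<bullet> wgrad \<Omega> v x))"

definition competing_op ::
  "'a::euclidean_space set \<Rightarrow> real \<Rightarrow> real \<Rightarrow> ('a \<Rightarrow> real) \<Rightarrow> ('a \<Rightarrow> real) \<Rightarrow> real" where
  "competing_op \<Omega> p q u v = - plaplacian \<Omega> p u v + plaplacian \<Omega> q u v"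

text \<open>The functional $v \mapsto \int_\Omega f(x, w, \nabla w)\, v\, dx$.\<close>

definition reaction ::
  "'a::euclidean_space set \<Rightarrow> ('a \<Rightarrow> real \<Rightarrow> 'a \<Rightarrow> real) \<Rightarrow> ('a \<Rightarrow> real) \<Rightarrow> ('a \<Rightarrow> real) \<Rightarrow> real" where
  "reaction \<Omega> f w v = (LINT x|lebesgue_on \<Omega>. f x (w x) (wgrad \<Omega> w x) * v x)"

definition strong_generalized_solution ::
  "'a::euclidean_space set \<Rightarrow> real \<Rightarrow> real \<Rightarrow> (('a \<Rightarrow> real) \<Rightarrow> 'a \<Rightarrow> real) \<Rightarrow>
   ('a \<Rightarrow> real \<Rightarrow> 'a \<Rightarrow> real) \<Rightarrow> ('a \<Rightarrow> real) \<Rightarrow> bool" where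
  "strong_generalized_solution \<Omega> p q T f u \<longleftrightarrow> u \<in> W10 \<Omega> p \<and>
     (\<exists>U. (\<forall>n::nat. U n \<in> W10 \<Omega> p) \<and>
        weakly_converges (W10 \<Omega> p) (W10_norm \<Omega> p) U u \<and>
        weakly_converges (Wdual \<Omega> p) (Wdual_norm \<Omega> p)
          (\<lambda>n v. competing_op \<Omega> p q (U n) v - reaction \<Omega> f (T (U n)) v) (\<lambda>v. 0) \<and>
        (\<lambda>n. competing_op \<Omega> p q (U n) (\<lambda>x. U n x - u x)) \<longlonglongrightarrow> 0)"

end

theory Submission
  imports Defs "HOL-Library.Diagonal_Subsequence"
begin

text \<open>
  Let \<open>B u v = \<langle>-\<Delta>\<^sub>p u + \<Delta>\<^sub>q u, v\<rangle> - \<integral> f(x, T u, \<nabla>T u) v\<close>.  Conditions (1) and (2) make \<open>B\<close> bounded on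
  bounded sets, demicontinuous, and coercive: \<open>B u u \<ge> \<delta> \<parallel>\<nabla>u\<parallel>\<^sup>p - C\<close>, the competing \<open>q\<close>-term being
  of lower order.  There is no monotonicity or maximum principle, so one only solves the Galerkin
  equations \<open>B u\<^sub>n e\<^sub>i = 0\<close>, \<open>i < n\<close>, for a dense sequence \<open>e\<close>, by the finite-dimensional zero theorem
  for coercive maps.  The solutions also satisfy \<open>B u\<^sub>n u\<^sub>n = 0\<close>, hence are bounded, and
  \<open>B u\<^sub>n v \<rightarrow> 0\<close> for every \<open>v\<close>; since the space is reflexive, this is weak convergence to zero in
  the dual.  Along a weakly convergent subsequence \<open>u\<^sub>n \<rightharpoonup> u\<close>, compactness of the embedding
  into \<open>L\<^sup>k\<close> with a subcritical \<open>k\<close> dual to the growth of \<open>f\<close> sends the reaction term tested with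
  \<open>u\<^sub>n - u\<close> to zero, and \<open>B u\<^sub>n (u\<^sub>n - u) = - B u\<^sub>n u \<rightarrow> 0\<close> gives the last condition.

  Reflexivity and separability are obtained concretely: \<open>W\<^sub>0\<^bsup>1,p\<^esup>\<close> is represented by its closed
  subspace of gradients in \<open>L\<^sup>p\<close>, whose functionals are represented by minimizing a uniformly
  convex functional.
\<close>

section \<open>Powers of norms\<close>

text \<open>The two indices of \<open>S\<close> in the smallness condition are Hoelder conjugates:
  p*/(p*-\<alpha>) is conjugate to p*/\<alpha>, the exponent in which |T u|^\<alpha> is integrable,
  and p/(p-\<beta>) is conjugate to p/\<beta>, the one for |grad T u|^\<beta>. Pairing the reaction
  with u therefore costs at most the left side of that condition times the p-th power of the
  gradient norm, plus terms of degree one, so a positive share of the principal term survives. The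
  upper bounds on \<alpha>, \<beta> and r say precisely that the three dual exponents stay below p*;
  their maximum is the subcritical k. The difference of the two Laplacians is not monotone, so weak
  convergence of u_n does not identify the limit of B u_n with B u, and the notion of solution asks
  for no such identification. Continuity of T for the norms suffices because limits inside T are
  taken only along norm-convergent sequences, in the finite-dimensional problems. There f has no
  common majorant; convergence a.e. along subsequences together with uniform bounds takes its
  place.\<close>

definition conjx :: "real \<Rightarrow> real" where
  "conjx s = s / (s - 1)"

lemma conjx_gt_1: "1 < s \<Longrightarrow> 1 < conjx s"
  by (simp add: conjx_def)

lemma conjx_conjx: "1 < s \<Longrightarrow> conjx (conjx s) = s"
  by (simp add: conjx_def field_simps)

lemma conjx_sum: "1 < s \<Longrightarrow> 1 / s + 1 / conjx s = 1"
  by (simp add: conjx_def field_simps)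

lemma conjx_mult: "1 < s \<Longrightarrow> (s - 1) * conjx s = s"
  by (simp add: conjx_def)

text \<open>The gradient of |a|^s / s, that is, the duality map of L^s taken pointwise. It is both
  the integrand of the s-Laplacian and the form in which minimizers represent functionals. As
  \<open>0 powr t = 0\<close>, it vanishes at the origin for s < 2 too.\<close>

definition dmap :: "real \<Rightarrow> 'b::euclidean_space \<Rightarrow> 'b" where
  "dmap s a = (norm a powr (s - 2)) *\<^sub>R a"

lemma norm_dmap: "norm (dmap s a) = norm a powr (s - 1)"
proof (cases "a = 0")
  case False
  then have "norm a powr (s - 2) * norm a powr 1 = norm a powr (s - 1)"
    by (subst powr_add[symmetric]) simp
  with False show ?thesis by (simp add: dmap_def)
qed (simp add: dmap_def)

lemma dmap_inner_self: "dmap s a \<bullet> a = norm a powr s"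
proof (cases "a = 0")
  case False
  then have "norm a powr (s - 2) * norm a powr 2 = norm a powr s"
    by (subst powr_add[symmetric]) simp
  with False show ?thesis by (simp add: dmap_def power2_norm_eq_inner)
qed (simp add: dmap_def)

lemma norm_dmap_powr: "1 < s \<Longrightarrow> norm (dmap s a) powr conjx s = norm a powr s"
  by (simp add: norm_dmap powr_powr conjx_mult)

lemma continuous_dmap:
  assumes "1 < s"
  shows "continuous_on UNIV (dmap s :: 'b::euclidean_space \<Rightarrow> 'b)"
proof -
  have "isCont (dmap s) a" for a :: 'b
  proof (cases "a = 0")
    case True
    have "((\<lambda>x::'b. norm x powr (s - 1)) \<longlongrightarrow> 0 powr (s - 1)) (at 0)"
      using assms by (intro tendsto_powr') (auto intro!: tendsto_norm_zero tendsto_ident_at)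
    then have "((\<lambda>x::'b. norm (dmap s x)) \<longlongrightarrow> 0) (at 0)"
      by (simp add: norm_dmap)
    then have "(dmap s \<longlongrightarrow> (0::'b)) (at 0)"
      by (rule tendsto_norm_zero_cancel)
    with True show ?thesis by (simp add: isCont_def dmap_def)
  next
    case False
    then show ?thesis
      unfolding dmap_def by (intro continuous_intros) auto
  qed
  then show ?thesis by (simp add: continuous_on_eq_continuous_at)
qed

lemma powr_add_le:
  fixes a b :: real
  assumes "0 \<le> a" "0 \<le> b" "0 \<le> s"
  shows "(a + b) powr s \<le> 2 powr s * (a powr s + b powr s)"
proof -
  have "(a + b) powr s \<le> (2 * max a b) powr s"
    using assms by (intro powr_mono2) auto
  also have "\<dots> = 2 powr s * (max a b) powr s"
    by (simp add: powr_mult)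
  also have "max a b powr s \<le> a powr s + b powr s"
    by (simp add: max_def)
  finally show ?thesis by simp
qed

lemma norm_powr_add_le:
  fixes a b :: "'b::real_normed_vector"
  assumes "0 \<le> s"
  shows "norm (a + b) powr s \<le> 2 powr s * (norm a powr s + norm b powr s)"
proof -
  have "norm (a + b) powr s \<le> (norm a + norm b) powr s"
    using assms by (intro powr_mono2 norm_triangle_ineq) auto
  with powr_add_le[of "norm a" "norm b" s] assms show ?thesis by simp
qed

lemma Young_powr:
  fixes a b :: real
  assumes "1 < s" "0 \<le> a" "0 \<le> b"
  shows "s * (a powr (s - 1) * b) \<le> (s - 1) * a powr s + b powr s"
proof -
  have "a powr (s - 1) * b \<le> (a powr (s - 1)) powr conjx s / conjx s + b powr s / s"
    using assms conjx_gt_1[of s] conjx_sum[of s]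
    by (intro Youngs_inequality) (auto simp: add.commute)
  also have "\<dots> = a powr s * (s - 1) / s + b powr s / s"
    using assms by (simp add: powr_powr conjx_mult) (simp add: conjx_def)
  finally show ?thesis using assms by (simp add: field_simps)
qed

text \<open>Convexity of |.|^s: the graph lies above its tangent at b, whose slope is s *
  \<open>dmap s b\<close>. Cauchy-Schwarz and Young give this without any differentiation.\<close>

lemma norm_powr_tangent:
  fixes a b :: "'b::euclidean_space"
  assumes "1 < s"
  shows "norm b powr s + s * (dmap s b \<bullet> (a - b)) \<le> norm a powr s"
proof -
  have "dmap s b \<bullet> a \<le> norm (dmap s b) * norm a" by (rule norm_cauchy_schwarz)
  then have "s * (dmap s b \<bullet> a) \<le> s * (norm b powr (s - 1) * norm a)"
    using assms by (simp add: norm_dmap)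
  also have "\<dots> \<le> (s - 1) * norm b powr s + norm a powr s"
    using assms by (intro Young_powr) auto
  finally show ?thesis
    by (simp add: inner_diff_right dmap_inner_self algebra_simps)
qed

text \<open>The mean value theorem on the two halves of the interval: the derivative is strictly
  increasing, so the second half gains more than the first.\<close>

lemma powr_midpoint_strict:
  fixes x y :: real
  assumes s: "1 < s" and xy: "0 \<le> x" "x < y"
  shows "((x + y) / 2) powr s < (x powr s + y powr s) / 2"
proof -
  define m where "m = (x + y) / 2"
  have m: "x < m" "m < y" "0 < m" using xy by (auto simp: m_def)
  have cont: "continuous_on {u..v} (\<lambda>t. t powr s)" if "0 \<le> u" for u v
    using s that by (intro continuous_on_powr') (auto intro: continuous_intros)
  have der: "((\<lambda>t. t powr s) has_real_derivative s * t powr (s - 1)) (at t)" if "0 < t" for t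
    using that by (rule has_real_derivative_powr)
  have "\<exists>l z. x < z \<and> z < m \<and> DERIV (\<lambda>t. t powr s) z :> l \<and> m powr s - x powr s = (m - x) * l"
    using der xy(1) by (intro MVT[OF m(1) cont]) (auto simp: real_differentiable_def intro!: exI[of _ "s * _ powr (s - 1)"] der)
  then obtain l z where z: "x < z" "z < m" "((\<lambda>t. t powr s) has_real_derivative l) (at z)"
    "m powr s - x powr s = (m - x) * l" by blast
  have "\<exists>l z. m < z \<and> z < y \<and> DERIV (\<lambda>t. t powr s) z :> l \<and> y powr s - m powr s = (y - m) * l"
    using der m(3) by (intro MVT[OF m(2) cont]) (auto simp: real_differentiable_def intro!: exI[of _ "s * _ powr (s - 1)"] der)
  then obtain l' z' where z': "m < z'" "z' < y" "((\<lambda>t. t powr s) has_real_derivative l') (at z')"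
    "y powr s - m powr s = (y - m) * l'" by blast
  have "l = s * z powr (s - 1)" "l' = s * z' powr (s - 1)"
    using z(1,3) z'(1,3) der[of z] der[of z'] xy m DERIV_unique by auto
  moreover have "z powr (s - 1) < z' powr (s - 1)"
    using s z z' xy by (intro powr_less_mono2) auto
  ultimately have "l < l'" using s by simp
  moreover have "y - m = m - x" by (simp add: m_def field_simps)
  ultimately have "m powr s - x powr s < y powr s - m powr s"
    using z z' m by simp
  then show ?thesis by (simp add: m_def field_simps)
qed

text \<open>Two sources of strictness. For equal norms the parallelogram law makes the midpoint
  strictly shorter; for different norms the triangle inequality reduces to the strictly convex
  scalar power.\<close>

lemma norm_powr_midpoint_strict:
  fixes a b :: "'b::euclidean_space"
  assumes s: "1 < s" and ab: "a \<noteq> b"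
  shows "norm ((1/2) *\<^sub>R (a + b)) powr s < (norm a powr s + norm b powr s) / 2"
proof (cases "norm a = norm b")
  case True
  have "(norm (a + b))\<^sup>2 + (norm (a - b))\<^sup>2 = 4 * (norm a)\<^sup>2"
    using True by (simp add: power2_norm_eq_inner inner_simps inner_commute)
      (metis True power2_norm_eq_inner)
  moreover have "0 < (norm (a - b))\<^sup>2" using ab by simp
  ultimately have "(norm (a + b))\<^sup>2 < 4 * (norm a)\<^sup>2" by linarith
  then have "(norm (a + b))\<^sup>2 < (2 * norm a)\<^sup>2" by (simp add: power_mult_distrib)
  then have "norm (a + b) < 2 * norm a"
    by (rule power2_less_imp_less) auto
  then have "norm ((1/2) *\<^sub>R (a + b)) < norm a" by simp
  then have "norm ((1/2) *\<^sub>R (a + b)) powr s < norm a powr s"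
    using s by (intro powr_less_mono2) auto
  with True show ?thesis by simp
next
  case False
  have "norm ((1/2) *\<^sub>R (a + b)) powr s \<le> ((norm a + norm b) / 2) powr s"
    using s by (intro powr_mono2) (auto intro: norm_triangle_ineq)
  also have "\<dots> < (norm a powr s + norm b powr s) / 2"
    using powr_midpoint_strict[of s "norm a" "norm b"] powr_midpoint_strict[of s "norm b" "norm a"] False s
    by (cases "norm a" "norm b" rule: linorder_cases) (auto simp: add.commute)
  finally show ?thesis .
qed

text \<open>Uniform convexity in integrable form; it follows from strict convexity because both sides
  are homogeneous and the unit sphere is compact.\<close>

lemma uniform_convexity:
  assumes s: "1 < s" and e: "0 < e"
  shows "\<exists>C\<ge>0. \<forall>a b::'b::euclidean_space.
    norm (a - b) powr s \<le> e * (norm a powr s + norm b powr s)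
      + C * ((norm a powr s + norm b powr s) / 2 - norm ((1/2) *\<^sub>R (a + b)) powr s)"
proof -
  define m where "m z = norm (fst z) powr s + norm (snd z) powr s" for z :: "'b \<times> 'b"
  define D where "D z = m z / 2 - norm ((1/2) *\<^sub>R (fst z + snd z)) powr s" for z :: "'b \<times> 'b"
  define d where "d z = norm (fst z - snd z) powr s" for z :: "'b \<times> 'b"
  have contp: "continuous_on UNIV (\<lambda>z. norm (h z) powr s)"
    if "continuous_on UNIV h" for h :: "'b \<times> 'b \<Rightarrow> 'b"
    using s that by (intro continuous_on_powr' continuous_intros) auto
  have cm: "continuous_on UNIV m" unfolding m_def
    by (intro continuous_intros contp)
  have cD: "continuous_on UNIV D" unfolding D_def
    by (intro continuous_intros contp cm) auto
  have cd: "continuous_on UNIV d" unfolding d_def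
    by (intro continuous_intros contp)
  have D0: "0 \<le> D z" for z
    using norm_powr_midpoint_strict[OF s, of "fst z" "snd z"]
    by (cases "fst z = snd z") (auto simp: D_def m_def scaleR_2[symmetric] less_imp_le)
  have d_le: "d z \<le> 2 powr s * m z" for z
    using norm_powr_add_le[of s "fst z" "- snd z"] s by (simp add: d_def m_def)
  \<comment> \<open>Normalized pairs at distance at least e in the sense of \<open>d\<close>. On
    this compact set the convexity defect \<open>D\<close> has a positive minimum \<delta>.\<close>
  define K where "K = {z. m z = 1} \<inter> {z. e \<le> d z}"
  have "closed K" unfolding K_def
    by (intro closed_Int closed_Collect_eq closed_Collect_le cm cd continuous_intros)
  moreover have "K \<subseteq> cball 0 2"
  proof
    fix z assume "z \<in> K"
    then have "norm (fst z) powr s \<le> 1" "norm (snd z) powr s \<le> 1"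
      using powr_ge_zero[of "norm (fst z)" s] powr_ge_zero[of "norm (snd z)" s]
      unfolding K_def m_def by (auto simp del: powr_ge_zero)
    then have "norm (fst z) \<le> 1" "norm (snd z) \<le> 1"
      using s powr_less_mono2[of s 1 "norm (fst z)"] powr_less_mono2[of s 1 "norm (snd z)"]
      by (auto simp: not_less[symmetric])
    then show "z \<in> cball 0 2"
      using norm_Pair_le[of "fst z" "snd z"] by simp
  qed
  ultimately have "compact K" using bounded_cball bounded_subset compact_eq_bounded_closed by blast
  have "\<exists>\<delta>>0. \<forall>z\<in>K. \<delta> \<le> D z"
  proof (cases "K = {}")
    case False
    obtain w where w: "w \<in> K" "\<forall>z\<in>K. D w \<le> D z"
      using continuous_attains_inf[OF \<open>compact K\<close> False continuous_on_subset[OF cD]] by auto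
    have "fst w \<noteq> snd w" using w(1) e s by (auto simp: K_def d_def)
    then have "0 < D w"
      using norm_powr_midpoint_strict[OF s, of "fst w" "snd w"] by (simp add: D_def m_def)
    with w show ?thesis by blast
  qed (auto intro: exI[of _ 1])
  then obtain \<delta> where \<delta>: "\<delta> > 0" "\<And>z. z \<in> K \<Longrightarrow> \<delta> \<le> D z" by blast
  \<comment> \<open>The constant: d <= 2^s m always, and on K the defect is at least \<delta>, so
    2^s / \<delta> times the defect covers d. Off K the term e * m already does.\<close>
  have main: "d z \<le> e * m z + 2 powr s / \<delta> * D z" for z
  proof (cases "m z = 0")
    case True
    with d_le[of z] e D0[of z] \<delta> show ?thesis by (auto intro: order_trans)
  next
    case False
    then have mz: "0 < m z" by (simp add: m_def less_le)
    \<comment> \<open>The scaling factor that brings \<open>z\<close> to \<open>m = 1\<close>;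
      \<open>m\<close>, \<open>d\<close> and \<open>D\<close> are all homogeneous of degree
      s.\<close>
    define t where "t = m z powr (- 1 / s)"
    have t: "0 < t" "t powr s = 1 / m z"
      using mz s by (auto simp: t_def powr_powr powr_minus_divide powr_divide)
    have hom: "norm (t *\<^sub>R a) powr s = norm a powr s / m z" for a :: 'b
      using t by (simp add: powr_mult)
    have sc: "m (t *\<^sub>R z) = m z / m z" "d (t *\<^sub>R z) = d z / m z" "D (t *\<^sub>R z) = D z / m z"
    proof -
      show 1: "m (t *\<^sub>R z) = m z / m z" by (simp only: m_def fst_scaleR snd_scaleR hom add_divide_distrib)
      show "d (t *\<^sub>R z) = d z / m z"
        unfolding d_def using hom[of "fst z - snd z"] by (simp add: scaleR_diff_right)
      have "(1/2) *\<^sub>R (fst (t *\<^sub>R z) + snd (t *\<^sub>R z)) = t *\<^sub>R ((1/2) *\<^sub>R (fst z + snd z))"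
        by (simp add: scaleR_add_right)
      then show "D (t *\<^sub>R z) = D z / m z"
        unfolding D_def 1 by (simp only: hom diff_divide_distrib) simp
    qed
    have "d z / m z \<le> e + 2 powr s / \<delta> * (D z / m z)"
    proof (cases "d z / m z < e")
      case True
      with D0[of z] mz \<delta> show ?thesis by (smt (verit) divide_nonneg_pos mult_nonneg_nonneg powr_ge_zero)
    next
      case False
      then have "t *\<^sub>R z \<in> K" using mz by (simp add: K_def sc)
      then have "\<delta> \<le> D z / m z" using \<delta>(2) sc by metis
      then have "1 \<le> (D z / m z) / \<delta>" using \<delta>(1) by (subst le_divide_eq_1_pos)
      then have "2 powr s * 1 \<le> 2 powr s * ((D z / m z) / \<delta>)" by (intro mult_left_mono) auto
      moreover have "d z / m z \<le> 2 powr s" using d_le[of z] mz by (simp add: field_simps)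
      ultimately show ?thesis using e by (simp add: mult.commute)
    qed
    then have "d z / m z * m z \<le> (e + 2 powr s / \<delta> * (D z / m z)) * m z"
      using mz by (intro mult_right_mono) auto
    then show ?thesis using mz by (simp add: algebra_simps)
  qed
  show ?thesis
    using main[of "(a, b)" for a b] \<delta>(1)
    by (intro exI[of _ "2 powr s / \<delta>"]) (simp add: d_def m_def D_def)
qed

section \<open>Lebesgue spaces of vector-valued functions\<close>

text \<open>A real-valued counterpart of \<open>Lspace\<close>. Integrability must be part of
  membership, because the Bochner integral of a non-integrable function is 0 and \<open>pint\<close>
  alone would say nothing. Convexity arguments use \<open>pint\<close>, the power without the
  root.\<close>

definition Lp :: "'a measure \<Rightarrow> real \<Rightarrow> ('a \<Rightarrow> 'b::euclidean_space) set" where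
  "Lp M s = {g \<in> borel_measurable M. integrable M (\<lambda>x. norm (g x) powr s)}"

definition pint :: "'a measure \<Rightarrow> real \<Rightarrow> ('a \<Rightarrow> 'b::euclidean_space) \<Rightarrow> real" where
  "pint M s g = (\<integral>x. norm (g x) powr s \<partial>M)"

definition pnorm :: "'a measure \<Rightarrow> real \<Rightarrow> ('a \<Rightarrow> 'b::euclidean_space) \<Rightarrow> real" where
  "pnorm M s g = pint M s g powr (1 / s)"

lemma LpD: "g \<in> Lp M s \<Longrightarrow> g \<in> borel_measurable M"
  "g \<in> Lp M s \<Longrightarrow> integrable M (\<lambda>x. norm (g x) powr s)"
  by (auto simp: Lp_def)

lemma LpI: "g \<in> borel_measurable M \<Longrightarrow> integrable M (\<lambda>x. norm (g x) powr s) \<Longrightarrow> g \<in> Lp M s"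
  by (auto simp: Lp_def)

lemma Lp_bound:
  assumes "g \<in> borel_measurable M" "integrable M h" "AE x in M. norm (g x) powr s \<le> h x"
  shows "g \<in> Lp M s"
  using assms(1)
  by (intro LpI Bochner_Integration.integrable_bound[OF assms(2)])
     (use assms in \<open>auto elim!: eventually_mono\<close>)

lemma zero_in_Lp [simp]: "(\<lambda>x. 0) \<in> Lp M s"
  by (simp add: Lp_def)

lemma Lp_scaleR: "g \<in> Lp M s \<Longrightarrow> (\<lambda>x. c *\<^sub>R g x) \<in> Lp M s"
  by (auto simp: Lp_def powr_mult)

lemma Lp_cmult: "g \<in> Lp M s \<Longrightarrow> (\<lambda>x. c * g x :: real) \<in> Lp M s"
  using Lp_scaleR[of g M s c] by simp

lemma Lp_uminus: "g \<in> Lp M s \<Longrightarrow> (\<lambda>x. - g x) \<in> Lp M s"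
  by (auto simp: Lp_def)

lemma Lp_add:
  assumes "0 \<le> s" "g \<in> Lp M s" "h \<in> Lp M s"
  shows "(\<lambda>x. g x + h x) \<in> Lp M s"
proof (rule Lp_bound)
  show "integrable M (\<lambda>x. 2 powr s * (norm (g x) powr s + norm (h x) powr s))"
    using assms by (auto simp: Lp_def)
qed (use assms norm_powr_add_le in \<open>auto simp: Lp_def\<close>)

lemma Lp_diff: "0 \<le> s \<Longrightarrow> g \<in> Lp M s \<Longrightarrow> h \<in> Lp M s \<Longrightarrow> (\<lambda>x. g x - h x) \<in> Lp M s"
  using Lp_add[of s g M "\<lambda>x. - h x"] by (simp add: Lp_uminus)

lemma Lp_norm: "g \<in> Lp M s \<Longrightarrow> (\<lambda>x. norm (g x)) \<in> Lp M s"
  by (auto simp: Lp_def)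

lemma Lp_AE_cong:
  assumes "g \<in> Lp M s" "h \<in> borel_measurable M" "AE x in M. g x = h x"
  shows "h \<in> Lp M s"
  using assms by (intro Lp_bound[of h M "\<lambda>x. norm (g x) powr s"]) (auto simp: Lp_def elim!: eventually_mono)

text \<open>On a finite measure space the pointwise bound a^t <= 1 + a^s for t <= s is
  enough.\<close>

lemma Lp_mono_exponent:
  assumes "finite_measure M" "g \<in> Lp M s" "0 \<le> t" "t \<le> s"
  shows "g \<in> Lp M t"
proof (rule Lp_bound)
  interpret finite_measure M by fact
  show "integrable M (\<lambda>x. 1 + norm (g x) powr s)"
    using assms by (auto simp: Lp_def)
  have "a powr t \<le> 1 + a powr s" if "0 \<le> a" for a :: real
  proof (cases "a \<le> 1")
    case True
    then show ?thesis using that assms powr_le1[of t a] by (smt (verit) powr_ge_zero)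
  next
    case False
    then have "a powr t \<le> a powr s" using assms by (intro powr_mono) auto
    then show ?thesis by simp
  qed
  then show "AE x in M. norm (g x) powr t \<le> 1 + norm (g x) powr s" by simp
qed (use assms in \<open>auto simp: Lp_def\<close>)

lemma pint_nonneg [simp]: "0 \<le> pint M s g"
  by (simp add: pint_def)

lemma pnorm_nonneg [simp]: "0 \<le> pnorm M s g"
  by (simp add: pnorm_def)

lemma pint_AE_cong:
  "AE x in M. g x = h x \<Longrightarrow> g \<in> borel_measurable M \<Longrightarrow> h \<in> borel_measurable M \<Longrightarrow> pint M s g = pint M s h"
  unfolding pint_def by (intro integral_cong_AE) (auto elim!: eventually_mono)

lemma pnorm_AE_cong:
  "AE x in M. g x = h x \<Longrightarrow> g \<in> borel_measurable M \<Longrightarrow> h \<in> borel_measurable M \<Longrightarrow> pnorm M s g = pnorm M s h"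
  unfolding pnorm_def by (simp add: pint_AE_cong)

lemma pnorm_powr: "s \<noteq> 0 \<Longrightarrow> pnorm M s g powr s = pint M s g"
  by (simp add: pnorm_def powr_powr)

lemma pnorm_scaleR: "s \<noteq> 0 \<Longrightarrow> pnorm M s (\<lambda>x. c *\<^sub>R g x) = \<bar>c\<bar> * pnorm M s g"
  by (simp add: pnorm_def pint_def powr_mult powr_powr)

lemma pnorm_uminus: "pnorm M s (\<lambda>x. - g x) = pnorm M s g"
  by (simp add: pnorm_def pint_def)

lemma pnorm_minus_commute: "pnorm M s (\<lambda>x. g x - h x) = pnorm M s (\<lambda>x. h x - g x)"
  by (simp add: pnorm_def pint_def norm_minus_commute)

lemma pnorm_norm [simp]: "pnorm M s (\<lambda>x. norm (g x)) = pnorm M s g"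
  by (simp add: pnorm_def pint_def)

lemma pnorm_zero [simp]: "pnorm M s (\<lambda>x. 0) = 0"
  by (simp add: pnorm_def pint_def)

lemma pint_eq_0_iff:
  assumes "g \<in> Lp M s"
  shows "pint M s g = 0 \<longleftrightarrow> (AE x in M. g x = 0)"
  unfolding pint_def using assms
  by (subst integral_nonneg_eq_0_iff_AE) (auto simp: Lp_def)

lemma pnorm_eq_0_iff:
  assumes "g \<in> Lp M s"
  shows "pnorm M s g = 0 \<longleftrightarrow> (AE x in M. g x = 0)"
  using pint_eq_0_iff[OF assms] by (simp add: pnorm_def)

lemma pint_mono:
  assumes "AE x in M. norm (g x) \<le> norm (h x)" "h \<in> Lp M s" "g \<in> borel_measurable M" "0 \<le> s"
  shows "pint M s g \<le> pint M s h"
proof -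
  have *: "AE x in M. norm (g x) powr s \<le> norm (h x) powr s"
    using assms(1) by eventually_elim (use assms(4) in \<open>auto intro: powr_mono2\<close>)
  with assms(2,3) have "g \<in> Lp M s" by (intro Lp_bound[of g M "\<lambda>x. norm (h x) powr s"]) (auto simp: Lp_def)
  with * assms(2) show ?thesis
    unfolding pint_def by (intro integral_mono_AE) (auto simp: Lp_def)
qed

lemma pnorm_mono:
  assumes "AE x in M. norm (g x) \<le> norm (h x)" "h \<in> Lp M s" "g \<in> borel_measurable M" "0 \<le> s"
  shows "pnorm M s g \<le> pnorm M s h"
  unfolding pnorm_def using pint_mono[OF assms] assms(4) by (intro powr_mono2) auto

section \<open>The inequalities of Hoelder and Minkowski\<close>

lemma Young_integrable:
  assumes s: "1 < s" and g: "g \<in> Lp M s" and h: "h \<in> Lp M (conjx s)"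
  shows "integrable M (\<lambda>x. norm (g x) * norm (h x))"
proof (rule Bochner_Integration.integrable_bound)
  show "integrable M (\<lambda>x. norm (g x) powr s / s + norm (h x) powr conjx s / conjx s)"
    using g h by (auto simp: Lp_def)
  show "AE x in M. norm (norm (g x) * norm (h x))
      \<le> norm (norm (g x) powr s / s + norm (h x) powr conjx s / conjx s)"
    using Youngs_inequality[of s "conjx s"] s conjx_gt_1[OF s] conjx_sum[OF s] by auto
qed (use g h in \<open>auto simp: Lp_def\<close>)

text \<open>Young's inequality is integrated after both factors are divided by their norms; the
  bound is then 1/s + 1/s' = 1. A factor of norm zero vanishes a.e. and is treated apart.\<close>

lemma Hoelder:
  assumes s: "1 < s" and g: "g \<in> Lp M s" and h: "h \<in> Lp M (conjx s)"
  shows "(\<integral>x. norm (g x) * norm (h x) \<partial>M) \<le> pnorm M s g * pnorm M (conjx s) h"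
proof (cases "pnorm M s g = 0 \<or> pnorm M (conjx s) h = 0")
  case True
  then have "AE x in M. norm (g x) * norm (h x) = 0"
    using pnorm_eq_0_iff[OF g] pnorm_eq_0_iff[OF h] by (auto elim!: eventually_mono)
  then have "(\<integral>x. norm (g x) * norm (h x) \<partial>M) = 0"
    by (rule integral_eq_zero_AE)
  with True show ?thesis by simp
next
  case False
  let ?t = "conjx s"
  define a b where "a = pnorm M s g" and "b = pnorm M ?t h"
  have ab: "0 < a" "0 < b"
    using False pnorm_nonneg[of M s g] pnorm_nonneg[of M ?t h] unfolding a_def b_def by linarith+
  have t: "1 < ?t" by (rule conjx_gt_1[OF s])
  have ints: "integrable M (\<lambda>x. norm (g x) powr s)" "integrable M (\<lambda>x. norm (h x) powr ?t)"
    using g h by (auto simp: Lp_def)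
  have "(\<integral>x. norm (g x) * norm (h x) / (a * b) \<partial>M)
      \<le> (\<integral>x. norm (g x) powr s / (s * a powr s) + norm (h x) powr ?t / (?t * b powr ?t) \<partial>M)"
  proof (rule integral_mono)
    show "integrable M (\<lambda>x. norm (g x) * norm (h x) / (a * b))"
      using Young_integrable[OF s g h] by simp
    show "norm (g x) * norm (h x) / (a * b)
      \<le> norm (g x) powr s / (s * a powr s) + norm (h x) powr ?t / (?t * b powr ?t)" for x
      using Youngs_inequality[of s ?t "norm (g x) / a" "norm (h x) / b"] s t conjx_sum[OF s] ab
      by (simp add: powr_divide mult.commute)
  qed (use ints in auto)
  also have "\<dots> = pint M s g / (s * a powr s) + pint M ?t h / (?t * b powr ?t)"
    using ints by (simp add: pint_def)
  also have "\<dots> = 1 / s + 1 / ?t"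
    using s t ab unfolding a_def b_def by (simp add: pnorm_powr) (auto simp: pnorm_def)
  also have "\<dots> = 1" by (rule conjx_sum[OF s])
  finally show ?thesis using ab by (simp add: a_def b_def field_simps)
qed

lemma inner_integrable:
  fixes g h :: "'a \<Rightarrow> 'b::euclidean_space"
  assumes "1 < s" "g \<in> Lp M s" "h \<in> Lp M (conjx s)"
  shows "integrable M (\<lambda>x. g x \<bullet> h x)"
  using Cauchy_Schwarz_ineq2 assms
  by (intro Bochner_Integration.integrable_bound[OF Young_integrable[OF assms]])
     (auto simp: Lp_def abs_mult)

lemma inner_integral_le:
  fixes g h :: "'a \<Rightarrow> 'b::euclidean_space"
  assumes "1 < s" "g \<in> Lp M s" "h \<in> Lp M (conjx s)"
  shows "\<bar>\<integral>x. g x \<bullet> h x \<partial>M\<bar> \<le> pnorm M s g * pnorm M (conjx s) h"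
proof -
  have "\<bar>\<integral>x. g x \<bullet> h x \<partial>M\<bar> \<le> (\<integral>x. \<bar>g x \<bullet> h x\<bar> \<partial>M)" by (rule integral_abs_bound)
  also have "\<dots> \<le> (\<integral>x. norm (g x) * norm (h x) \<partial>M)"
    using Young_integrable[OF assms] inner_integrable[OF assms] Cauchy_Schwarz_ineq2
    by (intro integral_mono) auto
  also have "\<dots> \<le> pnorm M s g * pnorm M (conjx s) h" by (rule Hoelder[OF assms])
  finally show ?thesis .
qed

lemma powr_convex_combination:
  fixes a b l :: real
  assumes "1 \<le> s" "0 \<le> a" "0 \<le> b" "0 < l" "l < 1"
  shows "(l * a + (1 - l) * b) powr s \<le> l * a powr s + (1 - l) * b powr s"
proof -
  have *: "(c * a) powr s \<le> c * a powr s" if "0 \<le> a" "0 < c" "c < 1" for a c :: real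
    using powr_le_one_le[of c s] that assms(1) by (simp add: powr_mult mult_right_mono)
  show ?thesis
  proof (cases "a = 0 \<or> b = 0")
    case True
    then show ?thesis using *[of a l] *[of b "1 - l"] assms by auto
  next
    case False
    then show ?thesis
      using convex_onD[OF powr_convex[OF assms(1)], of "1 - l" a b] assms by simp
  qed
qed

text \<open>With a, b the two norms, (g + h) / (a + b) is bounded by the convex combination, with
  weights a/(a+b) and b/(a+b), of two functions of norm one. Convexity of the power finishes, and
  this route includes s = 1.\<close>

lemma pnorm_triangle:
  assumes s: "1 \<le> s" and g: "g \<in> Lp M s" and h: "h \<in> Lp M s"
  shows "pnorm M s (\<lambda>x. g x + h x) \<le> pnorm M s g + pnorm M s h"
proof (cases "pnorm M s g = 0 \<or> pnorm M s h = 0")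
  case True
  then consider "AE x in M. g x = 0" "pnorm M s g = 0" | "AE x in M. h x = 0" "pnorm M s h = 0"
    using pnorm_eq_0_iff[OF g] pnorm_eq_0_iff[OF h] by auto
  then show ?thesis
  proof cases
    case 1
    have "pnorm M s (\<lambda>x. g x + h x) = pnorm M s h"
      using 1(1) g h by (intro pnorm_AE_cong) (auto simp: Lp_def elim!: eventually_mono)
    with 1 show ?thesis by simp
  next
    case 2
    have "pnorm M s (\<lambda>x. g x + h x) = pnorm M s g"
      using 2(1) g h by (intro pnorm_AE_cong) (auto simp: Lp_def elim!: eventually_mono)
    with 2 show ?thesis by simp
  qed
next
  case False
  define a b where "a = pnorm M s g" and "b = pnorm M s h"
  have ab: "0 < a" "0 < b"
    using False pnorm_nonneg[of M s g] pnorm_nonneg[of M s h] unfolding a_def b_def by linarith+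
  define l where "l = a / (a + b)"
  have l: "0 < l" "l < 1" using ab by (auto simp: l_def)
  have l': "1 - l = b / (a + b)" using ab by (simp add: l_def field_simps)
  have ints: "integrable M (\<lambda>x. norm (g x) powr s)" "integrable M (\<lambda>x. norm (h x) powr s)"
    "integrable M (\<lambda>x. norm (g x + h x) powr s)"
    using g h LpD(2)[OF Lp_add[OF _ g h]] s by (auto simp: Lp_def)
  have "norm (g x + h x) powr s / (a + b) powr s
      \<le> l * (norm (g x) powr s / a powr s) + (1 - l) * (norm (h x) powr s / b powr s)" for x
  proof -
    have "(norm (g x + h x) / (a + b)) powr s \<le> ((norm (g x) + norm (h x)) / (a + b)) powr s"
      using s ab by (intro powr_mono2 divide_right_mono norm_triangle_ineq) auto
    also have "(norm (g x) + norm (h x)) / (a + b) = l * (norm (g x) / a) + (1 - l) * (norm (h x) / b)"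
      unfolding l' unfolding l_def using ab by (simp add: add_divide_distrib)
    also have "\<dots> powr s \<le> l * (norm (g x) / a) powr s + (1 - l) * (norm (h x) / b) powr s"
      using ab l s by (intro powr_convex_combination) auto
    finally show ?thesis by (simp add: powr_divide)
  qed
  then have "(\<integral>x. norm (g x + h x) powr s / (a + b) powr s \<partial>M)
      \<le> (\<integral>x. l * (norm (g x) powr s / a powr s) + (1 - l) * (norm (h x) powr s / b powr s) \<partial>M)"
    using ints by (intro integral_mono) auto
  also have "\<dots> = l * (pint M s g / a powr s) + (1 - l) * (pint M s h / b powr s)"
    using ints by (simp add: pint_def)
  also have "\<dots> = l + (1 - l)"
    using ab s unfolding a_def b_def by (simp add: pnorm_powr) (auto simp: pnorm_def)
  finally have "pint M s (\<lambda>x. g x + h x) \<le> (a + b) powr s"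
    using ab by (simp add: pint_def field_simps)
  then have "pnorm M s (\<lambda>x. g x + h x) \<le> ((a + b) powr s) powr (1 / s)"
    unfolding pnorm_def using s by (intro powr_mono2) auto
  also have "\<dots> = a + b" using ab s by (simp add: powr_powr)
  finally show ?thesis by (simp add: a_def b_def)
qed

lemma pnorm_triangle_diff:
  assumes s: "1 \<le> s" and g: "g \<in> Lp M s" and h: "h \<in> Lp M s"
  shows "pnorm M s (\<lambda>x. g x - h x) \<le> pnorm M s g + pnorm M s h"
  using pnorm_triangle[OF s g Lp_uminus[OF h]] by (simp add: pnorm_uminus)

lemma pnorm_dist_triangle:
  assumes s: "1 \<le> s" and g: "g \<in> Lp M s" and h: "h \<in> Lp M s" and k: "k \<in> Lp M s"
  shows "pnorm M s (\<lambda>x. g x - k x) \<le> pnorm M s (\<lambda>x. g x - h x) + pnorm M s (\<lambda>x. h x - k x)"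
proof -
  have "(\<lambda>x. g x - h x) \<in> Lp M s" "(\<lambda>x. h x - k x) \<in> Lp M s"
    using assms by (auto intro!: Lp_diff)
  from pnorm_triangle[OF s this] show ?thesis by simp
qed

lemma pnorm_diff_bound:
  assumes s: "1 \<le> s" and g: "g \<in> Lp M s" and h: "h \<in> Lp M s"
  shows "\<bar>pnorm M s g - pnorm M s h\<bar> \<le> pnorm M s (\<lambda>x. g x - h x)"
  using pnorm_dist_triangle[OF s g h zero_in_Lp] pnorm_dist_triangle[OF s h g zero_in_Lp]
    pnorm_minus_commute[of M s g h] by simp

lemma pnorm_tendsto:
  assumes s: "1 \<le> s" and g: "\<And>n. g n \<in> Lp M s" and h: "h \<in> Lp M s"
    and lim: "(\<lambda>n. pnorm M s (\<lambda>x. g n x - h x)) \<longlonglongrightarrow> 0"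
  shows "(\<lambda>n. pnorm M s (g n)) \<longlonglongrightarrow> pnorm M s h"
proof -
  have "(\<lambda>n. pnorm M s (g n) - pnorm M s h) \<longlonglongrightarrow> 0"
    using pnorm_diff_bound[OF s g h]
    by (intro Lim_null_comparison[OF _ lim]) auto
  then show ?thesis by (simp add: LIM_zero_iff)
qed

lemma pint_tendsto:
  assumes s: "1 \<le> s" and g: "\<And>n. g n \<in> Lp M s" and h: "h \<in> Lp M s"
    and lim: "(\<lambda>n. pnorm M s (\<lambda>x. g n x - h x)) \<longlonglongrightarrow> 0"
  shows "(\<lambda>n. pint M s (g n)) \<longlonglongrightarrow> pint M s h"
proof -
  have "(\<lambda>n. pnorm M s (g n) powr s) \<longlonglongrightarrow> pnorm M s h powr s"
    using pnorm_tendsto[OF assms] s by (intro tendsto_powr') auto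
  then show ?thesis using s by (simp add: pnorm_powr)
qed

lemma pnorm_tendsto_0_iff:
  assumes "0 < s"
  shows "(\<lambda>n. pnorm M s (g n)) \<longlonglongrightarrow> 0 \<longleftrightarrow> (\<lambda>n. pint M s (g n)) \<longlonglongrightarrow> 0"
proof
  assume "(\<lambda>n. pnorm M s (g n)) \<longlonglongrightarrow> 0"
  then have "(\<lambda>n. pnorm M s (g n) powr s) \<longlonglongrightarrow> 0 powr s"
    using assms by (intro tendsto_powr') auto
  then show "(\<lambda>n. pint M s (g n)) \<longlonglongrightarrow> 0" using assms by (simp add: pnorm_powr)
next
  assume "(\<lambda>n. pint M s (g n)) \<longlonglongrightarrow> 0"
  then have "(\<lambda>n. pint M s (g n) powr (1 / s)) \<longlonglongrightarrow> 0 powr (1 / s)"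
    using assms by (intro tendsto_powr') auto
  then show "(\<lambda>n. pnorm M s (g n)) \<longlonglongrightarrow> 0" by (simp add: pnorm_def)
qed

section \<open>Almost everywhere limits and completeness\<close>

lemma AE_subseq:
  assumes s: "1 \<le> s" and g: "\<And>n. g n \<in> Lp M s" and h: "h \<in> Lp M s"
    and lim: "(\<lambda>n. pnorm M s (\<lambda>x. g n x - h x)) \<longlonglongrightarrow> 0"
  shows "\<exists>r::nat\<Rightarrow>nat. strict_mono r \<and> (AE x in M. (\<lambda>n. g (r n) x) \<longlonglongrightarrow> h x)"
proof -
  have d: "(\<lambda>x. g n x - h x) \<in> Lp M s" for n using s g h by (intro Lp_diff) auto
  have "(\<lambda>n. \<integral>x. norm (norm (g n x - h x) powr s) \<partial>M) \<longlonglongrightarrow> 0"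
    using lim s unfolding pnorm_tendsto_0_iff[of s, OF less_le_trans[OF zero_less_one s]] by (simp add: pint_def)
  from tendsto_L1_AE_subseq[OF LpD(2)[OF d] this]
  obtain r where r: "strict_mono r" "AE x in M. (\<lambda>n. norm (g (r n) x - h x) powr s) \<longlonglongrightarrow> 0" by blast
  have "(\<lambda>n. g (r n) x) \<longlonglongrightarrow> h x" if "(\<lambda>n. norm (g (r n) x - h x) powr s) \<longlonglongrightarrow> 0" for x
  proof -
    have "(\<lambda>n. (norm (g (r n) x - h x) powr s) powr (1 / s)) \<longlonglongrightarrow> 0 powr (1 / s)"
      using that s by (intro tendsto_powr') auto
    then have "(\<lambda>n. norm (g (r n) x - h x)) \<longlonglongrightarrow> 0" using s by (simp add: powr_powr)
    then show ?thesis by (simp add: tendsto_norm_zero_iff LIM_zero_iff)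
  qed
  with r show ?thesis by (auto elim!: eventually_mono)
qed

text \<open>The estimate is made with [0,\<infinity>]-valued integrals, so that membership of the
  limit comes out as a conclusion together with the bound.\<close>

lemma Fatou_pint:
  fixes g :: "nat \<Rightarrow> 'a \<Rightarrow> 'b::euclidean_space"
  assumes s: "0 < s" and g: "\<And>n. g n \<in> Lp M s" and bound: "\<And>n. pint M s (g n) \<le> B"
    and h: "h \<in> borel_measurable M" and lim: "AE x in M. (\<lambda>n. g n x) \<longlonglongrightarrow> h x"
  shows "h \<in> Lp M s" "pint M s h \<le> B"
proof -
  have [measurable]: "g n \<in> borel_measurable M" for n using g LpD by blast
  note [measurable] = h
  have B0: "0 \<le> B" using bound[of 0] pint_nonneg order_trans by blast
  have "(\<integral>\<^sup>+ x. ennreal (norm (h x) powr s) \<partial>M) \<le> (\<integral>\<^sup>+ x. liminf (\<lambda>n. ennreal (norm (g n x) powr s)) \<partial>M)"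
  proof (rule nn_integral_mono_AE)
    show "AE x in M. ennreal (norm (h x) powr s) \<le> liminf (\<lambda>n. ennreal (norm (g n x) powr s))"
      using lim
    proof eventually_elim
      case (elim x)
      then have "(\<lambda>n. norm (g n x) powr s) \<longlonglongrightarrow> norm (h x) powr s"
        using s by (intro tendsto_powr' tendsto_intros) auto
      then have "(\<lambda>n. ennreal (norm (g n x) powr s)) \<longlonglongrightarrow> ennreal (norm (h x) powr s)"
        by (rule tendsto_ennrealI)
      from lim_imp_Liminf[OF sequentially_bot this] show ?case by simp
    qed
  qed
  also have "\<dots> \<le> liminf (\<lambda>n. \<integral>\<^sup>+ x. ennreal (norm (g n x) powr s) \<partial>M)"
    by (intro nn_integral_liminf) auto
  also have "\<dots> \<le> ennreal B"
  proof (rule order_trans[OF Liminf_le_Limsup[OF sequentially_bot] Limsup_bounded], rule always_eventually, rule allI)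
    fix n
    have "(\<integral>\<^sup>+ x. ennreal (norm (g n x) powr s) \<partial>M) = ennreal (pint M s (g n))"
      unfolding pint_def using LpD(2)[OF g] by (intro nn_integral_eq_integral) auto
    then show "(\<integral>\<^sup>+ x. ennreal (norm (g n x) powr s) \<partial>M) \<le> ennreal B"
      using bound by (simp add: ennreal_leI)
  qed
  finally have *: "(\<integral>\<^sup>+ x. ennreal (norm (h x) powr s) \<partial>M) \<le> ennreal B" .
  then have int: "integrable M (\<lambda>x. norm (h x) powr s)"
    by (intro integrableI_nonneg) (auto intro: le_less_trans)
  then show "h \<in> Lp M s" by (intro LpI h)
  have "(\<integral>\<^sup>+ x. ennreal (norm (h x) powr s) \<partial>M) = ennreal (pint M s h)"
    unfolding pint_def by (intro nn_integral_eq_integral int) auto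
  with * B0 show "pint M s h \<le> B" by simp
qed

text \<open>The terms tend to zero, so the increments are eventually below 2^-k. The weights 2^k
  thus turn summability of powers into absolute convergence of the telescoping series, whatever s >
  0 is.\<close>

lemma AE_summable_powr_imp_convergent:
  fixes y :: "nat \<Rightarrow> 'b::euclidean_space"
  assumes s: "0 < s" and sum: "summable (\<lambda>k. (2 ^ k * norm (y (Suc k) - y k)) powr s)"
  shows "convergent y"
proof -
  have "(\<lambda>k. ((2 ^ k * norm (y (Suc k) - y k)) powr s) powr (1 / s)) \<longlonglongrightarrow> 0 powr (1 / s)"
    using summable_LIMSEQ_zero[OF sum] s by (intro tendsto_powr') auto
  then have "(\<lambda>k. 2 ^ k * norm (y (Suc k) - y k)) \<longlonglongrightarrow> 0"
    using s by (simp add: powr_powr)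
  then have "eventually (\<lambda>k. 2 ^ k * norm (y (Suc k) - y k) < 1) sequentially"
    by (rule order_tendstoD) simp
  then have "eventually (\<lambda>k. norm (y (Suc k) - y k) \<le> (1/2) ^ k) sequentially"
    by eventually_elim (simp add: field_simps power_one_over)
  then have "summable (\<lambda>k. y (Suc k) - y k)"
    by (rule summable_comparison_test_ev) (simp add: summable_geometric)
  then have "convergent (\<lambda>n. y 0 + (\<Sum>k<n. y (Suc k) - y k))"
    unfolding summable_iff_convergent by (intro convergent_add convergent_const)
  then show ?thesis by (simp add: sum_lessThan_telescope)
qed

lemma Lp_complete:
  fixes g :: "nat \<Rightarrow> 'a \<Rightarrow> 'b::euclidean_space"
  assumes s: "1 \<le> s" and g: "\<And>n. g n \<in> Lp M s"
    and cauchy: "\<And>e. 0 < e \<Longrightarrow> \<exists>N. \<forall>m\<ge>N. \<forall>n\<ge>N. pnorm M s (\<lambda>x. g m x - g n x) < e"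
  shows "\<exists>h\<in>Lp M s. (\<lambda>n. pnorm M s (\<lambda>x. g n x - h x)) \<longlonglongrightarrow> 0"
proof -
  \<comment> \<open>The rate 4^-k serves twice: one factor 2^-k is spent on the weights 2^k in the
    pointwise argument, the other makes the integrals summable.\<close>
  have "\<exists>r. \<forall>k::nat. (\<forall>m\<ge>r k. \<forall>n\<ge>r k. pnorm M s (\<lambda>x. g m x - g n x) < (1/4) ^ k) \<and> r k < r (Suc k)"
  proof (rule dependent_nat_choice)
    show "\<exists>N. \<forall>m\<ge>N. \<forall>n\<ge>N. pnorm M s (\<lambda>x. g m x - g n x) < (1/4) ^ 0"
      using cauchy[of 1] by simp
    fix N' and k :: nat
    obtain N where N: "\<forall>m\<ge>N. \<forall>n\<ge>N. pnorm M s (\<lambda>x. g m x - g n x) < (1/4) ^ Suc k"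
      using cauchy[of "(1/4) ^ Suc k"] by auto
    then show "\<exists>y. (\<forall>m\<ge>y. \<forall>n\<ge>y. pnorm M s (\<lambda>x. g m x - g n x) < (1/4) ^ Suc k) \<and> N' < y"
      by (intro exI[of _ "max N (Suc N')"]) auto
  qed
  then obtain r :: "nat \<Rightarrow> nat" where r: "\<And>k m n. m \<ge> r k \<Longrightarrow> n \<ge> r k \<Longrightarrow> pnorm M s (\<lambda>x. g m x - g n x) < (1/4) ^ k"
    and mono: "\<And>k. r k < r (Suc k)" by blast
  have sm: "strict_mono r" using mono by (simp add: strict_mono_Suc_iff)
  define y where "y k = g (r k)" for k
  have ym [measurable]: "y k \<in> borel_measurable M" for k unfolding y_def using g LpD by blast
  have d: "(\<lambda>x. y (Suc k) x - y k x) \<in> Lp M s" for k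
    unfolding y_def using s g by (intro Lp_diff) auto
  have bound: "(\<integral>\<^sup>+ x. ennreal ((2 ^ k * norm (y (Suc k) x - y k x)) powr s) \<partial>M) \<le> ennreal ((1/2) ^ k)" for k
  proof -
    have "(\<integral>\<^sup>+ x. ennreal ((2 ^ k * norm (y (Suc k) x - y k x)) powr s) \<partial>M)
        = ennreal (\<integral>x. (2 ^ k * norm (y (Suc k) x - y k x)) powr s \<partial>M)"
      using LpD(2)[OF d[of k]] by (intro nn_integral_eq_integral) (auto simp: powr_mult)
    also have "(\<integral>x. (2 ^ k * norm (y (Suc k) x - y k x)) powr s \<partial>M)
        = (2 ^ k * pnorm M s (\<lambda>x. y (Suc k) x - y k x)) powr s"
      using s by (simp add: powr_mult pnorm_powr) (simp add: pint_def)
    also have "\<dots> \<le> ((1/2) ^ k) powr s"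
    proof (rule powr_mono2)
      have "pnorm M s (\<lambda>x. y (Suc k) x - y k x) \<le> (1/4) ^ k"
        using r[of k "r (Suc k)" "r k"] mono[of k] by (simp add: y_def)
      then have "2 ^ k * pnorm M s (\<lambda>x. y (Suc k) x - y k x) \<le> 2 ^ k * (1/4) ^ k"
        by (intro mult_left_mono) auto
      also have "\<dots> = (1/2) ^ k" by (simp add: power_mult_distrib[symmetric])
      finally show "2 ^ k * pnorm M s (\<lambda>x. y (Suc k) x - y k x) \<le> (1/2) ^ k" .
    qed (use s in auto)
    also have "\<dots> \<le> (1/2) ^ k"
      using s by (intro powr_le_one_le) (auto simp: power_le_one)
    finally show ?thesis by (simp add: ennreal_leI)
  qed
  have "(\<integral>\<^sup>+ x. (\<Sum>k. ennreal ((2 ^ k * norm (y (Suc k) x - y k x)) powr s)) \<partial>M)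
      = (\<Sum>k. \<integral>\<^sup>+ x. ennreal ((2 ^ k * norm (y (Suc k) x - y k x)) powr s) \<partial>M)"
    by (intro nn_integral_suminf) auto
  also have "\<dots> \<le> (\<Sum>k. ennreal ((1/2) ^ k))" by (intro suminf_le bound) auto
  also have "\<dots> = ennreal 2"
    using geometric_sums[of "1/2::real"] by (intro suminf_ennreal_eq) auto
  finally have "(\<integral>\<^sup>+ x. (\<Sum>k. ennreal ((2 ^ k * norm (y (Suc k) x - y k x)) powr s)) \<partial>M) \<le> ennreal 2" .
  then have "(\<integral>\<^sup>+ x. (\<Sum>k. ennreal ((2 ^ k * norm (y (Suc k) x - y k x)) powr s)) \<partial>M) \<noteq> \<infinity>"
    by (auto simp: top_unique)
  then have "AE x in M. (\<Sum>k. ennreal ((2 ^ k * norm (y (Suc k) x - y k x)) powr s)) \<noteq> \<infinity>"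
    by (intro nn_integral_PInf_AE) auto
  then have conv: "AE x in M. convergent (\<lambda>k. y k x)"
  proof eventually_elim
    case (elim x)
    then have "summable (\<lambda>k. (2 ^ k * norm (y (Suc k) x - y k x)) powr s)"
      by (intro summable_suminf_not_top) auto
    then show ?case using s by (intro AE_summable_powr_imp_convergent[of s]) auto
  qed
  define h where "h x = lim (\<lambda>k. y k x)" for x
  have hm [measurable]: "h \<in> borel_measurable M" unfolding h_def by measurable
  have lim: "AE x in M. (\<lambda>k. y k x) \<longlonglongrightarrow> h x"
    using conv by eventually_elim (simp add: h_def convergent_LIMSEQ_iff)
  \<comment> \<open>Fatou along the chosen subsequence with \<open>n\<close> fixed: the distance of
    \<open>g n\<close> to the limit is at most its distance to the tail. This gives convergence of
    the whole sequence at once.\<close>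
  have fatou: "(\<lambda>x. g n x - h x) \<in> Lp M s \<and> pnorm M s (\<lambda>x. g n x - h x) \<le> (1/4) ^ j"
    if n: "n \<ge> r j" for n j
  proof -
    have gm [measurable]: "g n \<in> borel_measurable M" using g LpD by blast
    have d': "(\<lambda>x. g n x - y (k + j) x) \<in> Lp M s" for k unfolding y_def using s g by (intro Lp_diff) auto
    have le: "pint M s (\<lambda>x. g n x - y (k + j) x) \<le> ((1/4) ^ j) powr s" for k
    proof -
      have "r (k + j) \<ge> r j" using sm by (simp add: strict_mono_less_eq)
      then have "pnorm M s (\<lambda>x. g n x - y (k + j) x) < (1/4) ^ j" using r[of j n "r (k + j)"] n by (simp add: y_def)
      then have "pnorm M s (\<lambda>x. g n x - y (k + j) x) powr s \<le> ((1/4) ^ j) powr s" using s by (intro powr_mono2) auto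
      then show ?thesis using s by (simp add: pnorm_powr)
    qed
    have "AE x in M. (\<lambda>k. g n x - y (k + j) x) \<longlonglongrightarrow> g n x - h x"
      using lim by eventually_elim (intro tendsto_intros LIMSEQ_ignore_initial_segment)
    from Fatou_pint[OF _ d' le _ this] s
    have *: "(\<lambda>x. g n x - h x) \<in> Lp M s" "pint M s (\<lambda>x. g n x - h x) \<le> ((1/4) ^ j) powr s" by auto
    then have "pnorm M s (\<lambda>x. g n x - h x) \<le> (((1/4) ^ j) powr s) powr (1 / s)"
      unfolding pnorm_def using s by (intro powr_mono2) auto
    with * s show ?thesis by (simp add: powr_powr)
  qed
  have "(\<lambda>x. g (r 0) x - h x) \<in> Lp M s"
    using fatou[of 0 "r 0"] by simp
  from Lp_diff[OF _ g[of "r 0"] this] s have "h \<in> Lp M s" by simp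
  moreover have "(\<lambda>n. pnorm M s (\<lambda>x. g n x - h x)) \<longlonglongrightarrow> 0"
  proof (rule LIMSEQ_I)
    fix e :: real assume "0 < e"
    then obtain j where j: "(1/4::real) ^ j < e" using real_arch_pow_inv[of e "1/4"] by auto
    show "\<exists>N. \<forall>n\<ge>N. norm (pnorm M s (\<lambda>x. g n x - h x) - 0) < e"
      using fatou[of j] j by (intro exI[of _ "r j"]) (auto intro: le_less_trans)
  qed
  ultimately show ?thesis by blast
qed

section \<open>Minimization over closed subspaces and duality\<close>

definition closed_subspace :: "'a measure \<Rightarrow> real \<Rightarrow> ('a \<Rightarrow> 'b::euclidean_space) set \<Rightarrow> bool" where
  "closed_subspace M s Y \<longleftrightarrow> Y \<subseteq> Lp M s \<and> (\<lambda>x. 0) \<in> Y \<and>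
     (\<forall>u\<in>Y. \<forall>v\<in>Y. (\<lambda>x. u x + v x) \<in> Y) \<and> (\<forall>c. \<forall>u\<in>Y. (\<lambda>x. c *\<^sub>R u x) \<in> Y) \<and>
     (\<forall>U h. (\<forall>n::nat. U n \<in> Y) \<longrightarrow> h \<in> Lp M s \<longrightarrow> (\<lambda>n. pnorm M s (\<lambda>x. U n x - h x)) \<longlonglongrightarrow> 0 \<longrightarrow> h \<in> Y)"

lemma closed_subspaceD:
  assumes "closed_subspace M s Y"
  shows "u \<in> Y \<Longrightarrow> u \<in> Lp M s" "(\<lambda>x. 0) \<in> Y" "u \<in> Y \<Longrightarrow> v \<in> Y \<Longrightarrow> (\<lambda>x. u x + v x) \<in> Y"
    "u \<in> Y \<Longrightarrow> (\<lambda>x. c *\<^sub>R u x) \<in> Y"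
    "(\<And>n. U n \<in> Y) \<Longrightarrow> h \<in> Lp M s \<Longrightarrow> (\<lambda>n. pnorm M s (\<lambda>x. U n x - h x)) \<longlonglongrightarrow> 0 \<Longrightarrow> h \<in> Y"
  using assms unfolding closed_subspace_def by blast+

text \<open>The constant sequence \<open>u\<close> converges in the seminorm to each of its a.e.
  modifications, so sequential closedness already absorbs the passage between
  representatives.\<close>

lemma closed_subspace_AE:
  assumes Y: "closed_subspace M s Y" and "0 \<le> s" "u \<in> Y" "h \<in> borel_measurable M" "AE x in M. u x = h x"
  shows "h \<in> Y"
proof (rule closed_subspaceD(5)[OF Y])
  show "h \<in> Lp M s" using Lp_AE_cong[OF closed_subspaceD(1)[OF Y]] assms by blast
  have "(\<lambda>x. u x - h x) \<in> Lp M s" using \<open>h \<in> Lp M s\<close> assms closed_subspaceD(1)[OF Y] by (intro Lp_diff)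
  then have "pnorm M s (\<lambda>x. u x - h x) = 0"
    using assms(5) by (subst pnorm_eq_0_iff) auto
  then show "(\<lambda>n::nat. pnorm M s (\<lambda>x. u x - h x)) \<longlonglongrightarrow> 0" by simp
qed (use assms in auto)

lemma closed_subspace_Lp: "0 \<le> s \<Longrightarrow> closed_subspace M s (Lp M s)"
  by (auto simp: closed_subspace_def intro: Lp_add Lp_scaleR)

definition bounded_linear_on :: "'a measure \<Rightarrow> real \<Rightarrow> ('a \<Rightarrow> 'b::euclidean_space) set \<Rightarrow> (('a \<Rightarrow> 'b) \<Rightarrow> real) \<Rightarrow> bool" where
  "bounded_linear_on M s Y l \<longleftrightarrow> (\<forall>u\<in>Y. \<forall>v\<in>Y. l (\<lambda>x. u x + v x) = l u + l v) \<and>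
     (\<forall>c. \<forall>u\<in>Y. l (\<lambda>x. c *\<^sub>R u x) = c * l u) \<and> (\<exists>C. \<forall>u\<in>Y. \<bar>l u\<bar> \<le> C * pnorm M s u)"

lemma dmap_Lp:
  assumes "1 < s" "g \<in> Lp M s"
  shows "(\<lambda>x. dmap s (g x)) \<in> Lp M (conjx s)"
proof (rule LpI)
  show "(\<lambda>x. dmap s (g x)) \<in> borel_measurable M"
    using borel_measurable_continuous_on[OF continuous_dmap[OF assms(1)] LpD(1)[OF assms(2)]] .
qed (use assms in \<open>simp add: norm_dmap_powr LpD\<close>)

lemma pint_dmap: "1 < s \<Longrightarrow> pint M (conjx s) (\<lambda>x. dmap s (g x)) = pint M s g"
  by (simp add: pint_def norm_dmap_powr)

lemma dmap_inner_integrable: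
  assumes "1 < s" "g \<in> Lp M s" "v \<in> Lp M s"
  shows "integrable M (\<lambda>x. dmap s (g x) \<bullet> v x)"
  using inner_integrable[OF conjx_gt_1[OF assms(1)] dmap_Lp[OF assms(1,2)]] assms
  by (simp add: conjx_conjx)

text \<open>The limit needed for the first variation of the functional. Steps 1/(n+1) are at most 1,
  so (|a| + |v|)^s is a majorant.\<close>

lemma dmap_inner_tendsto:
  fixes a v :: "'a \<Rightarrow> 'b::euclidean_space"
  assumes s: "1 < s" and a: "a \<in> Lp M s" and v: "v \<in> Lp M s"
  shows "(\<lambda>n. \<integral>x. dmap s (a x + (1 / real (Suc n)) *\<^sub>R v x) \<bullet> v x \<partial>M) \<longlonglongrightarrow> (\<integral>x. dmap s (a x) \<bullet> v x \<partial>M)"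
proof (rule integral_dominated_convergence[where w = "\<lambda>x. (norm (a x) + norm (v x)) powr s"])
  have "(\<lambda>x. norm (a x) + norm (v x)) \<in> Lp M s"
    using s a v by (intro Lp_add Lp_norm) auto
  then show "integrable M (\<lambda>x. (norm (a x) + norm (v x)) powr s)" by (simp add: Lp_def)
  have t: "(\<lambda>n. a x + (1 / real (Suc n)) *\<^sub>R v x) \<longlonglongrightarrow> a x + 0 *\<^sub>R v x" for x
    by (intro tendsto_intros LIMSEQ_Suc[OF lim_1_over_n])
  have "isCont (dmap s) (a x)" for x
    using continuous_dmap[OF s, where 'b = 'b] by (simp add: continuous_on_eq_continuous_at)
  then have "(\<lambda>n. dmap s (a x + (1 / real (Suc n)) *\<^sub>R v x)) \<longlonglongrightarrow> dmap s (a x)" for x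
    using t[of x] by (auto intro: isCont_tendsto_compose)
  then show "AE x in M. (\<lambda>n. dmap s (a x + (1 / real (Suc n)) *\<^sub>R v x) \<bullet> v x) \<longlonglongrightarrow> dmap s (a x) \<bullet> v x"
    by (auto intro!: tendsto_intros)
  have "norm (dmap s (a x + (1 / real (Suc n)) *\<^sub>R v x) \<bullet> v x) \<le> (norm (a x) + norm (v x)) powr s" for n x
  proof -
    let ?w = "a x + (1 / real (Suc n)) *\<^sub>R v x"
    have "norm ((1 / real (Suc n)) *\<^sub>R v x) \<le> norm (v x)"
      by (auto simp: divide_le_eq mult_le_cancel_left1)
    then have w: "norm ?w \<le> norm (a x) + norm (v x)" using norm_triangle_ineq[of "a x"] by (smt (verit))
    have "norm (dmap s ?w \<bullet> v x) \<le> norm ?w powr (s - 1) * norm (v x)"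
      using Cauchy_Schwarz_ineq2[of "dmap s ?w" "v x"] by (simp add: norm_dmap)
    also have "\<dots> \<le> (norm (a x) + norm (v x)) powr (s - 1) * (norm (a x) + norm (v x))"
      using w s by (intro mult_mono powr_mono2) auto
    also have "\<dots> = (norm (a x) + norm (v x)) powr s"
      by (simp add: powr_mult_base[symmetric] powr_mult_base mult.commute)
    finally show ?thesis .
  qed
  then show "AE x in M. norm (dmap s (a x + (1 / real (Suc n)) *\<^sub>R v x) \<bullet> v x) \<le> (norm (a x) + norm (v x)) powr s" for n
    by simp
  have "(\<lambda>x. a x + (1 / real (Suc n)) *\<^sub>R v x) \<in> Lp M s" for n
    using s by (intro Lp_add[OF _ a Lp_scaleR[OF v]]) auto
  then show "(\<lambda>x. dmap s (a x + (1 / real (Suc n)) *\<^sub>R v x) \<bullet> v x) \<in> borel_measurable M" for n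
    using dmap_inner_integrable[OF s _ v] by blast
  show "(\<lambda>x. dmap s (a x) \<bullet> v x) \<in> borel_measurable M"
    using dmap_inner_integrable[OF s a v] by blast
qed

text \<open>Young's inequality with the weights 2^(-1/s) and 2^(1/s): the first turns the
  coefficient 1/s into 1/(2s), so half of a term t^s / s remains after the linear term has been
  absorbed.\<close>

lemma coercive_scalar_bound:
  fixes s C :: real
  assumes "1 < s" "0 \<le> C"
  shows "\<exists>B. \<forall>t\<ge>0. C * t \<le> t powr s / (2 * s) + B"
proof -
  define c where "c = (2 powr (1 / s) * C) powr conjx s / conjx s"
  have "C * t \<le> t powr s / (2 * s) + c" if "0 \<le> t" for t
  proof -
    have e: "2 powr (1 / s) * 2 powr (- 1 / s) = (1::real)"
      by (subst powr_add[symmetric]) simp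
    have e2: "(2 powr (- 1 / s) * t) powr s = t powr s / 2"
      using assms by (simp add: powr_mult powr_powr powr_minus_divide powr_divide)
    have "C * t = (2 powr (- 1 / s) * t) * (2 powr (1 / s) * C)"
      using e by (simp add: algebra_simps)
    also have "\<dots> \<le> (2 powr (- 1 / s) * t) powr s / s + c"
      unfolding c_def using assms conjx_gt_1[of s] conjx_sum[of s] that by (intro Youngs_inequality) auto
    finally show ?thesis unfolding e2 by simp
  qed
  then show ?thesis by blast
qed

lemma midpoint_arith:
  fixes a b c d p q r :: real
  assumes "a < c + p" "b < c + q" "c \<le> d" "p \<le> r" "q \<le> r"
  shows "(a + b) / 2 - d \<le> r"
proof -
  have "a + b \<le> (c + p) + (c + q)" using assms by (intro add_mono) auto
  also have "\<dots> \<le> (d + r) + (d + r)" using assms by (intro add_mono) auto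
  finally show ?thesis by (simp add: field_simps)
qed

text \<open>The minimizer of \<open>\<parallel>y - h\<parallel>\<^sup>s / s - l y\<close> over \<open>Y\<close>.  Minimizing sequences are Cauchy by uniform
  convexity, so no weak compactness is needed.\<close>

theorem duality_map_surjective:
  fixes h :: "'a \<Rightarrow> 'b::euclidean_space"
  assumes s: "1 < s" and Y: "closed_subspace M s Y" and l: "bounded_linear_on M s Y l" and h: "h \<in> Lp M s"
  shows "\<exists>y\<in>Y. \<forall>v\<in>Y. (\<integral>x. dmap s (y x - h x) \<bullet> v x \<partial>M) = l v"
proof -
  note YD = closed_subspaceD[OF Y]
  have s1: "1 \<le> s" "0 \<le> s" using s by auto
  obtain C0 where C0: "\<And>u. u \<in> Y \<Longrightarrow> \<bar>l u\<bar> \<le> C0 * pnorm M s u"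
    using l unfolding bounded_linear_on_def by blast
  define C where "C = max C0 0"
  have C: "\<bar>l u\<bar> \<le> C * pnorm M s u" "0 \<le> C" if "u \<in> Y" for u
    using C0[OF that] mult_right_mono[of C0 C "pnorm M s u"] by (auto simp: C_def)
  have "0 \<le> C" by (simp add: C_def)
  have ladd: "l (\<lambda>x. u x + v x) = l u + l v" if "u \<in> Y" "v \<in> Y" for u v
    using l that unfolding bounded_linear_on_def by blast
  have lscale: "l (\<lambda>x. c *\<^sub>R u x) = c * l u" if "u \<in> Y" for u c
    using l that unfolding bounded_linear_on_def by blast
  have ldiff: "(\<lambda>x. u x - v x) \<in> Y \<and> l (\<lambda>x. u x - v x) = l u - l v" if "u \<in> Y" "v \<in> Y" for u v
    using ladd[OF that(1) YD(4)[OF that(2), of "-1"]] lscale[OF that(2), of "-1"] YD(3)[OF that(1) YD(4)[OF that(2), of "-1"]]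
    by simp
  have Lh: "(\<lambda>x. y x - h x) \<in> Lp M s" if "y \<in> Y" for y
    using s1 h YD(1)[OF that] by (intro Lp_diff)
  define \<Phi> where "\<Phi> y = pint M s (\<lambda>x. y x - h x) / s - l y" for y
  obtain B where B: "\<And>t. 0 \<le> t \<Longrightarrow> C * t \<le> t powr s / (2 * s) + B"
    using coercive_scalar_bound[OF s \<open>0 \<le> C\<close>] by blast
  define B' where "B' = B + C * pnorm M s h"
  \<comment> \<open>Half of the power term pays for the functional; the other half bounds minimizing
    sequences.\<close>
  have coer: "pint M s (\<lambda>x. y x - h x) / (2 * s) - B' \<le> \<Phi> y" if y: "y \<in> Y" for y
  proof -
    have "pnorm M s (\<lambda>x. y x - 0) \<le> pnorm M s (\<lambda>x. y x - h x) + pnorm M s (\<lambda>x. h x - 0)"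
      using s1 h YD(1)[OF y] by (intro pnorm_dist_triangle) auto
    then have "C * pnorm M s y \<le> C * pnorm M s (\<lambda>x. y x - h x) + C * pnorm M s h"
      using mult_left_mono[OF _ \<open>0 \<le> C\<close>] by (fastforce simp: distrib_left[symmetric])
    moreover have "C * pnorm M s (\<lambda>x. y x - h x) \<le> pint M s (\<lambda>x. y x - h x) / (2 * s) + B"
      using B[of "pnorm M s (\<lambda>x. y x - h x)"] s by (simp add: pnorm_powr)
    ultimately have "l y \<le> pint M s (\<lambda>x. y x - h x) / (2 * s) + B'"
      using C(1)[OF y] unfolding B'_def by linarith
    moreover have "pint M s (\<lambda>x. y x - h x) / s = pint M s (\<lambda>x. y x - h x) / (2 * s) + pint M s (\<lambda>x. y x - h x) / (2 * s)"
      using s by (simp add: field_simps)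
    ultimately show ?thesis unfolding \<Phi>_def by linarith
  qed
  have bdd: "bdd_below (\<Phi> ` Y)"
  proof (rule bdd_belowI2)
    fix y assume "y \<in> Y"
    show "- B' \<le> \<Phi> y" using coer[OF \<open>y \<in> Y\<close>] s pint_nonneg[of M s "\<lambda>x. y x - h x"]
      by (smt (verit) divide_nonneg_nonneg)
  qed
  define I where "I = (INF y\<in>Y. \<Phi> y)"
  have I_le: "I \<le> \<Phi> y" if "y \<in> Y" for y unfolding I_def using bdd that by (rule cINF_lower)
  have "\<exists>y\<in>Y. \<Phi> y < I + 1 / real (Suc n)" for n
    using YD(2) bdd unfolding I_def by (subst cINF_less_iff[symmetric]) auto
  then obtain w where w: "\<And>n. w n \<in> Y" "\<And>n. \<Phi> (w n) < I + 1 / real (Suc n)" by metis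
  define R where "R = (I + 1 + B') * (2 * s)"
  have wR: "pint M s (\<lambda>x. w n x - h x) \<le> R" for n
  proof -
    have "1 / real (Suc n) \<le> 1" by simp
    then have "pint M s (\<lambda>x. w n x - h x) / (2 * s) \<le> I + 1 + B'"
      using coer[OF w(1), of n] w(2)[of n] by linarith
    then show ?thesis unfolding R_def using s by (simp add: field_simps)
  qed
  have R0: "0 \<le> R" using wR[of 0] pint_nonneg order_trans by blast
  have cauchy: "\<exists>N. \<forall>m\<ge>N. \<forall>n\<ge>N. pnorm M s (\<lambda>x. w m x - w n x) < e" if e: "0 < e" for e
  proof -
    \<comment> \<open>Chosen so that the first term of uniform convexity, at most \<epsilon> (R + R)
      on the minimizing sequence, stays below half of e^s. The other half is left for the midpoint
      defect.\<close>
    define \<epsilon> where "\<epsilon> = e powr s / (4 * (R + 1))"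
    have \<epsilon>: "0 < \<epsilon>" "\<epsilon> * (R + R) < e powr s / 2 + \<epsilon> * 0"
    proof -
      show "0 < \<epsilon>" unfolding \<epsilon>_def using e R0 by simp
      have "e powr s * R < e powr s * (R + 1)" using e by simp
      then show "\<epsilon> * (R + R) < e powr s / 2 + \<epsilon> * 0" unfolding \<epsilon>_def using R0 by (simp add: field_simps)
    qed
    obtain K where K: "0 \<le> K" "\<And>a b::'b. norm (a - b) powr s \<le> \<epsilon> * (norm a powr s + norm b powr s)
      + K * ((norm a powr s + norm b powr s) / 2 - norm ((1/2) *\<^sub>R (a + b)) powr s)"
      using uniform_convexity[OF s \<epsilon>(1)] by blast
    have "(\<lambda>N. K * s * (1 / real (Suc N))) \<longlonglongrightarrow> K * s * 0"
      by (intro tendsto_intros LIMSEQ_Suc[OF lim_1_over_n])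
    then have "eventually (\<lambda>N. K * s * (1 / real (Suc N)) < e powr s / 2) sequentially"
      using e by (intro order_tendstoD) auto
    then obtain N where N: "K * s * (1 / real (Suc N)) < e powr s / 2"
      by (meson eventually_sequentially order_refl)
    have "pnorm M s (\<lambda>x. w m x - w n x) < e" if mn: "m \<ge> N" "n \<ge> N" for m n
    proof -
      define a b where "a x = w m x - h x" and "b x = w n x - h x" for x
      have ab: "a \<in> Lp M s" "b \<in> Lp M s" unfolding a_def b_def using Lh w(1) by auto
      define z where "z x = (1/2) *\<^sub>R (w m x + w n x)" for x
      have z: "z \<in> Y" unfolding z_def using w(1) by (intro YD(3,4))
      have zh: "z x - h x = (1/2) *\<^sub>R (a x + b x)" for x
        by (simp add: z_def a_def b_def algebra_simps scaleR_2[symmetric])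
      have int: "integrable M (\<lambda>x. norm (a x) powr s)" "integrable M (\<lambda>x. norm (b x) powr s)"
        "integrable M (\<lambda>x. norm ((1/2) *\<^sub>R (a x + b x)) powr s)"
        "integrable M (\<lambda>x. norm (a x - b x) powr s)"
        using ab Lh[OF z] Lp_diff[OF s1(2) ab] by (auto simp: Lp_def zh)
      have "pint M s (\<lambda>x. a x - b x) \<le> (\<integral>x. \<epsilon> * (norm (a x) powr s + norm (b x) powr s)
          + K * ((norm (a x) powr s + norm (b x) powr s) / 2 - norm ((1/2) *\<^sub>R (a x + b x)) powr s) \<partial>M)"
        unfolding pint_def using int K(2) by (intro integral_mono) auto
      also have "\<dots> = \<epsilon> * (pint M s a + pint M s b) + K * ((pint M s a + pint M s b) / 2 - pint M s (\<lambda>x. z x - h x))"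
        unfolding pint_def zh using int by simp
      also have "\<dots> \<le> \<epsilon> * (R + R) + K * (s * (1 / real (Suc N)))"
      proof (intro add_mono mult_left_mono)
        \<comment> \<open>Linearity makes \<open>l\<close> drop out at the midpoint: the defect of
          the power integral is s times the defect of \<Phi>, and the latter is small because \<Phi>
          at the midpoint is no less than the infimum.\<close>
        have "l z = (l (w m) + l (w n)) / 2"
          unfolding z_def using lscale[OF YD(3)[OF w(1) w(1)]] ladd[OF w(1) w(1)] by simp
        then have "(pint M s a + pint M s b) / 2 - pint M s (\<lambda>x. z x - h x) = s * ((\<Phi> (w m) + \<Phi> (w n)) / 2 - \<Phi> z)"
          unfolding \<Phi>_def a_def b_def using s by (simp add: field_simps)
        also have "\<dots> \<le> s * (1 / real (Suc N))"
        proof (rule mult_left_mono)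
          have "1 / real (Suc m) \<le> 1 / real (Suc N)" "1 / real (Suc n) \<le> 1 / real (Suc N)"
            using mn by (auto intro!: divide_left_mono)
          then show "(\<Phi> (w m) + \<Phi> (w n)) / 2 - \<Phi> z \<le> 1 / real (Suc N)"
            using midpoint_arith[OF w(2)[of m] w(2)[of n] I_le[OF z]] by blast
        qed (use s in auto)
        finally show "(pint M s a + pint M s b) / 2 - pint M s (\<lambda>x. z x - h x) \<le> s * (1 / real (Suc N))" .
        show "pint M s a \<le> R" "pint M s b \<le> R" unfolding a_def b_def by (rule wR)+
      qed (use \<epsilon> K in auto)
      also have "\<dots> < e powr s" using add_strict_mono[OF \<epsilon>(2) N] by (simp add: mult.assoc)
      finally have "pint M s (\<lambda>x. w m x - w n x) < e powr s" by (simp add: a_def b_def)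
      then have "pnorm M s (\<lambda>x. w m x - w n x) < (e powr s) powr (1 / s)"
        unfolding pnorm_def using s by (intro powr_less_mono2) auto
      then show ?thesis using e s by (simp add: powr_powr)
    qed
    then show ?thesis by blast
  qed
  obtain y where y: "y \<in> Lp M s" "(\<lambda>n. pnorm M s (\<lambda>x. w n x - y x)) \<longlonglongrightarrow> 0"
    using Lp_complete[OF s1(1) YD(1)[OF w(1)] cauchy] by blast
  have yY: "y \<in> Y" using YD(5)[OF w(1) y] .
  have "(\<lambda>n. \<Phi> (w n)) \<longlonglongrightarrow> \<Phi> y"
  proof -
    have "(\<lambda>n. pint M s (\<lambda>x. w n x - h x)) \<longlonglongrightarrow> pint M s (\<lambda>x. y x - h x)"
      using y(2) by (intro pint_tendsto[OF s1(1) Lh[OF w(1)] Lh[OF yY]]) simp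
    moreover have "(\<lambda>n. l (w n) - l y) \<longlonglongrightarrow> 0"
    proof (rule Lim_null_comparison)
      show "\<forall>\<^sub>F n in sequentially. norm (l (w n) - l y) \<le> C * pnorm M s (\<lambda>x. w n x - y x)"
        using ldiff[OF w(1) yY] C(1) by (auto intro!: always_eventually) metis
      show "(\<lambda>n. C * pnorm M s (\<lambda>x. w n x - y x)) \<longlonglongrightarrow> 0" using tendsto_mult_left[OF y(2), of C] by simp
    qed
    then have "(\<lambda>n. l (w n)) \<longlonglongrightarrow> l y" by (simp add: LIM_zero_iff)
    ultimately show ?thesis unfolding \<Phi>_def using s by (intro tendsto_intros) auto
  qed
  moreover have "(\<lambda>n. I + 1 / real (Suc n)) \<longlonglongrightarrow> I + 0"
    by (intro tendsto_intros LIMSEQ_Suc[OF lim_1_over_n])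
  ultimately have "\<Phi> y \<le> I + 0"
    using w(2) by (intro LIMSEQ_le[of "\<lambda>n. \<Phi> (w n)" _ "\<lambda>n. I + 1 / real (Suc n)"]) (auto intro: less_imp_le)
  then have min: "\<Phi> y \<le> \<Phi> v" if "v \<in> Y" for v using I_le[OF that] by simp
  \<comment> \<open>The tangent inequality is applied at the perturbed point y + t v, so minimality
    gives an inequality for each t > 0 and only the continuity of \<open>dmap\<close> is needed as t
    tends to 0. Replacing v by -v turns it into equality.\<close>
  have half: "l v \<le> (\<integral>x. dmap s (y x - h x) \<bullet> v x \<partial>M)" if v: "v \<in> Y" for v
  proof (rule LIMSEQ_le_const[OF dmap_inner_tendsto[OF s Lh[OF yY] YD(1)[OF v]]], intro exI allI impI)
    fix n
    define t where "t = 1 / real (Suc n)"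
    have t: "0 < t" by (simp add: t_def)
    define y' where "y' x = y x + t *\<^sub>R v x" for x
    have y': "y' \<in> Y" unfolding y'_def using yY v by (intro YD(3,4))
    have "norm (y' x - h x) powr s + s * (dmap s (y' x - h x) \<bullet> ((y x - h x) - (y' x - h x))) \<le> norm (y x - h x) powr s" for x
      by (rule norm_powr_tangent[OF s])
    then have "norm (y' x - h x) powr s - s * t * (dmap s (y' x - h x) \<bullet> v x) \<le> norm (y x - h x) powr s" for x
      by (simp add: y'_def algebra_simps)
    then have "(\<integral>x. norm (y' x - h x) powr s - s * t * (dmap s (y' x - h x) \<bullet> v x) \<partial>M) \<le> pint M s (\<lambda>x. y x - h x)"
      unfolding pint_def
      using LpD(2)[OF Lh[OF y']] LpD(2)[OF Lh[OF yY]] dmap_inner_integrable[OF s Lh[OF y'] YD(1)[OF v]]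
      by (intro integral_mono) auto
    also have "(\<integral>x. norm (y' x - h x) powr s - s * t * (dmap s (y' x - h x) \<bullet> v x) \<partial>M)
        = pint M s (\<lambda>x. y' x - h x) - s * t * (\<integral>x. dmap s (y' x - h x) \<bullet> v x \<partial>M)"
      using LpD(2)[OF Lh[OF y']] dmap_inner_integrable[OF s Lh[OF y'] YD(1)[OF v]]
      by (simp add: pint_def)
    finally have 1: "pint M s (\<lambda>x. y' x - h x) / s \<le> pint M s (\<lambda>x. y x - h x) / s + t * (\<integral>x. dmap s (y' x - h x) \<bullet> v x \<partial>M)"
      using s by (simp add: field_simps)
    have "l y' = l y + t * l v"
      unfolding y'_def using ladd[OF yY YD(4)[OF v]] lscale[OF v] by simp
    with 1 min[OF y'] have "t * l v \<le> t * (\<integral>x. dmap s (y' x - h x) \<bullet> v x \<partial>M)"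
      unfolding \<Phi>_def by linarith
    then have "l v \<le> (\<integral>x. dmap s (y' x - h x) \<bullet> v x \<partial>M)" using t by simp
    then show "l v \<le> (\<integral>x. dmap s (y x - h x + (1 / real (Suc n)) *\<^sub>R v x) \<bullet> v x \<partial>M)"
      by (simp add: y'_def t_def algebra_simps)
  qed
  have "(\<integral>x. dmap s (y x - h x) \<bullet> v x \<partial>M) = l v" if v: "v \<in> Y" for v
  proof -
    have "(\<lambda>x. - v x) \<in> Y" "l (\<lambda>x. - v x) = - l v"
      using YD(4)[OF v, of "-1"] lscale[OF v, of "-1"] by auto
    then show ?thesis using half[OF v] half[of "\<lambda>x. - v x"] by simp
  qed
  with yY show ?thesis by blast
qed

lemma Lp_Riesz:
  fixes l :: "('a \<Rightarrow> 'b::euclidean_space) \<Rightarrow> real"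
  assumes s: "1 < s" and l: "bounded_linear_on M s (Lp M s) l"
  shows "\<exists>g\<in>Lp M (conjx s). \<forall>v\<in>Lp M s. l v = (\<integral>x. g x \<bullet> v x \<partial>M)"
proof -
  obtain y where "y \<in> Lp M s" "\<forall>v\<in>Lp M s. (\<integral>x. dmap s (y x - 0) \<bullet> v x \<partial>M) = l v"
    using duality_map_surjective[OF s closed_subspace_Lp l zero_in_Lp] s by auto
  then show ?thesis using dmap_Lp[OF s, of y M] by (intro bexI[of _ "\<lambda>x. dmap s (y x)"]) auto
qed

lemma Lp_projection:
  fixes h :: "'a \<Rightarrow> 'b::euclidean_space"
  assumes s: "1 < s" and Y: "closed_subspace M s Y" and h: "h \<in> Lp M s"
  shows "\<exists>y\<in>Y. \<forall>v\<in>Y. (\<integral>x. dmap s (y x - h x) \<bullet> v x \<partial>M) = 0"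
proof (rule duality_map_surjective[OF s Y _ h])
  show "bounded_linear_on M s Y (\<lambda>v. 0)"
    by (auto simp: bounded_linear_on_def intro!: exI[of _ 0])
qed

text \<open>This takes the place of Hahn-Banach. With y the nearest point of Y to h, the function
  \<open>dmap s (y - h)\<close> annihilates Y, hence by assumption h, hence y - h; but its pairing
  with y - h is the s-th power of the distance.\<close>

lemma closed_subspace_annihilator:
  fixes h :: "'a \<Rightarrow> 'b::euclidean_space"
  assumes s: "1 < s" and Y: "closed_subspace M s Y" and h: "h \<in> Lp M s"
    and ann: "\<And>g. g \<in> Lp M (conjx s) \<Longrightarrow> (\<And>v. v \<in> Y \<Longrightarrow> (\<integral>x. g x \<bullet> v x \<partial>M) = 0) \<Longrightarrow> (\<integral>x. g x \<bullet> h x \<partial>M) = 0"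
  shows "h \<in> Y"
proof -
  obtain y where y: "y \<in> Y" "\<And>v. v \<in> Y \<Longrightarrow> (\<integral>x. dmap s (y x - h x) \<bullet> v x \<partial>M) = 0"
    using Lp_projection[OF s Y h] by blast
  have yL: "y \<in> Lp M s" using closed_subspaceD(1)[OF Y y(1)] .
  have d: "(\<lambda>x. y x - h x) \<in> Lp M s" using s yL h by (intro Lp_diff) auto
  have "(\<integral>x. dmap s (y x - h x) \<bullet> h x \<partial>M) = 0"
    using ann[OF dmap_Lp[OF s d]] y(2) by blast
  moreover have "(\<integral>x. dmap s (y x - h x) \<bullet> y x \<partial>M) = 0" using y by blast
  ultimately have "(\<integral>x. dmap s (y x - h x) \<bullet> (y x - h x) \<partial>M) = 0"
    using dmap_inner_integrable[OF s d] yL h by (simp add: inner_diff_right)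
  then have "pint M s (\<lambda>x. y x - h x) = 0" by (simp add: pint_def dmap_inner_self)
  then have "AE x in M. y x = h x" using pint_eq_0_iff[OF d] by (auto elim!: eventually_mono)
  then show ?thesis using closed_subspace_AE[OF Y _ y(1) LpD(1)[OF h]] s by simp
qed

section \<open>Almost everywhere convergence and weak convergence\<close>

text \<open>Young's inequality with a small constant reduces the claim to dominated convergence of
  the positive part of \<open>norm (g n) * norm w - e * norm (g n) powr s\<close>.\<close>

lemma AE_bounded_imp_weak_null:
  fixes g :: "nat \<Rightarrow> 'a \<Rightarrow> 'b::euclidean_space" and w :: "'a \<Rightarrow> 'c::euclidean_space"
  assumes s: "1 < s" and g: "\<And>n. g n \<in> Lp M s" and bound: "\<And>n. pint M s (g n) \<le> B"
    and w: "w \<in> Lp M (conjx s)" and lim: "AE x in M. (\<lambda>n. g n x) \<longlonglongrightarrow> 0"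
  shows "(\<lambda>n. \<integral>x. norm (g n x) * norm (w x) \<partial>M) \<longlonglongrightarrow> 0"
proof (rule LIMSEQ_I)
  have [measurable]: "g n \<in> borel_measurable M" for n using LpD(1)[OF g] .
  have [measurable]: "w \<in> borel_measurable M" using LpD(1)[OF w] .
  have B0: "0 \<le> B" using bound[of 0] pint_nonneg order_trans by blast
  fix r :: real assume r: "0 < r"
  define e where "e = r / (2 * (B + 1))"
  have e: "0 < e" using r B0 by (simp add: e_def)
  have eB: "e * B < r / 2"
  proof -
    have "e * B < e * (B + 1)" using e by simp
    also have "\<dots> = r / 2" using B0 by (simp add: e_def field_simps)
    finally show ?thesis .
  qed
  \<comment> \<open>The rescaling for which (k a)^s / s is exactly e * a^s.\<close>
  define k where "k = (e * s) powr (1 / s)"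
  have k: "0 < k" "k powr s = e * s" using e s by (auto simp: k_def powr_powr)
  define c where "c = (1 / k) powr conjx s / conjx s"
  have young: "a * b \<le> e * a powr s + c * b powr conjx s" if "0 \<le> a" "0 \<le> b" for a b
  proof -
    have "a * b = (k * a) * (b / k)" using k by simp
    also have "\<dots> \<le> (k * a) powr s / s + (b / k) powr conjx s / conjx s"
      using that s k conjx_gt_1[of s] conjx_sum[of s] by (intro Youngs_inequality) auto
    also have "\<dots> = e * a powr s + c * b powr conjx s"
      using s k by (simp add: powr_mult c_def powr_divide)
    finally show ?thesis .
  qed
  define F where "F n x = max 0 (norm (g n x) * norm (w x) - e * norm (g n x) powr s)" for n x
  have int1: "integrable M (\<lambda>x. norm (g n x) * norm (w x))" for n by (rule Young_integrable[OF s g w])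
  have int2: "integrable M (\<lambda>x. norm (g n x) powr s)" for n using g by (rule LpD)
  have "(\<lambda>n. \<integral>x. F n x \<partial>M) \<longlonglongrightarrow> (\<integral>x. 0 \<partial>M)"
  proof (rule integral_dominated_convergence[where w = "\<lambda>x. c * norm (w x) powr conjx s"])
    show "integrable M (\<lambda>x. c * norm (w x) powr conjx s)" using w by (simp add: Lp_def)
    show "AE x in M. (\<lambda>n. F n x) \<longlonglongrightarrow> 0"
      using lim
    proof eventually_elim
      case (elim x)
      then have "(\<lambda>n. norm (g n x)) \<longlonglongrightarrow> 0" by (rule tendsto_norm_zero)
      then have "(\<lambda>n. max 0 (norm (g n x) * norm (w x) - e * norm (g n x) powr s))
          \<longlonglongrightarrow> max 0 (0 * norm (w x) - e * 0 powr s)"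
        using s by (intro tendsto_intros tendsto_powr') auto
      then show ?case by (simp add: F_def)
    qed
    have "0 \<le> c * norm (w x) powr conjx s" for x
      using conjx_gt_1[OF s] by (simp add: c_def)
    then have "norm (F n x) \<le> c * norm (w x) powr conjx s" for n x
      using young[of "norm (g n x)" "norm (w x)"] by (simp add: F_def)
    then show "AE x in M. norm (F n x) \<le> c * norm (w x) powr conjx s" for n by simp
  qed (auto simp: F_def)
  then have "eventually (\<lambda>n. (\<integral>x. F n x \<partial>M) < r / 2) sequentially"
    using r by (intro order_tendstoD) auto
  then obtain N where N: "\<And>n. n \<ge> N \<Longrightarrow> (\<integral>x. F n x \<partial>M) < r / 2" by (auto simp: eventually_sequentially)
  have "norm ((\<integral>x. norm (g n x) * norm (w x) \<partial>M) - 0) < r" if "n \<ge> N" for n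
  proof -
    have intF: "integrable M (F n)"
      unfolding F_def using int1 int2 by (intro integrable_max) auto
    have "(\<integral>x. norm (g n x) * norm (w x) \<partial>M) \<le> (\<integral>x. F n x + e * norm (g n x) powr s \<partial>M)"
      using int1 int2 intF by (intro integral_mono) (auto simp: F_def)
    also have "\<dots> = (\<integral>x. F n x \<partial>M) + e * pint M s (g n)" using int2 intF by (simp add: pint_def)
    also have "\<dots> < r / 2 + r / 2"
      using N[OF that] mult_left_mono[OF bound[of n], of e] e eB by linarith
    finally show ?thesis by (simp add: integral_nonneg_AE)
  qed
  then show "\<exists>N. \<forall>n\<ge>N. norm ((\<integral>x. norm (g n x) * norm (w x) \<partial>M) - 0) < r" by blast
qed

text \<open>Fatou puts the limit into the same ball, so the differences are bounded and tend to 0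
  a.e. This is the device for passing to the limit in nonlinear terms that have bounds but no common
  majorant.\<close>

lemma AE_bounded_imp_weak_convergence:
  fixes g :: "nat \<Rightarrow> 'a \<Rightarrow> 'b::euclidean_space"
  assumes s: "1 < s" and g: "\<And>n. g n \<in> Lp M s" and bound: "\<And>n. pint M s (g n) \<le> B"
    and w: "w \<in> Lp M (conjx s)" and h: "h \<in> borel_measurable M" and lim: "AE x in M. (\<lambda>n. g n x) \<longlonglongrightarrow> h x"
  shows "(\<lambda>n. \<integral>x. g n x \<bullet> w x \<partial>M) \<longlonglongrightarrow> (\<integral>x. h x \<bullet> w x \<partial>M)"
proof -
  have hL: "h \<in> Lp M s" and hB: "pint M s h \<le> B"
    using Fatou_pint[OF _ g bound h lim] s by auto
  have d: "(\<lambda>x. g n x - h x) \<in> Lp M s" for n using s g hL by (intro Lp_diff) auto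
  have "pint M s (\<lambda>x. g n x - h x) \<le> 2 powr s * (B + B)" for n
  proof -
    have "pint M s (\<lambda>x. g n x - h x) \<le> (\<integral>x. 2 powr s * (norm (g n x) powr s + norm (h x) powr s) \<partial>M)"
      unfolding pint_def
    proof (rule integral_mono)
      show "norm (g n x - h x) powr s \<le> 2 powr s * (norm (g n x) powr s + norm (h x) powr s)" for x
        using norm_powr_add_le[of s "g n x" "- h x"] s by simp
    qed (use LpD(2)[OF d] LpD(2)[OF g] LpD(2)[OF hL] in auto)
    also have "\<dots> = 2 powr s * (pint M s (g n) + pint M s h)"
      using LpD(2)[OF g] LpD(2)[OF hL] by (simp add: pint_def)
    also have "\<dots> \<le> 2 powr s * (B + B)" using bound[of n] hB by (intro mult_left_mono add_mono) auto
    finally show ?thesis .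
  qed
  from AE_bounded_imp_weak_null[OF s d this w] lim
  have "(\<lambda>n. \<integral>x. norm (g n x - h x) * norm (w x) \<partial>M) \<longlonglongrightarrow> 0"
    by (auto simp: LIM_zero_iff elim!: eventually_mono)
  then have "(\<lambda>n. (\<integral>x. g n x \<bullet> w x \<partial>M) - (\<integral>x. h x \<bullet> w x \<partial>M)) \<longlonglongrightarrow> 0"
  proof (rule Lim_null_comparison[rotated], intro always_eventually allI)
    fix n
    have "(\<integral>x. g n x \<bullet> w x \<partial>M) - (\<integral>x. h x \<bullet> w x \<partial>M) = (\<integral>x. (g n x - h x) \<bullet> w x \<partial>M)"
      using inner_integrable[OF s g w] inner_integrable[OF s hL w] by (simp add: inner_diff_left)
    also have "norm \<dots> \<le> (\<integral>x. norm ((g n x - h x) \<bullet> w x) \<partial>M)" by (rule integral_norm_bound)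
    also have "\<dots> \<le> (\<integral>x. norm (g n x - h x) * norm (w x) \<partial>M)"
      using Young_integrable[OF s d w] inner_integrable[OF s d w] Cauchy_Schwarz_ineq2
      by (intro integral_mono) auto
    finally show "norm ((\<integral>x. g n x \<bullet> w x \<partial>M) - (\<integral>x. h x \<bullet> w x \<partial>M)) \<le> (\<integral>x. norm (g n x - h x) * norm (w x) \<partial>M)" .
  qed
  then show ?thesis by (simp add: LIM_zero_iff)
qed

section \<open>Zeros of coercive maps on cubes of arbitrary dimension\<close>

definition cube :: "nat \<Rightarrow> real \<Rightarrow> (nat \<Rightarrow> real) set" where
  "cube n R = {c. (\<forall>i<n. \<bar>c i\<bar> \<le> R) \<and> (\<forall>i\<ge>n. c i = 0)}"

text \<open>Coordinatewise sequential continuity. It avoids a topology on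
  \<open>nat \<Rightarrow> real\<close> and is what the demicontinuity of the operator
  delivers.\<close>

definition cube_continuous :: "nat \<Rightarrow> real \<Rightarrow> ((nat \<Rightarrow> real) \<Rightarrow> nat \<Rightarrow> real) \<Rightarrow> bool" where
  "cube_continuous n R F \<longleftrightarrow> (\<forall>C c. (\<forall>k. C k \<in> cube n R) \<longrightarrow> c \<in> cube n R \<longrightarrow> (\<forall>j<n. (\<lambda>k::nat. C k j) \<longlonglongrightarrow> c j)
     \<longrightarrow> (\<forall>i<n. (\<lambda>k. F (C k) i) \<longlonglongrightarrow> F c i))"

lemma cube_continuousD:
  "cube_continuous n R F \<Longrightarrow> (\<And>k. C k \<in> cube n R) \<Longrightarrow> c \<in> cube n R \<Longrightarrow>
    (\<And>j. j < n \<Longrightarrow> (\<lambda>k::nat. C k j) \<longlonglongrightarrow> c j) \<Longrightarrow> i < n \<Longrightarrow> (\<lambda>k. F (C k) i) \<longlonglongrightarrow> F c i"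
  by (simp add: cube_continuous_def)

lemma cube_subseq:
  fixes C :: "nat \<Rightarrow> nat \<Rightarrow> real"
  assumes "\<And>k i. i < n \<Longrightarrow> \<bar>C k i\<bar> \<le> R"
  shows "\<exists>r::nat\<Rightarrow>nat. strict_mono r \<and> (\<forall>i<n. convergent (\<lambda>k. C (r k) i))"
  using assms
proof (induction n)
  case 0
  then show ?case by (auto intro: strict_mono_id[unfolded id_def])
next
  case (Suc n)
  then obtain r :: "nat \<Rightarrow> nat" where r: "strict_mono r" "\<And>i. i < n \<Longrightarrow> convergent (\<lambda>k. C (r k) i)" by auto
  have "seq_compact {-R..R}" by (intro compact_imp_seq_compact) simp
  moreover have "\<forall>k. C (r k) n \<in> {-R..R}" using Suc.prems[of n] by (auto simp: abs_le_iff minus_le_iff)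
  ultimately obtain l r' where r': "strict_mono r'" "((\<lambda>k. C (r k) n) \<circ> r') \<longlonglongrightarrow> l"
    by (elim seq_compactE)
  have "convergent (\<lambda>k. C (r (r' k)) i)" if i: "i < Suc n" for i
  proof (cases "i = n")
    case True
    then show ?thesis using r'(2) by (auto simp: convergent_def o_def)
  next
    case False
    then obtain L where "(\<lambda>k. C (r k) i) \<longlonglongrightarrow> L" using r(2)[of i] i False by (auto simp: convergent_def less_Suc_eq)
    from LIMSEQ_subseq_LIMSEQ[OF this r'(1)] show ?thesis by (auto simp: convergent_def o_def)
  qed
  moreover have "strict_mono (r \<circ> r')" using r(1) r'(1) by (rule strict_mono_o)
  ultimately show ?case by (intro exI[of _ "\<lambda>k. r (r' k)"]) (simp add: o_def)
qed

text \<open>Kuhn's combinatorial lemma is used directly since the library's Brouwer theorem has its dimension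
  fixed by a type.  A limit point of the completely labelled cells solves the variational
  inequality for the map on the cube.\<close>

lemma cube_variational_inequality:
  fixes F :: "(nat \<Rightarrow> real) \<Rightarrow> nat \<Rightarrow> real"
  assumes R: "0 < R"
    and cont: "cube_continuous n R F"
  shows "\<exists>c\<in>cube n R. \<forall>i<n. (0 < F c i \<longrightarrow> c i = - R) \<and> (F c i < 0 \<longrightarrow> c i = R)"
proof -
  \<comment> \<open>The grid with \<open>Suc p\<close> subdivisions of each edge; \<open>Suc\<close>
    keeps the mesh 2R / (p+1) defined for every p.\<close>
  define pt where "pt p x i = (if i < n then - R + 2 * R * real (x i) / real (Suc p) else 0)" for p x and i :: nat
  \<comment> \<open>The label records the sign of F in direction i, except on the two faces
    orthogonal to i, where Kuhn's lemma prescribes it.\<close>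
  define lab where "lab p x i = (if x i = 0 then 0 else if x i = Suc p then 1 else if F (pt p x) i \<le> 0 then 0 else (1::nat))"
    for p and x :: "nat \<Rightarrow> nat" and i
  have pt_cube: "pt p x \<in> cube n R" if "\<forall>i<n. x i \<le> Suc p" for p x
  proof -
    have "\<bar>- R + 2 * R * real (x i) / real (Suc p)\<bar> \<le> R" if i: "i < n" for i
    proof -
      have "real (x i) / real (Suc p) \<le> 1" "0 \<le> real (x i) / real (Suc p)"
        using \<open>\<forall>i<n. x i \<le> Suc p\<close> i by (auto simp: divide_le_eq)
      with mult_left_mono[of _ 1 "2 * R"] mult_left_mono[of 0 _ "2 * R"] R
      have "0 \<le> 2 * R * (real (x i) / real (Suc p))" "2 * R * (real (x i) / real (Suc p)) \<le> 2 * R"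
        by fastforce+
      then show ?thesis by (simp add: abs_le_iff)
    qed
    then show ?thesis by (auto simp: cube_def pt_def)
  qed
  define near_cell where "near_cell q r \<longleftrightarrow> (\<forall>j<n. q j \<le> r j \<and> r j \<le> q j + 1)" for q r :: "nat \<Rightarrow> nat"
  define good where "good p q \<longleftrightarrow> (\<forall>i<n. q i < Suc p) \<and>
    (\<forall>i<n. \<exists>r s. near_cell q r \<and> near_cell q s \<and> lab p r i \<noteq> lab p s i)" for p and q :: "nat \<Rightarrow> nat"
  have "\<exists>q. good p q" for p
  proof -
    have lab01: "lab p x i = 0 \<or> lab p x i = 1" "x i = 0 \<Longrightarrow> lab p x i = 0" "x i = Suc p \<Longrightarrow> lab p x i = 1" for x i
      by (auto simp: lab_def)
    show ?thesis
      unfolding good_def near_cell_def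
      by (rule kuhn_lemma[of "Suc p" n "lab p"]) (use lab01 in \<open>simp, blast, blast, blast, blast\<close>)
  qed
  then obtain Q where Q: "\<And>p. good p (Q p)" by metis
  define q where "q = Q"
  have q: "i < n \<Longrightarrow> q p i < Suc p" for p i using Q[of p] by (simp add: good_def q_def)
  have "\<exists>r s. near_cell (q p) r \<and> near_cell (q p) s \<and> lab p r i = 0 \<and> lab p s i = 1" if i: "i < n" for p i
  proof -
    obtain r s where rs: "near_cell (q p) r" "near_cell (q p) s" "lab p r i \<noteq> lab p s i"
      using Q[of p] i unfolding good_def q_def by blast
    have "(lab p r i = 0 \<and> lab p s i = 1) \<or> (lab p s i = 0 \<and> lab p r i = 1)"
      using rs(3) by (auto simp: lab_def split: if_splits)
    with rs show ?thesis by blast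
  qed
  then have ex: "\<exists>w. near_cell (q p) (fst w) \<and> near_cell (q p) (snd w) \<and> lab p (fst w) i = 0 \<and> lab p (snd w) i = 1"
    if "i < n" for p i using that by simp
  define W where "W p i = (SOME w. near_cell (q p) (fst w) \<and> near_cell (q p) (snd w) \<and> lab p (fst w) i = 0 \<and> lab p (snd w) i = 1)" for p i
  define r s where "r p i = fst (W p i)" and "s p i = snd (W p i)" for p i
  have rs: "near_cell (q p) (r p i) \<and> near_cell (q p) (s p i) \<and> lab p (r p i) i = 0 \<and> lab p (s p i) i = 1" if "i < n" for p i
    unfolding r_def s_def W_def using someI_ex[OF ex[OF that]] .
  have r: "q p j \<le> r p i j \<and> r p i j \<le> q p j + 1" if "i < n" "j < n" for p i j
    using rs[OF that(1), of p] that(2) by (simp add: near_cell_def)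
  have s: "q p j \<le> s p i j \<and> s p i j \<le> q p j + 1" if "i < n" "j < n" for p i j
    using rs[OF that(1), of p] that(2) by (simp add: near_cell_def)
  have lab: "lab p (r p i) i = 0" "lab p (s p i) i = 1" if "i < n" for p i
    using rs[OF that, of p] by auto
  have qc: "pt p (q p) \<in> cube n R" for p using q by (intro pt_cube) (auto intro: less_imp_le)
  then have "\<bar>pt p (q p) i\<bar> \<le> R" if "i < n" for p i using that by (auto simp: cube_def)
  then obtain \<rho> :: "nat \<Rightarrow> nat" where \<rho>: "strict_mono \<rho>" "\<forall>i<n. convergent (\<lambda>k. pt (\<rho> k) (q (\<rho> k)) i)"
    using cube_subseq[of n "\<lambda>p. pt p (q p)" R] by auto
  define c where "c i = (if i < n then lim (\<lambda>k. pt (\<rho> k) (q (\<rho> k)) i) else 0)" for i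
  have lim_q: "(\<lambda>k. pt (\<rho> k) (q (\<rho> k)) i) \<longlonglongrightarrow> c i" if "i < n" for i
    using \<rho>(2) that by (simp add: c_def convergent_LIMSEQ_iff)
  have "c \<in> cube n R"
  proof -
    have "\<bar>c i\<bar> \<le> R" if i: "i < n" for i
      using qc i by (intro LIMSEQ_le_const2[OF tendsto_rabs[OF lim_q[OF i]]]) (auto simp: cube_def)
    then show ?thesis by (auto simp: cube_def c_def)
  qed
  \<comment> \<open>All corners of the labelled cells share the limit c, since the mesh tends to 0.
    Thus the points carrying the opposite labels, different for each i, may be used
    together.\<close>
  have near: "(\<lambda>k. pt (\<rho> k) (y k) j) \<longlonglongrightarrow> c j"
    if y: "\<And>k j. j < n \<Longrightarrow> q (\<rho> k) j \<le> y k j \<and> y k j \<le> q (\<rho> k) j + 1" and j: "j < n" for y j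
  proof -
    have "(\<lambda>k. pt (\<rho> k) (y k) j - pt (\<rho> k) (q (\<rho> k)) j) \<longlonglongrightarrow> 0"
    proof (rule Lim_null_comparison, intro always_eventually allI)
      fix k
      have le: "\<bar>real (y k j) - real (q (\<rho> k) j)\<bar> \<le> 1" using y[OF j, of k] by linarith
      have "pt (\<rho> k) (y k) j - pt (\<rho> k) (q (\<rho> k)) j = 2 * R * ((real (y k j) - real (q (\<rho> k) j)) / real (Suc (\<rho> k)))"
        using j by (simp add: pt_def diff_divide_distrib algebra_simps)
      also have "norm \<dots> \<le> 2 * R * (1 / real (Suc (\<rho> k)))"
        using R le by (simp add: abs_mult divide_right_mono)
      also have "\<dots> \<le> 2 * R * (1 / real (Suc k))"
        using R strict_mono_imp_increasing[OF \<rho>(1), of k] by (intro mult_left_mono divide_left_mono) auto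
      finally show "norm (pt (\<rho> k) (y k) j - pt (\<rho> k) (q (\<rho> k)) j) \<le> 2 * R * (1 / real (Suc k))" .
      show "(\<lambda>k. 2 * R * (1 / real (Suc k))) \<longlonglongrightarrow> 0"
        using tendsto_mult_left[OF LIMSEQ_Suc[OF lim_1_over_n], of "2 * R"] by simp
    qed
    from tendsto_add[OF this lim_q[OF j]] show ?thesis by simp
  qed
  have inc: "pt p y \<in> cube n R" if "\<And>j. j < n \<Longrightarrow> y j \<le> q p j + 1" for p y
  proof (rule pt_cube, intro allI impI)
    fix i assume "i < n"
    then show "y i \<le> Suc p" using that[of i] q[of i p] by linarith
  qed
  have "(0 < F c i \<longrightarrow> c i = - R) \<and> (F c i < 0 \<longrightarrow> c i = R)" if i: "i < n" for i
  proof (intro conjI impI)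
    assume pos: "0 < F c i"
    have l: "(\<lambda>k. pt (\<rho> k) (r (\<rho> k) i) j) \<longlonglongrightarrow> c j" if "j < n" for j
      using r[OF i] that by (intro near) auto
    have "(\<lambda>k. F (pt (\<rho> k) (r (\<rho> k) i)) i) \<longlonglongrightarrow> F c i"
      using r[OF i] \<open>c \<in> cube n R\<close> l i by (intro cube_continuousD[OF cont] inc) auto
    then have "eventually (\<lambda>k. 0 < F (pt (\<rho> k) (r (\<rho> k) i)) i) sequentially"
      using pos by (rule order_tendstoD)
    then have "eventually (\<lambda>k. pt (\<rho> k) (r (\<rho> k) i) i = - R) sequentially"
    proof eventually_elim
      case (elim k)
      \<comment> \<open>With F positive at the point, the label 0 can only stem from the lower
        face.\<close>
      then have "r (\<rho> k) i i = 0" using lab(1)[OF i, of "\<rho> k"] by (auto simp: lab_def split: if_splits)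
      then show ?case using i by (simp add: pt_def)
    qed
    from tendsto_eventually[OF this] show "c i = - R" using l[OF i] LIMSEQ_unique by blast
  next
    assume neg: "F c i < 0"
    have l: "(\<lambda>k. pt (\<rho> k) (s (\<rho> k) i) j) \<longlonglongrightarrow> c j" if "j < n" for j
      using s[OF i] that by (intro near) auto
    have "(\<lambda>k. F (pt (\<rho> k) (s (\<rho> k) i)) i) \<longlonglongrightarrow> F c i"
      using s[OF i] \<open>c \<in> cube n R\<close> l i by (intro cube_continuousD[OF cont] inc) auto
    then have "eventually (\<lambda>k. F (pt (\<rho> k) (s (\<rho> k) i)) i < 0) sequentially"
      using neg by (rule order_tendstoD)
    then have "eventually (\<lambda>k. pt (\<rho> k) (s (\<rho> k) i) i = R) sequentially"
    proof eventually_elim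
      case (elim k)
      then have "s (\<rho> k) i i = Suc (\<rho> k)" using lab(2)[OF i, of "\<rho> k"] by (auto simp: lab_def split: if_splits)
      then show ?case using i by (simp add: pt_def)
    qed
    from tendsto_eventually[OF this] show "c i = R" using l[OF i] LIMSEQ_unique by blast
  qed
  with \<open>c \<in> cube n R\<close> show ?thesis by blast
qed

text \<open>At a solution of the variational inequality every product \<open>F c j * c j\<close> is
  nonpositive. Coercivity on the faces then places c in the interior, where the inequality forces
  each component of F to vanish.\<close>

lemma coercive_zero:
  fixes F :: "(nat \<Rightarrow> real) \<Rightarrow> nat \<Rightarrow> real"
  assumes R: "0 < R"
    and cont: "cube_continuous n R F"
    and coercive: "\<And>c i. c \<in> cube n R \<Longrightarrow> i < n \<Longrightarrow> \<bar>c i\<bar> = R \<Longrightarrow> 0 < (\<Sum>j<n. F c j * c j)"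
  shows "\<exists>c\<in>cube n R. \<forall>i<n. F c i = 0"
proof -
  obtain c where c: "c \<in> cube n R" "\<And>i. i < n \<Longrightarrow> 0 < F c i \<Longrightarrow> c i = - R" "\<And>i. i < n \<Longrightarrow> F c i < 0 \<Longrightarrow> c i = R"
    using cube_variational_inequality[OF R cont] by blast
  have "F c j * c j \<le> 0" if "j < n" for j
    using c(2,3)[OF that] R by (cases "F c j" "0::real" rule: linorder_cases) (auto simp: mult_le_0_iff)
  then have "(\<Sum>j<n. F c j * c j) \<le> 0" by (intro sum_nonpos) auto
  then have "\<bar>c i\<bar> \<noteq> R" if "i < n" for i using coercive[OF c(1) that] by linarith
  then have "F c i = 0" if "i < n" for i
    using c(2,3)[OF that] R that by (cases "F c i" "0::real" rule: linorder_cases) fastforce+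
  with c(1) show ?thesis by blast
qed

section \<open>Smooth bump functions\<close>

text \<open>The functions t^-n exp(-1/t), extended by 0. The family is closed under differentiation
  up to linear combinations, so the smoothness of exp(-1/t) follows without any formula for its n-th
  derivative.\<close>

definition flat :: "nat \<Rightarrow> real \<Rightarrow> real" where
  "flat n t = (if 0 < t then (1 / t) ^ n * exp (- (1 / t)) else 0)"

lemma flat_tendsto_0: "(flat n \<longlongrightarrow> 0) (at 0)"
proof -
  have "((\<lambda>t. inverse t ^ n / exp (inverse t)) \<longlongrightarrow> (0::real)) (at_right 0)"
    by (rule filterlim_compose[OF tendsto_power_div_exp_0 filterlim_inverse_at_top_right])
  then have "(flat n \<longlongrightarrow> 0) (at_right 0)"
  proof (rule tendsto_cong[THEN iffD1, rotated])
    show "\<forall>\<^sub>F t in at_right 0. inverse t ^ n / exp (inverse t) = flat n t"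
      by (auto simp: eventually_at_filter flat_def exp_minus field_simps)
  qed
  moreover have "(flat n \<longlongrightarrow> 0) (at_left 0)"
    by (rule tendsto_eventually) (auto simp: eventually_at_filter flat_def)
  ultimately show ?thesis by (simp add: filterlim_split_at)
qed

lemma flat_deriv:
  "(flat n has_real_derivative flat (n + 2) t + (- real n) * flat (n + 1) t) (at t)"
proof -
  consider "0 < t" | "t < 0" | "t = 0" by linarith
  then show ?thesis
  proof cases
    case 1
    have "((\<lambda>t. (1 / t) ^ n * exp (- (1 / t))) has_real_derivative flat (n + 2) t + (- real n) * flat (n + 1) t) (at t)"
    proof -
      have "((\<lambda>t. (1 / t) ^ n) has_real_derivative (- real n * (1 / t) ^ (n + 1))) (at t)"
      proof (induction n)
        case (Suc n)
        have inv: "((\<lambda>t. 1 / t) has_real_derivative (- ((1 / t) ^ 2))) (at t)"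
          using 1 by (auto intro!: derivative_eq_intros simp: power2_eq_square)
        have "- (u ^ 2) * u ^ n + - real n * u ^ (n + 1) * u = - real (Suc n) * u ^ (Suc n + 1)" for u :: real
          by (simp add: algebra_simps power2_eq_square)
        then show ?case
          unfolding power_Suc[of _ n] by (rule DERIV_cong[OF DERIV_mult[OF inv Suc]])
      qed simp
      moreover have "((\<lambda>t. exp (- (1 / t))) has_real_derivative (1 / t) ^ 2 * exp (- (1 / t))) (at t)"
        using 1 by (auto intro!: derivative_eq_intros simp: power2_eq_square)
      ultimately have "((\<lambda>t. (1 / t) ^ n * exp (- (1 / t))) has_real_derivative
          (- real n * (1 / t) ^ (n + 1) * exp (- (1 / t)) + (1 / t) ^ 2 * exp (- (1 / t)) * (1 / t) ^ n)) (at t)"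
        by (rule DERIV_mult)
      moreover have "- real n * (1 / t) ^ (n + 1) * exp (- (1 / t)) + (1 / t) ^ 2 * exp (- (1 / t)) * (1 / t) ^ n
          = flat (n + 2) t + (- real n) * flat (n + 1) t"
        using 1 by (simp add: flat_def power_add power2_eq_square ac_simps)
      ultimately show ?thesis by simp
    qed
    then show ?thesis
      by (rule has_field_derivative_transform_within_open[of _ _ _ "{0<..}"]) (use 1 in \<open>auto simp: flat_def\<close>)
  next
    case 2
    have "((\<lambda>t. 0) has_real_derivative flat (n + 2) t + (- real n) * flat (n + 1) t) (at t)"
      using 2 by (auto simp: flat_def)
    then show ?thesis
      by (rule has_field_derivative_transform_within_open[of _ _ _ "{..<0}"]) (use 2 in \<open>auto simp: flat_def\<close>)
  next
    case 3
    \<comment> \<open>At the origin the difference quotient of \<open>flat n\<close> is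
      \<open>flat (n + 1)\<close> itself, which tends to 0.\<close>
    have "(\<lambda>h. (flat n (0 + h) - flat n 0) / h) \<midarrow>0\<rightarrow> 0"
    proof (rule tendsto_cong[THEN iffD1, OF _ flat_tendsto_0[of "Suc n"]])
      show "\<forall>\<^sub>F h in at 0. flat (Suc n) h = (flat n (0 + h) - flat n 0) / h"
        by (auto simp: eventually_at_filter flat_def)
    qed
    then show ?thesis using 3 by (simp add: DERIV_def flat_def)
  qed
qed

lemma flat_0_bounds: "0 \<le> flat 0 t" "flat 0 t \<le> 1"
  by (auto simp: flat_def)

lemma flat_0_tendsto_1:
  assumes "0 < t"
  shows "(\<lambda>k. flat 0 (real (Suc k) * t)) \<longlonglongrightarrow> 1"
proof -
  have "(\<lambda>k. exp (- (1 / t * (1 / real (Suc k))))) \<longlonglongrightarrow> exp (- (1 / t * 0))"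
    by (intro tendsto_intros LIMSEQ_Suc[OF lim_1_over_n])
  moreover have "flat 0 (real (Suc k) * t) = exp (- (1 / t * (1 / real (Suc k))))" for k
    using assms by (simp add: flat_def zero_less_mult_iff mult.commute)
  ultimately show ?thesis by simp
qed

text \<open>A class stable under partial derivatives and made of differentiable functions. Stability
  under \<open>iter_partial\<close> then gives smoothness by one induction on the list of
  directions.\<close>

inductive_set smooth_class :: "('a::euclidean_space \<Rightarrow> real) set" where
  const: "(\<lambda>x. c) \<in> smooth_class"
| ridge: "(\<lambda>x. flat n (v \<bullet> x + c)) \<in> smooth_class"
| add: "f \<in> smooth_class \<Longrightarrow> g \<in> smooth_class \<Longrightarrow> (\<lambda>x. f x + g x) \<in> smooth_class"
| mult: "f \<in> smooth_class \<Longrightarrow> g \<in> smooth_class \<Longrightarrow> (\<lambda>x. f x * g x) \<in> smooth_class"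

lemma smooth_class_deriv:
  "f \<in> smooth_class \<Longrightarrow> \<exists>D. (\<forall>x. (f has_derivative D x) (at x)) \<and> (\<forall>i. (\<lambda>x. D x i) \<in> smooth_class)"
proof (induction rule: smooth_class.induct)
  case (const c)
  then show ?case by (intro exI[of _ "\<lambda>x v. 0"]) (auto intro: smooth_class.const)
next
  case (ridge n v c)
  define d where "d x = flat (n + 2) (v \<bullet> x + c) + (- real n) * flat (n + 1) (v \<bullet> x + c)" for x
  have "((\<lambda>x. flat n (v \<bullet> x + c)) has_derivative (\<lambda>w. d x * (v \<bullet> w))) (at x)" for x
  proof -
    have 1: "(flat n has_derivative (\<lambda>h. d x * h)) (at (v \<bullet> x + c))"
      using flat_deriv[of n "v \<bullet> x + c"] unfolding has_field_derivative_def d_def .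
    have 2: "((\<lambda>x. v \<bullet> x + c) has_derivative (\<lambda>w. v \<bullet> w)) (at x)" by (auto intro!: derivative_eq_intros)
    show ?thesis using has_derivative_compose[OF 2 1] .
  qed
  moreover have "(\<lambda>x. d x * (v \<bullet> i)) \<in> smooth_class" for i
    unfolding d_def by (intro smooth_class.intros)
  ultimately show ?case by (intro exI[of _ "\<lambda>x w. d x * (v \<bullet> w)"]) auto
next
  case (add f g)
  then obtain D E where "\<forall>x. (f has_derivative D x) (at x)" "\<forall>i. (\<lambda>x. D x i) \<in> smooth_class"
    "\<forall>x. (g has_derivative E x) (at x)" "\<forall>i. (\<lambda>x. E x i) \<in> smooth_class" by blast
  then show ?case
    by (intro exI[of _ "\<lambda>x v. D x v + E x v"]) (auto intro: has_derivative_add smooth_class.add)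
next
  case (mult f g)
  then obtain D E where "\<forall>x. (f has_derivative D x) (at x)" "\<forall>i. (\<lambda>x. D x i) \<in> smooth_class"
    "\<forall>x. (g has_derivative E x) (at x)" "\<forall>i. (\<lambda>x. E x i) \<in> smooth_class" by blast
  moreover from this mult.hyps have "(\<lambda>x. f x * E x i + D x i * g x) \<in> smooth_class" for i
    by (intro smooth_class.add[OF smooth_class.mult smooth_class.mult]) auto
  ultimately show ?case
    by (intro exI[of _ "\<lambda>x v. f x * E x v + D x v * g x"]) (auto intro: has_derivative_mult)
qed

lemma smooth_class_iter_partial: "f \<in> smooth_class \<Longrightarrow> iter_partial is f \<in> smooth_class"
proof (induction "is")
  case (Cons i "is")
  then obtain D where D: "\<And>x. (iter_partial is f has_derivative D x) (at x)" "\<And>i. (\<lambda>x. D x i) \<in> smooth_class"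
    using smooth_class_deriv by blast
  have "iter_partial (i # is) f = (\<lambda>x. D x i)"
    using frechet_derivative_at[OF D(1)] by (auto simp: fun_eq_iff)
  with D(2) show ?case by simp
qed simp

lemma smooth_class_smooth: "f \<in> smooth_class \<Longrightarrow> smooth_fun f"
  using smooth_class_deriv[OF smooth_class_iter_partial]
  unfolding smooth_fun_def differentiable_def by blast

text \<open>One factor for each face of the box. As k grows the product tends to the indicator of
  the open box at every point, so these functions do the work of mollifiers.\<close>

definition bump :: "nat \<Rightarrow> 'a::euclidean_space \<Rightarrow> 'a \<Rightarrow> 'a \<Rightarrow> real" where
  "bump k a b x = (\<Prod>i\<in>Basis. flat 0 (real (Suc k) * (x \<bullet> i - a \<bullet> i)) * flat 0 (real (Suc k) * (b \<bullet> i - x \<bullet> i)))"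

lemma bump_smooth: "smooth_fun (bump k a b)"
proof (rule smooth_class_smooth)
  have prod: "(\<lambda>x. \<Prod>i\<in>I. g i x) \<in> smooth_class" if "\<And>i. i \<in> I \<Longrightarrow> g i \<in> smooth_class"
    for I :: "'a set" and g :: "'a \<Rightarrow> 'a \<Rightarrow> real"
    using that by (induction I rule: infinite_finite_induct) (auto intro: smooth_class.intros)
  have "(\<lambda>x. flat 0 ((real (Suc k) *\<^sub>R i) \<bullet> x + - (real (Suc k) * (a \<bullet> i)))
      * flat 0 ((- (real (Suc k) *\<^sub>R i)) \<bullet> x + real (Suc k) * (b \<bullet> i))) \<in> smooth_class" for i
    by (intro smooth_class.intros)
  moreover have "flat 0 (real (Suc k) * (x \<bullet> i - a \<bullet> i)) * flat 0 (real (Suc k) * (b \<bullet> i - x \<bullet> i))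
    = flat 0 ((real (Suc k) *\<^sub>R i) \<bullet> x + - (real (Suc k) * (a \<bullet> i)))
      * flat 0 ((- (real (Suc k) *\<^sub>R i)) \<bullet> x + real (Suc k) * (b \<bullet> i))" for x i :: 'a
    by (simp add: algebra_simps inner_commute)
  ultimately show "bump k a b \<in> smooth_class"
    unfolding bump_def[abs_def] by (intro prod) simp
qed

lemma bump_outside: "x \<notin> box a b \<Longrightarrow> bump k a b x = 0"
  by (auto simp: bump_def mem_box flat_def zero_less_mult_iff not_less intro!: bexI)

lemma bump_bounds: "0 \<le> bump k a b x" "bump k a b x \<le> 1"
  unfolding bump_def using flat_0_bounds
  by (auto intro!: prod_nonneg prod_le_1 mult_le_one)

lemma bump_tendsto: "(\<lambda>k. bump k a b x) \<longlonglongrightarrow> indicator (box a b) x"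
proof (cases "x \<in> box a b")
  case True
  then have "(\<lambda>k. bump k a b x) \<longlonglongrightarrow> (\<Prod>i\<in>(Basis::'a set). 1 * 1)"
    unfolding bump_def by (intro tendsto_prod tendsto_mult flat_0_tendsto_1) (auto simp: mem_box)
  with True show ?thesis by simp
qed (simp add: bump_outside)

lemma bump_test:
  assumes "cbox a b \<subseteq> \<Omega>"
  shows "bump k a b \<in> test_functions \<Omega>"
proof -
  have "{x. bump k a b x \<noteq> 0} \<subseteq> cbox a b" using bump_outside box_subset_cbox by blast
  then have "closure {x. bump k a b x \<noteq> 0} \<subseteq> cbox a b" by (rule closure_minimal[OF _ closed_cbox])
  moreover have "bounded {x. bump k a b x \<noteq> 0}"
    using \<open>{x. bump k a b x \<noteq> 0} \<subseteq> cbox a b\<close> bounded_cbox bounded_subset by blast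
  ultimately show ?thesis using assms bump_smooth by (auto simp: test_functions_def)
qed

section \<open>The fundamental lemma of the calculus of variations\<close>

text \<open>Open boxes form an intersection-stable generator of the Borel sets, so by Dynkin's
  argument all integrals over Borel sets vanish, and densities are unique a.e.\<close>

lemma AE_zero_if_box_integrals_zero:
  fixes h :: "'a::euclidean_space \<Rightarrow> real"
  assumes h: "integrable lebesgue h" and box: "\<And>a b. (\<integral>x. indicator (box a b) x * h x \<partial>lebesgue) = 0"
  shows "AE x in lebesgue. h x = 0"
proof -
  \<comment> \<open>The Dynkin argument concerns Borel sets, so h is replaced by a Borel
    representative.\<close>
  obtain g where g: "g \<in> borel_measurable lborel" "AE x in lborel. h x = g x"
    using completion_ex_borel_measurable_real[OF borel_measurable_integrable[OF h]] by blast
  have hg: "AE x in lebesgue. h x = g x" using g(2) by (rule AE_completion)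
  have gm: "g \<in> borel_measurable lebesgue" using g(1) by (rule measurable_completion)
  have "integrable lebesgue g" using h hg gm integrable_cong_AE borel_measurable_integrable by blast
  then have gi: "integrable lborel g" using integrable_completion[OF g(1)] by blast
  have gbox: "(\<integral>x. indicator (box a b) x * g x \<partial>lborel) = 0" for a b
  proof -
    have "(\<integral>x. indicator (box a b) x * g x \<partial>lborel) = (\<integral>x. indicator (box a b) x * g x \<partial>lebesgue)"
      using g(1) by (intro integral_completion[symmetric]) auto
    also have "\<dots> = (\<integral>x. indicator (box a b) x * h x \<partial>lebesgue)"
      using hg gm borel_measurable_integrable[OF h]
      by (intro integral_cong_AE) (auto elim!: eventually_mono intro!: borel_measurable_times borel_measurable_indicator)
    finally show ?thesis using box by simp
  qed
  have iA: "integrable lborel (\<lambda>x. indicator A x * g x)" if "A \<in> sets borel" for A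
    using integrable_mult_indicator[OF _ gi, of A] that by simp
  \<comment> \<open>The complement step requires the integral over the whole space, which is the
    limit over growing cubes.\<close>
  have total: "(\<integral>x. g x \<partial>lborel) = 0"
  proof -
    let ?B = "\<lambda>n::nat. box (- real n *\<^sub>R One) (real n *\<^sub>R One) :: 'a set"
    have "(\<lambda>n. \<integral>x. indicator (?B n) x * g x \<partial>lborel) \<longlonglongrightarrow> (\<integral>x. g x \<partial>lborel)"
    proof (rule integral_dominated_convergence[where w = "\<lambda>x. norm (g x)"])
      have "(\<lambda>n. indicator (?B n) x * g x) \<longlonglongrightarrow> g x" for x
      proof (rule tendsto_eventually)
        obtain m :: nat where m: "norm x < real m" using reals_Archimedean2 by blast
        have "x \<in> ?B n" if "n \<ge> m" for n
        proof -
          have "\<bar>x \<bullet> i\<bar> < real n" if "i \<in> Basis" for i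
            using Basis_le_norm[OF that, of x] m \<open>n \<ge> m\<close> by linarith
          then show ?thesis by (force simp: mem_box abs_less_iff)
        qed
        then show "\<forall>\<^sub>F n in sequentially. indicator (?B n) x * g x = g x"
          unfolding eventually_sequentially by (intro exI[of _ m]) auto
      qed
      then show "AE x in lborel. (\<lambda>n. indicator (?B n) x * g x) \<longlonglongrightarrow> g x" by simp
    qed (use gi g in \<open>auto simp: indicator_def\<close>)
    then show ?thesis by (simp add: gbox LIMSEQ_const_iff)
  qed
  have "(\<integral>x. indicator A x * g x \<partial>lborel) = 0" if A: "A \<in> sets borel" for A
  proof -
    have Asig: "A \<in> sigma_sets UNIV (range (\<lambda>(a, b). box a b))"
      using A by (simp add: borel_eq_box)
    have bs: "B \<in> sets borel" if "B \<in> sigma_sets UNIV (range (\<lambda>(a, b). box a b))" for B :: "'a set"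
      using that by (simp add: borel_eq_box)
    have "Int_stable (range (\<lambda>(a, b). box a b :: 'a set))" "range (\<lambda>(a, b). box a b :: 'a set) \<subseteq> Pow UNIV"
      by (auto simp: Int_stable_def box_Int_box)
    then show ?thesis using Asig
    proof (induction rule: sigma_sets_induct_disjoint)
      case (basic A)
      then show ?case using gbox by auto
    next
      case (compl A)
      have "(\<integral>x. indicator (UNIV - A) x * g x \<partial>lborel) = (\<integral>x. g x - indicator A x * g x \<partial>lborel)"
        by (intro Bochner_Integration.integral_cong) (auto simp: indicator_def)
      then show ?case using compl total gi iA[OF bs] by simp
    next
      case (union A)
      have Ab: "A i \<in> sets borel" for i using union bs by blast
      have "(\<lambda>n. \<integral>x. (\<Sum>i<n. indicator (A i) x * g x) \<partial>lborel) \<longlonglongrightarrow> (\<integral>x. indicator (\<Union>i. A i) x * g x \<partial>lborel)"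
      proof (rule integral_dominated_convergence[where w = "\<lambda>x. norm (g x)"])
        have sums: "(\<lambda>i. indicator (A i) x * g x) sums (indicator (\<Union>i. A i) x * g x)" for x
          using sums_mult2[OF indicator_sums[OF], of A x "g x"] union(1) by (auto simp: disjoint_family_on_def)
        then show "AE x in lborel. (\<lambda>n. \<Sum>i<n. indicator (A i) x * g x) \<longlonglongrightarrow> indicator (\<Union>i. A i) x * g x"
          by (simp add: sums_def)
        have "norm (\<Sum>i<n. indicator (A i) x * g x) \<le> norm (g x)" for n x
        proof -
          have "(\<Sum>i<n. indicator (A i) x) = (indicator (\<Union>i<n. A i) x :: real)"
            using union(1) by (subst indicator_UN_disjoint) (auto simp: disjoint_family_on_def)
          then have "(\<Sum>i<n. indicator (A i) x * g x) = indicator (\<Union>i<n. A i) x * g x"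
            by (simp add: sum_distrib_right[symmetric])
          then show ?thesis by (auto simp: indicator_def)
        qed
        then show "AE x in lborel. norm (\<Sum>i<n. indicator (A i) x * g x) \<le> norm (g x)" for n by simp
      qed (use gi iA[OF Ab] g Ab in \<open>auto intro!: borel_measurable_sum borel_measurable_times\<close>)
      moreover have "(\<integral>x. (\<Sum>i<n. indicator (A i) x * g x) \<partial>lborel) = 0" for n
        using union(3) iA[OF Ab] by (subst Bochner_Integration.integral_sum) auto
      ultimately show ?case by (simp add: LIMSEQ_const_iff)
    qed auto
  qed
  then have "AE x in lborel. g x = 0"
    using gi by (intro density_unique_real[where f' = "\<lambda>x. 0"]) (auto simp: set_lebesgue_integral_def)
  then show ?thesis using hg AE_completion by fastforce
qed

lemma continuous_imp_lebesgue_measurable: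
  fixes f :: "'a::euclidean_space \<Rightarrow> 'b::euclidean_space"
  assumes "continuous_on UNIV f"
  shows "f \<in> borel_measurable lebesgue"
  using borel_measurable_continuous_onI[OF assms] by (intro measurable_completion) simp

text \<open>Inside a closed box contained in \<Omega>, bump functions are admissible and approximate
  indicators of boxes, so all box integrals of d vanish there. Countably many such boxes cover
  \<Omega>.\<close>

lemma fundamental_lemma:
  fixes d :: "'a::euclidean_space \<Rightarrow> real"
  assumes \<Omega>: "open \<Omega>" and d: "locally_integrable \<Omega> d"
    and zero: "\<And>\<phi>. \<phi> \<in> test_functions \<Omega> \<Longrightarrow> (\<integral>x. d x * \<phi> x \<partial>lebesgue_on \<Omega>) = 0"
  shows "AE x in lebesgue_on \<Omega>. d x = 0"
proof -
  have \<Omega>m: "\<Omega> \<inter> space lebesgue \<in> sets lebesgue" using \<Omega> by simp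
  have sub: "AE x in lebesgue. x \<in> cbox u v \<longrightarrow> d x = 0" if uv: "cbox u v \<subseteq> \<Omega>" for u v
  proof -
    define h where "h x = indicator (cbox u v) x * d x" for x
    have hi: "integrable lebesgue h"
    proof -
      have "integrable (lebesgue_on (cbox u v)) d"
        using d uv compact_cbox unfolding locally_integrable_def by blast
      then show ?thesis unfolding h_def by (subst (asm) integrable_restrict_space) auto
    qed
    \<comment> \<open>The intersection with \<open>box u v\<close> is again a box, and its closure
      stays within \<Omega> when it is nonempty; this makes the bump on it a test function.\<close>
    have h0: "(\<integral>x. indicator (box a b \<inter> box u v) x * h x \<partial>lebesgue) = 0" for a b
    proof -
      have "\<exists>s t. box a b \<inter> box u v = box s t" unfolding box_Int_box by blast
      then obtain s t where st: "box a b \<inter> box u v = box s t" by blast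
      show ?thesis
      proof (cases "box s t = {}")
        case False
        then have sub2: "cbox s t \<subseteq> cbox u v"
        proof -
          have "box s t \<subseteq> cbox u v" using st box_subset_cbox[of u v] by blast
          from closure_minimal[OF this closed_cbox] False show ?thesis by simp
        qed
        have "(\<lambda>k. \<integral>x. bump k s t x * h x \<partial>lebesgue) \<longlonglongrightarrow> (\<integral>x. indicator (box s t) x * h x \<partial>lebesgue)"
        proof (rule integral_dominated_convergence[where w = "\<lambda>x. norm (h x)"])
          show "AE x in lebesgue. (\<lambda>k. bump k s t x * h x) \<longlonglongrightarrow> indicator (box s t) x * h x"
            by (intro AE_I2 tendsto_mult bump_tendsto tendsto_const)
          show "AE x in lebesgue. norm (bump k s t x * h x) \<le> norm (h x)" for k
            using bump_bounds[of k s t] by (auto simp: abs_mult mult_left_le_one_le)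
          have "continuous_on UNIV (bump k s t)" for k
            using bump_smooth[of k s t] unfolding smooth_fun_def
            by (auto simp: continuous_on_eq_continuous_at dest!: spec[of _ "[]"] intro: differentiable_imp_continuous_within)
          then have "bump k s t \<in> borel_measurable lebesgue" for k
            by (rule continuous_imp_lebesgue_measurable)
          then show "(\<lambda>x. bump k s t x * h x) \<in> borel_measurable lebesgue" for k
            using hi by (intro borel_measurable_times) auto
          show "(\<lambda>x. indicator (box s t) x * h x) \<in> borel_measurable lebesgue"
            using hi by (intro borel_measurable_times borel_measurable_indicator) auto
        qed (use hi in auto)
        moreover have "(\<integral>x. bump k s t x * h x \<partial>lebesgue) = 0" for k
        proof -
          have "bump k s t x * h x = indicator \<Omega> x *\<^sub>R (d x * bump k s t x)" for x
            using bump_outside[of x s t k] sub2 uv box_subset_cbox[of s t] by (auto simp: h_def indicator_def)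
          then have "(\<integral>x. bump k s t x * h x \<partial>lebesgue) = (\<integral>x. d x * bump k s t x \<partial>lebesgue_on \<Omega>)"
            by (simp only: integral_restrict_space[OF \<Omega>m])
          also have "\<dots> = 0" using sub2 uv by (intro zero bump_test) auto
          finally show ?thesis .
        qed
        ultimately show ?thesis by (simp add: LIMSEQ_const_iff st)
      qed (simp add: st)
    qed
    have "AE x in lebesgue. indicator (box u v) x * h x = 0"
    proof (rule AE_zero_if_box_integrals_zero)
      show "integrable lebesgue (\<lambda>x. indicator (box u v) x * h x)"
        using integrable_mult_indicator[OF _ hi, of "box u v"] by simp
      show "(\<integral>x. indicator (box a b) x * (indicator (box u v) x * h x) \<partial>lebesgue) = 0" for a b
        using h0[of a b] by (simp add: indicator_inter_arith mult.assoc)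
    qed
    moreover have "AE x in lebesgue. x \<notin> cbox u v - box u v"
      using negligible_frontier_interval[of u v] by (intro AE_not_in) (simp add: negligible_iff_null_sets)
    ultimately show ?thesis
      by eventually_elim (use box_subset_cbox[of u v] in \<open>auto simp: h_def indicator_def split: if_splits\<close>)
  qed
  obtain \<D> where \<D>: "countable \<D>" "\<D> \<subseteq> Pow \<Omega>" "\<And>X. X \<in> \<D> \<Longrightarrow> \<exists>u v. X = cbox u v" "\<Union>\<D> = \<Omega>"
    using open_countable_Union_open_cbox[OF \<Omega>] by blast
  have "AE x in lebesgue. x \<in> X \<longrightarrow> d x = 0" if "X \<in> \<D>" for X
    using \<D>(2) \<D>(3)[OF that] that sub by blast
  then have "AE x in lebesgue. \<forall>X\<in>\<D>. x \<in> X \<longrightarrow> d x = 0"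
    using \<D>(1) by (subst AE_ball_countable) auto
  then have "AE x in lebesgue. x \<in> \<Omega> \<longrightarrow> d x = 0"
    by eventually_elim (use \<D>(4) in auto)
  then show ?thesis using \<Omega>m by (simp add: AE_restrict_space_iff)
qed

section \<open>Continuously differentiable functions of compact support\<close>

definition C1c :: "'a::euclidean_space set \<Rightarrow> ('a \<Rightarrow> real) \<Rightarrow> ('a \<Rightarrow> 'a) \<Rightarrow> bool" where
  "C1c K \<phi> g \<longleftrightarrow> compact K \<and> (\<forall>x. x \<notin> K \<longrightarrow> \<phi> x = 0) \<and>
     (\<forall>x. (\<phi> has_derivative (\<lambda>v. g x \<bullet> v)) (at x)) \<and> continuous_on UNIV g"

lemma C1cD:
  assumes "C1c K \<phi> g"
  shows "compact K" "x \<notin> K \<Longrightarrow> \<phi> x = 0" "(\<phi> has_derivative (\<lambda>v. g x \<bullet> v)) (at x)" "continuous_on UNIV g"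
    "continuous_on UNIV \<phi>"
proof -
  show "compact K" "x \<notin> K \<Longrightarrow> \<phi> x = 0" "continuous_on UNIV g"
    and *: "(\<phi> has_derivative (\<lambda>v. g x \<bullet> v)) (at x)" for x
    using assms by (auto simp: C1c_def)
  then show "continuous_on UNIV \<phi>"
    using has_derivative_continuous[OF *] by (simp add: continuous_on_eq_continuous_at)
qed

lemma C1c_grad_zero:
  assumes "C1c K \<phi> g" "x \<notin> K"
  shows "g x = 0"
proof -
  have "open (- K)" using C1cD(1)[OF assms(1)] by (simp add: compact_imp_closed open_Compl)
  then have "((\<lambda>x. 0) has_derivative (\<lambda>v. g x \<bullet> v)) (at x)"
    using assms C1cD(2)[OF assms(1)]
    by (intro has_derivative_transform_within_open[OF C1cD(3)[OF assms(1)], of "- K"]) auto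
  then have "(\<lambda>v. g x \<bullet> v) = (\<lambda>v. 0)" by (rule has_derivative_unique) simp
  then have "g x \<bullet> g x = 0" by metis
  then show ?thesis by simp
qed

lemma C1c_mult:
  assumes "C1c K \<phi> g" "C1c K' \<psi> h"
  shows "C1c K (\<lambda>x. \<phi> x * \<psi> x) (\<lambda>x. \<phi> x *\<^sub>R h x + \<psi> x *\<^sub>R g x)"
  unfolding C1c_def
proof (intro conjI allI impI)
  show "((\<lambda>x. \<phi> x * \<psi> x) has_derivative (\<lambda>v. (\<phi> x *\<^sub>R h x + \<psi> x *\<^sub>R g x) \<bullet> v)) (at x)" for x
    using has_derivative_mult[OF C1cD(3)[OF assms(1)] C1cD(3)[OF assms(2)], of x]
    by (simp add: inner_add_left mult.commute)
  show "continuous_on UNIV (\<lambda>x. \<phi> x *\<^sub>R h x + \<psi> x *\<^sub>R g x)"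
    using assms[THEN C1cD(4)] assms[THEN C1cD(5)] by (intro continuous_intros)
qed (use C1cD(1,2)[OF assms(1)] in auto)

definition tgrad :: "('a::euclidean_space \<Rightarrow> real) \<Rightarrow> 'a \<Rightarrow> 'a" where
  "tgrad \<phi> x = (\<Sum>i\<in>Basis. frechet_derivative \<phi> (at x) i *\<^sub>R i)"

lemma tgrad_inner_Basis: "i \<in> Basis \<Longrightarrow> tgrad \<phi> x \<bullet> i = frechet_derivative \<phi> (at x) i"
  by (simp add: tgrad_def inner_sum_left_Basis)

lemma test_C1c:
  assumes "\<phi> \<in> test_functions \<Omega>"
  shows "\<exists>K\<subseteq>\<Omega>. C1c K \<phi> (tgrad \<phi>)"
proof (intro exI[of _ "closure {x. \<phi> x \<noteq> 0}"] conjI)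
  have sm: "iter_partial is \<phi> differentiable (at x)" if "set is \<subseteq> Basis" for "is" x
    using assms that by (auto simp: test_functions_def smooth_fun_def)
  have der: "(\<phi> has_derivative (\<lambda>v. tgrad \<phi> x \<bullet> v)) (at x)" for x
  proof -
    have d: "(\<phi> has_derivative frechet_derivative \<phi> (at x)) (at x)"
      using sm[of "[]"] by (simp add: frechet_derivative_works)
    then have lin: "linear (frechet_derivative \<phi> (at x))" by (rule has_derivative_linear)
    have "frechet_derivative \<phi> (at x) v = tgrad \<phi> x \<bullet> v" for v
    proof -
      have "frechet_derivative \<phi> (at x) v = frechet_derivative \<phi> (at x) (\<Sum>i\<in>Basis. (v \<bullet> i) *\<^sub>R i)"
        by (simp add: euclidean_representation)
      also have "\<dots> = (\<Sum>i\<in>Basis. (v \<bullet> i) * frechet_derivative \<phi> (at x) i)"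
        using lin by (simp add: linear_sum linear_cmul)
      also have "\<dots> = tgrad \<phi> x \<bullet> v"
        unfolding tgrad_def inner_sum_left inner_scaleR_left by (intro sum.cong) (auto simp: inner_commute)
      finally show ?thesis .
    qed
    then have "frechet_derivative \<phi> (at x) = (\<lambda>v. tgrad \<phi> x \<bullet> v)" by auto
    with d show ?thesis by simp
  qed
  have "continuous_on UNIV (\<lambda>x. frechet_derivative \<phi> (at x) i)" if "i \<in> Basis" for i
    using sm[of "[i]"] that by (auto simp: continuous_on_eq_continuous_at intro: differentiable_imp_continuous_within)
  then have "continuous_on UNIV (tgrad \<phi>)"
    unfolding tgrad_def[abs_def] by (intro continuous_intros) auto
  moreover have "\<phi> x = 0" if "x \<notin> closure {x. \<phi> x \<noteq> 0}" for x
    using that closure_subset[of "{x. \<phi> x \<noteq> 0}"] by blast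
  ultimately show "C1c (closure {x. \<phi> x \<noteq> 0}) \<phi> (tgrad \<phi>)"
    using assms der unfolding C1c_def test_functions_def by blast
  show "closure {x. \<phi> x \<noteq> 0} \<subseteq> \<Omega>" using assms by (auto simp: test_functions_def)
qed

lemma compact_support_bounded:
  fixes F :: "'a::euclidean_space \<Rightarrow> 'b::euclidean_space"
  assumes "continuous_on UNIV F" "compact K" "\<And>x. x \<notin> K \<Longrightarrow> F x = 0"
  shows "\<exists>B\<ge>0. \<forall>x. norm (F x) \<le> B"
proof -
  have "compact (F ` K)" using assms by (intro compact_continuous_image) (auto intro: continuous_on_subset)
  then have "bounded (F ` K)" by (rule compact_imp_bounded)
  then obtain B where B: "\<forall>y\<in>F ` K. norm y \<le> B" by (auto simp: bounded_iff)
  have "norm (F x) \<le> max B 0" for x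
    using B assms(3)[of x] by (cases "x \<in> K") auto
  then show ?thesis by (intro exI[of _ "max B 0"]) auto
qed

lemma compact_support_integrable:
  fixes F :: "'a::euclidean_space \<Rightarrow> 'b::euclidean_space"
  assumes "continuous_on UNIV F" "compact K" "\<And>x. x \<notin> K \<Longrightarrow> F x = 0"
  shows "integrable lborel F"
proof -
  have "integrable lborel (\<lambda>x. indicator K x *\<^sub>R F x)"
    using assms by (intro borel_integrable_compact) (auto intro: continuous_on_subset)
  moreover have "(\<lambda>x. indicator K x *\<^sub>R F x) = F"
    using assms(3) by (auto simp: indicator_def fun_eq_iff)
  ultimately show ?thesis by simp
qed

lemma lebesgue_on_compact_support:
  fixes F :: "'a::euclidean_space \<Rightarrow> 'b::euclidean_space"
  assumes F: "continuous_on UNIV F" "compact K" "\<And>x. x \<notin> K \<Longrightarrow> F x = 0" and \<Omega>: "open \<Omega>" "K \<subseteq> \<Omega>"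
  shows "integrable (lebesgue_on \<Omega>) F" "(\<integral>x. F x \<partial>lebesgue_on \<Omega>) = (\<integral>x. F x \<partial>lborel)"
proof -
  have m: "F \<in> borel_measurable lborel" using borel_measurable_continuous_onI[OF F(1)] by simp
  have eq: "(\<lambda>x. indicator \<Omega> x *\<^sub>R F x) = F"
    using F(3) \<Omega>(2) by (auto simp: indicator_def fun_eq_iff)
  have \<Omega>m: "\<Omega> \<inter> space lebesgue \<in> sets lebesgue" using \<Omega>(1) by simp
  have "integrable lebesgue F" using compact_support_integrable[OF F] integrable_completion[OF m] by blast
  then show "integrable (lebesgue_on \<Omega>) F" by (simp add: integrable_restrict_space[OF \<Omega>m] eq)
  show "(\<integral>x. F x \<partial>lebesgue_on \<Omega>) = (\<integral>x. F x \<partial>lborel)"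
    using integral_completion[OF m] by (simp add: integral_restrict_space[OF \<Omega>m] eq)
qed

lemma lborel_translation: "distr lborel borel (\<lambda>x. x + c) = (lborel :: 'a::euclidean_space measure)"
  using lborel_affine[of 1 c] by (simp add: density_1 add.commute)

lemma integral_translation:
  fixes F :: "'a::euclidean_space \<Rightarrow> 'b::euclidean_space"
  assumes "F \<in> borel_measurable borel"
  shows "(\<integral>x. F (x + c) \<partial>lborel) = (\<integral>x. F x \<partial>lborel)"
proof -
  have "(\<integral>x. F x \<partial>lborel) = (\<integral>x. F x \<partial>distr lborel borel (\<lambda>x. x + c))"
    by (simp add: lborel_translation)
  also have "\<dots> = (\<integral>x. F (x + c) \<partial>lborel)"
    using assms by (subst integral_distr) auto
  finally show ?thesis by simp
qed

lemma integrable_translation: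
  fixes F :: "'a::euclidean_space \<Rightarrow> 'b::euclidean_space"
  assumes "integrable lborel F"
  shows "integrable lborel (\<lambda>x. F (x + c))"
proof -
  have "integrable (distr lborel borel (\<lambda>x. x + c)) F" using assms by (simp add: lborel_translation)
  then show ?thesis by (rule integrable_distr[rotated]) simp
qed

text \<open>What dominated convergence requires for difference quotients with steps 1/(n+1); used
  both for integration by parts and for the translation estimate.\<close>

lemma C1c_difference_quotient:
  fixes v :: "'a::euclidean_space"
  assumes C: "C1c K \<phi> g"
  defines "q \<equiv> \<lambda>n x. real (Suc n) * (\<phi> (x + (1 / real (Suc n)) *\<^sub>R v) - \<phi> x)"
  shows "(\<lambda>n. q n x) \<longlonglongrightarrow> g x \<bullet> v"
    and "\<exists>w. integrable lborel w \<and> (\<forall>n x. \<bar>q n x\<bar> \<le> w x)"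
    and "q n \<in> borel_measurable borel"
proof -
  note D = C1cD[OF C]
  have "((\<lambda>t. \<phi> (x + t *\<^sub>R v)) has_derivative (\<lambda>t. g (x + 0 *\<^sub>R v) \<bullet> (t *\<^sub>R v))) (at 0)"
    by (rule has_derivative_compose[of "\<lambda>t. x + t *\<^sub>R v" "\<lambda>t. t *\<^sub>R v" 0 UNIV \<phi>])
       (use D(3)[of x] in \<open>auto intro!: derivative_eq_intros\<close>)
  then have "((\<lambda>t. \<phi> (x + t *\<^sub>R v)) has_real_derivative (g x \<bullet> v)) (at 0)"
    by (simp add: has_field_derivative_def mult_commute_abs)
  then have lim: "(\<lambda>t. (\<phi> (x + t *\<^sub>R v) - \<phi> x) / t) \<midarrow>0\<rightarrow> g x \<bullet> v"
    by (simp add: DERIV_def)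
  have "filterlim (\<lambda>n. 1 / real (Suc n)) (at 0) sequentially"
    using LIMSEQ_Suc[OF lim_1_over_n, where 'a1 = real] by (simp add: filterlim_at)
  from filterlim_compose[OF lim this]
  show "(\<lambda>n. q n x) \<longlonglongrightarrow> g x \<bullet> v" by (simp add: q_def mult.commute)
  obtain B where B: "0 \<le> B" "\<And>x. norm (g x) \<le> B"
    using compact_support_bounded[OF D(4,1) C1c_grad_zero[OF C]] by blast
  \<comment> \<open>A compact set containing every x for which x or x + v/(n+1) lies in K; outside
    it all quotients vanish.\<close>
  define K' where "K' = {x - y |x y. x \<in> K \<and> y \<in> cball 0 (norm v)}"
  have K': "compact K'" unfolding K'_def using D(1) by (intro compact_differences) auto
  have "\<bar>q n x\<bar> \<le> (B * norm v) * indicator K' x" for n x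
  proof (cases "x \<in> K'")
    case True
    have "norm (\<phi> (x + (1 / real (Suc n)) *\<^sub>R v) - \<phi> x) \<le> B * norm ((x + (1 / real (Suc n)) *\<^sub>R v) - x)"
    proof (rule differentiable_bound[of UNIV])
      show "(\<phi> has_derivative (\<lambda>v. g y \<bullet> v)) (at y within UNIV)" for y using D(3) by simp
      show "onorm (\<lambda>v. g y \<bullet> v) \<le> B" for y
      proof (rule onorm_le)
        fix w
        show "norm (g y \<bullet> w) \<le> B * norm w"
          using Cauchy_Schwarz_ineq2[of "g y" w] mult_right_mono[OF B(2)[of y], of "norm w"] by simp
      qed
    qed auto
    then have "\<bar>\<phi> (x + (1 / real (Suc n)) *\<^sub>R v) - \<phi> x\<bar> \<le> B * norm v / real (Suc n)" by simp
    then have "real (Suc n) * \<bar>\<phi> (x + (1 / real (Suc n)) *\<^sub>R v) - \<phi> x\<bar> \<le> B * norm v"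
      by (simp add: pos_le_divide_eq mult.commute)
    with True show ?thesis by (simp add: q_def abs_mult)
  next
    case False
    have "x \<notin> K" using False unfolding K'_def by (force intro: exI[of _ x] exI[of _ 0])
    moreover have "x + (1 / real (Suc n)) *\<^sub>R v \<notin> K"
    proof
      assume "x + (1 / real (Suc n)) *\<^sub>R v \<in> K"
      moreover have "(1 / real (Suc n)) *\<^sub>R v \<in> cball 0 (norm v)"
        by (auto simp: divide_le_eq mult_le_cancel_left1)
      ultimately have "x + (1 / real (Suc n)) *\<^sub>R v - (1 / real (Suc n)) *\<^sub>R v \<in> K'"
        unfolding K'_def by blast
      with False show False by simp
    qed
    ultimately show ?thesis using False D(2) by (simp add: q_def)
  qed
  moreover have "integrable lborel (\<lambda>x. (B * norm v) * indicator K' x :: real)"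
  proof (intro integrable_mult_right integrable_real_indicator)
    show "emeasure lborel K' < \<infinity>" using K' by (intro emeasure_bounded_finite compact_imp_bounded)
    show "K' \<in> sets lborel" using K' by (simp add: compact_imp_closed)
  qed
  ultimately show "\<exists>w. integrable lborel w \<and> (\<forall>n x. \<bar>q n x\<bar> \<le> w x)" by blast
  have [measurable]: "\<phi> \<in> borel_measurable borel" using borel_measurable_continuous_onI[OF D(5)] .
  show "q n \<in> borel_measurable borel" unfolding q_def by measurable
qed

text \<open>By translation invariance each difference quotient has integral 0. Applied to products
  this is integration by parts.\<close>

lemma C1c_integral_grad:
  assumes C: "C1c K \<phi> g"
  shows "(\<integral>x. g x \<bullet> v \<partial>lborel) = 0"
proof -
  define q where "q n x = real (Suc n) * (\<phi> (x + (1 / real (Suc n)) *\<^sub>R v) - \<phi> x)" for n x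
  note Q = C1c_difference_quotient[OF C, where v = v, folded q_def]
  obtain w where w: "integrable lborel w" "\<And>n x. \<bar>q n x\<bar> \<le> w x" using Q(2) by blast
  have [measurable]: "\<phi> \<in> borel_measurable borel" using borel_measurable_continuous_onI[OF C1cD(5)[OF C]] .
  have i: "integrable lborel \<phi>" using C1cD[OF C] by (intro compact_support_integrable) auto
  have "(\<lambda>n. \<integral>x. q n x \<partial>lborel) \<longlonglongrightarrow> (\<integral>x. g x \<bullet> v \<partial>lborel)"
    using Q(1,3) w borel_measurable_continuous_onI[OF C1cD(4)[OF C]]
    by (intro integral_dominated_convergence[where w = w]) (auto intro!: borel_measurable_inner)
  moreover have "(\<integral>x. q n x \<partial>lborel) = 0" for n
    using i integrable_translation[OF i] by (simp add: q_def integral_translation)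
  ultimately show ?thesis by (simp add: LIMSEQ_const_iff)
qed

text \<open>The \<open>L\<^sup>1\<close> modulus of continuity is subadditive in the shift, so it is controlled by its
  derivative at \<open>0\<close>.\<close>

lemma C1c_translation_estimate:
  assumes C: "C1c K \<phi> g"
  shows "integrable lborel (\<lambda>x. \<bar>\<phi> (x + v) - \<phi> x\<bar>)"
    "(\<integral>x. \<bar>\<phi> (x + v) - \<phi> x\<bar> \<partial>lborel) \<le> norm v * (\<integral>x. norm (g x) \<partial>lborel)"
proof -
  have m [measurable]: "\<phi> \<in> borel_measurable borel" using borel_measurable_continuous_onI[OF C1cD(5)[OF C]] .
  have i: "integrable lborel \<phi>" using C1cD[OF C] by (intro compact_support_integrable) auto
  have iA: "integrable lborel (\<lambda>x. \<bar>\<phi> (x + u) - \<phi> x\<bar>)" for u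
    using i integrable_translation[OF i] by simp
  then show "integrable lborel (\<lambda>x. \<bar>\<phi> (x + v) - \<phi> x\<bar>)" .
  define A where "A u = (\<integral>x. \<bar>\<phi> (x + u) - \<phi> x\<bar> \<partial>lborel)" for u
  have A_add: "A (u + w) \<le> A u + A w" for u w
  proof -
    have iAu: "integrable lborel (\<lambda>x. \<bar>\<phi> (x + w + u) - \<phi> (x + w)\<bar>)"
      using integrable_translation[OF iA[of u], of w] .
    have "A (u + w) \<le> (\<integral>x. \<bar>\<phi> (x + w + u) - \<phi> (x + w)\<bar> + \<bar>\<phi> (x + w) - \<phi> x\<bar> \<partial>lborel)"
      unfolding A_def using iA iAu by (intro integral_mono) (auto simp: add.assoc add.commute[of u w])
    also have "\<dots> = (\<integral>x. \<bar>\<phi> (x + w + u) - \<phi> (x + w)\<bar> \<partial>lborel) + A w"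
      unfolding A_def using iA iAu by (intro Bochner_Integration.integral_add)
    also have "(\<integral>x. \<bar>\<phi> (x + w + u) - \<phi> (x + w)\<bar> \<partial>lborel) = A u"
      unfolding A_def by (rule integral_translation[of "\<lambda>x. \<bar>\<phi> (x + u) - \<phi> x\<bar>" w]) measurable
    finally show ?thesis .
  qed
  have A_mult: "A (real n *\<^sub>R u) \<le> real n * A u" for n u
  proof (induction n)
    case (Suc n)
    then show ?case using A_add[of u "real n *\<^sub>R u"] by (simp add: algebra_simps)
  qed (simp add: A_def)
  define q where "q n x = real (Suc n) * (\<phi> (x + (1 / real (Suc n)) *\<^sub>R v) - \<phi> x)" for n x
  note Q = C1c_difference_quotient[OF C, where v = v, folded q_def]
  obtain w where w: "integrable lborel w" "\<And>n x. \<bar>q n x\<bar> \<le> w x" using Q(2) by blast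
  have gm: "g \<in> borel_measurable borel" using borel_measurable_continuous_onI[OF C1cD(4)[OF C]] .
  have "(\<lambda>n. \<integral>x. \<bar>q n x\<bar> \<partial>lborel) \<longlonglongrightarrow> (\<integral>x. \<bar>g x \<bullet> v\<bar> \<partial>lborel)"
    using Q(1,3) w gm
    by (intro integral_dominated_convergence[where w = w])
       (auto intro!: borel_measurable_inner borel_measurable_abs tendsto_rabs)
  moreover have "A v \<le> (\<integral>x. \<bar>q n x\<bar> \<partial>lborel)" for n
    using A_mult[of "Suc n" "(1 / real (Suc n)) *\<^sub>R v"] by (simp add: A_def q_def abs_mult)
  ultimately have "A v \<le> (\<integral>x. \<bar>g x \<bullet> v\<bar> \<partial>lborel)" by (intro LIMSEQ_le_const) auto
  also have "\<dots> \<le> (\<integral>x. norm v * norm (g x) \<partial>lborel)"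
  proof (rule integral_mono)
    have ig: "integrable lborel g"
      using C1cD[OF C] C1c_grad_zero[OF C] by (intro compact_support_integrable) auto
    then show "integrable lborel (\<lambda>x. norm v * norm (g x))" "integrable lborel (\<lambda>x. \<bar>g x \<bullet> v\<bar>)" by auto
    show "\<bar>g x \<bullet> v\<bar> \<le> norm v * norm (g x)" for x
      using Cauchy_Schwarz_ineq2[of "g x" v] by (simp add: mult.commute)
  qed
  finally show "(\<integral>x. \<bar>\<phi> (x + v) - \<phi> x\<bar> \<partial>lborel) \<le> norm v * (\<integral>x. norm (g x) \<partial>lborel)"
    by (simp add: A_def)
qed

text \<open>The average differs from \<phi> by a mean of shifts with |z| < h, each costing at most h
  times the L^1 norm of the gradient. Tonelli exchanges the two integrals, and working in
  [0,\<infinity>] avoids any prior integrability claim.\<close>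

lemma C1c_average_estimate:
  fixes \<phi> :: "'a::euclidean_space \<Rightarrow> real"
  assumes C: "C1c K \<phi> g" and h: "0 < h"
  defines "b \<equiv> measure lborel (ball (0::'a) h)"
  shows "(\<integral>\<^sup>+x. ennreal \<bar>\<phi> x - (\<integral>y. indicator (ball x h) y * \<phi> y \<partial>lborel) / b\<bar> \<partial>lborel)
    \<le> ennreal (h * (\<integral>x. norm (g x) \<partial>lborel))"
proof -
  have m [measurable]: "\<phi> \<in> borel_measurable borel" using borel_measurable_continuous_onI[OF C1cD(5)[OF C]] .
  have [measurable]: "ball x h \<in> sets borel" for x :: 'a by simp
  have i: "integrable lborel \<phi>" using C1cD[OF C] by (intro compact_support_integrable) auto
  have b: "0 < b" unfolding b_def using h content_ball_pos by (simp add: measure_completion)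
  have eb: "emeasure lborel (ball (0::'a) h) = ennreal b"
    unfolding b_def by (rule emeasure_eq_ennreal_measure) (use emeasure_lborel_ball_finite[of "0::'a" h] in auto)
  have ib: "integrable lborel (\<lambda>z. indicator (ball (0::'a) h) z * c :: real)" for c
    by (intro integrable_mult_left integrable_real_indicator) (auto simp: emeasure_lborel_ball_finite[unfolded infinity_ennreal_def])
  define G where "G = (\<integral>x. norm (g x) \<partial>lborel)"
  have G0: "0 \<le> G" by (simp add: G_def)
  have *: "ennreal \<bar>\<phi> x - (\<integral>y. indicator (ball x h) y * \<phi> y \<partial>lborel) / b\<bar>
      \<le> ennreal (1 / b) * (\<integral>\<^sup>+z. indicator (ball 0 h) z * ennreal \<bar>\<phi> (x + z) - \<phi> x\<bar> \<partial>lborel)" for x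
  proof -
    have itx: "integrable lborel (\<lambda>z. indicator (ball 0 h) z * \<phi> (x + z))"
      using integrable_mult_indicator[OF _ integrable_translation[OF i, of x], of "ball 0 h"]
      by (simp add: add.commute)
    have int: "integrable lborel (\<lambda>z. indicator (ball 0 h) z * (\<phi> x - \<phi> (x + z)))"
      using Bochner_Integration.integrable_diff[OF ib[of "\<phi> x"] itx] by (simp add: algebra_simps)
    have "(\<integral>y. indicator (ball x h) y * \<phi> y \<partial>lborel) = (\<integral>z. indicator (ball x h) (z + x) * \<phi> (z + x) \<partial>lborel)"
      using m by (intro integral_translation[symmetric]) (auto intro!: borel_measurable_times borel_measurable_indicator)
    also have "\<dots> = (\<integral>z. indicator (ball 0 h) z * \<phi> (x + z) \<partial>lborel)"
      by (intro Bochner_Integration.integral_cong) (auto simp: indicator_def dist_norm add.commute)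
    finally have "b * \<phi> x - (\<integral>y. indicator (ball x h) y * \<phi> y \<partial>lborel)
        = (\<integral>z. indicator (ball (0::'a) h) z * \<phi> x \<partial>lborel) - (\<integral>z. indicator (ball 0 h) z * \<phi> (x + z) \<partial>lborel)"
      by (simp add: b_def)
    also have "\<dots> = (\<integral>z. indicator (ball 0 h) z * \<phi> x - indicator (ball 0 h) z * \<phi> (x + z) \<partial>lborel)"
      using ib itx by (intro Bochner_Integration.integral_diff[symmetric])
    also have "\<dots> = (\<integral>z. indicator (ball 0 h) z * (\<phi> x - \<phi> (x + z)) \<partial>lborel)"
      by (simp add: algebra_simps)
    finally have "\<phi> x - (\<integral>y. indicator (ball x h) y * \<phi> y \<partial>lborel) / b
        = (1 / b) * (\<integral>z. indicator (ball 0 h) z * (\<phi> x - \<phi> (x + z)) \<partial>lborel)"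
      using b by (simp add: field_simps)
    then have "ennreal \<bar>\<phi> x - (\<integral>y. indicator (ball x h) y * \<phi> y \<partial>lborel) / b\<bar>
        = ennreal (1 / b) * ennreal \<bar>\<integral>z. indicator (ball 0 h) z * (\<phi> x - \<phi> (x + z)) \<partial>lborel\<bar>"
      using b by (simp add: abs_mult ennreal_mult[symmetric])
    also have "ennreal \<bar>\<integral>z. indicator (ball 0 h) z * (\<phi> x - \<phi> (x + z)) \<partial>lborel\<bar>
        \<le> (\<integral>\<^sup>+z. ennreal (norm (indicator (ball 0 h) z * (\<phi> x - \<phi> (x + z)))) \<partial>lborel)"
      using integral_norm_bound_ennreal[OF int] by simp
    also have "\<dots> = (\<integral>\<^sup>+z. indicator (ball 0 h) z * ennreal \<bar>\<phi> (x + z) - \<phi> x\<bar> \<partial>lborel)"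
      by (intro nn_integral_cong) (auto simp: indicator_def abs_minus_commute)
    finally show ?thesis by (simp add: mult_left_mono)
  qed
  have "(\<integral>\<^sup>+x. ennreal \<bar>\<phi> x - (\<integral>y. indicator (ball x h) y * \<phi> y \<partial>lborel) / b\<bar> \<partial>lborel)
      \<le> (\<integral>\<^sup>+x. ennreal (1 / b) * (\<integral>\<^sup>+z. indicator (ball 0 h) z * ennreal \<bar>\<phi> (x + z) - \<phi> x\<bar> \<partial>lborel) \<partial>lborel)"
    by (intro nn_integral_mono *)
  also have "\<dots> = ennreal (1 / b) * (\<integral>\<^sup>+x. (\<integral>\<^sup>+z. indicator (ball 0 h) z * ennreal \<bar>\<phi> (x + z) - \<phi> x\<bar> \<partial>lborel) \<partial>lborel)"
    by (rule nn_integral_cmult) measurable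
  also have "(\<integral>\<^sup>+x. (\<integral>\<^sup>+z. indicator (ball 0 h) z * ennreal \<bar>\<phi> (x + z) - \<phi> x\<bar> \<partial>lborel) \<partial>lborel)
      = (\<integral>\<^sup>+z. (\<integral>\<^sup>+x. indicator (ball 0 h) z * ennreal \<bar>\<phi> (x + z) - \<phi> x\<bar> \<partial>lborel) \<partial>lborel)"
    by (rule lborel_pair.Fubini') measurable
  also have "\<dots> \<le> (\<integral>\<^sup>+z. ennreal (h * G) * indicator (ball (0::'a) h) z \<partial>lborel)"
  proof (rule nn_integral_mono)
    fix z :: 'a
    have "(\<integral>\<^sup>+x. ennreal \<bar>\<phi> (x + z) - \<phi> x\<bar> \<partial>lborel) = ennreal (\<integral>x. \<bar>\<phi> (x + z) - \<phi> x\<bar> \<partial>lborel)"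
      by (intro nn_integral_eq_integral C1c_translation_estimate(1)[OF C]) auto
    also have "\<dots> \<le> ennreal (norm z * G)"
      unfolding G_def by (intro ennreal_leI C1c_translation_estimate(2)[OF C])
    also have "\<dots> \<le> ennreal (h * G)" if "z \<in> ball 0 h"
      using that G0 by (intro ennreal_leI mult_right_mono) auto
    finally show "(\<integral>\<^sup>+x. indicator (ball 0 h) z * ennreal \<bar>\<phi> (x + z) - \<phi> x\<bar> \<partial>lborel)
        \<le> ennreal (h * G) * indicator (ball (0::'a) h) z"
      by (auto simp: indicator_def)
  qed
  also have "\<dots> = ennreal (h * G) * ennreal b"
    by (simp add: nn_integral_cmult_indicator eb)
  finally have "(\<integral>\<^sup>+x. ennreal \<bar>\<phi> x - (\<integral>y. indicator (ball x h) y * \<phi> y \<partial>lborel) / b\<bar> \<partial>lborel)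
      \<le> ennreal (1 / b) * (ennreal (h * G) * ennreal b)"
    by (simp add: mult_left_mono)
  also have "\<dots> = ennreal (h * G)"
    using b h G0 by (simp add: ennreal_mult[symmetric])
  finally show ?thesis by (simp add: G_def)
qed

section \<open>Weak gradients\<close>

text \<open>Completeness of Lebesgue measure. It is needed because \<open>wgrad\<close> is an
  arbitrary choice known only up to null sets, and because a Caratheodory function may be
  discontinuous on a null set.\<close>

lemma AE_lebesgue_on_measurable:
  fixes f g :: "'a::euclidean_space \<Rightarrow> 'b::euclidean_space"
  assumes S: "S \<in> sets lebesgue" and f: "f \<in> borel_measurable (lebesgue_on S)"
    and eq: "AE x in lebesgue_on S. f x = g x"
  shows "g \<in> borel_measurable (lebesgue_on S)"
proof -
  have "AE x in lebesgue. x \<in> S \<longrightarrow> f x = g x" using eq S by (subst (asm) AE_restrict_space_iff) auto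
  then obtain N where N: "N \<in> null_sets lebesgue" "{x \<in> space lebesgue. \<not> (x \<in> S \<longrightarrow> f x = g x)} \<subseteq> N"
    by (auto simp: eventually_ae_filter)
  have "g measurable_on S"
  proof (rule measurable_on_spike)
    show "f measurable_on S" using f S by (simp add: measurable_on_iff_borel_measurable)
    show "negligible N" using N(1) by (simp add: negligible_iff_null_sets)
    show "g x = f x" if "x \<in> S - N" for x using N(2) that by auto
  qed
  then show ?thesis using S by (simp add: measurable_on_iff_borel_measurable)
qed

lemma Lnorm_eq:
  assumes "u \<in> Lp (lebesgue_on \<Omega>) s"
  shows "Lnorm \<Omega> (ereal s) u = ennreal (pnorm (lebesgue_on \<Omega>) s u)"
proof -
  have "(\<integral>\<^sup>+ x. ennreal (norm (u x) powr s) \<partial>lebesgue_on \<Omega>) = ennreal (pint (lebesgue_on \<Omega>) s u)"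
    unfolding pint_def using assms by (intro nn_integral_eq_integral) (auto simp: Lp_def)
  then show ?thesis by (simp add: Lnorm_def ennreal_powr_def pnorm_def)
qed

lemma Lnorm_finite_imp_Lp:
  assumes "u \<in> borel_measurable (lebesgue_on \<Omega>)" "Lnorm \<Omega> (ereal s) u < top"
  shows "u \<in> Lp (lebesgue_on \<Omega>) s"
proof (rule LpI)
  have "(\<integral>\<^sup>+ x. ennreal (norm (u x) powr s) \<partial>lebesgue_on \<Omega>) < top"
    using assms(2) by (auto simp: Lnorm_def ennreal_powr_def less_top split: if_splits)
  then show "integrable (lebesgue_on \<Omega>) (\<lambda>x. norm (u x) powr s)"
    using assms(1) by (intro integrableI_nonneg) auto
qed (use assms in auto)

lemma Lspace_eq: "Lspace \<Omega> (ereal s) = Lp (lebesgue_on \<Omega>) s"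
  by (auto simp: Lspace_def Lnorm_eq intro: Lnorm_finite_imp_Lp dest: LpD(1))

lemma Lp_bounded:
  assumes "finite_measure M" "g \<in> borel_measurable M" "\<And>x. x \<in> space M \<Longrightarrow> norm (g x) \<le> B" "0 \<le> s"
  shows "g \<in> Lp M s"
proof (rule Lp_bound)
  interpret finite_measure M by fact
  show "integrable M (\<lambda>x. B powr s)" by simp
  show "AE x in M. norm (g x) powr s \<le> B powr s" using assms by (auto intro!: AE_I2 powr_mono2)
qed fact

lemma Lp_imp_integrable:
  fixes u :: "'a \<Rightarrow> 'b::euclidean_space"
  assumes "finite_measure M" "u \<in> Lp M s" "1 \<le> s"
  shows "integrable M u"
proof -
  have "u \<in> Lp M 1" using Lp_mono_exponent[OF assms(1,2), of 1] assms(3) by simp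
  then show ?thesis by (auto simp: Lp_def integrable_norm_iff)
qed

lemma integrable_imp_locally_integrable:
  fixes u :: "'a::euclidean_space \<Rightarrow> 'b::euclidean_space"
  assumes "\<Omega> \<in> sets lebesgue" "integrable (lebesgue_on \<Omega>) u"
  shows "locally_integrable \<Omega> u"
  unfolding locally_integrable_def
proof (intro allI impI)
  fix K assume K: "compact K \<and> K \<subseteq> \<Omega>"
  then have Km: "K \<in> sets lebesgue" by (simp add: compact_imp_closed)
  have "integrable lebesgue (\<lambda>x. indicator \<Omega> x *\<^sub>R u x)"
    using assms by (subst (asm) integrable_restrict_space) auto
  then have "integrable lebesgue (\<lambda>x. indicator K x *\<^sub>R indicator \<Omega> x *\<^sub>R u x)"
    by (rule integrable_mult_indicator[OF Km])
  moreover have "(\<lambda>x. indicator K x *\<^sub>R indicator \<Omega> x *\<^sub>R u x) = (\<lambda>x. indicator K x *\<^sub>R u x)"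
    using K by (auto simp: indicator_def fun_eq_iff)
  ultimately have "integrable lebesgue (\<lambda>x. indicator K x *\<^sub>R u x)" by (simp only:)
  then show "integrable (lebesgue_on K) u" using Km by (subst integrable_restrict_space) auto
qed

text \<open>Ensures that the integrals defining a weak gradient really exist, so that they may be
  split linearly.\<close>

lemma locally_integrable_times:
  fixes d :: "'a::euclidean_space \<Rightarrow> 'b::euclidean_space"
  assumes \<Omega>: "open \<Omega>" and d: "locally_integrable \<Omega> d"
    and \<psi>: "continuous_on UNIV \<psi>" "compact K" "K \<subseteq> \<Omega>" "\<And>x. x \<notin> K \<Longrightarrow> \<psi> x = 0"
  shows "integrable (lebesgue_on \<Omega>) (\<lambda>x. \<psi> x *\<^sub>R d x)"
proof -
  have Km: "K \<in> sets lebesgue" using \<psi>(2) by (simp add: compact_imp_closed)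
  have "integrable (lebesgue_on K) d" using d \<psi> by (auto simp: locally_integrable_def)
  then have i: "integrable lebesgue (\<lambda>x. indicator K x *\<^sub>R d x)"
    using Km by (subst (asm) integrable_restrict_space) auto
  obtain B where B: "\<And>x. norm (\<psi> x) \<le> B" using compact_support_bounded[OF \<psi>(1,2,4)] by blast
  have "integrable lebesgue (\<lambda>x. \<psi> x *\<^sub>R indicator K x *\<^sub>R d x)"
  proof (rule Bochner_Integration.integrable_bound)
    show "integrable lebesgue (\<lambda>x. B *\<^sub>R indicator K x *\<^sub>R d x)" using i by (rule integrable_scaleR_right)
    show "(\<lambda>x. \<psi> x *\<^sub>R indicator K x *\<^sub>R d x) \<in> borel_measurable lebesgue"
      by (rule borel_measurable_scaleR[OF continuous_imp_lebesgue_measurable[OF \<psi>(1)] borel_measurable_integrable[OF i]])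
    have "\<bar>\<psi> x\<bar> \<le> \<bar>B\<bar>" for x using B[of x] by simp
    then show "AE x in lebesgue. norm (\<psi> x *\<^sub>R indicator K x *\<^sub>R d x) \<le> norm (B *\<^sub>R indicator K x *\<^sub>R d x)"
      by (intro AE_I2) (simp add: abs_mult mult_right_mono)
  qed
  moreover have "(\<lambda>x. \<psi> x *\<^sub>R indicator K x *\<^sub>R d x) = (\<lambda>x. indicator \<Omega> x *\<^sub>R \<psi> x *\<^sub>R d x)"
    using \<psi>(3,4) by (auto simp: indicator_def fun_eq_iff)
  ultimately have "integrable lebesgue (\<lambda>x. indicator \<Omega> x *\<^sub>R \<psi> x *\<^sub>R d x)" by (simp only:)
  then show ?thesis using \<Omega> by (subst integrable_restrict_space) auto
qed

lemma locally_integrable_inner_diff: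
  assumes "locally_integrable \<Omega> g" "locally_integrable \<Omega> g'"
  shows "locally_integrable \<Omega> (\<lambda>x. (g x - g' x) \<bullet> i)"
  using assms unfolding locally_integrable_def by auto

text \<open>Each component of the difference is orthogonal to all test functions, so the fundamental
  lemma applies.\<close>

lemma weak_gradient_unique:
  assumes \<Omega>: "open \<Omega>" and g: "is_weak_gradient \<Omega> u g" and g': "is_weak_gradient \<Omega> u g'"
  shows "AE x in lebesgue_on \<Omega>. g x = g' x"
proof -
  have "AE x in lebesgue_on \<Omega>. (g x - g' x) \<bullet> i = 0" if i: "i \<in> Basis" for i
  proof (rule fundamental_lemma[OF \<Omega>])
    show "locally_integrable \<Omega> (\<lambda>x. (g x - g' x) \<bullet> i)"
      using g g' by (intro locally_integrable_inner_diff) (auto simp: is_weak_gradient_def)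
    fix \<phi> assume \<phi>: "\<phi> \<in> test_functions \<Omega>"
    obtain K where K: "K \<subseteq> \<Omega>" "C1c K \<phi> (tgrad \<phi>)" using test_C1c[OF \<phi>] by blast
    have int: "integrable (lebesgue_on \<Omega>) (\<lambda>x. (G x \<bullet> i) * \<phi> x)" if "is_weak_gradient \<Omega> u G" for G
    proof -
      have "integrable (lebesgue_on \<Omega>) (\<lambda>x. \<phi> x *\<^sub>R G x)"
        using that C1cD[OF K(2)] K(1) by (intro locally_integrable_times[OF \<Omega>]) (auto simp: is_weak_gradient_def)
      then have "integrable (lebesgue_on \<Omega>) (\<lambda>x. (\<phi> x *\<^sub>R G x) \<bullet> i)" by (rule integrable_inner_left)
      then show ?thesis by (simp add: mult.commute)
    qed
    have "(\<integral>x. ((g x - g' x) \<bullet> i) * \<phi> x \<partial>lebesgue_on \<Omega>)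
        = (\<integral>x. (g x \<bullet> i) * \<phi> x \<partial>lebesgue_on \<Omega>) - (\<integral>x. (g' x \<bullet> i) * \<phi> x \<partial>lebesgue_on \<Omega>)"
      using int[OF g] int[OF g'] by (simp add: inner_diff_left left_diff_distrib)
    also have "\<dots> = 0"
      using g g' \<phi> i unfolding is_weak_gradient_def by (metis (no_types, lifting) cancel_comm_monoid_add_class.diff_cancel minus_minus)
    finally show "(\<integral>x. ((g x - g' x) \<bullet> i) * \<phi> x \<partial>lebesgue_on \<Omega>) = 0" .
  qed
  then have "AE x in lebesgue_on \<Omega>. \<forall>i\<in>Basis. (g x - g' x) \<bullet> i = 0"
    by (subst AE_finite_all) auto
  then show ?thesis
    by eventually_elim (subst euclidean_eq_iff, simp add: inner_diff_left)
qed

lemma wgrad_AE: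
  assumes "open \<Omega>" "is_weak_gradient \<Omega> u g"
  shows "is_weak_gradient \<Omega> u (wgrad \<Omega> u)" "AE x in lebesgue_on \<Omega>. wgrad \<Omega> u x = g x"
proof -
  show *: "is_weak_gradient \<Omega> u (wgrad \<Omega> u)" unfolding wgrad_def using assms(2) by (rule someI[of "is_weak_gradient \<Omega> u"])
  show "AE x in lebesgue_on \<Omega>. wgrad \<Omega> u x = g x" by (rule weak_gradient_unique[OF assms(1) * assms(2)])
qed

lemma W1D:
  assumes \<Omega>: "open \<Omega>" and u: "u \<in> W1 \<Omega> p"
  shows "u \<in> Lp (lebesgue_on \<Omega>) p" "wgrad \<Omega> u \<in> Lp (lebesgue_on \<Omega>) p" "is_weak_gradient \<Omega> u (wgrad \<Omega> u)"
proof -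
  obtain g where g: "g \<in> Lp (lebesgue_on \<Omega>) p" "is_weak_gradient \<Omega> u g" and uL: "u \<in> Lp (lebesgue_on \<Omega>) p"
    using u by (auto simp: W1_def Lspace_eq)
  note w = wgrad_AE[OF \<Omega> g(2)]
  have eq: "AE x in lebesgue_on \<Omega>. g x = wgrad \<Omega> u x" using w(2) by (auto elim!: eventually_mono)
  show "wgrad \<Omega> u \<in> Lp (lebesgue_on \<Omega>) p"
    using g(1) eq AE_lebesgue_on_measurable[OF _ LpD(1)[OF g(1)] eq] \<Omega> by (intro Lp_AE_cong[OF g(1)]) auto
  show "u \<in> Lp (lebesgue_on \<Omega>) p" "is_weak_gradient \<Omega> u (wgrad \<Omega> u)" by fact+
qed

lemma W1_norm_eq:
  assumes "open \<Omega>" "u \<in> W1 \<Omega> p"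
  shows "W1_norm \<Omega> p u = pnorm (lebesgue_on \<Omega>) p u + pnorm (lebesgue_on \<Omega>) p (wgrad \<Omega> u)"
  using W1D[OF assms] by (simp add: W1_norm_def Lnorm_eq)

section \<open>The space of functions with zero trace\<close>

locale sobolev =
  fixes \<Omega> :: "'a::euclidean_space set" and p pstar :: real and S :: "real \<Rightarrow> real"
  assumes \<Omega>: "open \<Omega>" "bounded \<Omega>" and p: "1 < p" "p < real DIM('a)" and S: "sobolev_constants \<Omega> p S"
    and pstar: "pstar = crit_exp (real DIM('a)) p"
begin

abbreviation "M \<equiv> lebesgue_on \<Omega>"
abbreviation "X \<equiv> W10 \<Omega> p"
abbreviation "grd \<equiv> wgrad \<Omega>"

lemma p_bounds: "0 \<le> p" "1 \<le> p" "0 < p" using p by auto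

lemma \<Omega>_sets [simp]: "\<Omega> \<in> sets lebesgue" using \<Omega>(1) by simp

sublocale finite_measure M
proof
  have "emeasure lborel \<Omega> < \<infinity>" using \<Omega>(2) by (rule emeasure_bounded_finite)
  then show "emeasure M (space M) \<noteq> \<infinity>" using \<Omega>(1) by (simp add: space_restrict_space emeasure_restrict_space)
qed

lemma finM: "finite_measure M" by unfold_locales

lemma p_less_pstar: "p < pstar" "1 < pstar"
proof -
  have "p * (real DIM('a) - p) < p * real DIM('a)" using p by simp
  then show "p < pstar" using p by (simp add: pstar crit_exp_def field_simps)
  then show "1 < pstar" using p by simp
qed

lemma Lp_mono: "g \<in> Lp M s \<Longrightarrow> 0 \<le> t \<Longrightarrow> t \<le> s \<Longrightarrow> g \<in> Lp M t"
  by (rule Lp_mono_exponent[OF finM])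

lemma continuous_bounded_Lp:
  fixes F :: "'a \<Rightarrow> 'b::euclidean_space"
  assumes "continuous_on UNIV F" "compact K" "\<And>x. x \<notin> K \<Longrightarrow> F x = 0" "0 \<le> s"
  shows "F \<in> Lp M s"
proof -
  obtain B where "\<And>x. norm (F x) \<le> B" using compact_support_bounded[OF assms(1-3)] by blast
  moreover have "F \<in> borel_measurable M"
    using continuous_imp_lebesgue_measurable[OF assms(1)] by (intro measurable_restrict_space1)
  ultimately show ?thesis using assms(4) by (intro Lp_bounded[OF finM]) auto
qed

lemma test_Lp:
  assumes "\<phi> \<in> test_functions \<Omega>" "0 \<le> s"
  shows "\<phi> \<in> Lp M s" "tgrad \<phi> \<in> Lp M s"
proof -
  obtain K where K: "K \<subseteq> \<Omega>" "C1c K \<phi> (tgrad \<phi>)" using test_C1c[OF assms(1)] by blast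
  show "\<phi> \<in> Lp M s" "tgrad \<phi> \<in> Lp M s"
    using C1cD[OF K(2)] C1c_grad_zero[OF K(2)] assms(2) by (auto intro!: continuous_bounded_Lp[of _ K])
qed

text \<open>Integration by parts in the form that the gradient of the product of two test functions
  has integral zero. The supports are compact in \<Omega>, so integrals over \<Omega> and over the
  whole space agree.\<close>

lemma test_weak_gradient:
  assumes \<phi>: "\<phi> \<in> test_functions \<Omega>"
  shows "is_weak_gradient \<Omega> \<phi> (tgrad \<phi>)"
  unfolding is_weak_gradient_def
proof (intro conjI ballI)
  show "locally_integrable \<Omega> \<phi>" "locally_integrable \<Omega> (tgrad \<phi>)"
    using test_Lp[OF \<phi>, of 1] Lp_imp_integrable[OF finM]
    by (auto intro!: integrable_imp_locally_integrable)
  fix \<psi> and i :: 'a assume \<psi>: "\<psi> \<in> test_functions \<Omega>" and i: "i \<in> Basis"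
  obtain K where K: "K \<subseteq> \<Omega>" "C1c K \<phi> (tgrad \<phi>)" using test_C1c[OF \<phi>] by blast
  obtain K' where K': "K' \<subseteq> \<Omega>" "C1c K' \<psi> (tgrad \<psi>)" using test_C1c[OF \<psi>] by blast
  note D = C1cD[OF K(2)] and D' = C1cD[OF K'(2)]
  let ?F = "\<lambda>x. \<phi> x * (tgrad \<psi> x \<bullet> i)" and ?G = "\<lambda>x. (tgrad \<phi> x \<bullet> i) * \<psi> x"
  have F: "continuous_on UNIV ?F" "\<And>x. x \<notin> K \<Longrightarrow> ?F x = 0"
    and G: "continuous_on UNIV ?G" "\<And>x. x \<notin> K \<Longrightarrow> ?G x = 0"
    using D D' C1c_grad_zero[OF K(2)] by (auto intro!: continuous_intros)
  have "0 = (\<integral>x. (\<phi> x *\<^sub>R tgrad \<psi> x + \<psi> x *\<^sub>R tgrad \<phi> x) \<bullet> i \<partial>lborel)"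
    using C1c_integral_grad[OF C1c_mult[OF K(2) K'(2)]] by simp
  also have "\<dots> = (\<integral>x. ?F x + ?G x \<partial>lborel)" by (simp add: inner_add_left mult.commute)
  also have "\<dots> = (\<integral>x. ?F x \<partial>lborel) + (\<integral>x. ?G x \<partial>lborel)"
    using compact_support_integrable[OF F(1) D(1) F(2)] compact_support_integrable[OF G(1) D(1) G(2)]
    by (intro Bochner_Integration.integral_add) auto
  finally have "(\<integral>x. ?F x \<partial>lborel) = - (\<integral>x. ?G x \<partial>lborel)" by simp
  then have "(\<integral>x. ?F x \<partial>M) = - (\<integral>x. ?G x \<partial>M)"
    using lebesgue_on_compact_support(2)[OF F(1) D(1) F(2) \<Omega>(1) K(1)]
      lebesgue_on_compact_support(2)[OF G(1) D(1) G(2) \<Omega>(1) K(1)] by simp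
  then show "(\<integral>x. \<phi> x * frechet_derivative \<psi> (at x) i \<partial>M) = - (\<integral>x. (tgrad \<phi> x \<bullet> i) * \<psi> x \<partial>M)"
    using i by (simp add: tgrad_inner_Basis)
qed

lemma pairing_tendsto:
  fixes U :: "nat \<Rightarrow> 'a \<Rightarrow> 'b::euclidean_space"
  assumes s: "1 < s" and U: "\<And>n. U n \<in> Lp M s" and u: "u \<in> Lp M s" and w: "w \<in> Lp M (conjx s)"
    and lim: "(\<lambda>n. pnorm M s (\<lambda>x. U n x - u x)) \<longlonglongrightarrow> 0"
  shows "(\<lambda>n. \<integral>x. U n x \<bullet> w x \<partial>M) \<longlonglongrightarrow> (\<integral>x. u x \<bullet> w x \<partial>M)"
proof -
  have "(\<lambda>n. (\<integral>x. U n x \<bullet> w x \<partial>M) - (\<integral>x. u x \<bullet> w x \<partial>M)) \<longlonglongrightarrow> 0"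
  proof (rule Lim_null_comparison, intro always_eventually allI)
    fix n
    have d: "(\<lambda>x. U n x - u x) \<in> Lp M s" using s U u by (intro Lp_diff) auto
    have "(\<integral>x. U n x \<bullet> w x \<partial>M) - (\<integral>x. u x \<bullet> w x \<partial>M) = (\<integral>x. (U n x - u x) \<bullet> w x \<partial>M)"
      using inner_integrable[OF s U w] inner_integrable[OF s u w] by (simp add: inner_diff_left)
    then show "norm ((\<integral>x. U n x \<bullet> w x \<partial>M) - (\<integral>x. u x \<bullet> w x \<partial>M)) \<le> pnorm M s (\<lambda>x. U n x - u x) * pnorm M (conjx s) w"
      using inner_integral_le[OF s d w] by simp
    show "(\<lambda>n. pnorm M s (\<lambda>x. U n x - u x) * pnorm M (conjx s) w) \<longlonglongrightarrow> 0"
      using tendsto_mult_right[OF lim] by simp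
  qed
  then show ?thesis by (simp add: LIM_zero_iff)
qed

text \<open>Both sides of the defining identity are pairings with fixed functions of L^p', hence
  continuous under L^p convergence of the function and of the gradient.\<close>

lemma weak_gradient_limit:
  assumes U: "\<And>n::nat. U n \<in> Lp M p" "\<And>n. G n \<in> Lp M p" "\<And>n. is_weak_gradient \<Omega> (U n) (G n)"
    and ug: "u \<in> Lp M p" "g \<in> Lp M p"
    and lim: "(\<lambda>n. pnorm M p (\<lambda>x. U n x - u x)) \<longlonglongrightarrow> 0" "(\<lambda>n. pnorm M p (\<lambda>x. G n x - g x)) \<longlonglongrightarrow> 0"
  shows "is_weak_gradient \<Omega> u g"
  unfolding is_weak_gradient_def
proof (intro conjI ballI)
  show "locally_integrable \<Omega> u" "locally_integrable \<Omega> g"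
    using ug Lp_imp_integrable[OF finM _ p_bounds(2)] by (auto intro!: integrable_imp_locally_integrable)
  fix \<phi> and i :: 'a assume \<phi>: "\<phi> \<in> test_functions \<Omega>" and i: "i \<in> Basis"
  have c: "0 \<le> conjx p" using conjx_gt_1[OF p(1)] by simp
  have m: "(\<lambda>x. tgrad \<phi> x \<bullet> i) \<in> Lp M (conjx p)"
  proof (rule Lp_bound[OF _ LpD(2)[OF test_Lp(2)[OF \<phi> c]]])
    show "(\<lambda>x. tgrad \<phi> x \<bullet> i) \<in> borel_measurable M"
      using LpD(1)[OF test_Lp(2)[OF \<phi> c]] by (intro borel_measurable_inner) auto
    show "AE x in M. norm (tgrad \<phi> x \<bullet> i) powr conjx p \<le> norm (tgrad \<phi> x) powr conjx p"
      using Basis_le_norm[OF i] c by (intro AE_I2 powr_mono2) auto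
  qed
  have 1: "(\<lambda>n. \<integral>x. U n x * (tgrad \<phi> x \<bullet> i) \<partial>M) \<longlonglongrightarrow> (\<integral>x. u x * (tgrad \<phi> x \<bullet> i) \<partial>M)"
    using pairing_tendsto[OF p(1) U(1) ug(1) m lim(1)] by simp
  have "(\<lambda>x. \<phi> x *\<^sub>R i) \<in> Lp M (conjx p)"
    using test_Lp(1)[OF \<phi> c] i by (auto simp: Lp_def)
  from pairing_tendsto[OF p(1) U(2) ug(2) this lim(2)]
  have 2: "(\<lambda>n. - (\<integral>x. (G n x \<bullet> i) * \<phi> x \<partial>M)) \<longlonglongrightarrow> - (\<integral>x. (g x \<bullet> i) * \<phi> x \<partial>M)"
    by (intro tendsto_minus) (simp add: mult.commute)
  have "(\<integral>x. U n x * (tgrad \<phi> x \<bullet> i) \<partial>M) = - (\<integral>x. (G n x \<bullet> i) * \<phi> x \<partial>M)" for n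
    using U(3)[of n] \<phi> i by (simp add: is_weak_gradient_def tgrad_inner_Basis)
  then have "(\<integral>x. u x * (tgrad \<phi> x \<bullet> i) \<partial>M) = - (\<integral>x. (g x \<bullet> i) * \<phi> x \<partial>M)"
    using 1 2 LIMSEQ_unique by simp
  then show "(\<integral>x. u x * frechet_derivative \<phi> (at x) i \<partial>M) = - (\<integral>x. (g x \<bullet> i) * \<phi> x \<partial>M)"
    using i by (simp add: tgrad_inner_Basis)
qed

section \<open>Linear operations and approximation by test functions\<close>

lemma weak_gradient_lincomb:
  assumes u: "is_weak_gradient \<Omega> u g" and v: "is_weak_gradient \<Omega> v h"
  shows "is_weak_gradient \<Omega> (\<lambda>x. u x + c * v x) (\<lambda>x. g x + c *\<^sub>R h x)"
  unfolding is_weak_gradient_def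
proof (intro conjI ballI)
  show "locally_integrable \<Omega> (\<lambda>x. u x + c * v x)" "locally_integrable \<Omega> (\<lambda>x. g x + c *\<^sub>R h x)"
    using u v by (auto simp: is_weak_gradient_def locally_integrable_def)
  fix \<phi> and i :: 'a assume \<phi>: "\<phi> \<in> test_functions \<Omega>" and i: "i \<in> Basis"
  obtain K where K: "K \<subseteq> \<Omega>" "C1c K \<phi> (tgrad \<phi>)" using test_C1c[OF \<phi>] by blast
  note D = C1cD[OF K(2)]
  have loc: "locally_integrable \<Omega> u" "locally_integrable \<Omega> v" "locally_integrable \<Omega> g" "locally_integrable \<Omega> h"
    using u v by (auto simp: is_weak_gradient_def)
  have "continuous_on UNIV (\<lambda>x. tgrad \<phi> x \<bullet> i)" using D by (intro continuous_intros)
  note T = locally_integrable_times[OF \<Omega>(1) _ this D(1) K(1)]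
  have 1: "integrable M (\<lambda>x. (tgrad \<phi> x \<bullet> i) *\<^sub>R u x)" "integrable M (\<lambda>x. (tgrad \<phi> x \<bullet> i) *\<^sub>R v x)"
    by (rule T[OF loc(1)], simp add: C1c_grad_zero[OF K(2)]) (rule T[OF loc(2)], simp add: C1c_grad_zero[OF K(2)])
  have "integrable M (\<lambda>x. \<phi> x *\<^sub>R g x)" "integrable M (\<lambda>x. \<phi> x *\<^sub>R h x)"
    using locally_integrable_times[OF \<Omega>(1) _ D(5,1) K(1) D(2)] loc by auto
  then have 2: "integrable M (\<lambda>x. (\<phi> x *\<^sub>R g x) \<bullet> i)" "integrable M (\<lambda>x. (\<phi> x *\<^sub>R h x) \<bullet> i)"
    using integrable_inner_left by blast+
  have "(\<integral>x. (u x + c * v x) * (tgrad \<phi> x \<bullet> i) \<partial>M)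
      = (\<integral>x. (tgrad \<phi> x \<bullet> i) *\<^sub>R u x + c * ((tgrad \<phi> x \<bullet> i) *\<^sub>R v x) \<partial>M)"
    by (simp add: algebra_simps)
  also have "\<dots> = (\<integral>x. (tgrad \<phi> x \<bullet> i) *\<^sub>R u x \<partial>M) + c * (\<integral>x. (tgrad \<phi> x \<bullet> i) *\<^sub>R v x \<partial>M)"
    using 1 by simp
  also have "\<dots> = - (\<integral>x. (g x \<bullet> i) * \<phi> x \<partial>M) + c * - (\<integral>x. (h x \<bullet> i) * \<phi> x \<partial>M)"
    using u v \<phi> i by (simp add: is_weak_gradient_def tgrad_inner_Basis mult.commute)
  also have "\<dots> = - (\<integral>x. (\<phi> x *\<^sub>R g x) \<bullet> i + c * ((\<phi> x *\<^sub>R h x) \<bullet> i) \<partial>M)"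
    using 2 by (simp add: mult.commute)
  also have "\<dots> = - (\<integral>x. ((g x + c *\<^sub>R h x) \<bullet> i) * \<phi> x \<partial>M)"
    by (simp add: algebra_simps inner_add_left)
  finally show "(\<integral>x. (u x + c * v x) * frechet_derivative \<phi> (at x) i \<partial>M) = - (\<integral>x. ((g x + c *\<^sub>R h x) \<bullet> i) * \<phi> x \<partial>M)"
    using i by (simp add: tgrad_inner_Basis)
qed

lemma W1I:
  assumes "u \<in> Lp M p" "g \<in> Lp M p" "is_weak_gradient \<Omega> u g"
  shows "u \<in> W1 \<Omega> p"
  using assms by (auto simp: W1_def Lspace_eq)

lemma Lp_lincomb: "0 \<le> s \<Longrightarrow> u \<in> Lp M s \<Longrightarrow> v \<in> Lp M s \<Longrightarrow> (\<lambda>x. u x + c *\<^sub>R v x) \<in> Lp M s"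
  by (intro Lp_add Lp_scaleR)

lemma W1_lincomb:
  assumes "u \<in> W1 \<Omega> p" "v \<in> W1 \<Omega> p"
  shows "(\<lambda>x. u x + c * v x) \<in> W1 \<Omega> p" "AE x in M. grd (\<lambda>x. u x + c * v x) x = grd u x + c *\<^sub>R grd v x"
proof -
  note U = W1D[OF \<Omega>(1) assms(1)] and V = W1D[OF \<Omega>(1) assms(2)]
  note w = weak_gradient_lincomb[OF U(3) V(3), of c]
  show "(\<lambda>x. u x + c * v x) \<in> W1 \<Omega> p"
    using Lp_lincomb[OF p_bounds(1) U(1) V(1), of c] Lp_lincomb[OF p_bounds(1) U(2) V(2), of c] w by (intro W1I) auto
  show "AE x in M. grd (\<lambda>x. u x + c * v x) x = grd u x + c *\<^sub>R grd v x"
    by (rule wgrad_AE(2)[OF \<Omega>(1) w])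
qed

lemma W1_diff:
  assumes "u \<in> W1 \<Omega> p" "v \<in> W1 \<Omega> p"
  shows "(\<lambda>x. u x - v x) \<in> W1 \<Omega> p" "AE x in M. grd (\<lambda>x. u x - v x) x = grd u x - grd v x"
  using W1_lincomb[OF assms, of "-1"] by auto

lemma W1_norm_diff:
  assumes "u \<in> W1 \<Omega> p" "v \<in> W1 \<Omega> p"
  shows "W1_norm \<Omega> p (\<lambda>x. u x - v x) = pnorm M p (\<lambda>x. u x - v x) + pnorm M p (\<lambda>x. grd u x - grd v x)"
proof -
  note D = W1_diff[OF assms]
  have "(\<lambda>x. grd u x - grd v x) \<in> Lp M p" using W1D(2)[OF \<Omega>(1)] assms p_bounds by (intro Lp_diff) auto
  then have "pnorm M p (grd (\<lambda>x. u x - v x)) = pnorm M p (\<lambda>x. grd u x - grd v x)"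
    using D W1D(2)[OF \<Omega>(1) D(1)] by (intro pnorm_AE_cong) (auto dest: LpD(1))
  then show ?thesis using W1_norm_eq[OF \<Omega>(1) D(1)] by simp
qed

lemma test_W1: "\<phi> \<in> test_functions \<Omega> \<Longrightarrow> \<phi> \<in> W1 \<Omega> p"
  using test_Lp[of \<phi> p] test_weak_gradient p_bounds by (intro W1I) auto

lemma test_wgrad: "\<phi> \<in> test_functions \<Omega> \<Longrightarrow> AE x in M. grd \<phi> x = tgrad \<phi> x"
  by (rule wgrad_AE(2)[OF \<Omega>(1) test_weak_gradient])

lemma pnorm_Lp_cong: "AE x in M. g x = h x \<Longrightarrow> g \<in> Lp M s \<Longrightarrow> h \<in> Lp M s \<Longrightarrow> pnorm M s g = pnorm M s h"
  by (intro pnorm_AE_cong) (auto dest: LpD)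

lemma test_wgrad_diff:
  assumes "\<phi> \<in> test_functions \<Omega>" "g \<in> Lp M p"
  shows "pnorm M p (\<lambda>x. grd \<phi> x - g x) = pnorm M p (\<lambda>x. tgrad \<phi> x - g x)"
  using test_wgrad[OF assms(1)] W1D(2)[OF \<Omega>(1) test_W1[OF assms(1)]] test_Lp(2)[OF assms(1) p_bounds(1)] assms(2)
  by (intro pnorm_Lp_cong Lp_diff[OF p_bounds(1)]) (auto elim!: eventually_mono)

lemma XD:
  assumes "u \<in> X"
  shows "u \<in> W1 \<Omega> p" "u \<in> Lp M p" "grd u \<in> Lp M p" "is_weak_gradient \<Omega> u (grd u)"
    "\<exists>\<phi>. (\<forall>n::nat. \<phi> n \<in> test_functions \<Omega>) \<and> (\<lambda>n. pnorm M p (\<lambda>x. \<phi> n x - u x)) \<longlonglongrightarrow> 0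
       \<and> (\<lambda>n. pnorm M p (\<lambda>x. tgrad (\<phi> n) x - grd u x)) \<longlonglongrightarrow> 0"
proof -
  show u: "u \<in> W1 \<Omega> p" using assms by (simp add: W10_def)
  show "u \<in> Lp M p" "grd u \<in> Lp M p" "is_weak_gradient \<Omega> u (grd u)" using W1D[OF \<Omega>(1) u] by auto
  obtain \<phi> where \<phi>: "\<And>n::nat. \<phi> n \<in> test_functions \<Omega>" "(\<lambda>n. W1_norm \<Omega> p (\<lambda>x. \<phi> n x - u x)) \<longlonglongrightarrow> 0"
    using assms by (auto simp: W10_def)
  have eq: "W1_norm \<Omega> p (\<lambda>x. \<phi> n x - u x) = pnorm M p (\<lambda>x. \<phi> n x - u x) + pnorm M p (\<lambda>x. tgrad (\<phi> n) x - grd u x)" for n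
    using W1_norm_diff[OF test_W1[OF \<phi>(1)] u] test_wgrad_diff[OF \<phi>(1) \<open>grd u \<in> Lp M p\<close>] by simp
  have "(\<lambda>n. pnorm M p (\<lambda>x. \<phi> n x - u x)) \<longlonglongrightarrow> 0" "(\<lambda>n. pnorm M p (\<lambda>x. tgrad (\<phi> n) x - grd u x)) \<longlonglongrightarrow> 0"
    by (rule Lim_null_comparison[OF _ \<phi>(2)], rule always_eventually, simp add: eq)+
  with \<phi>(1) show "\<exists>\<phi>. (\<forall>n::nat. \<phi> n \<in> test_functions \<Omega>) \<and> (\<lambda>n. pnorm M p (\<lambda>x. \<phi> n x - u x)) \<longlonglongrightarrow> 0
       \<and> (\<lambda>n. pnorm M p (\<lambda>x. tgrad (\<phi> n) x - grd u x)) \<longlonglongrightarrow> 0" by blast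
qed

text \<open>A criterion that does not presuppose a weak gradient: if test functions and their
  classical gradients converge in L^p, the second limit is automatically the gradient of the
  first.\<close>

lemma XI:
  assumes ug: "u \<in> Lp M p" "g \<in> Lp M p" and \<phi>: "\<And>n::nat. \<phi> n \<in> test_functions \<Omega>"
    and lim: "(\<lambda>n. pnorm M p (\<lambda>x. \<phi> n x - u x)) \<longlonglongrightarrow> 0" "(\<lambda>n. pnorm M p (\<lambda>x. tgrad (\<phi> n) x - g x)) \<longlonglongrightarrow> 0"
  shows "u \<in> X" "AE x in M. grd u x = g x"
proof -
  have w: "is_weak_gradient \<Omega> u g"
    using weak_gradient_limit[OF test_Lp(1)[OF \<phi> p_bounds(1)] test_Lp(2)[OF \<phi> p_bounds(1)] test_weak_gradient[OF \<phi>] ug lim] .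
  then have u: "u \<in> W1 \<Omega> p" using ug by (intro W1I)
  show ae: "AE x in M. grd u x = g x" by (rule wgrad_AE(2)[OF \<Omega>(1) w])
  have "pnorm M p (\<lambda>x. tgrad (\<phi> n) x - grd u x) = pnorm M p (\<lambda>x. tgrad (\<phi> n) x - g x)" for n
    using ae test_Lp(2)[OF \<phi> p_bounds(1)] W1D(2)[OF \<Omega>(1) u] ug
    by (intro pnorm_Lp_cong Lp_diff[OF p_bounds(1)]) (auto elim!: eventually_mono)
  then have "W1_norm \<Omega> p (\<lambda>x. \<phi> n x - u x) = pnorm M p (\<lambda>x. \<phi> n x - u x) + pnorm M p (\<lambda>x. tgrad (\<phi> n) x - g x)" for n
    using W1_norm_diff[OF test_W1[OF \<phi>] u] test_wgrad_diff[OF \<phi> W1D(2)[OF \<Omega>(1) u]] by simp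
  then have "(\<lambda>n. W1_norm \<Omega> p (\<lambda>x. \<phi> n x - u x)) \<longlonglongrightarrow> 0" using tendsto_add[OF lim] by simp
  with u \<phi> show "u \<in> X" by (auto simp: W10_def)
qed

lemma iter_partial_lincomb:
  assumes "smooth_fun \<phi>" "smooth_fun \<psi>" "set is \<subseteq> Basis"
  shows "iter_partial is (\<lambda>x. \<phi> x + c * \<psi> x) = (\<lambda>x. iter_partial is \<phi> x + c * iter_partial is \<psi> x)"
  using assms(3)
proof (induction "is")
  case (Cons i "is")
  have d: "iter_partial is \<phi> differentiable at x" "iter_partial is \<psi> differentiable at x" for x
    using assms Cons.prems by (auto simp: smooth_fun_def)
  have "frechet_derivative (\<lambda>x. iter_partial is \<phi> x + c * iter_partial is \<psi> x) (at x)
      = (\<lambda>v. frechet_derivative (iter_partial is \<phi>) (at x) v + c * frechet_derivative (iter_partial is \<psi>) (at x) v)" for x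
    using d[of x] unfolding frechet_derivative_works
    by (intro frechet_derivative_at[symmetric]) (auto intro!: has_derivative_add has_derivative_mult_right)
  with Cons show ?case by simp
qed simp

lemma test_lincomb:
  assumes \<phi>: "\<phi> \<in> test_functions \<Omega>" and \<psi>: "\<psi> \<in> test_functions \<Omega>"
  shows "(\<lambda>x. \<phi> x + c * \<psi> x) \<in> test_functions \<Omega>" "tgrad (\<lambda>x. \<phi> x + c * \<psi> x) x = tgrad \<phi> x + c *\<^sub>R tgrad \<psi> x"
proof -
  have sm: "smooth_fun \<phi>" "smooth_fun \<psi>" using assms by (auto simp: test_functions_def)
  have "smooth_fun (\<lambda>x. \<phi> x + c * \<psi> x)"
    using sm unfolding smooth_fun_def
    by (auto simp: iter_partial_lincomb[OF sm] intro!: differentiable_add differentiable_mult)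
  moreover have "closure {x. \<phi> x + c * \<psi> x \<noteq> 0} \<subseteq> closure {x. \<phi> x \<noteq> 0} \<union> closure {x. \<psi> x \<noteq> 0}"
    unfolding closure_Un[symmetric] by (rule closure_mono) auto
  ultimately show "(\<lambda>x. \<phi> x + c * \<psi> x) \<in> test_functions \<Omega>"
    using assms compact_Un[of "closure {x. \<phi> x \<noteq> 0}" "closure {x. \<psi> x \<noteq> 0}"]
    unfolding test_functions_def by (simp add: compact_eq_bounded_closed) (meson Un_least bounded_Un bounded_subset subset_trans)
  have "frechet_derivative (\<lambda>x. \<phi> x + c * \<psi> x) (at x) i = frechet_derivative \<phi> (at x) i + c * frechet_derivative \<psi> (at x) i"
    if "i \<in> Basis" for i
    using iter_partial_lincomb[OF sm, of "[i]" c] that by (simp add: fun_eq_iff)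
  then show "tgrad (\<lambda>x. \<phi> x + c * \<psi> x) x = tgrad \<phi> x + c *\<^sub>R tgrad \<psi> x"
    by (simp add: tgrad_def scaleR_add_left sum.distrib scaleR_sum_right)
qed

lemma pnorm_lincomb_tendsto:
  fixes U V :: "nat \<Rightarrow> 'a \<Rightarrow> 'b::euclidean_space"
  assumes s: "1 \<le> s" and "\<And>n. U n \<in> Lp M s" "\<And>n. V n \<in> Lp M s" "u \<in> Lp M s" "v \<in> Lp M s"
    and lim: "(\<lambda>n. pnorm M s (\<lambda>x. U n x - u x)) \<longlonglongrightarrow> 0" "(\<lambda>n. pnorm M s (\<lambda>x. V n x - v x)) \<longlonglongrightarrow> 0"
  shows "(\<lambda>n. pnorm M s (\<lambda>x. (U n x + c *\<^sub>R V n x) - (u x + c *\<^sub>R v x))) \<longlonglongrightarrow> 0"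
proof (rule Lim_null_comparison, intro always_eventually allI)
  show "(\<lambda>n. pnorm M s (\<lambda>x. U n x - u x) + \<bar>c\<bar> * pnorm M s (\<lambda>x. V n x - v x)) \<longlonglongrightarrow> 0"
    using tendsto_add[OF lim(1) tendsto_mult_left[OF lim(2), of "\<bar>c\<bar>"]] by simp
  fix n
  have d: "(\<lambda>x. U n x - u x) \<in> Lp M s" "(\<lambda>x. V n x - v x) \<in> Lp M s" using assms by (auto intro!: Lp_diff)
  have "pnorm M s (\<lambda>x. (U n x + c *\<^sub>R V n x) - (u x + c *\<^sub>R v x)) = pnorm M s (\<lambda>x. (U n x - u x) + c *\<^sub>R (V n x - v x))"
    by (simp add: algebra_simps)
  also have "\<dots> \<le> pnorm M s (\<lambda>x. U n x - u x) + pnorm M s (\<lambda>x. c *\<^sub>R (V n x - v x))"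
    using s d(1) Lp_scaleR[OF d(2)] by (rule pnorm_triangle)
  finally show "norm (pnorm M s (\<lambda>x. (U n x + c *\<^sub>R V n x) - (u x + c *\<^sub>R v x)))
      \<le> pnorm M s (\<lambda>x. U n x - u x) + \<bar>c\<bar> * pnorm M s (\<lambda>x. V n x - v x)"
    using s by (simp add: pnorm_scaleR)
qed

text \<open>Linear combinations of the approximating test functions approximate the combination. The
  single form u + c v yields sums, differences and multiples.\<close>

lemma X_lincomb:
  assumes u: "u \<in> X" and v: "v \<in> X"
  shows "(\<lambda>x. u x + c * v x) \<in> X" "AE x in M. grd (\<lambda>x. u x + c * v x) x = grd u x + c *\<^sub>R grd v x"
proof -
  obtain \<phi> where \<phi>: "\<And>n::nat. \<phi> n \<in> test_functions \<Omega>" "(\<lambda>n. pnorm M p (\<lambda>x. \<phi> n x - u x)) \<longlonglongrightarrow> 0"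
       "(\<lambda>n. pnorm M p (\<lambda>x. tgrad (\<phi> n) x - grd u x)) \<longlonglongrightarrow> 0" using XD(5)[OF u] by blast
  obtain \<psi> where \<psi>: "\<And>n::nat. \<psi> n \<in> test_functions \<Omega>" "(\<lambda>n. pnorm M p (\<lambda>x. \<psi> n x - v x)) \<longlonglongrightarrow> 0"
       "(\<lambda>n. pnorm M p (\<lambda>x. tgrad (\<psi> n) x - grd v x)) \<longlonglongrightarrow> 0" using XD(5)[OF v] by blast
  note L = test_Lp[OF \<phi>(1) p_bounds(1)] test_Lp[OF \<psi>(1) p_bounds(1)]
  note l1 = pnorm_lincomb_tendsto[OF p_bounds(2) L(1) L(3) XD(2)[OF u] XD(2)[OF v] \<phi>(2) \<psi>(2), of c]
  note l2 = pnorm_lincomb_tendsto[OF p_bounds(2) L(2) L(4) XD(3)[OF u] XD(3)[OF v] \<phi>(3) \<psi>(3), of c]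
  show "(\<lambda>x. u x + c * v x) \<in> X" "AE x in M. grd (\<lambda>x. u x + c * v x) x = grd u x + c *\<^sub>R grd v x"
    using XI[of "\<lambda>x. u x + c * v x" "\<lambda>x. grd u x + c *\<^sub>R grd v x" "\<lambda>n x. \<phi> n x + c * \<psi> n x"]
      Lp_lincomb[OF p_bounds(1) XD(2)[OF u] XD(2)[OF v], of c] Lp_lincomb[OF p_bounds(1) XD(3)[OF u] XD(3)[OF v], of c]
      test_lincomb[OF \<phi>(1) \<psi>(1)] l1 l2 by auto
qed

lemma X_zero: "(\<lambda>x. 0) \<in> X" "AE x in M. grd (\<lambda>x. 0) x = 0"
proof -
  have t: "(\<lambda>x. 0) \<in> test_functions \<Omega>"
    using smooth_class_smooth[OF smooth_class.const[of 0]] by (simp add: test_functions_def)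
  have "tgrad (\<lambda>x::'a. 0) = (\<lambda>x. 0)" by (simp add: tgrad_def[abs_def])
  then show "(\<lambda>x. 0) \<in> X" "AE x in M. grd (\<lambda>x. 0) x = 0"
    using XI[OF zero_in_Lp zero_in_Lp, of "\<lambda>n x. 0"] t by simp_all
qed

lemma X_add:
  assumes "u \<in> X" "v \<in> X"
  shows "(\<lambda>x. u x + v x) \<in> X" "AE x in M. grd (\<lambda>x. u x + v x) x = grd u x + grd v x"
  using X_lincomb[OF assms, of 1] by auto

lemma X_diff:
  assumes "u \<in> X" "v \<in> X"
  shows "(\<lambda>x. u x - v x) \<in> X" "AE x in M. grd (\<lambda>x. u x - v x) x = grd u x - grd v x"
  using X_lincomb[OF assms, of "-1"] by auto

lemma X_scale:
  assumes "u \<in> X"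
  shows "(\<lambda>x. c * u x) \<in> X" "AE x in M. grd (\<lambda>x. c * u x) x = c *\<^sub>R grd u x"
proof -
  show "(\<lambda>x. c * u x) \<in> X" using X_lincomb(1)[OF X_zero(1) assms, of c] by simp
  show "AE x in M. grd (\<lambda>x. c * u x) x = c *\<^sub>R grd u x"
    using X_lincomb(2)[OF X_zero(1) assms, of c] X_zero(2) by (auto elim!: eventually_elim2)
qed

lemma X_sum:
  fixes E :: "nat \<Rightarrow> 'a \<Rightarrow> real"
  assumes "\<And>i. i < n \<Longrightarrow> E i \<in> X"
  shows "(\<lambda>x. \<Sum>i<n. c i * E i x) \<in> X \<and>
    (AE x in M. grd (\<lambda>x. \<Sum>i<n. c i * E i x) x = (\<Sum>i<n. c i *\<^sub>R grd (E i) x))"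
  using assms
proof (induction n)
  case 0
  show ?case using X_zero by auto
next
  case (Suc n)
  have E: "E n \<in> X" and IH: "(\<lambda>x. \<Sum>i<n. c i * E i x) \<in> X"
    "AE x in M. grd (\<lambda>x. \<Sum>i<n. c i * E i x) x = (\<Sum>i<n. c i *\<^sub>R grd (E i) x)"
    using Suc by auto
  note l = X_lincomb[OF IH(1) E, of "c n"]
  have "AE x in M. grd (\<lambda>x. (\<Sum>i<n. c i * E i x) + c n * E n x) x = (\<Sum>i<n. c i *\<^sub>R grd (E i) x) + c n *\<^sub>R grd (E n) x"
    using l(2) IH(2) by eventually_elim simp
  with l(1) show ?case by simp
qed

lemma grad_diff_pnorm:
  assumes "u \<in> X" "v \<in> X"
  shows "pnorm M p (grd (\<lambda>x. u x - v x)) = pnorm M p (\<lambda>x. grd u x - grd v x)"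
  using X_diff[OF assms] XD(3)[OF X_diff(1)[OF assms]] XD(3)[OF assms(1)] XD(3)[OF assms(2)]
  by (intro pnorm_Lp_cong Lp_diff[OF p_bounds(1)]) auto

section \<open>Embeddings and completeness\<close>

lemma X_norm: "u \<in> X \<Longrightarrow> W10_norm \<Omega> p u = pnorm M p (grd u)"
  using XD(3) by (simp add: W10_norm_def Lnorm_eq)

lemma Sobolev:
  assumes "u \<in> X" "1 \<le> t" "t \<le> pstar"
  shows "u \<in> Lp M t" "pnorm M t u \<le> S t * pnorm M p (grd u)" "0 < S t"
proof -
  show St: "0 < S t" using S assms by (auto simp: sobolev_constants_def pstar)
  have le: "Lnorm \<Omega> (ereal t) u \<le> ennreal (S t) * ennreal (pnorm M p (grd u))"
  proof -
    have "\<forall>u\<in>X. Lnorm \<Omega> (ereal t) u \<le> ennreal (S t) * Lnorm \<Omega> (ereal p) (grd u)"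
      using S assms(2,3) unfolding sobolev_constants_def pstar by blast
    from bspec[OF this assms(1)] show ?thesis by (simp only: Lnorm_eq[OF XD(3)[OF assms(1)]])
  qed
  also have "\<dots> < top" by (simp add: ennreal_mult_less_top)
  finally show uL: "u \<in> Lp M t" using LpD(1)[OF XD(2)[OF assms(1)]] by (intro Lnorm_finite_imp_Lp)
  have "ennreal (pnorm M t u) \<le> ennreal (S t * pnorm M p (grd u))"
    using le St by (simp add: Lnorm_eq[OF uL] ennreal_mult)
  then show "pnorm M t u \<le> S t * pnorm M p (grd u)" using St by (simp add: ennreal_le_iff)
qed

text \<open>The embedding into L^p, available since p < p*, makes the functions Cauchy as soon as
  their gradients are. Test functions within 1/(n+1) of the n-th element then approximate the limit
  pair.\<close>

lemma X_closed:
  assumes U: "\<And>n::nat. U n \<in> X" and h: "h \<in> Lp M p" and lim: "(\<lambda>n. pnorm M p (\<lambda>x. grd (U n) x - h x)) \<longlonglongrightarrow> 0"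
  shows "\<exists>u\<in>X. AE x in M. grd u x = h x"
proof -
  note UD = XD[OF U]
  have pp: "1 \<le> p" "p \<le> pstar" using p p_less_pstar by auto
  have cauchy: "\<exists>N. \<forall>m\<ge>N. \<forall>n\<ge>N. pnorm M p (\<lambda>x. U m x - U n x) < e" if e: "0 < e" for e
  proof -
    have Sp: "0 < S p" using Sobolev(3)[OF X_zero(1) pp] .
    obtain N where N: "\<And>n. n \<ge> N \<Longrightarrow> pnorm M p (\<lambda>x. grd (U n) x - h x) < e / (2 * S p)"
      using order_tendstoD(2)[OF lim, of "e / (2 * S p)"] e Sp by (auto simp: eventually_sequentially)
    have "pnorm M p (\<lambda>x. U m x - U n x) < e" if mn: "m \<ge> N" "n \<ge> N" for m n
    proof -
      have "pnorm M p (\<lambda>x. U m x - U n x) \<le> S p * pnorm M p (\<lambda>x. grd (U m) x - grd (U n) x)"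
        using Sobolev(2)[OF X_diff(1)[OF U U] pp, of m n] grad_diff_pnorm[OF U U] by simp
      also have "pnorm M p (\<lambda>x. grd (U m) x - grd (U n) x) \<le> pnorm M p (\<lambda>x. grd (U m) x - h x) + pnorm M p (\<lambda>x. h x - grd (U n) x)"
        by (rule pnorm_dist_triangle[OF p_bounds(2) UD(3) h UD(3)])
      also have "\<dots> < e / (2 * S p) + e / (2 * S p)"
        using N[OF mn(1)] N[OF mn(2)] pnorm_minus_commute[of M p h "grd (U n)"] by simp
      also have "S p * (e / (2 * S p) + e / (2 * S p)) = e" using Sp by (simp add: field_simps)
      finally show ?thesis using Sp by simp
    qed
    then show ?thesis by blast
  qed
  obtain u where u: "u \<in> Lp M p" "(\<lambda>n. pnorm M p (\<lambda>x. U n x - u x)) \<longlonglongrightarrow> 0"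
    using Lp_complete[OF p_bounds(2) UD(2) cauchy] by blast
  have "\<exists>\<phi>\<in>test_functions \<Omega>. pnorm M p (\<lambda>x. \<phi> x - U n x) < 1 / real (Suc n)
      \<and> pnorm M p (\<lambda>x. tgrad \<phi> x - grd (U n) x) < 1 / real (Suc n)" for n
  proof -
    obtain \<phi> where \<phi>: "\<And>n::nat. \<phi> n \<in> test_functions \<Omega>" and l: "(\<lambda>k. pnorm M p (\<lambda>x. \<phi> k x - U n x)) \<longlonglongrightarrow> 0"
       "(\<lambda>k. pnorm M p (\<lambda>x. tgrad (\<phi> k) x - grd (U n) x)) \<longlonglongrightarrow> 0" using UD(5)[of n] by blast
    have "eventually (\<lambda>k. pnorm M p (\<lambda>x. \<phi> k x - U n x) < 1 / real (Suc n)
        \<and> pnorm M p (\<lambda>x. tgrad (\<phi> k) x - grd (U n) x) < 1 / real (Suc n)) sequentially"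
      by (intro eventually_conj order_tendstoD(2)[OF l(1)] order_tendstoD(2)[OF l(2)]) auto
    then show ?thesis using \<phi> by (auto simp: eventually_sequentially)
  qed
  then obtain \<phi> where \<phi>: "\<And>n. \<phi> n \<in> test_functions \<Omega>" and
    near: "\<And>n. pnorm M p (\<lambda>x. \<phi> n x - U n x) < 1 / real (Suc n)" "\<And>n. pnorm M p (\<lambda>x. tgrad (\<phi> n) x - grd (U n) x) < 1 / real (Suc n)"
    by metis
  have lim0: "(\<lambda>n. 1 / real (Suc n)) \<longlonglongrightarrow> 0" by (rule LIMSEQ_Suc[OF lim_1_over_n])
  have "(\<lambda>n. pnorm M p (\<lambda>x. \<phi> n x - u x)) \<longlonglongrightarrow> 0"
  proof (rule Lim_null_comparison, intro always_eventually allI)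
    show "norm (pnorm M p (\<lambda>x. \<phi> n x - u x)) \<le> 1 / real (Suc n) + pnorm M p (\<lambda>x. U n x - u x)" for n
      using pnorm_dist_triangle[OF p_bounds(2) test_Lp(1)[OF \<phi> p_bounds(1)] UD(2) u(1), of n n] near(1)[of n] by simp
    show "(\<lambda>n. 1 / real (Suc n) + pnorm M p (\<lambda>x. U n x - u x)) \<longlonglongrightarrow> 0" using tendsto_add[OF lim0 u(2)] by simp
  qed
  moreover have "(\<lambda>n. pnorm M p (\<lambda>x. tgrad (\<phi> n) x - h x)) \<longlonglongrightarrow> 0"
  proof (rule Lim_null_comparison, intro always_eventually allI)
    show "norm (pnorm M p (\<lambda>x. tgrad (\<phi> n) x - h x)) \<le> 1 / real (Suc n) + pnorm M p (\<lambda>x. grd (U n) x - h x)" for n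
      using pnorm_dist_triangle[OF p_bounds(2) test_Lp(2)[OF \<phi> p_bounds(1)] UD(3) h, of n n] near(2)[of n] by simp
    show "(\<lambda>n. 1 / real (Suc n) + pnorm M p (\<lambda>x. grd (U n) x - h x)) \<longlonglongrightarrow> 0" using tendsto_add[OF lim0 lim] by simp
  qed
  ultimately show ?thesis using XI(1)[OF u(1) h, of \<phi>] XI(2)[OF u(1) h, of \<phi>] \<phi> by blast
qed

definition gradients :: "('a \<Rightarrow> 'a) set" where
  "gradients = {g \<in> Lp M p. \<exists>u\<in>X. AE x in M. grd u x = g x}"

lemma grad_in_gradients: "u \<in> X \<Longrightarrow> grd u \<in> gradients"
  using XD(3) by (auto simp: gradients_def)

lemma gradients_closed: "closed_subspace M p gradients"
  unfolding closed_subspace_def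
proof (intro conjI ballI allI impI)
  show "gradients \<subseteq> Lp M p" by (auto simp: gradients_def)
  show "(\<lambda>x. 0) \<in> gradients" using X_zero by (auto simp: gradients_def)
  fix g assume g: "g \<in> gradients"
  then obtain u where u: "u \<in> X" "AE x in M. grd u x = g x" and gL: "g \<in> Lp M p" by (auto simp: gradients_def)
  {
    fix c
    have "AE x in M. grd (\<lambda>x. c * u x) x = c *\<^sub>R g x" using X_scale(2)[OF u(1), of c] u(2) by eventually_elim simp
    then show "(\<lambda>x. c *\<^sub>R g x) \<in> gradients" using X_scale(1)[OF u(1)] Lp_scaleR[OF gL] by (auto simp: gradients_def)
  }
  fix h assume h: "h \<in> gradients"
  then obtain v where v: "v \<in> X" "AE x in M. grd v x = h x" and hL: "h \<in> Lp M p" by (auto simp: gradients_def)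
  have "AE x in M. grd (\<lambda>x. u x + v x) x = g x + h x"
    using X_add(2)[OF u(1) v(1)] u(2) v(2) by eventually_elim simp
  then show "(\<lambda>x. g x + h x) \<in> gradients" using X_add(1)[OF u(1) v(1)] Lp_add[OF p_bounds(1) gL hL] by (auto simp: gradients_def)
next
  fix G h assume G: "\<forall>n::nat. G n \<in> gradients" and h: "h \<in> Lp M p" and lim: "(\<lambda>n. pnorm M p (\<lambda>x. G n x - h x)) \<longlonglongrightarrow> 0"
  then have "\<forall>n. \<exists>u. u \<in> X \<and> (AE x in M. grd u x = G n x)" by (auto simp: gradients_def)
  then obtain U where U: "\<And>n. U n \<in> X" "\<And>n. AE x in M. grd (U n) x = G n x" by metis
  have "pnorm M p (\<lambda>x. grd (U n) x - h x) = pnorm M p (\<lambda>x. G n x - h x)" for n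
    using U(2)[of n] XD(3)[OF U(1)[of n]] h G
    by (intro pnorm_Lp_cong Lp_diff[OF p_bounds(1)]) (auto simp: gradients_def elim!: eventually_mono)
  then have "\<exists>u\<in>X. AE x in M. grd u x = h x" using lim by (intro X_closed[OF U(1) h]) simp
  then show "h \<in> gradients" using h by (auto simp: gradients_def)
qed

end

section \<open>Separability, weak compactness and reflexivity\<close>

lemma diagonal_convergent_subseq:
  fixes f :: "nat \<Rightarrow> nat \<Rightarrow> real"
  assumes bound: "\<And>k n. \<bar>f n k\<bar> \<le> B k"
  shows "\<exists>r::nat\<Rightarrow>nat. strict_mono r \<and> (\<forall>k. convergent (\<lambda>n. f (r n) k))"
proof -
  interpret sub: subseqs "\<lambda>k s. convergent (\<lambda>n. f (s n) k)"
  proof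
    fix k and s :: "nat \<Rightarrow> nat"
    have sc: "seq_compact {- B k..B k}" by (intro compact_imp_seq_compact) simp
    have "\<forall>n. f (s n) k \<in> {- B k..B k}" using bound[of _ k] by (auto simp: abs_le_iff minus_le_iff)
    from seq_compactE[OF sc this] obtain l r where "strict_mono r" "((\<lambda>n. f (s n) k) \<circ> r) \<longlonglongrightarrow> l" by blast
    then show "\<exists>r'. strict_mono r' \<and> convergent (\<lambda>n. f ((s \<circ> r') n) k)"
      by (auto simp: convergent_def o_def)
  qed
  have "convergent (\<lambda>n. f (sub.diagseq n) k)" for k
  proof -
    \<comment> \<open>The diagonal sequence is a subsequence of the k-th extracted one only after an
      initial segment, hence the shift by \<open>Suc k\<close>, which convergence ignores.\<close>
    have "convergent (\<lambda>n. f ((sub.diagseq \<circ> ((+) (Suc k))) n) k)"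
    proof (rule sub.diagseq_holds)
      fix r s :: "nat \<Rightarrow> nat" and n :: nat
      assume r: "strict_mono r" and "convergent (\<lambda>m. f (s m) n)"
      then show "convergent (\<lambda>m. f ((s \<circ> r) m) n)"
        using convergent_subseq_convergent[of "\<lambda>m. f (s m) n" r] by (simp add: o_def)
    qed
    then show ?thesis
      using convergent_ignore_initial_segment[of "\<lambda>n. f (sub.diagseq n) k" "Suc k"]
      by (simp add: o_def add.commute)
  qed
  then show ?thesis using sub.subseq_diagseq by blast
qed

text \<open>The corners are taken strictly inside, above a and below b. The approximating boxes thus
  lie in \<open>box a b\<close>, and the indicators converge at every point, including the
  boundary.\<close>

lemma box_indicator_approx:
  fixes D :: "'a::euclidean_space set"
  assumes D: "\<And>S. open S \<Longrightarrow> S \<noteq> {} \<Longrightarrow> \<exists>d\<in>D. d \<in> S"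
  shows "\<exists>s t. (\<forall>n::nat. s n \<in> D \<and> t n \<in> D) \<and>
    (\<forall>x. (\<lambda>n. indicator (box (s n) (t n)) x :: real) \<longlonglongrightarrow> indicator (box a b) x)"
proof -
  have ne: "box c (c + (1 / real (Suc n)) *\<^sub>R One) \<noteq> {}" for c :: 'a and n
    by (auto simp: box_ne_empty inner_add_left)
  have "\<exists>s\<in>D. s \<in> box a (a + (1 / real (Suc n)) *\<^sub>R One)" for n by (rule D[OF open_box ne])
  then obtain s where s: "\<And>n. s n \<in> D" "\<And>n. s n \<in> box a (a + (1 / real (Suc n)) *\<^sub>R One)" by metis
  have "\<exists>t\<in>D. t \<in> box (b - (1 / real (Suc n)) *\<^sub>R One) b" for n
    using ne[of "b - (1 / real (Suc n)) *\<^sub>R One" n] by (intro D[OF open_box]) simp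
  then obtain t where t: "\<And>n. t n \<in> D" "\<And>n. t n \<in> box (b - (1 / real (Suc n)) *\<^sub>R One) b" by metis
  have s': "a \<bullet> i < s n \<bullet> i" "s n \<bullet> i < a \<bullet> i + 1 / real (Suc n)" if "i \<in> Basis" for n i
    using s(2)[of n] that by (auto simp: mem_box inner_add_left)
  have t': "b \<bullet> i - 1 / real (Suc n) < t n \<bullet> i" "t n \<bullet> i < b \<bullet> i" if "i \<in> Basis" for n i
    using t(2)[of n] that by (auto simp: mem_box inner_diff_left)
  have "(\<lambda>n. indicator (box (s n) (t n)) x :: real) \<longlonglongrightarrow> indicator (box a b) x" for x
  proof (cases "x \<in> box a b")
    case True
    have z: "(\<lambda>n. 1 / real (Suc n)) \<longlonglongrightarrow> 0" by (rule LIMSEQ_Suc[OF lim_1_over_n])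
    have "eventually (\<lambda>n. s n \<bullet> i < x \<bullet> i \<and> x \<bullet> i < t n \<bullet> i) sequentially" if i: "i \<in> Basis" for i
    proof -
      have "0 < x \<bullet> i - a \<bullet> i" "0 < b \<bullet> i - x \<bullet> i" using True i by (auto simp: mem_box)
      from order_tendstoD(2)[OF z this(1)] order_tendstoD(2)[OF z this(2)]
      show ?thesis
      proof eventually_elim
        case (elim n)
        then show ?case using s'(2)[OF i, of n] t'(1)[OF i, of n] by linarith
      qed
    qed
    then have "eventually (\<lambda>n. \<forall>i\<in>Basis. s n \<bullet> i < x \<bullet> i \<and> x \<bullet> i < t n \<bullet> i) sequentially"
      by (intro eventually_ball_finite) auto
    then have "eventually (\<lambda>n. indicator (box (s n) (t n)) x = (1::real)) sequentially"
      by eventually_elim (simp add: mem_box)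
    with True show ?thesis by (auto intro: tendsto_eventually)
  next
    case False
    have "x \<notin> box (s n) (t n)" for n
    proof
      assume "x \<in> box (s n) (t n)"
      then have "\<forall>i\<in>Basis. a \<bullet> i < x \<bullet> i \<and> x \<bullet> i < b \<bullet> i"
        using s'(1) t'(2) by (auto simp: mem_box) (meson less_trans)+
      with False show False by (simp add: mem_box)
    qed
    with False show ?thesis by simp
  qed
  with s(1) t(1) show ?thesis by blast
qed

context sobolev
begin

section \<open>A countable dense family in L^s\<close>

definition box_fun :: "'a \<times> 'a \<times> 'a \<Rightarrow> 'a \<Rightarrow> 'a" where
  "box_fun z x = (case z of (a, b, i) \<Rightarrow> indicator (box a b) x *\<^sub>R i)"

lemma box_fun_Lp:
  assumes "0 \<le> s"
  shows "box_fun z \<in> Lp M s"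
proof (rule Lp_bounded[OF finM])
  obtain a b i where z: "z = (a, b, i)" by (cases z)
  have "indicator (box a b) \<in> borel_measurable (lebesgue :: 'a measure)"
    by (rule borel_measurable_indicator) simp
  then show "box_fun z \<in> borel_measurable M"
    unfolding box_fun_def[abs_def] z by (auto intro!: measurable_restrict_space1 borel_measurable_scaleR)
  show "norm (box_fun z x) \<le> norm (snd (snd z))" for x
    by (simp add: box_fun_def z indicator_def)
qed fact

text \<open>Countably many boxes detect every function, because every box is a pointwise limit of
  boxes with corners in the dense set and the integrals converge by domination.\<close>

lemma box_fun_total:
  assumes D: "\<And>U. open U \<Longrightarrow> U \<noteq> {} \<Longrightarrow> \<exists>d\<in>D. d \<in> U"
    and g: "g \<in> Lp M s" "1 \<le> s"
    and zero: "\<And>z. z \<in> D \<times> D \<times> Basis \<Longrightarrow> (\<integral>x. g x \<bullet> box_fun z x \<partial>M) = 0"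
  shows "AE x in M. g x = 0"
proof -
  have gi: "integrable M g" by (rule Lp_imp_integrable[OF finM g])
  have "AE x in M. g x \<bullet> i = 0" if i: "i \<in> Basis" for i
  proof -
    define h where "h x = indicator \<Omega> x * (g x \<bullet> i)" for x
    have gii: "integrable M (\<lambda>x. g x \<bullet> i)" using gi by (rule integrable_inner_left)
    then have hi: "integrable lebesgue h"
      unfolding h_def by (subst (asm) integrable_restrict_space) auto
    have "AE x in lebesgue. h x = 0"
    proof (rule AE_zero_if_box_integrals_zero[OF hi])
      fix a b
      obtain s t where st: "\<And>n::nat. s n \<in> D" "\<And>n. t n \<in> D"
        "\<And>x. (\<lambda>n. indicator (box (s n) (t n)) x :: real) \<longlonglongrightarrow> indicator (box a b) x"
        using box_indicator_approx[OF D, of a b] by blast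
      have "(\<lambda>n. \<integral>x. indicator (box (s n) (t n)) x * h x \<partial>lebesgue) \<longlonglongrightarrow> (\<integral>x. indicator (box a b) x * h x \<partial>lebesgue)"
      proof (rule integral_dominated_convergence[where w = "\<lambda>x. norm (h x)"])
        show "AE x in lebesgue. (\<lambda>n. indicator (box (s n) (t n)) x * h x) \<longlonglongrightarrow> indicator (box a b) x * h x"
          by (intro AE_I2 tendsto_mult st(3) tendsto_const)
        show "AE x in lebesgue. norm (indicator (box (s n) (t n)) x * h x) \<le> norm (h x)" for n
          by (auto simp: indicator_def)
        have m: "(\<lambda>x. indicator (box c d) x * h x) \<in> borel_measurable lebesgue" for c d
          using hi by (intro borel_measurable_times borel_measurable_indicator) auto
        show "(\<lambda>x. indicator (box a b) x * h x) \<in> borel_measurable lebesgue"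
          "(\<lambda>x. indicator (box (s n) (t n)) x * h x) \<in> borel_measurable lebesgue" for n by (rule m)+
      qed (use hi in auto)
      moreover have "(\<integral>x. indicator (box (s n) (t n)) x * h x \<partial>lebesgue) = 0" for n
      proof -
        have "(\<integral>x. indicator (box (s n) (t n)) x * h x \<partial>lebesgue)
            = (\<integral>x. indicator \<Omega> x *\<^sub>R (g x \<bullet> box_fun (s n, t n, i) x) \<partial>lebesgue)"
          by (intro Bochner_Integration.integral_cong) (auto simp: h_def box_fun_def)
        also have "\<dots> = (\<integral>x. g x \<bullet> box_fun (s n, t n, i) x \<partial>M)"
          by (subst integral_restrict_space) auto
        also have "\<dots> = 0" using zero st i by simp
        finally show ?thesis .
      qed
      ultimately show "(\<integral>x. indicator (box a b) x * h x \<partial>lebesgue) = 0" by (simp add: LIMSEQ_const_iff)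
    qed
    then show ?thesis by (subst AE_restrict_space_iff) (auto simp: h_def elim!: eventually_mono)
  qed
  then have "AE x in M. \<forall>i\<in>Basis. g x \<bullet> i = 0" by (subst AE_finite_all) auto
  then show ?thesis by eventually_elim (simp add: euclidean_all_zero_iff)
qed

lemma closed_subspace_box_fun:
  assumes D: "\<And>U. open U \<Longrightarrow> U \<noteq> {} \<Longrightarrow> \<exists>d\<in>D. d \<in> U"
    and s: "1 < s" and Y: "closed_subspace M s Y" and box: "\<And>z. z \<in> D \<times> D \<times> Basis \<Longrightarrow> box_fun z \<in> Y"
    and h: "h \<in> Lp M s"
  shows "h \<in> Y"
proof (rule closed_subspace_annihilator[OF s Y h])
  fix g assume g: "g \<in> Lp M (conjx s)" and ann: "\<And>v. v \<in> Y \<Longrightarrow> (\<integral>x. g x \<bullet> v x \<partial>M) = 0"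
  have "AE x in M. g x = 0"
    using conjx_gt_1[OF s] ann box by (intro box_fun_total[OF D g]) auto
  then show "(\<integral>x. g x \<bullet> h x \<partial>M) = 0"
    by (intro integral_eq_zero_AE) (auto elim!: eventually_mono)
qed

text \<open>Finite rational combinations are coded by lists: these are countable, and addition and
  rational scaling become append and map.\<close>

definition comb :: "(rat \<times> 'a \<times> 'a \<times> 'a) list \<Rightarrow> 'a \<Rightarrow> 'a" where
  "comb L x = (\<Sum>y\<leftarrow>L. of_rat (fst y) *\<^sub>R box_fun (snd y) x)"

lemma comb_Cons: "comb (y # L) = (\<lambda>x. of_rat (fst y) *\<^sub>R box_fun (snd y) x + comb L x)"
  by (simp add: comb_def fun_eq_iff)

lemma comb_append: "comb (L @ L') = (\<lambda>x. comb L x + comb L' x)"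
  by (simp add: comb_def fun_eq_iff)

lemma comb_scale: "comb (map (\<lambda>y. (q * fst y, snd y)) L) = (\<lambda>x. of_rat q *\<^sub>R comb L x)"
  by (induction L) (simp_all add: comb_Cons comb_def[of "[]"] of_rat_mult scaleR_add_right fun_eq_iff)

lemma comb_Lp: "0 \<le> s \<Longrightarrow> comb L \<in> Lp M s"
proof (induction L)
  case Nil
  have "comb [] = (\<lambda>x. 0)" by (simp add: comb_def fun_eq_iff)
  then show ?case by simp
next
  case (Cons y L)
  then show ?case unfolding comb_Cons by (intro Lp_add Lp_scaleR box_fun_Lp) auto
qed

text \<open>The closure of the rational combinations is shown to be a closed subspace. It contains
  all box functions with corners in the dense set, hence everything by the annihilator criterion; no
  density of simple or continuous functions is used.\<close>

lemma Lp_separable: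
  assumes s: "1 < s"
  obtains d :: "nat \<Rightarrow> 'a \<Rightarrow> 'a" where "\<And>i. d i \<in> Lp M s"
    "\<And>h e. h \<in> Lp M s \<Longrightarrow> 0 < e \<Longrightarrow> \<exists>i. pnorm M s (\<lambda>x. h x - d i x) < e"
proof -
  have s': "1 \<le> s" "0 \<le> s" "s \<noteq> 0" using s by auto
  obtain D :: "'a set" where D: "countable D" "\<And>U. open U \<Longrightarrow> U \<noteq> {} \<Longrightarrow> \<exists>d\<in>D. d \<in> U"
    using countable_dense_setE by blast
  define A where "A = lists ((UNIV :: rat set) \<times> D \<times> D \<times> (Basis :: 'a set))"
  define Y where "Y = {h \<in> Lp M s. \<forall>e>0. \<exists>L\<in>A. pnorm M s (\<lambda>x. h x - comb L x) < e}"
  have "countable A" unfolding A_def using D(1)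
    by (intro countable_lists countable_SIGMA) (auto intro: countable_finite)
  have dist: "pnorm M s (\<lambda>x. h x - k x) \<le> pnorm M s (\<lambda>x. h x - g x) + pnorm M s (\<lambda>x. g x - k x)"
    if "h \<in> Lp M s" "g \<in> Lp M s" "k \<in> Lp M s" for h g k :: "'a \<Rightarrow> 'a"
    by (rule pnorm_dist_triangle[OF s'(1) that])
  have "closed_subspace M s Y"
    unfolding closed_subspace_def
  proof (intro conjI ballI allI impI)
    show "Y \<subseteq> Lp M s" by (auto simp: Y_def)
    have "comb [] = (\<lambda>x. 0)" by (simp add: comb_def fun_eq_iff)
    then show "(\<lambda>x. 0) \<in> Y" by (auto simp: Y_def A_def intro!: bexI[of _ "[]"])
  next
    fix u v assume uv: "u \<in> Y" "v \<in> Y"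
    then have L: "u \<in> Lp M s" "v \<in> Lp M s" by (auto simp: Y_def)
    have "\<exists>L\<in>A. pnorm M s (\<lambda>x. (u x + v x) - comb L x) < e" if "0 < e" for e
    proof -
      have e2: "0 < e / 2" using \<open>0 < e\<close> by simp
      obtain L1 where L1: "L1 \<in> A" "pnorm M s (\<lambda>x. u x - comb L1 x) < e / 2"
        using uv(1) e2 unfolding Y_def by blast
      obtain L2 where L2: "L2 \<in> A" "pnorm M s (\<lambda>x. v x - comb L2 x) < e / 2"
        using uv(2) e2 unfolding Y_def by blast
      have d: "(\<lambda>x. u x - comb L1 x) \<in> Lp M s" "(\<lambda>x. v x - comb L2 x) \<in> Lp M s"
        using L comb_Lp s' by (auto intro!: Lp_diff)
      have "pnorm M s (\<lambda>x. (u x + v x) - comb (L1 @ L2) x) = pnorm M s (\<lambda>x. (u x - comb L1 x) + (v x - comb L2 x))"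
        by (simp add: comb_append algebra_simps)
      also have "\<dots> \<le> pnorm M s (\<lambda>x. u x - comb L1 x) + pnorm M s (\<lambda>x. v x - comb L2 x)"
        by (rule pnorm_triangle[OF s'(1) d])
      also have "\<dots> < e" using L1(2) L2(2) by linarith
      finally show ?thesis using L1(1) L2(1) by (intro bexI[of _ "L1 @ L2"]) (auto simp: A_def)
    qed
    then show "(\<lambda>x. u x + v x) \<in> Y" using Lp_add[OF s'(2) L] by (auto simp: Y_def)
  next
    fix c u assume u: "u \<in> Y"
    then have L: "u \<in> Lp M s" by (auto simp: Y_def)
    have "\<exists>L\<in>A. pnorm M s (\<lambda>x. c *\<^sub>R u x - comb L x) < e" if e: "0 < e" for e
    proof -
      have "0 < e / (2 * (\<bar>c\<bar> + 1))" using e by simp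
      then obtain L1 where L1: "L1 \<in> A" "pnorm M s (\<lambda>x. u x - comb L1 x) < e / (2 * (\<bar>c\<bar> + 1))"
        using u unfolding Y_def by blast
      \<comment> \<open>A real multiple is replaced by a rational one: q within e/(2N) of c changes
        the combination by less than e/2. The summand 1 keeps N positive.\<close>
      define N where "N = pnorm M s (comb L1) + 1"
      have N: "0 < N" unfolding N_def using pnorm_nonneg[of M s "comb L1"] by linarith
      obtain q' where "q' \<in> \<rat>" "c < q'" "q' < c + e / (2 * N)"
        using Rats_dense_in_real[of c "c + e / (2 * N)"] e N by auto
      then obtain q where q: "c < of_rat q" "of_rat q < c + e / (2 * N)" by (auto elim: Rats_cases)
      have cL: "comb L1 \<in> Lp M s" using comb_Lp s' by simp
      have "pnorm M s (\<lambda>x. c *\<^sub>R u x - of_rat q *\<^sub>R comb L1 x)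
          \<le> pnorm M s (\<lambda>x. c *\<^sub>R u x - c *\<^sub>R comb L1 x) + pnorm M s (\<lambda>x. c *\<^sub>R comb L1 x - of_rat q *\<^sub>R comb L1 x)"
        using L cL by (intro dist Lp_scaleR)
      also have "\<dots> = \<bar>c\<bar> * pnorm M s (\<lambda>x. u x - comb L1 x) + \<bar>c - of_rat q\<bar> * pnorm M s (comb L1)"
        using pnorm_scaleR[OF s'(3), of M c "\<lambda>x. u x - comb L1 x"] pnorm_scaleR[OF s'(3), of M "c - of_rat q" "comb L1"]
        by (simp add: scaleR_diff_right scaleR_diff_left)
      also have "\<dots> < e / 2 + e / 2"
      proof (rule add_le_less_mono)
        have "\<bar>c\<bar> * pnorm M s (\<lambda>x. u x - comb L1 x) \<le> (\<bar>c\<bar> + 1) * (e / (2 * (\<bar>c\<bar> + 1)))"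
          using L1(2) by (intro mult_mono) auto
        also have "\<dots> = e / 2" by (simp add: field_simps add_nonneg_eq_0_iff)
        finally show "\<bar>c\<bar> * pnorm M s (\<lambda>x. u x - comb L1 x) \<le> e / 2" .
        have "\<bar>c - of_rat q\<bar> * pnorm M s (comb L1) \<le> \<bar>c - of_rat q\<bar> * N"
          by (intro mult_left_mono) (auto simp: N_def)
        also have "\<dots> < e / (2 * N) * N" using q N by (intro mult_strict_right_mono) auto
        also have "\<dots> = e / 2" using N by simp
        finally show "\<bar>c - of_rat q\<bar> * pnorm M s (comb L1) < e / 2" .
      qed
      finally have "pnorm M s (\<lambda>x. c *\<^sub>R u x - comb (map (\<lambda>y. (q * fst y, snd y)) L1) x) < e"
        by (simp add: comb_scale)
      moreover have "map (\<lambda>y. (q * fst y, snd y)) L1 \<in> A" using L1(1) by (auto simp: A_def lists_eq_set)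
      ultimately show ?thesis by blast
    qed
    then show "(\<lambda>x. c *\<^sub>R u x) \<in> Y" using Lp_scaleR[OF L] by (auto simp: Y_def)
  next
    fix U :: "nat \<Rightarrow> 'a \<Rightarrow> 'a" and h
    assume U: "\<forall>n. U n \<in> Y" and h: "h \<in> Lp M s" and lim: "(\<lambda>n. pnorm M s (\<lambda>x. U n x - h x)) \<longlonglongrightarrow> 0"
    have "\<exists>L\<in>A. pnorm M s (\<lambda>x. h x - comb L x) < e" if e: "0 < e" for e
    proof -
      have "eventually (\<lambda>n. pnorm M s (\<lambda>x. U n x - h x) < e / 2) sequentially"
        using e by (intro order_tendstoD(2)[OF lim]) auto
      then obtain n where n: "pnorm M s (\<lambda>x. U n x - h x) < e / 2" by (auto simp: eventually_sequentially)
      have "0 < e / 2" using e by simp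
      then obtain L where L: "L \<in> A" "pnorm M s (\<lambda>x. U n x - comb L x) < e / 2" using U unfolding Y_def by blast
      have "U n \<in> Lp M s" using U by (auto simp: Y_def)
      from dist[OF h this comb_Lp[OF s'(2), of L]] n L(2)
      have "pnorm M s (\<lambda>x. h x - comb L x) < e" using pnorm_minus_commute[of M s h "U n"] by simp
      with L(1) show ?thesis by blast
    qed
    with h show "h \<in> Y" by (auto simp: Y_def)
  qed
  moreover have "box_fun z \<in> Y" if "z \<in> D \<times> D \<times> Basis" for z
  proof -
    have "comb [(1, z)] = box_fun z" by (simp add: comb_def fun_eq_iff)
    moreover have "[(1, z)] \<in> A" using that by (simp add: A_def)
    ultimately show ?thesis using box_fun_Lp[OF s'(2)] by (auto simp: Y_def intro!: bexI[of _ "[(1, z)]"])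
  qed
  ultimately have "h \<in> Y" if "h \<in> Lp M s" for h
    using closed_subspace_box_fun[OF D(2) s _ _ that] by blast
  then have near: "\<exists>L\<in>A. pnorm M s (\<lambda>x. h x - comb L x) < e" if "h \<in> Lp M s" "0 < e" for h e
    using that by (simp add: Y_def)
  have "[] \<in> A" by (simp add: A_def)
  show thesis
  proof (rule that)
    show "comb (from_nat_into A i) \<in> Lp M s" for i by (rule comb_Lp[OF s'(2)])
    fix h :: "'a \<Rightarrow> 'a" and e :: real assume "h \<in> Lp M s" "0 < e"
    from near[OF this] obtain L where L: "L \<in> A" "pnorm M s (\<lambda>x. h x - comb L x) < e" by (elim bexE)
    obtain i where "from_nat_into A i = L" using from_nat_into_surj[OF \<open>countable A\<close> L(1)] by (elim exE)
    with L show "\<exists>i. pnorm M s (\<lambda>x. h x - comb (from_nat_into A i) x) < e" by (intro exI[of _ i]) simp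
  qed
qed

text \<open>A subset of a separable metric space is separable: from each ball of radius 1/(k+1)
  about a dense point that meets the gradients one element is picked, and from the others 0.\<close>

lemma X_separable:
  "\<exists>E::nat \<Rightarrow> 'a \<Rightarrow> real. (\<forall>n. E n \<in> X) \<and> (\<forall>u\<in>X. \<forall>e>0. \<exists>n. pnorm M p (\<lambda>x. grd u x - grd (E n) x) < e)"
proof -
  obtain d :: "nat \<Rightarrow> 'a \<Rightarrow> 'a" where d: "\<And>i. d i \<in> Lp M p"
    and dense: "\<And>h e. h \<in> Lp M p \<Longrightarrow> 0 < e \<Longrightarrow> \<exists>i. pnorm M p (\<lambda>x. h x - d i x) < e"
    by (rule Lp_separable[OF p(1)]) (rule that)
  define near where "near i k v \<longleftrightarrow> v \<in> X \<and> pnorm M p (\<lambda>x. grd v x - d i x) < 1 / real (Suc k)" for i k v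
  define pick where "pick i k = (if \<exists>v. near i k v then SOME v. near i k v else (\<lambda>x. 0))" for i k
  have pickX: "pick i k \<in> X" for i k
    using someI_ex[of "near i k"] X_zero(1) by (auto simp: pick_def near_def)
  have pick_near: "\<exists>i k. pnorm M p (\<lambda>x. grd u x - grd (pick i k) x) < e" if u: "u \<in> X" and e: "0 < e" for u e
  proof -
    obtain k where k: "1 / real (Suc k) < e / 2" using e nat_approx_posE[of "e / 2"] by auto
    have "0 < 1 / real (Suc k)" by simp
    from dense[OF XD(3)[OF u] this] obtain i where i: "pnorm M p (\<lambda>x. grd u x - d i x) < 1 / real (Suc k)"
      by (elim exE)
    then have "near i k u" using u by (simp add: near_def)
    then have "near i k (pick i k)" using someI_ex[of "near i k"] by (auto simp: pick_def)
    then have "pnorm M p (\<lambda>x. grd (pick i k) x - d i x) < 1 / real (Suc k)" by (simp add: near_def)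
    with i k pnorm_dist_triangle[OF p_bounds(2) XD(3)[OF u] d[of i] XD(3)[OF pickX[of i k]]]
      pnorm_minus_commute[of M p "d i" "grd (pick i k)"]
    show ?thesis by (intro exI[of _ i] exI[of _ k]) linarith
  qed
  have "\<exists>n. pnorm M p (\<lambda>x. grd u x - grd (case prod_decode n of (i, k) \<Rightarrow> pick i k) x) < e" if u: "u \<in> X" "0 < e" for u e
  proof -
    obtain i k where "pnorm M p (\<lambda>x. grd u x - grd (pick i k) x) < e"
      using pick_near[OF u] by blast
    then show ?thesis by (intro exI[of _ "prod_encode (i, k)"]) simp
  qed
  then show ?thesis
    using pickX by (intro exI[of _ "\<lambda>n. case prod_decode n of (i, k) \<Rightarrow> pick i k"]) (auto split: prod.split)
qed

section \<open>Weak sequential compactness\<close>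

lemma conjx_p_bounds: "1 < conjx p" "0 \<le> conjx p" "1 \<le> conjx p" "conjx (conjx p) = p"
  using conjx_gt_1[OF p(1)] conjx_conjx[OF p(1)] by auto

lemma pair_integrable:
  fixes g v :: "'a \<Rightarrow> 'b::euclidean_space"
  assumes "g \<in> Lp M (conjx p)" "v \<in> Lp M p"
  shows "integrable M (\<lambda>x. g x \<bullet> v x)" "\<bar>\<integral>x. g x \<bullet> v x \<partial>M\<bar> \<le> pnorm M (conjx p) g * pnorm M p v"
  using inner_integrable[OF conjx_p_bounds(1) assms(1)] inner_integral_le[OF conjx_p_bounds(1) assms(1)] assms(2) conjx_p_bounds(4) by auto

lemma gradients_annihilator:
  assumes h: "h \<in> Lp M p"
    and ann: "\<And>g. g \<in> Lp M (conjx p) \<Longrightarrow> (\<And>u. u \<in> X \<Longrightarrow> (\<integral>x. g x \<bullet> grd u x \<partial>M) = 0) \<Longrightarrow> (\<integral>x. g x \<bullet> h x \<partial>M) = 0"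
  shows "\<exists>u\<in>X. AE x in M. grd u x = h x"
proof -
  have "h \<in> gradients"
    using ann grad_in_gradients by (intro closed_subspace_annihilator[OF p(1) gradients_closed h]) blast
  then show ?thesis by (auto simp: gradients_def)
qed

lemma pairing_AE_cong:
  fixes g :: "'a \<Rightarrow> 'b::euclidean_space"
  assumes "AE x in M. v x = w x" "g \<in> Lp M s" "v \<in> borel_measurable M" "w \<in> borel_measurable M"
  shows "(\<integral>x. g x \<bullet> v x \<partial>M) = (\<integral>x. g x \<bullet> w x \<partial>M)"
  using assms by (intro integral_cong_AE) (auto dest: LpD(1) intro!: borel_measurable_inner elim!: eventually_mono)

text \<open>A diagonal subsequence converges against a dense sequence of L^p', hence against all of
  it by the uniform bound. The limit is a bounded functional, represented by some h in L^p; whatever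
  annihilates all gradients annihilates h, so h is a gradient.\<close>

lemma weak_compactness:
  assumes U: "\<And>n::nat. U n \<in> X" and bound: "\<And>n. pnorm M p (grd (U n)) \<le> B"
  shows "\<exists>r u. strict_mono (r::nat\<Rightarrow>nat) \<and> u \<in> X \<and>
    (\<forall>g\<in>Lp M (conjx p). (\<lambda>n. \<integral>x. g x \<bullet> grd (U (r n)) x \<partial>M) \<longlonglongrightarrow> (\<integral>x. g x \<bullet> grd u x \<partial>M))"
proof -
  have B0: "0 \<le> B" using bound[of 0] pnorm_nonneg order_trans by blast
  obtain d :: "nat \<Rightarrow> 'a \<Rightarrow> 'a" where d: "\<And>i. d i \<in> Lp M (conjx p)"
    and dense: "\<And>h e. h \<in> Lp M (conjx p) \<Longrightarrow> 0 < e \<Longrightarrow> \<exists>i. pnorm M (conjx p) (\<lambda>x. h x - d i x) < e"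
    by (rule Lp_separable[OF conjx_p_bounds(1)]) (rule that)
  define a where "a r g n = (\<integral>x. g x \<bullet> grd (U (r n)) x \<partial>M)" for r :: "nat \<Rightarrow> nat" and g n
  have a_le: "\<bar>a r g n\<bar> \<le> pnorm M (conjx p) g * B" if "g \<in> Lp M (conjx p)" for r g n
    using pair_integrable(2)[OF that XD(3)[OF U[of "r n"]]] mult_left_mono[OF bound[of "r n"] pnorm_nonneg[of M "conjx p" g]]
    unfolding a_def by linarith
  have a_diff: "\<bar>a r g n - a r h n\<bar> \<le> pnorm M (conjx p) (\<lambda>x. g x - h x) * B"
    if "g \<in> Lp M (conjx p)" "h \<in> Lp M (conjx p)" for r g h n
  proof -
    have "a r g n - a r h n = a r (\<lambda>x. g x - h x) n"
      using pair_integrable(1)[OF that(1) XD(3)[OF U]] pair_integrable(1)[OF that(2) XD(3)[OF U]]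
      by (simp add: a_def inner_diff_left)
    then show ?thesis using a_le[OF Lp_diff[OF conjx_p_bounds(2) that]] by simp
  qed
  obtain r where r: "strict_mono r" "\<And>k. convergent (\<lambda>n. \<integral>x. d k x \<bullet> grd (U (r n)) x \<partial>M)"
    using diagonal_convergent_subseq[of "\<lambda>n k. \<integral>x. d k x \<bullet> grd (U n) x \<partial>M" "\<lambda>k. pnorm M (conjx p) (d k) * B"]
      a_le[OF d, of id] by (auto simp: a_def)
  have conv: "convergent (a r g)" if g: "g \<in> Lp M (conjx p)" for g
  proof -
    have "Cauchy (a r g)"
    proof (rule metric_CauchyI)
      fix e :: real assume e: "0 < e"
      define \<delta> where "\<delta> = e / (3 * (B + 1))"
      have \<delta>: "0 < \<delta>" "\<delta> * B \<le> e / 3"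
      proof -
        show "0 < \<delta>" using e B0 by (simp add: \<delta>_def)
        then have "\<delta> * B \<le> \<delta> * (B + 1)" by simp
        also have "\<dots> = e / 3" using B0 by (simp add: \<delta>_def field_simps)
        finally show "\<delta> * B \<le> e / 3" .
      qed
      from dense[OF g \<delta>(1)] obtain k where k: "pnorm M (conjx p) (\<lambda>x. g x - d k x) < \<delta>" by (elim exE)
      have close: "\<bar>a r g n - a r (d k) n\<bar> \<le> e / 3" for n
        using a_diff[OF g d, of r n k] mult_right_mono[OF less_imp_le[OF k] B0] \<delta>(2) by linarith
      have "Cauchy (a r (d k))" using r(2)[of k] unfolding a_def[abs_def] by (rule convergent_Cauchy)
      then obtain N where N: "\<And>m n. m \<ge> N \<Longrightarrow> n \<ge> N \<Longrightarrow> dist (a r (d k) m) (a r (d k) n) < e / 3"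
        using e metric_CauchyD[of "a r (d k)" "e / 3"] by auto
      have "dist (a r g m) (a r g n) < e" if "m \<ge> N" "n \<ge> N" for m n
        using N[OF that] close[of m] close[of n] unfolding dist_real_def by linarith
      then show "\<exists>N. \<forall>m\<ge>N. \<forall>n\<ge>N. dist (a r g m) (a r g n) < e" by blast
    qed
    then show ?thesis by (simp add: Cauchy_convergent)
  qed
  define m where "m g = lim (a r g)" for g
  have m: "a r g \<longlonglongrightarrow> m g" if "g \<in> Lp M (conjx p)" for g
    using conv[OF that] by (simp add: m_def convergent_LIMSEQ_iff)
  have "bounded_linear_on M (conjx p) (Lp M (conjx p)) m"
    unfolding bounded_linear_on_def
  proof (intro conjI ballI allI exI[of _ B])
    fix u v :: "'a \<Rightarrow> 'a" assume uv: "u \<in> Lp M (conjx p)" "v \<in> Lp M (conjx p)"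
    have "a r (\<lambda>x. u x + v x) = (\<lambda>n. a r u n + a r v n)"
      using pair_integrable(1)[OF uv(1) XD(3)[OF U]] pair_integrable(1)[OF uv(2) XD(3)[OF U]]
      by (simp add: a_def inner_add_left fun_eq_iff)
    then have "a r (\<lambda>x. u x + v x) \<longlonglongrightarrow> m u + m v" using tendsto_add[OF m[OF uv(1)] m[OF uv(2)]] by simp
    then show "m (\<lambda>x. u x + v x) = m u + m v" by (rule LIMSEQ_unique[OF m[OF Lp_add[OF conjx_p_bounds(2) uv]]])
  next
    fix c and u :: "'a \<Rightarrow> 'a" assume u: "u \<in> Lp M (conjx p)"
    have "a r (\<lambda>x. c *\<^sub>R u x) = (\<lambda>n. c * a r u n)" by (simp add: a_def fun_eq_iff)
    then have "a r (\<lambda>x. c *\<^sub>R u x) \<longlonglongrightarrow> c * m u" using tendsto_mult_left[OF m[OF u], of c] by simp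
    then show "m (\<lambda>x. c *\<^sub>R u x) = c * m u" by (rule LIMSEQ_unique[OF m[OF Lp_scaleR[OF u]]])
  next
    fix u :: "'a \<Rightarrow> 'a" assume u: "u \<in> Lp M (conjx p)"
    show "\<bar>m u\<bar> \<le> B * pnorm M (conjx p) u"
      using a_le[OF u, of r] by (intro LIMSEQ_le_const2[OF tendsto_rabs[OF m[OF u]]]) (auto simp: mult.commute)
  qed
  from Lp_Riesz[OF conjx_p_bounds(1) this] obtain h where h: "h \<in> Lp M p"
    "\<And>g. g \<in> Lp M (conjx p) \<Longrightarrow> m g = (\<integral>x. h x \<bullet> g x \<partial>M)" by (auto simp: conjx_p_bounds(4))
  have "\<exists>u\<in>X. AE x in M. grd u x = h x"
  proof (rule gradients_annihilator[OF h(1)])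
    fix g assume g: "g \<in> Lp M (conjx p)" and "\<And>u. u \<in> X \<Longrightarrow> (\<integral>x. g x \<bullet> grd u x \<partial>M) = 0"
    then have "a r g = (\<lambda>n. 0)" using U by (simp add: a_def fun_eq_iff)
    with m[OF g] have "m g = 0" by (simp add: LIMSEQ_const_iff)
    then show "(\<integral>x. g x \<bullet> h x \<partial>M) = 0" using h(2)[OF g] by (simp add: inner_commute)
  qed
  then obtain u where u: "u \<in> X" "AE x in M. grd u x = h x" by blast
  have "(\<lambda>n. \<integral>x. g x \<bullet> grd (U (r n)) x \<partial>M) \<longlonglongrightarrow> (\<integral>x. g x \<bullet> grd u x \<partial>M)" if g: "g \<in> Lp M (conjx p)" for g
    using m[OF g] h(2)[OF g] pairing_AE_cong[OF u(2) g LpD(1)[OF XD(3)[OF u(1)]] LpD(1)[OF h(1)]]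
    by (simp add: a_def[abs_def] inner_commute)
  with r(1) u(1) show ?thesis by blast
qed

section \<open>Representation of the dual and of the bidual\<close>

definition grad_functional :: "('a \<Rightarrow> 'a) \<Rightarrow> ('a \<Rightarrow> real) \<Rightarrow> real" where
  "grad_functional g v = (\<integral>x. g x \<bullet> grd v x \<partial>M)"

lemma grad_functional_dual:
  assumes g: "g \<in> Lp M (conjx p)"
  shows "grad_functional g \<in> Wdual \<Omega> p"
  unfolding Wdual_def dual_space_def
proof (safe intro!: exI[of _ "pnorm M (conjx p) g"])
  fix u v assume u: "u \<in> X" and v: "v \<in> X"
  have "grad_functional g (\<lambda>x. u x + v x) = (\<integral>x. g x \<bullet> (grd u x + grd v x) \<partial>M)"
    unfolding grad_functional_def using X_add[OF u v] XD(3)[OF X_add(1)[OF u v]] Lp_add[OF p_bounds(1) XD(3)[OF u] XD(3)[OF v]]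
    by (intro pairing_AE_cong[OF _ g]) (auto dest: LpD(1))
  also have "\<dots> = grad_functional g u + grad_functional g v"
    using pair_integrable(1)[OF g XD(3)[OF u]] pair_integrable(1)[OF g XD(3)[OF v]]
    by (simp add: grad_functional_def inner_add_right)
  finally show "grad_functional g (\<lambda>x. u x + v x) = grad_functional g u + grad_functional g v" .
next
  fix c u assume u: "u \<in> X"
  have "grad_functional g (\<lambda>x. c * u x) = (\<integral>x. g x \<bullet> (c *\<^sub>R grd u x) \<partial>M)"
    unfolding grad_functional_def using X_scale[OF u, of c] XD(3)[OF X_scale(1)[OF u, of c]] Lp_scaleR[OF XD(3)[OF u], of c]
    by (intro pairing_AE_cong[OF _ g]) (auto dest: LpD(1))
  then show "grad_functional g (\<lambda>x. c * u x) = c * grad_functional g u"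
    by (simp add: grad_functional_def)
next
  fix u assume u: "u \<in> X"
  show "\<bar>grad_functional g u\<bar> \<le> pnorm M (conjx p) g * W10_norm \<Omega> p u"
    using pair_integrable(2)[OF g XD(3)[OF u]] X_norm[OF u] by (simp add: grad_functional_def)
qed

lemma dualD:
  assumes "l \<in> dual_space X (W10_norm \<Omega> p)"
  shows "u \<in> X \<Longrightarrow> v \<in> X \<Longrightarrow> l (\<lambda>x. u x + v x) = l u + l v" "u \<in> X \<Longrightarrow> l (\<lambda>x. c * u x) = c * l u"
    "\<exists>C\<ge>0. \<forall>u\<in>X. \<bar>l u\<bar> \<le> C * pnorm M p (grd u)"
proof -
  show "u \<in> X \<Longrightarrow> v \<in> X \<Longrightarrow> l (\<lambda>x. u x + v x) = l u + l v" "u \<in> X \<Longrightarrow> l (\<lambda>x. c * u x) = c * l u"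
    using assms by (auto simp: dual_space_def)
  obtain C where C: "\<forall>u\<in>X. \<bar>l u\<bar> \<le> C * W10_norm \<Omega> p u" using assms unfolding dual_space_def by blast
  have "\<bar>l u\<bar> \<le> max C 0 * pnorm M p (grd u)" if "u \<in> X" for u
    using bspec[OF C that] X_norm[OF that] mult_right_mono[of C "max C 0" "pnorm M p (grd u)"] by simp
  then show "\<exists>C\<ge>0. \<forall>u\<in>X. \<bar>l u\<bar> \<le> C * pnorm M p (grd u)" by (intro exI[of _ "max C 0"]) auto
qed

lemma dual_diff:
  assumes "l \<in> dual_space X (W10_norm \<Omega> p)" "u \<in> X" "v \<in> X"
  shows "l (\<lambda>x. u x - v x) = l u - l v"
  using dualD(1)[OF assms(1,2) X_scale(1)[OF assms(3), of "-1"]] dualD(2)[OF assms(1,3), of "-1"] by simp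

lemma dual_AE_eq:
  assumes l: "l \<in> dual_space X (W10_norm \<Omega> p)" and u: "u \<in> X" and v: "v \<in> X" and eq: "AE x in M. grd u x = grd v x"
  shows "l u = l v"
proof -
  obtain C where C: "\<And>u. u \<in> X \<Longrightarrow> \<bar>l u\<bar> \<le> C * pnorm M p (grd u)" using dualD(3)[OF l] by blast
  have "pnorm M p (\<lambda>x. grd u x - grd v x) = 0"
    using pnorm_eq_0_iff[OF Lp_diff[OF p_bounds(1) XD(3)[OF u] XD(3)[OF v]]] eq by (auto elim!: eventually_mono)
  then show ?thesis using C[OF X_diff(1)[OF u v]] dual_diff[OF l u v] grad_diff_pnorm[OF u v] by simp
qed

text \<open>Choosing a potential for each gradient transports l to the closed subspace of gradients.
  The choice is harmless since l cannot separate functions whose gradients agree a.e. The minimizer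
  y there represents l through \<open>dmap p y\<close>.\<close>

lemma dual_representation:
  assumes l: "l \<in> dual_space X (W10_norm \<Omega> p)"
  shows "\<exists>g\<in>Lp M (conjx p). \<forall>v\<in>X. l v = grad_functional g v"
proof -
  define pot where "pot y = (SOME u. u \<in> X \<and> (AE x in M. grd u x = y x))" for y
  have pot: "pot y \<in> X" "AE x in M. grd (pot y) x = y x" if "y \<in> gradients" for y
  proof -
    have "\<exists>u. u \<in> X \<and> (AE x in M. grd u x = y x)" using that by (auto simp: gradients_def)
    note ex = someI_ex[OF this, folded pot_def]
    show "pot y \<in> X" by (rule conjunct1[OF ex])
    show "AE x in M. grd (pot y) x = y x" by (rule conjunct2[OF ex])
  qed
  note GD = closed_subspaceD[OF gradients_closed]
  obtain C where C: "\<And>u. u \<in> X \<Longrightarrow> \<bar>l u\<bar> \<le> C * pnorm M p (grd u)" using dualD(3)[OF l] by blast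
  have "bounded_linear_on M p gradients (\<lambda>y. l (pot y))"
    unfolding bounded_linear_on_def
  proof (intro conjI ballI allI exI[of _ C])
    fix u v assume uv: "u \<in> gradients" "v \<in> gradients"
    have "AE x in M. grd (pot (\<lambda>x. u x + v x)) x = grd (\<lambda>x. pot u x + pot v x) x"
      using pot(2)[OF GD(3)[OF uv]] pot(2)[OF uv(1)] pot(2)[OF uv(2)] X_add(2)[OF pot(1)[OF uv(1)] pot(1)[OF uv(2)]]
      by eventually_elim simp
    then show "l (pot (\<lambda>x. u x + v x)) = l (pot u) + l (pot v)"
      using dual_AE_eq[OF l pot(1)[OF GD(3)[OF uv]] X_add(1)[OF pot(1)[OF uv(1)] pot(1)[OF uv(2)]]]
        dualD(1)[OF l pot(1)[OF uv(1)] pot(1)[OF uv(2)]] by simp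
  next
    fix c u assume u: "u \<in> gradients"
    have "AE x in M. grd (pot (\<lambda>x. c *\<^sub>R u x)) x = grd (\<lambda>x. c * pot u x) x"
      using pot(2)[OF GD(4)[OF u, of c]] pot(2)[OF u] X_scale(2)[OF pot(1)[OF u], of c] by eventually_elim simp
    then show "l (pot (\<lambda>x. c *\<^sub>R u x)) = c * l (pot u)"
      using dual_AE_eq[OF l pot(1)[OF GD(4)[OF u, of c]] X_scale(1)[OF pot(1)[OF u], of c]]
        dualD(2)[OF l pot(1)[OF u], of c] by simp
  next
    fix u assume u: "u \<in> gradients"
    show "\<bar>l (pot u)\<bar> \<le> C * pnorm M p u"
      using C[OF pot(1)[OF u]] pnorm_Lp_cong[OF pot(2)[OF u] XD(3)[OF pot(1)[OF u]] GD(1)[OF u]] by simp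
  qed
  from duality_map_surjective[OF p(1) gradients_closed this zero_in_Lp]
  obtain y where y: "y \<in> gradients" "\<And>v. v \<in> gradients \<Longrightarrow> (\<integral>x. dmap p (y x) \<bullet> v x \<partial>M) = l (pot v)" by auto
  have "l v = grad_functional (\<lambda>x. dmap p (y x)) v" if v: "v \<in> X" for v
    using y(2)[OF grad_in_gradients[OF v]] pot[OF grad_in_gradients[OF v]] dual_AE_eq[OF l _ v]
    by (simp add: grad_functional_def)
  then show ?thesis using dmap_Lp[OF p(1) GD(1)[OF y(1)]] by blast
qed

lemma dual_norm_bound:
  assumes l: "l \<in> Wdual \<Omega> p" and C: "0 \<le> C" "\<And>u. u \<in> X \<Longrightarrow> \<bar>l u\<bar> \<le> C * pnorm M p (grd u)"
  shows "Wdual_norm \<Omega> p l \<le> C"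
  unfolding Wdual_norm_def dual_norm_def
proof (rule cSUP_least)
  have "pnorm M p (grd (\<lambda>x. 0)) = 0"
    using X_zero pnorm_eq_0_iff[OF XD(3)[OF X_zero(1)]] by simp
  then show "{u \<in> X. W10_norm \<Omega> p u \<le> 1} \<noteq> {}" using X_zero(1) X_norm by force
  fix u assume u: "u \<in> {u \<in> X. W10_norm \<Omega> p u \<le> 1}"
  then have "C * pnorm M p (grd u) \<le> C * 1" using X_norm C(1) by (intro mult_left_mono) auto
  then show "\<bar>l u\<bar> \<le> C" using C(2)[of u] u by auto
qed

text \<open>Restricted to functionals given by some g in L^p', L becomes a bounded functional of g
  and is represented by h in L^p. It vanishes on annihilators of the gradients, so h is a gradient;
  its potential u is the required element.\<close>

lemma bidual_representation:
  assumes L: "L \<in> dual_space (Wdual \<Omega> p) (Wdual_norm \<Omega> p)"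
  shows "\<exists>u\<in>X. \<forall>l\<in>Wdual \<Omega> p. L l = l u"
proof -
  have Ladd: "L (\<lambda>x. k x + l x) = L k + L l" if "k \<in> Wdual \<Omega> p" "l \<in> Wdual \<Omega> p" for k l
    using L that by (auto simp: dual_space_def)
  have Lscale: "L (\<lambda>x. c * k x) = c * L k" if "k \<in> Wdual \<Omega> p" for k c
    using L that by (auto simp: dual_space_def)
  obtain C where C': "\<forall>l\<in>Wdual \<Omega> p. \<bar>L l\<bar> \<le> C * Wdual_norm \<Omega> p l" using L unfolding dual_space_def by blast
  have C: "\<bar>L l\<bar> \<le> C * Wdual_norm \<Omega> p l" if "l \<in> Wdual \<Omega> p" for l using bspec[OF C' that] .
  have Wadd: "(\<lambda>x. k x + c * l x) \<in> Wdual \<Omega> p" if k: "k \<in> Wdual \<Omega> p" and l: "l \<in> Wdual \<Omega> p" for k l c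
  proof -
    note K = dualD[OF k[unfolded Wdual_def]] and L' = dualD[OF l[unfolded Wdual_def]]
    obtain A B where A: "\<And>u. u \<in> X \<Longrightarrow> \<bar>k u\<bar> \<le> A * pnorm M p (grd u)" and B: "\<And>u. u \<in> X \<Longrightarrow> \<bar>l u\<bar> \<le> B * pnorm M p (grd u)"
      using K(3) L'(3) by blast
    have "\<bar>k u + c * l u\<bar> \<le> (A + \<bar>c\<bar> * B) * W10_norm \<Omega> p u" if "u \<in> X" for u
    proof -
      have "\<bar>k u + c * l u\<bar> \<le> \<bar>k u\<bar> + \<bar>c\<bar> * \<bar>l u\<bar>" by (metis abs_mult abs_triangle_ineq)
      also have "\<dots> \<le> A * pnorm M p (grd u) + \<bar>c\<bar> * (B * pnorm M p (grd u))"
        using A[OF that] B[OF that] by (intro add_mono mult_left_mono) auto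
      finally show ?thesis using X_norm[OF that] by (simp add: algebra_simps)
    qed
    then have "\<exists>C. \<forall>u\<in>X. \<bar>k u + c * l u\<bar> \<le> C * W10_norm \<Omega> p u" by blast
    then show ?thesis unfolding Wdual_def dual_space_def
      by (intro CollectI conjI ballI allI) (simp_all add: K(1,2) L'(1,2) algebra_simps)
  qed
  \<comment> \<open>Elements of the dual are functions with arbitrary values outside the space. Two
    that agree on it differ by an element of dual norm 0, which L cannot see.\<close>
  have Leq: "L k = L l" if k: "k \<in> Wdual \<Omega> p" and l: "l \<in> Wdual \<Omega> p" and eq: "\<And>u. u \<in> X \<Longrightarrow> k u = l u" for k l
  proof -
    have d: "(\<lambda>x. k x + (-1) * l x) \<in> Wdual \<Omega> p" by (rule Wadd[OF k l])
    have s: "(\<lambda>x. 0 * l x + (-1) * l x) \<in> Wdual \<Omega> p" using Wadd[OF _ l, of "\<lambda>x. 0 * l x" "-1"] Wadd[OF l l, of "-1"] by simp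
    then have "L (\<lambda>x. k x + (-1) * l x) = L k + (-1) * L l"
      using Ladd[OF k, of "\<lambda>x. (-1) * l x"] Lscale[OF l, of "-1"] by simp
    moreover have "L (\<lambda>x. k x + (-1) * l x) = 0"
    proof -
      have n0: "Wdual_norm \<Omega> p (\<lambda>x. c * (k x + (-1) * l x)) = 0" for c
      proof -
        have e: "{u \<in> X. W10_norm \<Omega> p u \<le> 1} \<noteq> {}"
        proof -
          have "pnorm M p (grd (\<lambda>x. 0)) = 0"
            using X_zero pnorm_eq_0_iff[OF XD(3)[OF X_zero(1)]] by simp
          then show ?thesis using X_zero(1) X_norm by force
        qed
        have "(\<lambda>u. \<bar>c * (k u + (-1) * l u)\<bar>) ` {u \<in> X. W10_norm \<Omega> p u \<le> 1} = {0}"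
          using e eq by auto
        then show ?thesis unfolding Wdual_norm_def dual_norm_def by simp
      qed
      show ?thesis using C[OF d] n0[of 1] by simp
    qed
    ultimately show ?thesis by simp
  qed
  define m where "m g = L (grad_functional g)" for g
  note gfd = grad_functional_dual
  have "bounded_linear_on M (conjx p) (Lp M (conjx p)) m"
    unfolding bounded_linear_on_def
  proof (intro conjI ballI allI exI[of _ "max C 0"])
    fix u v :: "'a \<Rightarrow> 'a" assume uv: "u \<in> Lp M (conjx p)" "v \<in> Lp M (conjx p)"
    have "L (grad_functional (\<lambda>x. u x + v x)) = L (\<lambda>w. grad_functional u w + 1 * grad_functional v w)"
    proof (rule Leq[OF gfd[OF Lp_add[OF conjx_p_bounds(2) uv]] Wadd[OF gfd[OF uv(1)] gfd[OF uv(2)]]])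
      fix w assume w: "w \<in> X"
      show "grad_functional (\<lambda>x. u x + v x) w = grad_functional u w + 1 * grad_functional v w"
        using pair_integrable(1)[OF uv(1) XD(3)[OF w]] pair_integrable(1)[OF uv(2) XD(3)[OF w]]
        by (simp add: grad_functional_def inner_add_left)
    qed
    then show "m (\<lambda>x. u x + v x) = m u + m v" using Ladd[OF gfd[OF uv(1)] gfd[OF uv(2)]] by (simp add: m_def)
  next
    fix c and u :: "'a \<Rightarrow> 'a" assume u: "u \<in> Lp M (conjx p)"
    have "grad_functional (\<lambda>x. c *\<^sub>R u x) = (\<lambda>w. c * grad_functional u w)" by (simp add: grad_functional_def fun_eq_iff)
    then show "m (\<lambda>x. c *\<^sub>R u x) = c * m u" using Lscale[OF gfd[OF u], of c] by (simp add: m_def)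
  next
    fix u :: "'a \<Rightarrow> 'a" assume u: "u \<in> Lp M (conjx p)"
    have "Wdual_norm \<Omega> p (grad_functional u) \<le> pnorm M (conjx p) u"
      using pair_integrable(2)[OF u XD(3)] by (intro dual_norm_bound[OF gfd[OF u]]) (auto simp: grad_functional_def)
    \<comment> \<open>The constant C has no known sign; nonnegativity of the norm allows
      \<open>max C 0\<close> instead. A real supremum is compared with a member only after the set
      is known to be bounded above.\<close>
    moreover have "0 \<le> Wdual_norm \<Omega> p (grad_functional u)"
    proof -
      have "pnorm M p (grd (\<lambda>x. 0)) = 0"
        using X_zero pnorm_eq_0_iff[OF XD(3)[OF X_zero(1)]] by simp
      then have z: "(\<lambda>x. 0) \<in> {u \<in> X. W10_norm \<Omega> p u \<le> 1}" using X_zero(1) X_norm by simp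
      have "bdd_above ((\<lambda>v. \<bar>grad_functional u v\<bar>) ` {u \<in> X. W10_norm \<Omega> p u \<le> 1})"
      proof (rule bdd_aboveI2)
        fix v assume v: "v \<in> {u \<in> X. W10_norm \<Omega> p u \<le> 1}"
        then have "pnorm M (conjx p) u * pnorm M p (grd v) \<le> pnorm M (conjx p) u * 1"
          using X_norm by (intro mult_left_mono) auto
        then show "\<bar>grad_functional u v\<bar> \<le> pnorm M (conjx p) u"
          using pair_integrable(2)[OF u XD(3), of v] v by (simp add: grad_functional_def)
      qed
      from cSUP_upper[OF z this] show ?thesis unfolding Wdual_norm_def dual_norm_def by linarith
    qed
    ultimately have "C * Wdual_norm \<Omega> p (grad_functional u) \<le> max C 0 * pnorm M (conjx p) u"
      by (intro mult_mono) auto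
    then show "\<bar>m u\<bar> \<le> max C 0 * pnorm M (conjx p) u" using C[OF gfd[OF u]] by (simp add: m_def)
  qed
  from Lp_Riesz[OF conjx_p_bounds(1) this] obtain h where h: "h \<in> Lp M p"
    "\<And>g. g \<in> Lp M (conjx p) \<Longrightarrow> m g = (\<integral>x. h x \<bullet> g x \<partial>M)" by (auto simp: conjx_p_bounds(4))
  have "\<exists>u\<in>X. AE x in M. grd u x = h x"
  proof (rule gradients_annihilator[OF h(1)])
    fix g assume g: "g \<in> Lp M (conjx p)" and ann: "\<And>u. u \<in> X \<Longrightarrow> (\<integral>x. g x \<bullet> grd u x \<partial>M) = 0"
    have "L (grad_functional g) = L (\<lambda>w. 0 * grad_functional g w)"
      using Wadd[OF gfd[OF g] gfd[OF g], of "-1"] ann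
      by (intro Leq[OF gfd[OF g]]) (auto simp: grad_functional_def)
    then have "m g = 0" using Lscale[OF gfd[OF g], of 0] by (simp add: m_def)
    then show "(\<integral>x. g x \<bullet> h x \<partial>M) = 0" using h(2)[OF g] by (simp add: inner_commute)
  qed
  then obtain u where u: "u \<in> X" "AE x in M. grd u x = h x" by blast
  have "L l = l u" if l: "l \<in> Wdual \<Omega> p" for l
  proof -
    obtain g where g: "g \<in> Lp M (conjx p)" "\<And>v. v \<in> X \<Longrightarrow> l v = grad_functional g v"
      using dual_representation l unfolding Wdual_def by blast
    have "L l = m g" unfolding m_def using g by (intro Leq[OF l gfd[OF g(1)]]) auto
    also have "\<dots> = grad_functional g u"
      using h(2)[OF g(1)] pairing_AE_cong[OF u(2) g(1) LpD(1)[OF XD(3)[OF u(1)]] LpD(1)[OF h(1)]]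
      by (simp add: grad_functional_def inner_commute)
    also have "\<dots> = l u" using g(2)[OF u(1)] by simp
    finally show ?thesis .
  qed
  with u(1) show ?thesis by blast
qed

lemma weakly_converges_X:
  assumes "\<And>n::nat. U n \<in> X" "u \<in> X"
    "\<And>g. g \<in> Lp M (conjx p) \<Longrightarrow> (\<lambda>n. \<integral>x. g x \<bullet> grd (U n) x \<partial>M) \<longlonglongrightarrow> (\<integral>x. g x \<bullet> grd u x \<partial>M)"
  shows "weakly_converges X (W10_norm \<Omega> p) U u"
  unfolding weakly_converges_def
proof (intro conjI ballI allI)
  fix l assume "l \<in> dual_space X (W10_norm \<Omega> p)"
  then obtain g where g: "g \<in> Lp M (conjx p)" "\<And>v. v \<in> X \<Longrightarrow> l v = grad_functional g v"
    using dual_representation by blast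
  then show "(\<lambda>n. l (U n)) \<longlonglongrightarrow> l u" using assms by (simp add: grad_functional_def)
qed (use assms in auto)

lemma weakly_converges_Wdual:
  assumes F: "\<And>n::nat. F n \<in> Wdual \<Omega> p" and lim: "\<And>v. v \<in> X \<Longrightarrow> (\<lambda>n. F n v) \<longlonglongrightarrow> 0"
  shows "weakly_converges (Wdual \<Omega> p) (Wdual_norm \<Omega> p) F (\<lambda>v. 0)"
  unfolding weakly_converges_def
proof (intro conjI ballI allI)
  show z: "(\<lambda>v. 0) \<in> Wdual \<Omega> p" by (auto simp: Wdual_def dual_space_def intro!: exI[of _ 0])
  fix L assume "L \<in> dual_space (Wdual \<Omega> p) (Wdual_norm \<Omega> p)"
  then obtain u where u: "u \<in> X" "\<And>l. l \<in> Wdual \<Omega> p \<Longrightarrow> L l = l u" using bidual_representation by blast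
  then show "(\<lambda>n. L (F n)) \<longlonglongrightarrow> L (\<lambda>v. 0)" using lim[OF u(1)] u(2)[OF F] u(2)[OF z] by simp
qed (use F in auto)

end

section \<open>Compact embedding\<close>

context sobolev
begin

lemma L1_le: 
  fixes v :: "'a \<Rightarrow> 'b::euclidean_space"
  assumes v: "v \<in> Lp M p"
  shows "integrable M v" "(\<integral>x. norm (v x) \<partial>M) \<le> pnorm M p v * pnorm M (conjx p) (\<lambda>x. 1::real)"
proof -
  show "integrable M v" using v p_bounds by (intro Lp_imp_integrable[OF finM])
  have "(\<lambda>x. 1::real) \<in> Lp M (conjx p)" by (simp add: Lp_def)
  from Hoelder[OF p(1) v this] show "(\<integral>x. norm (v x) \<partial>M) \<le> pnorm M p v * pnorm M (conjx p) (\<lambda>x. 1::real)" by simp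
qed

lemma integral_M_eq_lborel:
  fixes F :: "'a \<Rightarrow> real"
  assumes "F \<in> borel_measurable borel" "\<And>x. x \<notin> \<Omega> \<Longrightarrow> F x = 0"
  shows "(\<integral>x. F x \<partial>M) = (\<integral>x. F x \<partial>lborel)"
proof -
  have "(\<lambda>x. indicator \<Omega> x *\<^sub>R F x) = F" using assms(2) by (auto simp: indicator_def fun_eq_iff)
  then show ?thesis using assms(1) by (simp add: integral_restrict_space integral_completion)
qed

lemma nn_integral_M_le_lborel: "(\<integral>\<^sup>+x. F x \<partial>M) \<le> (\<integral>\<^sup>+x. F x \<partial>lborel)"
proof -
  have "(\<integral>\<^sup>+x. F x \<partial>M) = (\<integral>\<^sup>+x. F x * indicator \<Omega> x \<partial>lebesgue)"
    by (rule nn_integral_restrict_space) simp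
  also have "\<dots> \<le> (\<integral>\<^sup>+x. F x \<partial>lebesgue)" by (intro nn_integral_mono) (auto simp: indicator_def)
  finally show ?thesis by (simp add: nn_integral_completion)
qed

text \<open>The mean over a ball of the extension by zero: the divisor is the measure of the full
  ball even where the ball leaves \<Omega>. For test functions it is therefore the average over the
  whole space.\<close>

definition avg :: "real \<Rightarrow> ('a \<Rightarrow> real) \<Rightarrow> 'a \<Rightarrow> real" where
  "avg h v x = (\<integral>y. indicator (ball x h) y * v y \<partial>M) / measure lborel (ball (0::'a) h)"

lemma ball_measure_pos: "0 < h \<Longrightarrow> 0 < measure lborel (ball (0::'a) h)"
  by (rule content_ball_pos)

lemma indicator_ball_integrable:
  fixes v :: "'a \<Rightarrow> real"
  assumes "integrable M v"
  shows "integrable M (\<lambda>y. indicator (ball x h) y * v y)"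
proof -
  have "ball x h \<inter> \<Omega> \<in> sets M" by (auto simp: sets_restrict_space)
  from integrable_mult_indicator[OF this assms]
  have "integrable M (\<lambda>y. indicator (ball x h \<inter> \<Omega>) y * v y)" by simp
  then show ?thesis
    by (rule Bochner_Integration.integrable_cong[THEN iffD1, rotated -1]) (auto simp: space_restrict_space indicator_def)
qed

lemma avg_diff_le:
  assumes "integrable M v" "integrable M w" "0 < h"
  shows "\<bar>avg h v x - avg h w x\<bar> \<le> (\<integral>y. \<bar>v y - w y\<bar> \<partial>M) / measure lborel (ball (0::'a) h)"
proof -
  have "avg h v x - avg h w x = (\<integral>y. indicator (ball x h) y * (v y - w y) \<partial>M) / measure lborel (ball (0::'a) h)"
    using indicator_ball_integrable[OF assms(1)] indicator_ball_integrable[OF assms(2)]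
    by (simp add: avg_def right_diff_distrib diff_divide_distrib)
  moreover have "\<bar>\<integral>y. indicator (ball x h) y * (v y - w y) \<partial>M\<bar> \<le> (\<integral>y. \<bar>v y - w y\<bar> \<partial>M)"
  proof -
    have i: "integrable M (\<lambda>y. v y - w y)" using assms by simp
    have "\<bar>\<integral>y. indicator (ball x h) y * (v y - w y) \<partial>M\<bar> \<le> (\<integral>y. \<bar>indicator (ball x h) y * (v y - w y)\<bar> \<partial>M)"
      by (rule integral_abs_bound)
    also have "\<dots> \<le> (\<integral>y. \<bar>v y - w y\<bar> \<partial>M)"
      using indicator_ball_integrable[OF i] i by (intro integral_mono) (auto simp: indicator_def)
    finally show ?thesis .
  qed
  ultimately show ?thesis using ball_measure_pos[OF assms(3)] by (simp add: abs_divide divide_right_mono)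
qed

lemma avg_functional:
  assumes "0 < h"
  shows "(\<lambda>v. avg h v x) \<in> dual_space X (W10_norm \<Omega> p)"
proof -
  have i: "integrable M u" if "u \<in> X" for u using L1_le(1)[OF XD(2)[OF that]] .
  have "\<bar>avg h u x\<bar> \<le> (S 1 / measure lborel (ball (0::'a) h)) * W10_norm \<Omega> p u" if u: "u \<in> X" for u
  proof -
    have "\<bar>avg h u x\<bar> \<le> (\<integral>y. \<bar>u y\<bar> \<partial>M) / measure lborel (ball (0::'a) h)"
      using avg_diff_le[OF i[OF u] _ assms, of "\<lambda>x. 0" x] by (simp add: avg_def)
    also have "(\<integral>y. \<bar>u y\<bar> \<partial>M) = pnorm M 1 u" by (simp add: pnorm_def pint_def)
    also have "pnorm M 1 u \<le> S 1 * pnorm M p (grd u)" using p_less_pstar by (intro Sobolev(2)[OF u]) auto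
    finally show ?thesis using ball_measure_pos[OF assms] X_norm[OF u] by (simp add: divide_right_mono)
  qed
  then have "\<exists>C. \<forall>u\<in>X. \<bar>avg h u x\<bar> \<le> C * W10_norm \<Omega> p u" by blast
  moreover have "avg h (\<lambda>x. u x + v x) x = avg h u x + avg h v x" if "u \<in> X" "v \<in> X" for u v
    using indicator_ball_integrable[OF i[OF that(1)]] indicator_ball_integrable[OF i[OF that(2)]]
    by (simp add: avg_def distrib_left add_divide_distrib)
  moreover have "avg h (\<lambda>x. c * u x) x = c * avg h u x" for c u
    by (simp add: avg_def mult.left_commute)
  ultimately show ?thesis by (simp add: dual_space_def)
qed

lemma avg_test:
  assumes \<phi>: "\<phi> \<in> test_functions \<Omega>" and h: "0 < h"
  shows "avg h \<phi> \<in> borel_measurable M" "integrable M (avg h \<phi>)"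
    "(\<integral>x. \<bar>\<phi> x\<bar> \<partial>M) \<le> h * (\<integral>x. norm (tgrad \<phi> x) \<partial>M) + (\<integral>x. \<bar>avg h \<phi> x\<bar> \<partial>M)"
proof -
  obtain K where K: "K \<subseteq> \<Omega>" "C1c K \<phi> (tgrad \<phi>)" using test_C1c[OF \<phi>] by blast
  have m [measurable]: "\<phi> \<in> borel_measurable borel" using borel_measurable_continuous_onI[OF C1cD(5)[OF K(2)]] .
  define b where "b = measure lborel (ball (0::'a) h)"
  have out: "\<phi> x = 0" if "x \<notin> \<Omega>" for x using C1cD(2)[OF K(2)] K(1) that by blast
  have eq: "avg h \<phi> x = (\<integral>y. indicator (ball x h) y * \<phi> y \<partial>lborel) / b" for x
    unfolding avg_def b_def using out m
    by (subst integral_M_eq_lborel) (auto intro!: borel_measurable_times borel_measurable_indicator)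
  \<comment> \<open>Written with a condition on \<open>dist x y\<close>, the integrand is visibly
    measurable in both variables, as the measurability of a parameter integral requires.\<close>
  have m1: "(\<lambda>x. \<integral>y. (if dist x y < h then \<phi> y else 0) \<partial>lborel) \<in> borel_measurable borel"
    by (rule lborel.borel_measurable_lebesgue_integral) measurable
  have "avg h \<phi> = (\<lambda>x. (\<integral>y. (if dist x y < h then \<phi> y else 0) \<partial>lborel) / b)"
    unfolding eq fun_eq_iff
    by (intro allI arg_cong2[where f = "(/)"] Bochner_Integration.integral_cong) (auto simp: indicator_def)
  with m1 have "avg h \<phi> \<in> borel_measurable borel" by simp
  then have "avg h \<phi> \<in> borel_measurable lebesgue" by (intro measurable_completion) simp
  then show mM: "avg h \<phi> \<in> borel_measurable M" by (rule measurable_restrict_space1)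
  note L = L1_le[OF test_Lp(1)[OF \<phi> p_bounds(1)]] L1_le[OF test_Lp(2)[OF \<phi> p_bounds(1)]]
  have "\<bar>avg h \<phi> x\<bar> \<le> (\<integral>y. \<bar>\<phi> y\<bar> \<partial>M) / b" for x
    using avg_diff_le[OF L(1) _ h, of "\<lambda>x. 0" x] by (simp add: avg_def b_def)
  then show i: "integrable M (avg h \<phi>)"
    using mM by (intro integrable_const_bound[of _ "(\<integral>y. \<bar>\<phi> y\<bar> \<partial>M) / b"]) auto
  have tg: "(\<integral>x. norm (tgrad \<phi> x) \<partial>lborel) = (\<integral>x. norm (tgrad \<phi> x) \<partial>M)"
    using C1cD(4)[OF K(2)] C1c_grad_zero[OF K(2)] K(1)
    by (intro integral_M_eq_lborel[symmetric]) (auto intro!: borel_measurable_continuous_onI continuous_intros)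
  have "ennreal (\<integral>x. \<bar>\<phi> x - avg h \<phi> x\<bar> \<partial>M) = (\<integral>\<^sup>+x. ennreal \<bar>\<phi> x - avg h \<phi> x\<bar> \<partial>M)"
    using L(1) i by (intro nn_integral_eq_integral[symmetric]) auto
  also have "\<dots> \<le> (\<integral>\<^sup>+x. ennreal \<bar>\<phi> x - avg h \<phi> x\<bar> \<partial>lborel)" by (rule nn_integral_M_le_lborel)
  also have "\<dots> \<le> ennreal (h * (\<integral>x. norm (tgrad \<phi> x) \<partial>M))"
    using C1c_average_estimate[OF K(2) h] by (simp add: eq b_def tg)
  finally have 1: "(\<integral>x. \<bar>\<phi> x - avg h \<phi> x\<bar> \<partial>M) \<le> h * (\<integral>x. norm (tgrad \<phi> x) \<partial>M)"
    using h by (subst (asm) ennreal_le_iff) (auto intro!: mult_nonneg_nonneg)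
  have "(\<integral>x. \<bar>\<phi> x\<bar> \<partial>M) \<le> (\<integral>x. \<bar>\<phi> x - avg h \<phi> x\<bar> + \<bar>avg h \<phi> x\<bar> \<partial>M)"
    using L(1) i by (intro integral_mono) auto
  also have "\<dots> = (\<integral>x. \<bar>\<phi> x - avg h \<phi> x\<bar> \<partial>M) + (\<integral>x. \<bar>avg h \<phi> x\<bar> \<partial>M)"
    using L(1) i by (intro Bochner_Integration.integral_add) auto
  finally show "(\<integral>x. \<bar>\<phi> x\<bar> \<partial>M) \<le> h * (\<integral>x. norm (tgrad \<phi> x) \<partial>M) + (\<integral>x. \<bar>avg h \<phi> x\<bar> \<partial>M)"
    using 1 by linarith
qed

text \<open>Local averages are bounded functionals, so they pass to the limit under weak convergence, while
  they differ from the function by at most the radius times the norm of the gradient.\<close>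

lemma weak_imp_L1:
  assumes W: "\<And>n::nat. W n \<in> X" and bound: "\<And>n. pnorm M p (grd (W n)) \<le> B"
    and weak: "\<And>l. l \<in> dual_space X (W10_norm \<Omega> p) \<Longrightarrow> (\<lambda>n. l (W n)) \<longlonglongrightarrow> 0"
  shows "(\<lambda>n. \<integral>x. \<bar>W n x\<bar> \<partial>M) \<longlonglongrightarrow> 0"
proof (rule LIMSEQ_I)
  fix e :: real assume e: "0 < e"
  have B0: "0 \<le> B" using bound[of 0] pnorm_nonneg order_trans by blast
  define c where "c = pnorm M (conjx p) (\<lambda>x. 1::real)"
  have c: "0 \<le> c" by (simp add: c_def)
  \<comment> \<open>The radius makes the error of averaging at most e/4. The bound is
    \<open>B + 1\<close> and not \<open>B\<close> because the estimate is applied to test functions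
    whose gradients lie within distance 1 of those of \<open>W n\<close>.\<close>
  define h where "h = e / (4 * (c * (B + 1) + 1))"
  have D0: "0 < c * (B + 1) + 1" using c B0 by (simp add: add_nonneg_pos)
  have h: "0 < h" unfolding h_def using e D0 by simp
  have hc: "h * ((B + 1) * c) \<le> e / 4"
  proof -
    have "h * ((B + 1) * c) \<le> h * (c * (B + 1) + 1)" using h by (intro mult_left_mono) auto
    also have "\<dots> = e / 4" unfolding h_def using D0 by (simp add: field_simps)
    finally show ?thesis .
  qed
  \<comment> \<open>The averaging estimate is available for test functions, so each
    \<open>W n\<close> is replaced by one within 1/(n+1).\<close>
  have "\<exists>\<phi>\<in>test_functions \<Omega>. pnorm M p (\<lambda>x. \<phi> x - W n x) < 1 / real (Suc n)
      \<and> pnorm M p (\<lambda>x. tgrad \<phi> x - grd (W n) x) < 1 / real (Suc n)" for n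
  proof -
    obtain \<phi> where \<phi>: "\<And>n::nat. \<phi> n \<in> test_functions \<Omega>" and l: "(\<lambda>k. pnorm M p (\<lambda>x. \<phi> k x - W n x)) \<longlonglongrightarrow> 0"
       "(\<lambda>k. pnorm M p (\<lambda>x. tgrad (\<phi> k) x - grd (W n) x)) \<longlonglongrightarrow> 0" using XD(5)[OF W[of n]] by blast
    have "eventually (\<lambda>k. pnorm M p (\<lambda>x. \<phi> k x - W n x) < 1 / real (Suc n)
        \<and> pnorm M p (\<lambda>x. tgrad (\<phi> k) x - grd (W n) x) < 1 / real (Suc n)) sequentially"
      by (intro eventually_conj order_tendstoD(2)[OF l(1)] order_tendstoD(2)[OF l(2)]) auto
    then show ?thesis using \<phi> by (auto simp: eventually_sequentially)
  qed
  then obtain \<phi> where \<phi>: "\<And>n. \<phi> n \<in> test_functions \<Omega>" and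
    near: "\<And>n. pnorm M p (\<lambda>x. \<phi> n x - W n x) < 1 / real (Suc n)" "\<And>n. pnorm M p (\<lambda>x. tgrad (\<phi> n) x - grd (W n) x) < 1 / real (Suc n)"
    by metis
  have lim0: "(\<lambda>n. 1 / real (Suc n)) \<longlonglongrightarrow> 0" by (rule LIMSEQ_Suc[OF lim_1_over_n])
  note LW = L1_le[OF XD(2)[OF W]] and L\<phi> = L1_le[OF test_Lp(1)[OF \<phi> p_bounds(1)]] and Lg = L1_le[OF test_Lp(2)[OF \<phi> p_bounds(1)]]
  have d: "(\<lambda>x. \<phi> n x - W n x) \<in> Lp M p" for n using test_Lp(1)[OF \<phi> p_bounds(1)] XD(2)[OF W] p_bounds by (intro Lp_diff) auto
  have diff: "(\<integral>x. \<bar>\<phi> n x - W n x\<bar> \<partial>M) \<le> (1 / real (Suc n)) * c" for n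
    using L1_le(2)[OF d, of n] mult_right_mono[OF less_imp_le[OF near(1)[of n]] c] by (simp add: c_def)
  have lim_diff: "(\<lambda>n. \<integral>x. \<bar>\<phi> n x - W n x\<bar> \<partial>M) \<longlonglongrightarrow> 0"
  proof (rule Lim_null_comparison, intro always_eventually allI)
    show "norm (\<integral>x. \<bar>\<phi> n x - W n x\<bar> \<partial>M) \<le> (1 / real (Suc n)) * c" for n using diff[of n] by simp
    show "(\<lambda>n. (1 / real (Suc n)) * c) \<longlonglongrightarrow> 0" using tendsto_mult_right[OF lim0, of c] by simp
  qed
  have "pnorm M p (tgrad (\<phi> n)) \<le> B + 1" for n
  proof -
    have "(1 / real (Suc n)) \<le> 1" by simp
    then show ?thesis
      using pnorm_diff_bound[OF p_bounds(2) test_Lp(2)[OF \<phi> p_bounds(1)] XD(3)[OF W], of n n] near(2)[of n] bound[of n] by linarith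
  qed
  then have G: "h * (\<integral>x. norm (tgrad (\<phi> n) x) \<partial>M) \<le> e / 4" for n
  proof -
    have "(\<integral>x. norm (tgrad (\<phi> n) x) \<partial>M) \<le> (B + 1) * c"
      using Lg(2)[of n] mult_right_mono[OF \<open>\<And>n. pnorm M p (tgrad (\<phi> n)) \<le> B + 1\<close>[of n] c] unfolding c_def by linarith
    then have "h * (\<integral>x. norm (tgrad (\<phi> n) x) \<partial>M) \<le> h * ((B + 1) * c)" using h by (intro mult_left_mono) auto
    with hc show ?thesis by linarith
  qed
  define b where "b = measure lborel (ball (0::'a) h)"
  have b: "0 < b" unfolding b_def by (rule ball_measure_pos[OF h])
  have avg0: "(\<lambda>n. avg h (\<phi> n) x) \<longlonglongrightarrow> 0" for x
  proof -
    have "(\<lambda>n. avg h (\<phi> n) x - avg h (W n) x) \<longlonglongrightarrow> 0"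
    proof (rule Lim_null_comparison, intro always_eventually allI)
      show "norm (avg h (\<phi> n) x - avg h (W n) x) \<le> (\<integral>x. \<bar>\<phi> n x - W n x\<bar> \<partial>M) / b" for n
        using avg_diff_le[OF L\<phi>(1) LW(1) h] by (simp add: b_def)
      show "(\<lambda>n. (\<integral>x. \<bar>\<phi> n x - W n x\<bar> \<partial>M) / b) \<longlonglongrightarrow> 0" using tendsto_divide_zero[OF lim_diff, of b] .
    qed
    from tendsto_add[OF this weak[OF avg_functional[OF h, of x]]] show ?thesis by simp
  qed
  have avg_bound: "\<bar>avg h (\<phi> n) x\<bar> \<le> (c * (S p * B) + c) / b" for n x
  proof -
    have Sp: "0 < S p" "pnorm M p (W n) \<le> S p * pnorm M p (grd (W n))"
      using Sobolev(2,3)[OF W, of p] p p_less_pstar by auto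
    have "S p * pnorm M p (grd (W n)) \<le> S p * B" using Sp bound by (intro mult_left_mono) auto
    then have "pnorm M p (W n) \<le> S p * B" using Sp(2) by linarith
    then have "pnorm M p (W n) * c \<le> (S p * B) * c" using c by (rule mult_right_mono)
    then have 1: "(\<integral>x. \<bar>W n x\<bar> \<partial>M) \<le> c * (S p * B)" using LW(2)[of n] by (simp add: c_def mult.commute)
    have "(\<integral>x. \<bar>\<phi> n x\<bar> \<partial>M) \<le> (\<integral>x. \<bar>W n x\<bar> + \<bar>\<phi> n x - W n x\<bar> \<partial>M)"
      using L\<phi>(1) LW(1) by (intro integral_mono) auto
    also have "\<dots> = (\<integral>x. \<bar>W n x\<bar> \<partial>M) + (\<integral>x. \<bar>\<phi> n x - W n x\<bar> \<partial>M)"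
      using L\<phi>(1) LW(1) by (intro Bochner_Integration.integral_add) auto
    also have "\<dots> \<le> c * (S p * B) + c"
    proof -
      have "(1 / real (Suc n)) * c \<le> 1 * c" using c by (intro mult_right_mono) auto
      with 1 diff[of n] show ?thesis by linarith
    qed
    finally have "(\<integral>x. \<bar>\<phi> n x\<bar> \<partial>M) / b \<le> (c * (S p * B) + c) / b" using b by (intro divide_right_mono) auto
    moreover have "\<bar>avg h (\<phi> n) x\<bar> \<le> (\<integral>x. \<bar>\<phi> n x\<bar> \<partial>M) / b"
      using avg_diff_le[OF L\<phi>(1) _ h, of "\<lambda>x. 0" n x] by (simp add: avg_def b_def)
    ultimately show ?thesis by linarith
  qed
  have "(\<lambda>n. \<integral>x. \<bar>avg h (\<phi> n) x\<bar> \<partial>M) \<longlonglongrightarrow> (\<integral>x. 0 \<partial>M)"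
  proof (rule integral_dominated_convergence[where w = "\<lambda>x. (c * (S p * B) + c) / b"])
    show "AE x in M. (\<lambda>n. \<bar>avg h (\<phi> n) x\<bar>) \<longlonglongrightarrow> 0" using avg0 by (auto intro!: tendsto_rabs_zero)
  qed (use avg_bound avg_test(1)[OF \<phi> h] in auto)
  then have "eventually (\<lambda>n. (\<integral>x. \<bar>avg h (\<phi> n) x\<bar> \<partial>M) < e / 4) sequentially"
    using e by (intro order_tendstoD(2)) auto
  moreover have "eventually (\<lambda>n. (\<integral>x. \<bar>\<phi> n x - W n x\<bar> \<partial>M) < e / 4) sequentially"
    using e by (intro order_tendstoD(2)[OF lim_diff]) auto
  ultimately have "eventually (\<lambda>n. norm ((\<integral>x. \<bar>W n x\<bar> \<partial>M) - 0) < e) sequentially"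
  proof eventually_elim
    case (elim n)
    have "(\<integral>x. \<bar>W n x\<bar> \<partial>M) \<le> (\<integral>x. \<bar>\<phi> n x\<bar> + \<bar>\<phi> n x - W n x\<bar> \<partial>M)"
      using L\<phi>(1) LW(1) by (intro integral_mono) auto
    also have "\<dots> = (\<integral>x. \<bar>\<phi> n x\<bar> \<partial>M) + (\<integral>x. \<bar>\<phi> n x - W n x\<bar> \<partial>M)"
      using L\<phi>(1) LW(1) by (intro Bochner_Integration.integral_add) auto
    finally have "(\<integral>x. \<bar>W n x\<bar> \<partial>M) < e"
      using avg_test(3)[OF \<phi> h, of n] G[of n] elim e by linarith
    then show ?case by simp
  qed
  then show "\<exists>N. \<forall>n\<ge>N. norm ((\<integral>x. \<bar>W n x\<bar> \<partial>M) - 0) < e" by (simp add: eventually_sequentially)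
qed

text \<open>The threshold s solves s^(k-P) = e: beyond it t^k <= e t^P, below it t^k <= s^(k-1) t.
  It interpolates between L^1 and the critical exponent, and later absorbs the q-term into the
  p-term.\<close>

lemma powr_interpolation:
  fixes k P e :: real
  assumes "1 \<le> k" "k < P" "0 < e"
  shows "\<exists>C\<ge>0. \<forall>t\<ge>0. t powr k \<le> e * t powr P + C * t"
proof -
  define s where "s = e powr (1 / (k - P))"
  have s: "0 < s" "s powr (k - P) = e" using assms by (auto simp: s_def powr_powr)
  have "t powr k \<le> e * t powr P + s powr (k - 1) * t" if t: "0 \<le> t" for t
  proof (cases "t \<le> s")
    case True
    have "t powr k = t powr (k - 1) * t"
      using t assms by (cases "t = 0") (auto simp: powr_mult_base[symmetric] powr_mult_base mult.commute)
    also have "\<dots> \<le> s powr (k - 1) * t" using True t assms by (intro mult_right_mono powr_mono2) auto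
    finally show ?thesis using assms by (simp add: add_increasing)
  next
    case False
    have "t powr k = t powr (k - P) * t powr P" by (simp add: powr_add[symmetric])
    also have "\<dots> \<le> e * t powr P"
      using powr_mono2'[of "k - P" s t] False assms s by (intro mult_right_mono) auto
    finally show ?thesis using t by (simp add: add_increasing2)
  qed
  then show ?thesis by (intro exI[of _ "s powr (k - 1)"]) auto
qed

text \<open>The critical norm is only bounded and enters with a small factor, while the L^1 norm
  tends to zero. Interpolation is possible exactly because k is strictly below p*.\<close>

lemma weak_imp_strong:
  assumes W: "\<And>n::nat. W n \<in> X" and bound: "\<And>n. pnorm M p (grd (W n)) \<le> B"
    and weak: "\<And>l. l \<in> dual_space X (W10_norm \<Omega> p) \<Longrightarrow> (\<lambda>n. l (W n)) \<longlonglongrightarrow> 0"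
    and k: "1 \<le> k" "k < pstar"
  shows "(\<lambda>n. pnorm M k (W n)) \<longlonglongrightarrow> 0"
proof -
  have B0: "0 \<le> B" using bound[of 0] pnorm_nonneg order_trans by blast
  have ps: "1 \<le> pstar" using p_less_pstar by simp
  define A where "A = (S pstar * B) powr pstar"
  have WA: "pint M pstar (W n) \<le> A" for n
  proof -
    have "pnorm M pstar (W n) \<le> S pstar * pnorm M p (grd (W n))" "0 < S pstar"
      using Sobolev(2,3)[OF W ps] by auto
    then have "pnorm M pstar (W n) \<le> S pstar * B" using mult_left_mono[OF bound[of n], of "S pstar"] by linarith
    then have "pnorm M pstar (W n) powr pstar \<le> A" unfolding A_def using ps by (intro powr_mono2) auto
    then show ?thesis using ps by (simp add: pnorm_powr)
  qed
  have A0: "0 \<le> A" by (simp add: A_def)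
  have "(\<lambda>n. pint M k (W n)) \<longlonglongrightarrow> 0"
  proof (rule LIMSEQ_I)
    fix r :: real assume r: "0 < r"
    define e where "e = r / (2 * (A + 1))"
    have e: "0 < e" using r A0 by (simp add: e_def)
    have eA: "e * A < r / 2"
    proof -
      have "e * A < e * (A + 1)" using e by simp
      also have "\<dots> = r / 2" using A0 by (simp add: e_def field_simps)
      finally show ?thesis .
    qed
    obtain C where C: "0 \<le> C" "\<And>t. 0 \<le> t \<Longrightarrow> t powr k \<le> e * t powr pstar + C * t"
      using powr_interpolation[OF k e] by blast
    have le: "pint M k (W n) \<le> e * A + C * (\<integral>x. \<bar>W n x\<bar> \<partial>M)" for n
    proof -
      have i: "integrable M (\<lambda>x. norm (W n x) powr k)" "integrable M (\<lambda>x. norm (W n x) powr pstar)" "integrable M (W n)"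
        using LpD(2)[OF Sobolev(1)[OF W]] k ps L1_le(1)[OF XD(2)[OF W]] by auto
      have "pint M k (W n) \<le> (\<integral>x. e * norm (W n x) powr pstar + C * norm (W n x) \<partial>M)"
        unfolding pint_def using i C(2) by (intro integral_mono) auto
      also have "\<dots> = e * pint M pstar (W n) + C * (\<integral>x. \<bar>W n x\<bar> \<partial>M)" using i by (simp add: pint_def)
      also have "\<dots> \<le> e * A + C * (\<integral>x. \<bar>W n x\<bar> \<partial>M)" using WA[of n] e by simp
      finally show ?thesis .
    qed
    have "(\<lambda>n. C * (\<integral>x. \<bar>W n x\<bar> \<partial>M)) \<longlonglongrightarrow> 0"
      using tendsto_mult_left[OF weak_imp_L1[where W = W, OF W bound weak], of C] by simp
    then have "eventually (\<lambda>n. C * (\<integral>x. \<bar>W n x\<bar> \<partial>M) < r / 2) sequentially"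
      using r by (intro order_tendstoD(2)) auto
    then have "eventually (\<lambda>n. norm (pint M k (W n) - 0) < r) sequentially"
    proof eventually_elim
      case (elim n)
      with le[of n] eA have "pint M k (W n) < r" by linarith
      then show ?case by simp
    qed
    then show "\<exists>N. \<forall>n\<ge>N. norm (pint M k (W n) - 0) < r" by (simp add: eventually_sequentially)
  qed
  then show ?thesis using k by (subst pnorm_tendsto_0_iff) auto
qed

end

section \<open>Superposition operators\<close>

text \<open>Simple functions approximate the pair (w, g). On each level set f has constant arguments
  and is measurable in x; continuity gives convergence a.e., and completeness of the measure
  disposes of the null set.\<close>

lemma caratheodory_measurable:
  fixes f :: "'a::euclidean_space \<Rightarrow> real \<Rightarrow> 'a \<Rightarrow> real"
  assumes f: "caratheodory \<Omega> f" and \<Omega>: "\<Omega> \<in> sets lebesgue"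
    and w: "w \<in> borel_measurable (lebesgue_on \<Omega>)" and g: "g \<in> borel_measurable (lebesgue_on \<Omega>)"
  shows "(\<lambda>x. f x (w x) (g x)) \<in> borel_measurable (lebesgue_on \<Omega>)"
proof -
  let ?M = "lebesgue_on \<Omega>"
  have z: "(\<lambda>x. (w x, g x)) \<in> borel_measurable ?M" using w g by (rule borel_measurable_Pair)
  obtain s where s: "\<And>i::nat. simple_function ?M (s i)" "\<And>x. x \<in> space ?M \<Longrightarrow> (\<lambda>i. s i x) \<longlonglongrightarrow> (w x, g x)"
    using borel_measurable_implies_sequence_metric[OF z, of undefined] by blast
  define G where "G i x = (\<Sum>c\<in>s i ` space ?M. indicator (s i -` {c} \<inter> space ?M) x * f x (fst c) (snd c))" for i x
  have Gm: "G i \<in> borel_measurable ?M" for i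
    unfolding G_def
  proof (intro borel_measurable_sum borel_measurable_times borel_measurable_indicator)
    show "s i -` {c} \<inter> space ?M \<in> sets ?M" for c using s(1)[of i] by (rule simple_functionD)
    show "(\<lambda>x. f x (fst c) (snd c)) \<in> borel_measurable ?M" for c using f by (simp add: caratheodory_def)
  qed
  have G_eq: "G i x = f x (fst (s i x)) (snd (s i x))" if x: "x \<in> space ?M" for i x
  proof -
    have fin: "finite (s i ` space ?M)" using s(1)[of i] by (rule simple_functionD)
    have "G i x = (\<Sum>c\<in>s i ` space ?M. if c = s i x then f x (fst c) (snd c) else 0)"
      unfolding G_def using x by (intro sum.cong) (auto simp: indicator_def)
    also have "\<dots> = f x (fst (s i x)) (snd (s i x))"
      using fin x by (subst sum.delta) auto
    finally show ?thesis .
  qed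
  have "AE x in ?M. continuous_on UNIV (\<lambda>(s, \<xi>). f x s \<xi>)" using f by (simp add: caratheodory_def)
  then have "AE x in ?M. lim (\<lambda>i. G i x) = f x (w x) (g x)"
  proof (rule AE_mp, intro AE_I2 impI)
    fix x assume x: "x \<in> space ?M" and c: "continuous_on UNIV (\<lambda>(s, \<xi>). f x s \<xi>)"
    have "isCont (\<lambda>(s, \<xi>). f x s \<xi>) (w x, g x)" using c by (simp add: continuous_on_eq_continuous_at)
    from isCont_tendsto_compose[OF this s(2)[OF x]]
    have "(\<lambda>i. G i x) \<longlonglongrightarrow> f x (w x) (g x)" using G_eq[OF x] by (simp add: case_prod_beta)
    then show "lim (\<lambda>i. G i x) = f x (w x) (g x)" by (rule limI)
  qed
  then show ?thesis by (rule AE_lebesgue_on_measurable[OF \<Omega> borel_measurable_lim_metric[OF Gm]])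
qed

text \<open>Converts a.e. convergence, available only along subsequences, into convergence of the
  full sequence.\<close>

lemma tendsto_if_subsubseq:
  fixes a :: "nat \<Rightarrow> real"
  assumes sub: "\<And>r::nat\<Rightarrow>nat. strict_mono r \<Longrightarrow> \<exists>r'::nat\<Rightarrow>nat. strict_mono r' \<and> (\<lambda>n. a (r (r' n))) \<longlonglongrightarrow> L"
  shows "a \<longlonglongrightarrow> L"
proof (rule ccontr)
  assume "\<not> a \<longlonglongrightarrow> L"
  then have "\<exists>e>0. \<forall>N. \<exists>n\<ge>N. e \<le> \<bar>a n - L\<bar>"
    by (simp add: LIMSEQ_iff not_less)
  then obtain e where e: "0 < e" "\<And>N. \<exists>n\<ge>N. e \<le> \<bar>a n - L\<bar>" by blast
  have "infinite {n. e \<le> \<bar>a n - L\<bar>}"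
    unfolding infinite_nat_iff_unbounded_le using e(2) by auto
  from infinite_enumerate[OF this] obtain r :: "nat \<Rightarrow> nat" where r: "strict_mono r" "\<And>n. e \<le> \<bar>a (r n) - L\<bar>" by auto
  obtain r' :: "nat \<Rightarrow> nat" where "(\<lambda>n. a (r (r' n))) \<longlonglongrightarrow> L" using sub[OF r(1)] by blast
  then have "eventually (\<lambda>n. \<bar>a (r (r' n)) - L\<bar> < e) sequentially"
    using e(1) by (simp add: tendsto_iff dist_real_def)
  then obtain N where "\<bar>a (r (r' N)) - L\<bar> < e" by (auto simp: eventually_sequentially)
  then show False using r(2)[of "r' N"] by linarith
qed

section \<open>Estimates for the operators\<close>

lemma conjx_antimono: "1 < a \<Longrightarrow> a \<le> b \<Longrightarrow> conjx b \<le> conjx a"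
  by (simp add: conjx_def field_simps)

lemma pnorm_norm_powr: "0 < a \<Longrightarrow> 0 < P \<Longrightarrow> pnorm M (P / a) (\<lambda>x. norm (g x) powr a) = pnorm M P g powr a"
  by (simp add: pnorm_def pint_def powr_powr)

lemma norm_powr_Lp:
  assumes M: "finite_measure M" and g: "g \<in> Lp M P" and a: "0 \<le> a" "0 \<le> s" "a * s \<le> P"
  shows "(\<lambda>x. norm (g x) powr a) \<in> Lp M s"
    "pint M s (\<lambda>x. norm (g x) powr a) \<le> measure M (space M) + pint M P g"
proof -
  interpret finite_measure M by fact
  have le: "norm (norm (g x) powr a) powr s \<le> 1 + norm (g x) powr P" for x
  proof (cases "norm (g x) \<le> 1")
    case True
    then have "norm (g x) powr (a * s) \<le> 1" using a by (intro powr_le1) auto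
    then show ?thesis by (simp add: powr_powr add_increasing2)
  next
    case False
    then have "norm (g x) powr (a * s) \<le> norm (g x) powr P" using a by (intro powr_mono) auto
    then show ?thesis by (simp add: powr_powr)
  qed
  have i: "integrable M (\<lambda>x. 1 + norm (g x) powr P)" using g by (auto simp: Lp_def)
  have m: "(\<lambda>x. norm (g x) powr a) \<in> borel_measurable M" using LpD(1)[OF g] by measurable
  show L: "(\<lambda>x. norm (g x) powr a) \<in> Lp M s" by (rule Lp_bound[OF m i]) (use le in simp)
  have "pint M s (\<lambda>x. norm (g x) powr a) \<le> (\<integral>x. 1 + norm (g x) powr P \<partial>M)"
    unfolding pint_def using LpD(2)[OF L] i le by (intro integral_mono) auto
  also have "\<dots> = measure M (space M) + pint M P g" using LpD(2)[OF g] by (simp add: pint_def)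
  finally show "pint M s (\<lambda>x. norm (g x) powr a) \<le> measure M (space M) + pint M P g" .
qed

context sobolev
begin

abbreviation "nX u \<equiv> pnorm M p (grd u)"

lemma nX_add:
  assumes u: "u \<in> X" and v: "v \<in> X"
  shows "nX (\<lambda>x. u x + v x) \<le> nX u + nX v"
  using pnorm_triangle[OF p_bounds(2) XD(3)[OF u] XD(3)[OF v]]
    pnorm_Lp_cong[OF X_add(2)[OF u v] XD(3)[OF X_add(1)[OF u v]] Lp_add[OF p_bounds(1) XD(3)[OF u] XD(3)[OF v]]] by simp

lemma nX_scale:
  assumes u: "u \<in> X"
  shows "nX (\<lambda>x. c * u x) = \<bar>c\<bar> * nX u"
  using pnorm_Lp_cong[OF X_scale(2)[OF u] XD(3)[OF X_scale(1)[OF u]] Lp_scaleR[OF XD(3)[OF u]], of c] p_bounds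
  by (simp add: pnorm_scaleR)

lemma nX_zero: "nX (\<lambda>x. 0) = 0"
  using X_zero pnorm_eq_0_iff[OF XD(3)[OF X_zero(1)]] by simp

lemma nX_diff: "u \<in> X \<Longrightarrow> v \<in> X \<Longrightarrow> nX (\<lambda>x. u x - v x) \<le> nX u + nX v"
  using nX_add[of u "\<lambda>x. (-1) * v x"] nX_scale[of v "-1"] X_scale(1)[of v "-1"] by simp

lemma nX_sum:
  fixes E :: "nat \<Rightarrow> 'a \<Rightarrow> real"
  assumes "\<And>i. E i \<in> X"
  shows "nX (\<lambda>x. \<Sum>i<n. c i * E i x) \<le> (\<Sum>i<n. \<bar>c i\<bar> * nX (E i))"
proof (induction n)
  case (Suc n)
  have 1: "(\<lambda>x. \<Sum>i<n. c i * E i x) \<in> X" using X_sum[of n E c] assms by blast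
  have "nX (\<lambda>x. (\<Sum>i<n. c i * E i x) + c n * E n x) \<le> nX (\<lambda>x. \<Sum>i<n. c i * E i x) + nX (\<lambda>x. c n * E n x)"
    by (rule nX_add[OF 1 X_scale(1)[OF assms]])
  then show ?case using Suc nX_scale[OF assms[of n], of "c n"] by simp
qed (simp add: nX_zero)

end

locale dirichlet = sobolev \<Omega> p pstar S
  for \<Omega> :: "'a::euclidean_space set" and p pstar :: real and S :: "real \<Rightarrow> real" +
  fixes q a1 a2 \<alpha> \<beta> r K1 K2 K3 :: real
    and T :: "('a \<Rightarrow> real) \<Rightarrow> 'a \<Rightarrow> real"
    and f :: "'a \<Rightarrow> real \<Rightarrow> 'a \<Rightarrow> real"
    and \<sigma> :: "'a \<Rightarrow> real"
  assumes q: "1 < q" "q < p"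
    and T_into: "\<And>u. u \<in> W10 \<Omega> p \<Longrightarrow> T u \<in> W1 \<Omega> p"
    and T_continuous: "seminorm_continuous (W10 \<Omega> p) (W10_norm \<Omega> p) (W1_norm \<Omega> p) T"
    and f: "caratheodory \<Omega> f"
    and a: "0 \<le> a1" "0 \<le> a2"
    and \<alpha>: "0 < \<alpha>" "\<alpha> < pstar - 1"
    and \<beta>: "0 < \<beta>" "\<beta> < p / real_of_ereal (conj_exp pstar)"
    and r: "1 \<le> r" "r < pstar"
    and \<sigma>: "\<sigma> \<in> Lspace \<Omega> (conj_exp r)"
    and growth: "AE x in lebesgue_on \<Omega>. \<forall>s \<xi>.
        \<bar>f x s \<xi>\<bar> \<le> \<sigma> x + a1 * \<bar>s\<bar> powr \<alpha> + a2 * norm \<xi> powr \<beta>"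
    and K: "0 \<le> K1" "0 \<le> K2" "0 \<le> K3"
    and small: "a1 * K1 * S (pstar / (pstar - \<alpha>)) + a2 * K2 * S (p / (p - \<beta>)) < 1"
    and T_bound: "\<And>u. u \<in> W10 \<Omega> p \<Longrightarrow>
        ennreal_powr (Lnorm \<Omega> pstar (T u)) \<alpha>
          \<le> ennreal K1 * ennreal_powr (Lnorm \<Omega> p (wgrad \<Omega> u)) (p - 1) + ennreal K3"
    and grad_T_bound: "\<And>u. u \<in> W10 \<Omega> p \<Longrightarrow>
        ennreal_powr (Lnorm \<Omega> p (wgrad \<Omega> (T u))) \<beta>
          \<le> ennreal K2 * ennreal_powr (Lnorm \<Omega> p (wgrad \<Omega> u)) (p - 1) + ennreal K3"
begin

section \<open>Exponents and integrability of the reaction term\<close>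

definition "s1 = pstar / (pstar - \<alpha>)"
definition "s2 = p / (p - \<beta>)"
text \<open>The smallest exponent against which all three parts of the growth bound can be tested:
  its conjugate \<open>m\<close> is at most r', p*/\<alpha> and p/\<beta>.\<close>

definition "k = max r (max s1 s2)"
definition "m = conjx k"
definition "vol = measure M (space M)"

lemma \<beta>_less: "\<beta> < p" "p / pstar < p - \<beta>"
proof -
  have ps: "1 < pstar" by (rule p_less_pstar)
  have "real_of_ereal (conj_exp pstar) = pstar / (pstar - 1)" using ps by (simp add: conj_exp_def)
  then have "\<beta> < p * (pstar - 1) / pstar" using \<beta>(2) by simp
  also have "\<dots> = p - p / pstar" using ps by (simp add: field_simps)
  finally show "p / pstar < p - \<beta>" by simp
  moreover have "0 < p / pstar" using ps p by simp
  ultimately show "\<beta> < p" by simp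
qed

lemma s1_bounds: "1 < s1" "s1 < pstar" "conjx s1 = pstar / \<alpha>" "conjx (pstar / \<alpha>) = s1" "1 < pstar / \<alpha>"
proof -
  have ps: "1 < pstar" by (rule p_less_pstar)
  show "1 < s1" using \<alpha> by (simp add: s1_def)
  have "pstar * 1 < pstar * (pstar - \<alpha>)" using \<alpha> ps by (intro mult_strict_left_mono) auto
  then show "s1 < pstar" using \<alpha> by (simp add: s1_def divide_less_eq)
  have "s1 - 1 = \<alpha> / (pstar - \<alpha>)" using \<alpha> by (simp add: s1_def field_simps)
  then show e: "conjx s1 = pstar / \<alpha>" using \<alpha> ps by (simp add: conjx_def s1_def)
  show "conjx (pstar / \<alpha>) = s1" using conjx_conjx[OF \<open>1 < s1\<close>] e by simp
  show "1 < pstar / \<alpha>" using \<alpha> by simp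
qed

lemma s2_bounds: "1 < s2" "s2 < pstar" "conjx s2 = p / \<beta>" "conjx (p / \<beta>) = s2" "1 < p / \<beta>"
proof -
  have ps: "1 < pstar" by (rule p_less_pstar)
  show "1 < s2" using \<beta>_less \<beta> by (simp add: s2_def)
  have "p < (p - \<beta>) * pstar" using \<beta>_less(2) ps by (simp add: divide_less_eq)
  then show "s2 < pstar" using \<beta>_less by (simp add: s2_def divide_less_eq mult.commute)
  have "s2 - 1 = \<beta> / (p - \<beta>)" using \<beta>_less by (simp add: s2_def field_simps)
  then show e: "conjx s2 = p / \<beta>" using \<beta>_less \<beta> by (simp add: conjx_def s2_def)
  show "conjx (p / \<beta>) = s2" using conjx_conjx[OF \<open>1 < s2\<close>] e by simp
  show "1 < p / \<beta>" using \<beta>_less \<beta> by simp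
qed

lemma k_bounds: "1 < k" "k < pstar" "1 \<le> k" "k \<le> pstar"
  using s1_bounds s2_bounds r by (auto simp: k_def)

lemma m_bounds: "1 < m" "0 \<le> m" "1 \<le> m" "conjx m = k" "\<alpha> * m \<le> pstar" "\<beta> * m \<le> p"
proof -
  show "1 < m" unfolding m_def by (rule conjx_gt_1[OF k_bounds(1)])
  then show "0 \<le> m" "1 \<le> m" by auto
  show "conjx m = k" unfolding m_def by (rule conjx_conjx[OF k_bounds(1)])
  have "m \<le> pstar / \<alpha>" "m \<le> p / \<beta>"
    using conjx_antimono[OF s1_bounds(1), of k] conjx_antimono[OF s2_bounds(1), of k] s1_bounds(3) s2_bounds(3) by (auto simp: m_def k_def)
  then show "\<alpha> * m \<le> pstar" "\<beta> * m \<le> p" using \<alpha> \<beta> by (auto simp: field_simps)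
qed

text \<open>For r = 1 the conjugate is infinite and \<sigma> is essentially bounded; otherwise r <=
  k gives m <= r'.\<close>

lemma \<sigma>_Lp: "\<sigma> \<in> Lp M m"
proof (cases "r = 1")
  case True
  then have s: "\<sigma> \<in> borel_measurable M" "esssup M (\<lambda>x. ennreal (norm (\<sigma> x))) < top"
    using \<sigma> by (auto simp: Lspace_def conj_exp_def Lnorm_def)
  define B where "B = enn2real (esssup M (\<lambda>x. ennreal (norm (\<sigma> x))))"
  have B: "esssup M (\<lambda>x. ennreal (norm (\<sigma> x))) = ennreal B" using s(2) by (simp add: B_def)
  have "AE x in M. ennreal (norm (\<sigma> x)) \<le> ennreal B"
    unfolding B[symmetric] by (rule esssup_AE)
  then have "AE x in M. norm (\<sigma> x) powr m \<le> B powr m"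
    by eventually_elim (use m_bounds in \<open>auto simp: B_def ennreal_le_iff intro!: powr_mono2\<close>)
  then show ?thesis using s(1) by (intro Lp_bound[of \<sigma> M "\<lambda>x. B powr m"]) auto
next
  case False
  then have "\<sigma> \<in> Lp M (conjx r)" using \<sigma> by (simp add: conj_exp_def Lspace_eq conjx_def)
  moreover have "m \<le> conjx r" unfolding m_def using False r by (intro conjx_antimono) (auto simp: k_def)
  ultimately show ?thesis using Lp_mono[of \<sigma> "conjx r" m] m_bounds(2) by blast
qed

text \<open>The bounds are inequalities in [0,\<infinity>] with finite right sides, and this is
  where the membership of \<open>T u\<close> in L^p* comes from.\<close>

lemma T_estimates:
  assumes u: "u \<in> X"
  shows "T u \<in> Lp M pstar" "pnorm M pstar (T u) powr \<alpha> \<le> K1 * nX u powr (p - 1) + K3"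
    "grd (T u) \<in> Lp M p" "pnorm M p (grd (T u)) powr \<beta> \<le> K2 * nX u powr (p - 1) + K3"
proof -
  note W = W1D[OF \<Omega>(1) T_into[OF u]]
  have rhs: "ennreal L * ennreal_powr (Lnorm \<Omega> p (grd u)) (p - 1) + ennreal K3 = ennreal (L * nX u powr (p - 1) + K3)"
    if "0 \<le> L" for L
    using that K by (simp add: Lnorm_eq[OF XD(3)[OF u]] ennreal_powr_def ennreal_mult)
  have 1: "ennreal_powr (Lnorm \<Omega> pstar (T u)) \<alpha> \<le> ennreal (K1 * nX u powr (p - 1) + K3)"
    using T_bound[OF u] rhs[OF K(1)] by simp
  then have "Lnorm \<Omega> pstar (T u) < top"
    by (auto simp: ennreal_powr_def less_top top_unique split: if_splits)
  then show L: "T u \<in> Lp M pstar" using LpD(1)[OF W(1)] by (intro Lnorm_finite_imp_Lp)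
  have nn: "0 \<le> L * nX u powr (p - 1) + K3" if "0 \<le> L" for L using that K by simp
  show "pnorm M pstar (T u) powr \<alpha> \<le> K1 * nX u powr (p - 1) + K3"
    using 1 nn[OF K(1)] by (simp add: Lnorm_eq[OF L] ennreal_powr_def ennreal_le_iff)
  show "grd (T u) \<in> Lp M p" by (rule W(2))
  show "pnorm M p (grd (T u)) powr \<beta> \<le> K2 * nX u powr (p - 1) + K3"
    using grad_T_bound[OF u] rhs[OF K(2)] nn[OF K(2)] by (simp add: Lnorm_eq[OF W(2)] ennreal_powr_def ennreal_le_iff)
qed

definition "rf u x = f x (T u x) (grd (T u) x)"
definition "h1 u x = \<bar>T u x\<bar> powr \<alpha>"
definition "h2 u x = norm (grd (T u) x) powr \<beta>"

lemma rf_measurable: "u \<in> X \<Longrightarrow> rf u \<in> borel_measurable M"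
  unfolding rf_def[abs_def]
  by (rule caratheodory_measurable[OF f \<Omega>_sets LpD(1)[OF T_estimates(1)] LpD(1)[OF T_estimates(3)]])

lemma rf_le: "u \<in> X \<Longrightarrow> AE x in M. \<bar>rf u x\<bar> \<le> \<bar>\<sigma> x\<bar> + a1 * h1 u x + a2 * h2 u x"
  using growth by eventually_elim (auto simp: rf_def h1_def h2_def intro: order_trans[OF _ add_mono[OF add_mono[OF abs_ge_self order_refl] order_refl]])

lemma h_Lp:
  assumes u: "u \<in> X"
  shows "h1 u \<in> Lp M m" "h2 u \<in> Lp M m" "h1 u \<in> Lp M (pstar / \<alpha>)" "h2 u \<in> Lp M (p / \<beta>)"
    "pint M m (h1 u) \<le> vol + pint M pstar (T u)" "pint M m (h2 u) \<le> vol + pint M p (grd (T u))"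
    "pnorm M (pstar / \<alpha>) (h1 u) = pnorm M pstar (T u) powr \<alpha>" "pnorm M (p / \<beta>) (h2 u) = pnorm M p (grd (T u)) powr \<beta>"
proof -
  note TE = T_estimates[OF u]
  have e1: "h1 u = (\<lambda>x. norm (T u x) powr \<alpha>)" and e2: "h2 u = (\<lambda>x. norm (grd (T u) x) powr \<beta>)"
    by (auto simp: h1_def h2_def fun_eq_iff)
  show "h1 u \<in> Lp M m" "pint M m (h1 u) \<le> vol + pint M pstar (T u)"
    unfolding e1 vol_def using norm_powr_Lp[OF finM TE(1), of \<alpha> m] \<alpha> m_bounds by auto
  show "h2 u \<in> Lp M m" "pint M m (h2 u) \<le> vol + pint M p (grd (T u))"
    unfolding e2 vol_def using norm_powr_Lp[OF finM TE(3), of \<beta> m] \<beta> m_bounds by auto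
  show "h1 u \<in> Lp M (pstar / \<alpha>)"
    unfolding e1 using norm_powr_Lp(1)[OF finM TE(1), of \<alpha> "pstar / \<alpha>"] \<alpha> s1_bounds by auto
  show "h2 u \<in> Lp M (p / \<beta>)"
    unfolding e2 using norm_powr_Lp(1)[OF finM TE(3), of \<beta> "p / \<beta>"] \<beta> s2_bounds by auto
  show "pnorm M (pstar / \<alpha>) (h1 u) = pnorm M pstar (T u) powr \<alpha>" "pnorm M (p / \<beta>) (h2 u) = pnorm M p (grd (T u)) powr \<beta>"
    unfolding e1 e2 using \<alpha> \<beta> p_less_pstar p_bounds
      pnorm_norm_powr[of \<alpha> pstar M "T u"] pnorm_norm_powr[of \<beta> p M "grd (T u)"] by auto
qed

lemma dominant_Lp:
  assumes u: "u \<in> X"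
  shows "(\<lambda>x. \<bar>\<sigma> x\<bar> + a1 * h1 u x + a2 * h2 u x) \<in> Lp M m"
  using Lp_norm[OF \<sigma>_Lp] Lp_cmult[OF h_Lp(1)[OF u], of a1] Lp_cmult[OF h_Lp(2)[OF u], of a2] m_bounds
  by (intro Lp_add) auto

lemma dominant_nonneg: "0 \<le> \<bar>\<sigma> x\<bar> + a1 * h1 u x + a2 * h2 u x"
  using a by (simp add: h1_def h2_def)

lemma rf_Lp: 
  assumes u: "u \<in> X"
  shows "rf u \<in> Lp M m"
proof (rule Lp_bound[OF rf_measurable[OF u] LpD(2)[OF dominant_Lp[OF u]]])
  show "AE x in M. norm (rf u x) powr m \<le> norm (\<bar>\<sigma> x\<bar> + a1 * h1 u x + a2 * h2 u x) powr m"
    using rf_le[OF u] by eventually_elim (use m_bounds in \<open>auto intro!: powr_mono2\<close>)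
qed

text \<open>Boundedness on bounded sets. The bounds on the \<alpha>-th and \<beta>-th powers of the
  norms are raised to p*/\<alpha> and p/\<beta> to control the integrals, and the finite volume
  allows the descent to the exponent m.\<close>

lemma rf_bound: "\<exists>B\<ge>0. \<forall>u\<in>X. nX u \<le> R \<longrightarrow> pnorm M m (rf u) \<le> B"
proof -
  define A1 where "A1 = (vol + (K1 * \<bar>R\<bar> powr (p - 1) + K3) powr (pstar / \<alpha>)) powr (1 / m)"
  define A2 where "A2 = (vol + (K2 * \<bar>R\<bar> powr (p - 1) + K3) powr (p / \<beta>)) powr (1 / m)"
  have "pnorm M m (rf u) \<le> pnorm M m \<sigma> + a1 * A1 + a2 * A2" if u: "u \<in> X" and R: "nX u \<le> R" for u
  proof -
    note TE = T_estimates[OF u] and H = h_Lp[OF u]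
    have R': "nX u powr (p - 1) \<le> \<bar>R\<bar> powr (p - 1)" using R p by (intro powr_mono2) auto
    have "pint M pstar (T u) = (pnorm M pstar (T u) powr \<alpha>) powr (pstar / \<alpha>)"
      using \<alpha> p_less_pstar by (simp add: powr_powr pnorm_powr)
    also have "\<dots> \<le> (K1 * \<bar>R\<bar> powr (p - 1) + K3) powr (pstar / \<alpha>)"
      using TE(2) mult_left_mono[OF R' K(1)] s1_bounds by (intro powr_mono2) auto
    finally have "pint M m (h1 u) \<le> vol + (K1 * \<bar>R\<bar> powr (p - 1) + K3) powr (pstar / \<alpha>)" using H(5) by linarith
    then have 1: "pnorm M m (h1 u) \<le> A1" unfolding pnorm_def A1_def using m_bounds by (intro powr_mono2) auto
    have "pint M p (grd (T u)) = (pnorm M p (grd (T u)) powr \<beta>) powr (p / \<beta>)"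
      using \<beta> p_bounds by (simp add: powr_powr pnorm_powr)
    also have "\<dots> \<le> (K2 * \<bar>R\<bar> powr (p - 1) + K3) powr (p / \<beta>)"
      using TE(4) mult_left_mono[OF R' K(2)] s2_bounds by (intro powr_mono2) auto
    finally have "pint M m (h2 u) \<le> vol + (K2 * \<bar>R\<bar> powr (p - 1) + K3) powr (p / \<beta>)" using H(6) by linarith
    then have 2: "pnorm M m (h2 u) \<le> A2" unfolding pnorm_def A2_def using m_bounds by (intro powr_mono2) auto
    have "pnorm M m (rf u) \<le> pnorm M m (\<lambda>x. \<bar>\<sigma> x\<bar> + a1 * h1 u x + a2 * h2 u x)"
      using rf_le[OF u] dominant_nonneg
      by (intro pnorm_mono dominant_Lp[OF u] rf_measurable[OF u] m_bounds) (auto elim!: eventually_mono)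
    also have "\<dots> \<le> pnorm M m (\<lambda>x. \<bar>\<sigma> x\<bar> + a1 * h1 u x) + pnorm M m (\<lambda>x. a2 * h2 u x)"
      using Lp_norm[OF \<sigma>_Lp] Lp_cmult[OF H(1), of a1] Lp_cmult[OF H(2), of a2] m_bounds
      by (intro pnorm_triangle Lp_add) auto
    also have "pnorm M m (\<lambda>x. \<bar>\<sigma> x\<bar> + a1 * h1 u x) \<le> pnorm M m (\<lambda>x. \<bar>\<sigma> x\<bar>) + pnorm M m (\<lambda>x. a1 * h1 u x)"
      using Lp_norm[OF \<sigma>_Lp] Lp_cmult[OF H(1), of a1] m_bounds by (intro pnorm_triangle) auto
    also have "pnorm M m (\<lambda>x. a1 * h1 u x) = a1 * pnorm M m (h1 u)"
      using pnorm_scaleR[of m M a1 "h1 u"] m_bounds a by simp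
    also have "pnorm M m (\<lambda>x. a2 * h2 u x) = a2 * pnorm M m (h2 u)"
      using pnorm_scaleR[of m M a2 "h2 u"] m_bounds a by simp
    also have "pnorm M m (\<lambda>x. \<bar>\<sigma> x\<bar>) = pnorm M m \<sigma>" using pnorm_norm[of M m \<sigma>] by simp
    finally show ?thesis using mult_left_mono[OF 1 a(1)] mult_left_mono[OF 2 a(2)] by linarith
  qed
  then show ?thesis using a by (intro exI[of _ "pnorm M m \<sigma> + a1 * A1 + a2 * A2"]) (auto simp: A1_def A2_def)
qed

section \<open>The competing operator combined with the reaction\<close>

definition "J a = dmap p a - dmap q a" for a :: 'a

lemma q_bounds: "0 < q - 1" "0 \<le> q - 1" "(q - 1) * conjx p \<le> p"
proof -
  show "0 < q - 1" "0 \<le> q - 1" using q by auto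
  have "(q - 1) * conjx p \<le> (p - 1) * conjx p" using q conjx_p_bounds by (intro mult_right_mono) auto
  then show "(q - 1) * conjx p \<le> p" using conjx_mult[OF p(1)] by simp
qed

lemma continuous_J: "continuous_on UNIV J"
  unfolding J_def[abs_def] by (intro continuous_intros continuous_dmap p q)

lemma J_Lp:
  assumes g: "g \<in> Lp M p"
  shows "(\<lambda>x. J (g x)) \<in> Lp M (conjx p)" "(\<lambda>x. dmap q (g x)) \<in> Lp M (conjx p)"
    "pint M (conjx p) (\<lambda>x. dmap q (g x)) \<le> vol + pint M p g"
proof -
  have "(\<lambda>x. dmap q (g x)) \<in> borel_measurable M"
    using borel_measurable_continuous_on[OF continuous_dmap[OF q(1)] LpD(1)[OF g]] .
  then show dq: "(\<lambda>x. dmap q (g x)) \<in> Lp M (conjx p)"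
    using norm_powr_Lp(1)[OF finM g q_bounds(2) conjx_p_bounds(2) q_bounds(3)] by (simp add: Lp_def norm_dmap)
  then show "(\<lambda>x. J (g x)) \<in> Lp M (conjx p)"
    unfolding J_def using dmap_Lp[OF p(1) g] conjx_p_bounds by (intro Lp_diff)
  show "pint M (conjx p) (\<lambda>x. dmap q (g x)) \<le> vol + pint M p g"
    using norm_powr_Lp(2)[OF finM g q_bounds(2) conjx_p_bounds(2) q_bounds(3)] by (simp add: pint_def norm_dmap vol_def)
qed

lemma J_bound: "\<exists>B\<ge>0. \<forall>g\<in>Lp M p. pnorm M p g \<le> R \<longrightarrow> pnorm M (conjx p) (\<lambda>x. J (g x)) \<le> B"
proof -
  define A where "A = \<bar>R\<bar> powr p"
  have "pnorm M (conjx p) (\<lambda>x. J (g x)) \<le> A powr (1 / conjx p) + (vol + A) powr (1 / conjx p)"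
    if g: "g \<in> Lp M p" and R: "pnorm M p g \<le> R" for g
  proof -
    have "pnorm M p g powr p \<le> A" unfolding A_def using R p by (intro powr_mono2) auto
    then have i: "pint M p g \<le> A" using p_bounds by (simp add: pnorm_powr)
    have "pnorm M (conjx p) (\<lambda>x. J (g x)) \<le> pnorm M (conjx p) (\<lambda>x. dmap p (g x)) + pnorm M (conjx p) (\<lambda>x. dmap q (g x))"
      unfolding J_def by (rule pnorm_triangle_diff[OF conjx_p_bounds(3) dmap_Lp[OF p(1) g] J_Lp(2)[OF g]])
    also have "\<dots> \<le> A powr (1 / conjx p) + (vol + A) powr (1 / conjx p)"
      unfolding pnorm_def using pint_dmap[OF p(1), of M g] J_Lp(3)[OF g] i conjx_p_bounds by (intro add_mono powr_mono2) auto
    finally show ?thesis .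
  qed
  then show ?thesis by (intro exI[of _ "A powr (1 / conjx p) + (vol + A) powr (1 / conjx p)"]) auto
qed

definition "Bop u v = competing_op \<Omega> p q u v - reaction \<Omega> f (T u) v"

lemma plap_eq: "plaplacian \<Omega> s u v = - (\<integral>x. dmap s (grd u x) \<bullet> grd v x \<partial>M)"
  by (simp add: plaplacian_def dmap_def)

lemma competing_eq:
  assumes "u \<in> X" "v \<in> X"
  shows "competing_op \<Omega> p q u v = (\<integral>x. J (grd u x) \<bullet> grd v x \<partial>M)"
  using pair_integrable(1)[OF dmap_Lp[OF p(1) XD(3)[OF assms(1)]] XD(3)[OF assms(2)]]
    pair_integrable(1)[OF J_Lp(2)[OF XD(3)[OF assms(1)]] XD(3)[OF assms(2)]]
  by (simp add: competing_op_def plap_eq J_def inner_diff_left)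

lemma reaction_eq: "reaction \<Omega> f (T u) v = (\<integral>x. rf u x \<bullet> v x \<partial>M)"
  by (simp add: reaction_def rf_def)

lemma X_Lk: "v \<in> X \<Longrightarrow> v \<in> Lp M k" "v \<in> X \<Longrightarrow> pnorm M k v \<le> S k * nX v" "0 < S k"
  using Sobolev[OF _ k_bounds(3,4)] X_zero by auto

lemma reaction_integrable:
  assumes "u \<in> X" "v \<in> X"
  shows "integrable M (\<lambda>x. rf u x \<bullet> v x)" "\<bar>\<integral>x. rf u x \<bullet> v x \<partial>M\<bar> \<le> pnorm M m (rf u) * pnorm M k v"
  using inner_integrable[OF m_bounds(1) rf_Lp[OF assms(1)], of v] inner_integral_le[OF m_bounds(1) rf_Lp[OF assms(1)], of v]
    X_Lk(1)[OF assms(2)] m_bounds(4) by auto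

lemma Bop_bound: "\<exists>B\<ge>0. \<forall>u\<in>X. nX u \<le> R \<longrightarrow> (\<forall>v\<in>X. \<bar>Bop u v\<bar> \<le> B * nX v)"
proof -
  obtain A where A: "0 \<le> A" "\<And>u. u \<in> X \<Longrightarrow> nX u \<le> R \<Longrightarrow> pnorm M m (rf u) \<le> A" using rf_bound[of R] by blast
  obtain B where B: "0 \<le> B" "\<And>g. g \<in> Lp M p \<Longrightarrow> pnorm M p g \<le> R \<Longrightarrow> pnorm M (conjx p) (\<lambda>x. J (g x)) \<le> B"
    using J_bound[of R] by blast
  have "\<bar>Bop u v\<bar> \<le> (B + A * S k) * nX v" if u: "u \<in> X" "nX u \<le> R" and v: "v \<in> X" for u v
  proof -
    have "\<bar>competing_op \<Omega> p q u v\<bar> \<le> pnorm M (conjx p) (\<lambda>x. J (grd u x)) * nX v"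
      using pair_integrable(2)[OF J_Lp(1)[OF XD(3)[OF u(1)]] XD(3)[OF v]] competing_eq[OF u(1) v] by simp
    also have "\<dots> \<le> B * nX v" using B(2)[OF XD(3)[OF u(1)] u(2)] by (intro mult_right_mono) auto
    finally have 1: "\<bar>competing_op \<Omega> p q u v\<bar> \<le> B * nX v" .
    have "\<bar>reaction \<Omega> f (T u) v\<bar> \<le> pnorm M m (rf u) * pnorm M k v"
      using reaction_integrable(2)[OF u(1) v] by (simp only: reaction_eq)
    also have "\<dots> \<le> A * (S k * nX v)" using A u X_Lk(2)[OF v] by (intro mult_mono) auto
    finally show ?thesis using 1 unfolding Bop_def by (simp add: algebra_simps)
  qed
  then show ?thesis using A(1) B(1) X_Lk(3) by (intro exI[of _ "B + A * S k"]) auto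
qed

lemma Bop_lincomb:
  assumes u: "u \<in> X" and v: "v \<in> X" and w: "w \<in> X"
  shows "Bop u (\<lambda>x. v x + c * w x) = Bop u v + c * Bop u w"
proof -
  have JL: "(\<lambda>x. J (grd u x)) \<in> Lp M (conjx p)" using J_Lp(1)[OF XD(3)[OF u]] .
  have "(\<integral>x. J (grd u x) \<bullet> grd (\<lambda>x. v x + c * w x) x \<partial>M) = (\<integral>x. J (grd u x) \<bullet> (grd v x + c *\<^sub>R grd w x) \<partial>M)"
    using LpD(1)[OF XD(3)[OF X_lincomb(1)[OF v w, of c]]] LpD(1)[OF Lp_lincomb[OF p_bounds(1) XD(3)[OF v] XD(3)[OF w], of c]]
    by (intro pairing_AE_cong[OF X_lincomb(2)[OF v w] JL])
  also have "\<dots> = (\<integral>x. J (grd u x) \<bullet> grd v x \<partial>M) + c * (\<integral>x. J (grd u x) \<bullet> grd w x \<partial>M)"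
    using pair_integrable(1)[OF JL XD(3)[OF v]] pair_integrable(1)[OF JL XD(3)[OF w]] by (simp add: inner_add_right)
  finally have 1: "competing_op \<Omega> p q u (\<lambda>x. v x + c * w x) = competing_op \<Omega> p q u v + c * competing_op \<Omega> p q u w"
    using competing_eq[OF u v] competing_eq[OF u w] competing_eq[OF u X_lincomb(1)[OF v w]] by simp
  have "(\<integral>x. rf u x \<bullet> (v x + c * w x) \<partial>M) = (\<integral>x. rf u x \<bullet> v x + c * (rf u x \<bullet> w x) \<partial>M)"
    by (simp add: algebra_simps)
  also have "\<dots> = (\<integral>x. rf u x \<bullet> v x \<partial>M) + c * (\<integral>x. rf u x \<bullet> w x \<partial>M)"
    using reaction_integrable(1)[OF u v] reaction_integrable(1)[OF u w]
    by (subst Bochner_Integration.integral_add) auto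
  finally show ?thesis using 1 by (simp add: Bop_def reaction_eq distrib_left right_diff_distrib)
qed

lemma Bop_zero: "u \<in> X \<Longrightarrow> Bop u (\<lambda>x. 0) = 0"
  using Bop_lincomb[OF _ X_zero(1) X_zero(1), of u 1] by simp

lemma Bop_scale: "u \<in> X \<Longrightarrow> v \<in> X \<Longrightarrow> Bop u (\<lambda>x. c * v x) = c * Bop u v"
  using Bop_lincomb[OF _ X_zero(1), of u v c] Bop_zero[of u] by simp

lemma Bop_diff: "u \<in> X \<Longrightarrow> v \<in> X \<Longrightarrow> w \<in> X \<Longrightarrow> Bop u (\<lambda>x. v x - w x) = Bop u v - Bop u w"
  using Bop_lincomb[of u v w "-1"] by simp

lemma Bop_sum:
  fixes E :: "nat \<Rightarrow> 'a \<Rightarrow> real"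
  assumes u: "u \<in> X" and E: "\<And>i. E i \<in> X"
  shows "Bop u (\<lambda>x. \<Sum>i<n. c i * E i x) = (\<Sum>i<n. c i * Bop u (E i))"
proof (induction n)
  case (Suc n)
  have 1: "(\<lambda>x. \<Sum>i<n. c i * E i x) \<in> X" using X_sum[of n E c] E by blast
  show ?case using Bop_lincomb[OF u 1 E[of n], of "c n"] Suc by simp
qed (simp add: Bop_zero u)

lemma Bop_dual: "u \<in> X \<Longrightarrow> Bop u \<in> Wdual \<Omega> p"
proof -
  assume u: "u \<in> X"
  obtain B where "\<forall>u'\<in>X. nX u' \<le> nX u \<longrightarrow> (\<forall>v\<in>X. \<bar>Bop u' v\<bar> \<le> B * nX v)" using Bop_bound[of "nX u"] by blast
  then have "\<forall>v\<in>X. \<bar>Bop u v\<bar> \<le> B * W10_norm \<Omega> p v" using u X_norm by simp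
  then have "\<exists>C. \<forall>v\<in>X. \<bar>Bop u v\<bar> \<le> C * W10_norm \<Omega> p v" by blast
  then show ?thesis
    unfolding Wdual_def dual_space_def
    using Bop_lincomb[OF u, of _ _ 1] Bop_scale[OF u] by simp
qed

lemma T_sequentially_continuous:
  assumes U: "\<And>n::nat. U n \<in> X" and u: "u \<in> X" and lim: "(\<lambda>n. nX (\<lambda>x. U n x - u x)) \<longlonglongrightarrow> 0"
  shows "(\<lambda>n. pnorm M p (\<lambda>x. T (U n) x - T u x)) \<longlonglongrightarrow> 0"
    "(\<lambda>n. pnorm M p (\<lambda>x. grd (T (U n)) x - grd (T u) x)) \<longlonglongrightarrow> 0"
proof -
  have W: "W1_norm \<Omega> p (\<lambda>x. T (U n) x - T u x)
      = pnorm M p (\<lambda>x. T (U n) x - T u x) + pnorm M p (\<lambda>x. grd (T (U n)) x - grd (T u) x)" for n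
    by (rule W1_norm_diff[OF T_into[OF U] T_into[OF u]])
  have "(\<lambda>n. W1_norm \<Omega> p (\<lambda>x. T (U n) x - T u x)) \<longlonglongrightarrow> 0"
  proof (rule LIMSEQ_I)
    fix e :: real assume e: "0 < e"
    obtain \<delta> where \<delta>: "\<delta> > 0" "\<And>v. v \<in> X \<Longrightarrow> W10_norm \<Omega> p (\<lambda>x. v x - u x) < \<delta> \<Longrightarrow> W1_norm \<Omega> p (\<lambda>x. T v x - T u x) < e"
      using T_continuous u e unfolding seminorm_continuous_def by meson
    have "eventually (\<lambda>n. nX (\<lambda>x. U n x - u x) < \<delta>) sequentially"
      using \<delta>(1) by (intro order_tendstoD(2)[OF lim]) auto
    then obtain N where N: "\<And>n. n \<ge> N \<Longrightarrow> nX (\<lambda>x. U n x - u x) < \<delta>" by (auto simp: eventually_sequentially)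
    have "norm (W1_norm \<Omega> p (\<lambda>x. T (U n) x - T u x) - 0) < e" if "n \<ge> N" for n
    proof -
      have "W10_norm \<Omega> p (\<lambda>x. U n x - u x) < \<delta>" using N[OF that] X_norm[OF X_diff(1)[OF U u]] by simp
      from \<delta>(2)[OF U this] have "W1_norm \<Omega> p (\<lambda>x. T (U n) x - T u x) < e" .
      then show ?thesis by (simp add: W)
    qed
    then show "\<exists>N. \<forall>n\<ge>N. norm (W1_norm \<Omega> p (\<lambda>x. T (U n) x - T u x) - 0) < e" by blast
  qed
  note L = this
  show "(\<lambda>n. pnorm M p (\<lambda>x. T (U n) x - T u x)) \<longlonglongrightarrow> 0"
    "(\<lambda>n. pnorm M p (\<lambda>x. grd (T (U n)) x - grd (T u) x)) \<longlonglongrightarrow> 0"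
    by (rule Lim_null_comparison[OF _ L], rule always_eventually, simp add: W)+
qed

text \<open>Three successive extractions make grad u, T u and grad T u converge a.e. Continuity of
  \<open>J\<close> and of f then gives a.e. convergence of the two densities, which are bounded in
  L^p' and L^m and so converge weakly there.\<close>

lemma Bop_demicontinuous:
  assumes U: "\<And>n::nat. U n \<in> X" and u: "u \<in> X" and v: "v \<in> X" and lim: "(\<lambda>n. nX (\<lambda>x. U n x - u x)) \<longlonglongrightarrow> 0"
  shows "(\<lambda>n. Bop (U n) v) \<longlonglongrightarrow> Bop u v"
proof (rule tendsto_if_subsubseq)
  fix \<rho> :: "nat \<Rightarrow> nat" assume \<rho>: "strict_mono \<rho>"
  define V where "V n = U (\<rho> n)" for n
  have V: "V n \<in> X" for n using U by (simp add: V_def)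
  have limV: "(\<lambda>n. nX (\<lambda>x. V n x - u x)) \<longlonglongrightarrow> 0"
    using LIMSEQ_subseq_LIMSEQ[OF lim \<rho>] by (simp add: V_def o_def)
  have limG: "(\<lambda>n. pnorm M p (\<lambda>x. grd (V n) x - grd u x)) \<longlonglongrightarrow> 0"
    using limV grad_diff_pnorm[OF V u] by simp
  have limT: "(\<lambda>n. pnorm M p (\<lambda>x. T (V n) x - T u x)) \<longlonglongrightarrow> 0"
    "(\<lambda>n. pnorm M p (\<lambda>x. grd (T (V n)) x - grd (T u) x)) \<longlonglongrightarrow> 0"
    using T_sequentially_continuous[OF V u limV] by auto
  have TL: "T w \<in> Lp M p" "grd (T w) \<in> Lp M p" if "w \<in> X" for w
    using W1D[OF \<Omega>(1) T_into[OF that]] by auto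
  obtain r1 :: "nat \<Rightarrow> nat" where r1: "strict_mono r1" "AE x in M. (\<lambda>n. grd (V (r1 n)) x) \<longlonglongrightarrow> grd u x"
    using AE_subseq[OF p_bounds(2) XD(3)[OF V] XD(3)[OF u] limG] by blast
  obtain r2 :: "nat \<Rightarrow> nat" where r2: "strict_mono r2" "AE x in M. (\<lambda>n. T (V (r1 (r2 n))) x) \<longlonglongrightarrow> T u x"
    using AE_subseq[OF p_bounds(2) TL(1)[OF V] TL(1)[OF u] LIMSEQ_subseq_LIMSEQ[OF limT(1) r1(1), unfolded o_def]] by blast
  have r12: "strict_mono (\<lambda>n. r1 (r2 n))" using strict_mono_o[OF r1(1) r2(1)] by (simp add: o_def)
  obtain r3 :: "nat \<Rightarrow> nat" where r3: "strict_mono r3" "AE x in M. (\<lambda>n. grd (T (V (r1 (r2 (r3 n))))) x) \<longlonglongrightarrow> grd (T u) x"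
    using AE_subseq[OF p_bounds(2) TL(2)[OF V] TL(2)[OF u] LIMSEQ_subseq_LIMSEQ[OF limT(2) r12, unfolded o_def]] by blast
  define \<tau> where "\<tau> n = r1 (r2 (r3 n))" for n
  have \<tau>: "strict_mono \<tau>" using strict_mono_o[OF r12 r3(1)] by (simp add: o_def \<tau>_def[abs_def])
  have r23: "strict_mono (\<lambda>n. r2 (r3 n))" using strict_mono_o[OF r2(1) r3(1)] by (simp add: o_def)
  have ae: "AE x in M. (\<lambda>n. J (grd (V (\<tau> n)) x)) \<longlonglongrightarrow> J (grd u x)"
    using r1(2)
  proof eventually_elim
    case (elim x)
    have "isCont J (grd u x)" using continuous_J by (simp add: continuous_on_eq_continuous_at)
    from isCont_tendsto_compose[OF this LIMSEQ_subseq_LIMSEQ[OF elim r23, unfolded o_def]]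
    show ?case by (simp add: \<tau>_def)
  qed
  have "AE x in M. continuous_on UNIV (\<lambda>(s, \<xi>). f x s \<xi>)" using f by (simp add: caratheodory_def)
  then have ae2: "AE x in M. (\<lambda>n. rf (V (\<tau> n)) x) \<longlonglongrightarrow> rf u x"
    using r2(2) r3(2)
  proof eventually_elim
    case (elim x)
    have "isCont (\<lambda>(s, \<xi>). f x s \<xi>) (T u x, grd (T u) x)" using elim(1) by (simp add: continuous_on_eq_continuous_at)
    moreover have "(\<lambda>n. (T (V (\<tau> n)) x, grd (T (V (\<tau> n))) x)) \<longlonglongrightarrow> (T u x, grd (T u) x)"
      using LIMSEQ_subseq_LIMSEQ[OF elim(2) r3(1)] elim(3) by (intro tendsto_Pair) (auto simp: o_def \<tau>_def)
    ultimately have "(\<lambda>n. (\<lambda>(s, \<xi>). f x s \<xi>) (T (V (\<tau> n)) x, grd (T (V (\<tau> n))) x)) \<longlonglongrightarrow> (\<lambda>(s, \<xi>). f x s \<xi>) (T u x, grd (T u) x)"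
      by (rule isCont_tendsto_compose)
    then show ?case by (simp add: rf_def)
  qed
  have "convergent (\<lambda>n. nX (V n))"
    using pnorm_tendsto[OF p_bounds(2) XD(3)[OF V] XD(3)[OF u] limG] by (auto simp: convergent_def)
  then have "Bseq (\<lambda>n. nX (V n))" by (rule convergent_imp_Bseq)
  then obtain R where R: "\<And>n. nX (V n) \<le> R" by (auto simp: Bseq_def)
  obtain A where A: "0 \<le> A" "\<And>u. u \<in> X \<Longrightarrow> nX u \<le> R \<Longrightarrow> pnorm M m (rf u) \<le> A" using rf_bound[of R] by blast
  obtain B where B: "0 \<le> B" "\<And>g. g \<in> Lp M p \<Longrightarrow> pnorm M p g \<le> R \<Longrightarrow> pnorm M (conjx p) (\<lambda>x. J (g x)) \<le> B"
    using J_bound[of R] by blast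
  have bJ: "pint M (conjx p) (\<lambda>x. J (grd (V (\<tau> n)) x)) \<le> B powr conjx p" for n
  proof -
    have "pnorm M (conjx p) (\<lambda>x. J (grd (V (\<tau> n)) x)) powr conjx p \<le> B powr conjx p"
      using B(2)[OF XD(3)[OF V] R] conjx_p_bounds by (intro powr_mono2) auto
    then show ?thesis using conjx_p_bounds by (simp add: pnorm_powr)
  qed
  have br: "pint M m (rf (V (\<tau> n))) \<le> A powr m" for n
  proof -
    have "pnorm M m (rf (V (\<tau> n))) powr m \<le> A powr m"
      using A(2)[OF V R] m_bounds by (intro powr_mono2) auto
    then show ?thesis using m_bounds by (simp add: pnorm_powr)
  qed
  have "(\<lambda>n. \<integral>x. J (grd (V (\<tau> n)) x) \<bullet> grd v x \<partial>M) \<longlonglongrightarrow> (\<integral>x. J (grd u x) \<bullet> grd v x \<partial>M)"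
    using XD(3)[OF v] LpD(1)[OF J_Lp(1)[OF XD(3)[OF u]]]
    by (intro AE_bounded_imp_weak_convergence[OF conjx_p_bounds(1) J_Lp(1)[OF XD(3)[OF V]] bJ _ _ ae]) (auto simp: conjx_p_bounds(4))
  moreover have "(\<lambda>n. \<integral>x. rf (V (\<tau> n)) x \<bullet> v x \<partial>M) \<longlonglongrightarrow> (\<integral>x. rf u x \<bullet> v x \<partial>M)"
    using X_Lk(1)[OF v] rf_measurable[OF u]
    by (intro AE_bounded_imp_weak_convergence[OF m_bounds(1) rf_Lp[OF V] br _ _ ae2]) (auto simp: m_bounds(4))
  ultimately have "(\<lambda>n. Bop (V (\<tau> n)) v) \<longlonglongrightarrow> Bop u v"
    unfolding Bop_def reaction_eq competing_eq[OF V v] competing_eq[OF u v] by (rule tendsto_diff)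
  then show "\<exists>r'. strict_mono r' \<and> (\<lambda>n. Bop (U (\<rho> (r' n))) v) \<longlonglongrightarrow> Bop u v"
    using \<tau> by (auto simp: V_def)
qed

text \<open>The terms with T are estimated by Hoelder in their own exponents p*/\<alpha> and
  p/\<beta>, not in the common \<open>m\<close>: only this yields the constants of the smallness
  condition and the full power t^(p-1) * t.\<close>

lemma Bop_coercive: "\<exists>\<delta>>0. \<exists>C\<ge>0. \<forall>u\<in>X. \<delta> * nX u powr p - C \<le> Bop u u"
proof -
  define \<kappa> where "\<kappa> = a1 * K1 * S s1 + a2 * K2 * S s2"
  have \<kappa>: "\<kappa> < 1" using small by (simp add: \<kappa>_def s1_def s2_def)
  \<comment> \<open>The gap 1 - \<kappa> is divided in two: one half absorbs the q-term, the other
    stays in front of the p-th power.\<close>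
  define \<epsilon> where "\<epsilon> = (1 - \<kappa>) / 2"
  have \<epsilon>: "0 < \<epsilon>" using \<kappa> by (simp add: \<epsilon>_def)
  obtain C1 where C1: "0 \<le> C1" "\<And>t. 0 \<le> t \<Longrightarrow> t powr q \<le> \<epsilon> * t powr p + C1 * t"
    using powr_interpolation[of q p \<epsilon>] q \<epsilon> by auto
  define c where "c = pnorm M (conjx p) (\<lambda>x. 1::real)"
  define C2 where "C2 = C1 * c + pnorm M m \<sigma> * S k + a1 * K3 * S s1 + a2 * K3 * S s2"
  have SS: "0 < S s1" "0 < S s2"
    using Sobolev(3)[OF X_zero(1), of s1] Sobolev(3)[OF X_zero(1), of s2] s1_bounds s2_bounds by auto
  have C2: "0 \<le> C2" unfolding C2_def c_def using C1 X_Lk(3) SS a K by (intro add_nonneg_nonneg mult_nonneg_nonneg) auto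
  have main: "\<epsilon> * nX u powr p - C2 * nX u \<le> Bop u u" if u: "u \<in> X" for u
  proof -
    define t where "t = nX u"
    have t: "0 \<le> t" by (simp add: t_def)
    note H = h_Lp[OF u] and TE = T_estimates[OF u, folded t_def] and uL = XD(3)[OF u]
    have iq: "integrable M (\<lambda>x. norm (grd u x) powr q)" using LpD(2)[OF Lp_mono[OF uL, of q]] q by simp
    have ip: "integrable M (\<lambda>x. norm (grd u x) powr p)" using LpD(2)[OF uL] .
    have "competing_op \<Omega> p q u u = (\<integral>x. norm (grd u x) powr p - norm (grd u x) powr q \<partial>M)"
      using competing_eq[OF u u] by (simp add: J_def inner_diff_left dmap_inner_self)
    also have "\<dots> = t powr p - (\<integral>x. norm (grd u x) powr q \<partial>M)"
      using iq ip p_bounds by (simp add: t_def pnorm_powr) (simp add: pint_def)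
    finally have A: "competing_op \<Omega> p q u u = t powr p - (\<integral>x. norm (grd u x) powr q \<partial>M)" .
    have "(\<integral>x. norm (grd u x) powr q \<partial>M) \<le> (\<integral>x. \<epsilon> * norm (grd u x) powr p + C1 * norm (grd u x) \<partial>M)"
      using iq ip L1_le(1)[OF uL] C1(2) by (intro integral_mono) auto
    also have "\<dots> = \<epsilon> * t powr p + C1 * (\<integral>x. norm (grd u x) \<partial>M)"
      using ip L1_le(1)[OF uL] p_bounds by (simp add: t_def pnorm_powr) (simp add: pint_def)
    also have "\<dots> \<le> \<epsilon> * t powr p + C1 * (t * c)"
      using L1_le(2)[OF uL] C1(1) unfolding t_def c_def by (intro add_left_mono mult_left_mono) auto
    finally have Q: "(\<integral>x. norm (grd u x) powr q \<partial>M) \<le> \<epsilon> * t powr p + C1 * (t * c)" .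
    have uk: "u \<in> Lp M (conjx m)" "u \<in> Lp M (conjx (pstar / \<alpha>))" "u \<in> Lp M (conjx (p / \<beta>))"
      using X_Lk(1)[OF u] Sobolev(1)[OF u, of s1] Sobolev(1)[OF u, of s2] s1_bounds s2_bounds m_bounds by auto
    note I1 = Young_integrable[OF m_bounds(1) \<sigma>_Lp uk(1)] and I2 = Young_integrable[OF s1_bounds(5) H(3) uk(2)]
      and I3 = Young_integrable[OF s2_bounds(5) H(4) uk(3)]
    have hn: "0 \<le> h1 u x" "0 \<le> h2 u x" for x by (auto simp: h1_def h2_def)
    have "(\<integral>x. rf u x \<bullet> u x \<partial>M) \<le> (\<integral>x. norm (\<sigma> x) * norm (u x) + a1 * (norm (h1 u x) * norm (u x)) + a2 * (norm (h2 u x) * norm (u x)) \<partial>M)"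
    proof (rule integral_mono_AE)
      show "integrable M (\<lambda>x. rf u x \<bullet> u x)" by (rule reaction_integrable(1)[OF u u])
      show "integrable M (\<lambda>x. norm (\<sigma> x) * norm (u x) + a1 * (norm (h1 u x) * norm (u x)) + a2 * (norm (h2 u x) * norm (u x)))"
        using I1 I2 I3 by auto
      show "AE x in M. rf u x \<bullet> u x \<le> norm (\<sigma> x) * norm (u x) + a1 * (norm (h1 u x) * norm (u x)) + a2 * (norm (h2 u x) * norm (u x))"
        using rf_le[OF u]
      proof eventually_elim
        case (elim x)
        have "rf u x \<bullet> u x \<le> \<bar>rf u x\<bar> * \<bar>u x\<bar>" by (simp add: abs_mult[symmetric])
        also have "\<dots> \<le> (\<bar>\<sigma> x\<bar> + a1 * h1 u x + a2 * h2 u x) * \<bar>u x\<bar>" using elim by (intro mult_right_mono) auto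
        finally show ?case using hn[of x] by (simp add: algebra_simps)
      qed
    qed
    also have "\<dots> = (\<integral>x. norm (\<sigma> x) * norm (u x) \<partial>M) + a1 * (\<integral>x. norm (h1 u x) * norm (u x) \<partial>M) + a2 * (\<integral>x. norm (h2 u x) * norm (u x) \<partial>M)"
      using I1 I2 I3 by simp
    also have "\<dots> \<le> pnorm M m \<sigma> * (S k * t) + a1 * ((K1 * t powr (p - 1) + K3) * (S s1 * t)) + a2 * ((K2 * t powr (p - 1) + K3) * (S s2 * t))"
    proof (intro add_mono mult_left_mono a)
      have "(\<integral>x. norm (\<sigma> x) * norm (u x) \<partial>M) \<le> pnorm M m \<sigma> * pnorm M k u"
        using Hoelder[OF m_bounds(1) \<sigma>_Lp uk(1)] by (simp add: m_bounds(4))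
      also have "\<dots> \<le> pnorm M m \<sigma> * (S k * t)" using X_Lk(2)[OF u] by (intro mult_left_mono) (auto simp: t_def)
      finally show "(\<integral>x. norm (\<sigma> x) * norm (u x) \<partial>M) \<le> pnorm M m \<sigma> * (S k * t)" .
      have "(\<integral>x. norm (h1 u x) * norm (u x) \<partial>M) \<le> pnorm M pstar (T u) powr \<alpha> * pnorm M s1 u"
        using Hoelder[OF s1_bounds(5) H(3) uk(2)] by (simp add: H(7) s1_bounds(4))
      also have "\<dots> \<le> (K1 * t powr (p - 1) + K3) * (S s1 * t)"
        using TE(2) Sobolev(2)[OF u, of s1] s1_bounds K unfolding t_def by (intro mult_mono) auto
      finally show "(\<integral>x. norm (h1 u x) * norm (u x) \<partial>M) \<le> (K1 * t powr (p - 1) + K3) * (S s1 * t)" .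
      have "(\<integral>x. norm (h2 u x) * norm (u x) \<partial>M) \<le> pnorm M p (grd (T u)) powr \<beta> * pnorm M s2 u"
        using Hoelder[OF s2_bounds(5) H(4) uk(3)] by (simp add: H(8) s2_bounds(4))
      also have "\<dots> \<le> (K2 * t powr (p - 1) + K3) * (S s2 * t)"
        using TE(4) Sobolev(2)[OF u, of s2] s2_bounds K unfolding t_def by (intro mult_mono) auto
      finally show "(\<integral>x. norm (h2 u x) * norm (u x) \<partial>M) \<le> (K2 * t powr (p - 1) + K3) * (S s2 * t)" .
    qed
    also have "\<dots> = \<kappa> * (t powr (p - 1) * t) + (pnorm M m \<sigma> * S k + a1 * K3 * S s1 + a2 * K3 * S s2) * t"
      by (simp add: \<kappa>_def algebra_simps)
    also have "t powr (p - 1) * t = t powr p"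
      using powr_mult_base[OF t, of "p - 1"] by (simp add: mult.commute)
    finally have R: "(\<integral>x. rf u x \<bullet> u x \<partial>M) \<le> \<kappa> * t powr p + (pnorm M m \<sigma> * S k + a1 * K3 * S s1 + a2 * K3 * S s2) * t" .
    have "Bop u u = t powr p - (\<integral>x. norm (grd u x) powr q \<partial>M) - (\<integral>x. rf u x \<bullet> u x \<partial>M)"
      by (simp only: Bop_def A reaction_eq)
    moreover have "t powr p = \<kappa> * t powr p + \<epsilon> * t powr p + \<epsilon> * t powr p"
      by (simp add: \<epsilon>_def algebra_simps)
    moreover have "C2 * t = C1 * (t * c) + (pnorm M m \<sigma> * S k + a1 * K3 * S s1 + a2 * K3 * S s2) * t"
      by (simp add: C2_def algebra_simps)
    ultimately show ?thesis using Q R unfolding t_def[symmetric] by linarith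
  qed
  \<comment> \<open>The remaining linear term is absorbed at the price of another half and of an
    additive constant.\<close>
  obtain B where B: "\<And>t. 0 \<le> t \<Longrightarrow> (C2 / \<epsilon>) * t \<le> t powr p / (2 * p) + B"
    using coercive_scalar_bound[OF p(1), of "C2 / \<epsilon>"] C2 \<epsilon> by auto
  have "\<epsilon> / 2 * nX u powr p - \<epsilon> * max B 0 \<le> Bop u u" if u: "u \<in> X" for u
  proof -
    have "\<epsilon> * ((C2 / \<epsilon>) * nX u) \<le> \<epsilon> * (nX u powr p / (2 * p) + B)" using B[of "nX u"] \<epsilon> by (intro mult_left_mono) auto
    then have 1: "C2 * nX u \<le> \<epsilon> * (nX u powr p / (2 * p)) + \<epsilon> * B" using \<epsilon> by (simp add: distrib_left)
    have "nX u powr p / (2 * p) \<le> nX u powr p / 2" using p by (intro divide_left_mono) auto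
    from mult_left_mono[OF this, of \<epsilon>] \<epsilon>
    have "\<epsilon> * (nX u powr p / (2 * p)) \<le> \<epsilon> / 2 * nX u powr p" by simp
    moreover have "\<epsilon> * B \<le> \<epsilon> * max B 0" using \<epsilon> by (intro mult_left_mono) auto
    ultimately show ?thesis using 1 main[OF u] by linarith
  qed
  then show ?thesis using \<epsilon> by (intro exI[of _ "\<epsilon> / 2"] conjI exI[of _ "\<epsilon> * max B 0"]) auto
qed

end

section \<open>Galerkin approximation\<close>

context dirichlet
begin

definition lin :: "(nat \<Rightarrow> 'a \<Rightarrow> real) \<Rightarrow> nat \<Rightarrow> (nat \<Rightarrow> real) \<Rightarrow> 'a \<Rightarrow> real" where
  "lin E n c = (\<lambda>x. \<Sum>i<n. c i * E i x)"

lemma lin_X: "(\<And>i. E i \<in> X) \<Longrightarrow> lin E n c \<in> X"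
  unfolding lin_def using X_sum[of n E c] by blast

lemma lin_Suc: "lin E (Suc n) c = (\<lambda>x. lin E n c x + c n * E n x)"
  by (simp add: lin_def fun_eq_iff)

lemma lin_scale: "lin E n (\<lambda>i. b * c i) = (\<lambda>x. b * lin E n c x)"
  by (simp add: lin_def fun_eq_iff sum_distrib_left mult.assoc)

lemma lin_diff: "lin E n (\<lambda>i. c i - d i) = (\<lambda>x. lin E n c x - lin E n d x)"
  by (simp add: lin_def fun_eq_iff sum_subtractf left_diff_distrib)

text \<open>Instead of extracting a basis from a dense sequence, the elements in the closure of the span of
  their predecessors are replaced by \<open>0\<close>: the indexing survives, and the coordinates with respect to
  the remaining elements are bounded by the norm.\<close>

definition kept :: "(nat \<Rightarrow> 'a \<Rightarrow> real) \<Rightarrow> nat \<Rightarrow> bool" where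
  "kept e n \<longleftrightarrow> (\<exists>\<delta>>0. \<forall>c. \<delta> \<le> nX (\<lambda>x. e n x - lin e n c x))"

definition prune :: "(nat \<Rightarrow> 'a \<Rightarrow> real) \<Rightarrow> nat \<Rightarrow> 'a \<Rightarrow> real" where
  "prune e n = (if kept e n then e n else (\<lambda>x. 0))"

lemma prune_X: "(\<And>i. e i \<in> X) \<Longrightarrow> prune e n \<in> X"
  using X_zero by (simp add: prune_def)

lemma lin_prune: "lin (prune e) n c = lin e n (\<lambda>i. if kept e i then c i else 0)"
  unfolding lin_def by (intro ext sum.cong) (auto simp: prune_def)

lemma prune_coordinates:
  assumes e: "\<And>i. e i \<in> X"
  shows "\<exists>\<kappa>>0. \<forall>c i. i < n \<longrightarrow> kept e i \<longrightarrow> \<bar>c i\<bar> \<le> \<kappa> * nX (lin (prune e) n c)"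
proof (induction n)
  case 0
  then show ?case by (intro exI[of _ 1]) auto
next
  case (Suc n)
  then obtain \<kappa> where \<kappa>: "0 < \<kappa>" "\<And>c i. i < n \<Longrightarrow> kept e i \<Longrightarrow> \<bar>c i\<bar> \<le> \<kappa> * nX (lin (prune e) n c)" by blast
  note PX = prune_X[of e, OF e] and LX = lin_X[of "prune e", OF prune_X[of e, OF e]]
  show ?case
  proof (cases "kept e n")
    case False
    then have "lin (prune e) (Suc n) c = lin (prune e) n c" for c by (simp add: lin_Suc prune_def)
    then have "\<bar>c i\<bar> \<le> \<kappa> * nX (lin (prune e) (Suc n) c)" if "i < Suc n" "kept e i" for c i
      using \<kappa>(2)[of i c] that False by (cases "i = n") auto
    with \<kappa>(1) show ?thesis by blast
  next
    case True
    then obtain \<delta> where \<delta>: "0 < \<delta>" "\<And>c. \<delta> \<le> nX (\<lambda>x. e n x - lin e n c x)" by (auto simp: kept_def)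
    \<comment> \<open>The first summand serves the new coordinate. The second serves the old ones,
      bounded after \<open>c n * e n\<close> has been subtracted from the combination.\<close>
    define \<kappa>' where "\<kappa>' = 1 / \<delta> + \<kappa> * (1 + nX (e n) / \<delta>)"
    have \<kappa>': "1 / \<delta> \<le> \<kappa>'" "\<kappa> * (1 + nX (e n) / \<delta>) \<le> \<kappa>'" "0 < \<kappa>'"
      unfolding \<kappa>'_def using \<kappa>(1) \<delta>(1) by (auto intro!: add_pos_nonneg mult_nonneg_nonneg add_nonneg_nonneg divide_nonneg_nonneg)
    have top: "\<bar>c n\<bar> \<le> (1 / \<delta>) * nX (lin (prune e) (Suc n) c)" for c
    proof (cases "c n = 0")
      case True
      then show ?thesis using \<delta>(1) by simp
    next
      case False
      \<comment> \<open>Division by the top coefficient writes the combination as \<open>c n\<close>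
        times \<open>e n\<close> minus an element of the span of its predecessors, to which the
        distance \<delta> applies.\<close>
      define d where "d i = (- 1 / c n) * (if kept e i then c i else 0)" for i
      have "lin (prune e) (Suc n) c = (\<lambda>x. c n * (e n x - lin e n d x))"
        using False True unfolding lin_Suc lin_prune d_def lin_scale
        by (auto simp: prune_def fun_eq_iff right_diff_distrib distrib_left)
      then have "nX (lin (prune e) (Suc n) c) = \<bar>c n\<bar> * nX (\<lambda>x. e n x - lin e n d x)"
        using nX_scale[OF X_diff(1)[OF e lin_X[OF e]]] by simp
      then have "\<bar>c n\<bar> * \<delta> \<le> nX (lin (prune e) (Suc n) c)" using \<delta>(2)[of d] by (simp add: mult_left_mono)
      then show ?thesis using \<delta>(1) by (simp add: field_simps)
    qed
    have "\<bar>c i\<bar> \<le> \<kappa>' * nX (lin (prune e) (Suc n) c)" if i: "i < Suc n" "kept e i" for c i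
    proof (cases "i = n")
      case True
      have "(1 / \<delta>) * nX (lin (prune e) (Suc n) c) \<le> \<kappa>' * nX (lin (prune e) (Suc n) c)"
        using \<kappa>' by (intro mult_right_mono) auto
      from order_trans[OF top this] show ?thesis unfolding True .
    next
      case False
      let ?N = "nX (lin (prune e) (Suc n) c)"
      have "lin (prune e) n c = (\<lambda>x. lin (prune e) (Suc n) c x - c n * e n x)"
        using True by (simp add: lin_Suc prune_def fun_eq_iff)
      then have "nX (lin (prune e) n c) \<le> ?N + \<bar>c n\<bar> * nX (e n)"
        using nX_diff[OF LX X_scale(1)[OF e], of "Suc n" c "c n" n] nX_scale[OF e, of "c n" n] by simp
      also have "\<dots> \<le> ?N + ((1 / \<delta>) * ?N) * nX (e n)" using top[of c] by (intro add_left_mono mult_right_mono) auto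
      also have "\<dots> = (1 + nX (e n) / \<delta>) * ?N" by (simp add: algebra_simps)
      finally have "\<kappa> * nX (lin (prune e) n c) \<le> \<kappa> * ((1 + nX (e n) / \<delta>) * ?N)" using \<kappa>(1) by (intro mult_left_mono) auto
      also have "\<dots> \<le> \<kappa>' * ?N" using mult_right_mono[OF \<kappa>'(2), of ?N] by (simp add: mult.assoc)
      finally have "\<kappa> * nX (lin (prune e) n c) \<le> \<kappa>' * ?N" .
      moreover have "i < n" using i(1) False by simp
      ultimately show ?thesis using order_trans[OF \<kappa>(2)[of i c]] i(2) by blast
    qed
    with \<kappa>'(3) show ?thesis by blast
  qed
qed

text \<open>Coercivity of the operator controls the coordinates of kept elements. The dropped ones,
  which do not affect the function, receive an equation of their own, so that the zero theorem
  applies on the full cube.\<close>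

lemma galerkin_step:
  assumes e: "\<And>i. e i \<in> X"
  shows "\<exists>u\<in>X. Bop u u = 0 \<and> (\<forall>i<n. Bop u (prune e i) = 0)"
proof -
  define E where "E = prune e"
  have E: "E i \<in> X" for i unfolding E_def by (rule prune_X[of e, OF e])
  note LX = lin_X[of E, OF E]
  from prune_coordinates[of e, OF e, of n, folded E_def] obtain \<kappa> where
    "0 < \<kappa> \<and> (\<forall>c i. i < n \<longrightarrow> kept e i \<longrightarrow> \<bar>c i\<bar> \<le> \<kappa> * nX (lin E n c))" ..
  then have \<kappa>: "0 < \<kappa>" "i < n \<Longrightarrow> kept e i \<Longrightarrow> \<bar>c i\<bar> \<le> \<kappa> * nX (lin E n c)" for c i by auto
  from Bop_coercive obtain \<delta> C where
    "0 < \<delta> \<and> 0 \<le> C \<and> (\<forall>u\<in>X. \<delta> * nX u powr p - C \<le> Bop u u)" by (elim exE conjE) (rule that, intro conjI)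
  then have \<delta>: "0 < \<delta>" "0 \<le> C" "u \<in> X \<Longrightarrow> \<delta> * nX u powr p - C \<le> Bop u u" for u by auto
  \<comment> \<open>For a dropped index \<open>E i = 0\<close>, so the first term vanishes and the
    component is just \<open>c i\<close>.\<close>
  define F where "F c i = Bop (lin E n c) (E i) + (if kept e i then 0 else c i)" for c i
  \<comment> \<open>The first summand makes the gradient norm large enough for \<delta> t^p - C >= 1
    on the faces of kept coordinates. On the faces of dropped ones the square R^2 >= R >= C + 1
    outweighs the lower bound -C.\<close>
  define R where "R = \<kappa> * ((C + 1) / \<delta>) powr (1 / p) + C + 1"
  have R: "0 < R" "\<kappa> * ((C + 1) / \<delta>) powr (1 / p) \<le> R" "C + 1 \<le> R"
    using \<kappa>(1) \<delta>(2) by (auto simp: R_def intro!: add_nonneg_pos add_nonneg_nonneg mult_nonneg_nonneg)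
  have Fsum: "(\<Sum>j<n. F c j * c j) = Bop (lin E n c) (lin E n c) + (\<Sum>j<n. if kept e j then 0 else (c j)\<^sup>2)" for c
  proof -
    have "Bop (lin E n c) (lin E n c) = (\<Sum>j<n. c j * Bop (lin E n c) (E j))"
      using Bop_sum[of _ E, OF LX[of n c] E, of c n] by (simp only: lin_def)
    then show ?thesis
      by (simp add: sum.distrib[symmetric]) (intro sum.cong, auto simp: F_def algebra_simps power2_eq_square)
  qed
  have "cube_continuous n R F"
    unfolding cube_continuous_def
  proof (intro allI impI)
    fix C' :: "nat \<Rightarrow> nat \<Rightarrow> real" and c i
    assume lim: "\<forall>j<n. (\<lambda>k::nat. C' k j) \<longlonglongrightarrow> c j" and i: "i < n"
    have "(\<lambda>k. nX (\<lambda>x. lin E n (C' k) x - lin E n c x)) \<longlonglongrightarrow> 0"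
    proof (rule Lim_null_comparison, intro always_eventually allI)
      show "norm (nX (\<lambda>x. lin E n (C' k) x - lin E n c x)) \<le> (\<Sum>j<n. \<bar>C' k j - c j\<bar> * nX (E j))" for k
        using nX_sum[of E "\<lambda>i. C' k i - c i" n, OF E, folded lin_def] unfolding lin_diff
        by (simp add: pnorm_nonneg)
      have "(\<lambda>k. \<Sum>j<n. \<bar>C' k j - c j\<bar> * nX (E j)) \<longlonglongrightarrow> (\<Sum>j<n. \<bar>c j - c j\<bar> * nX (E j))"
        using lim by (intro tendsto_intros) auto
      then show "(\<lambda>k. \<Sum>j<n. \<bar>C' k j - c j\<bar> * nX (E j)) \<longlonglongrightarrow> 0" by simp
    qed
    then have "(\<lambda>k. Bop (lin E n (C' k)) (E i)) \<longlonglongrightarrow> Bop (lin E n c) (E i)"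
      by (intro Bop_demicontinuous LX E)
    then show "(\<lambda>k. F (C' k) i) \<longlonglongrightarrow> F c i"
      unfolding F_def using lim i by (cases "kept e i") (auto intro!: tendsto_add)
  qed
  moreover have "0 < (\<Sum>j<n. F c j * c j)" if c: "c \<in> cube n R" "i < n" "\<bar>c i\<bar> = R" for c i
  proof (cases "kept e i")
    case True
    have "\<kappa> * ((C + 1) / \<delta>) powr (1 / p) \<le> \<kappa> * nX (lin E n c)" using \<kappa>(2)[OF c(2) True, of c] c(3) R(2) by linarith
    then have "((C + 1) / \<delta>) powr (1 / p) \<le> nX (lin E n c)" using \<kappa>(1) by simp
    then have "(((C + 1) / \<delta>) powr (1 / p)) powr p \<le> nX (lin E n c) powr p" using p_bounds by (intro powr_mono2) auto
    then have "(C + 1) / \<delta> \<le> nX (lin E n c) powr p" using p_bounds \<delta> by (simp add: powr_powr)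
    then have "C + 1 \<le> \<delta> * nX (lin E n c) powr p" using \<delta>(1) by (simp add: field_simps)
    then have "0 < Bop (lin E n c) (lin E n c)" using \<delta>(3)[OF LX, of n c] by linarith
    then show ?thesis unfolding Fsum by (intro add_pos_nonneg sum_nonneg) auto
  next
    case False
    have "0 \<le> \<delta> * nX (lin E n c) powr p" using \<delta>(1) by simp
    then have 1: "- C \<le> Bop (lin E n c) (lin E n c)" using \<delta>(3)[OF LX, of n c] by linarith
    have "R * 1 \<le> R * R" using R \<delta>(2) by (intro mult_left_mono) auto
    moreover have "R * R = (c i)\<^sup>2" using c(3) by (metis power2_abs power2_eq_square)
    moreover have "(c i)\<^sup>2 \<le> (\<Sum>j<n. if kept e j then 0 else (c j)\<^sup>2)"
      using member_le_sum[of i "{..<n}" "\<lambda>j. if kept e j then 0 else (c j)\<^sup>2"] c(2) False by auto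
    ultimately show ?thesis unfolding Fsum using 1 R(3) by linarith
  qed
  ultimately obtain c where c: "\<And>i. i < n \<Longrightarrow> F c i = 0"
    using coercive_zero[OF R(1), of n F] by blast
  have zero: "Bop (lin E n c) (E i) = 0" if i: "i < n" for i
  proof (cases "kept e i")
    case True
    then show ?thesis using c[OF i] by (simp add: F_def)
  next
    case False
    then have "E i = (\<lambda>x. 0)" by (simp add: E_def prune_def)
    then show ?thesis using Bop_zero[OF LX] by simp
  qed
  have "Bop (lin E n c) (lin E n c) = (\<Sum>j<n. c j * Bop (lin E n c) (E j))"
    using Bop_sum[of _ E, OF LX[of n c] E, of c n] by (simp only: lin_def)
  then have "Bop (lin E n c) (lin E n c) = 0" using zero by simp
  then show ?thesis using zero LX by (intro bexI[of _ "lin E n c"]) (auto simp: E_def)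
qed

text \<open>The v with \<open>Bop (U n) v\<close> tending to 0 form a linear set, closed because the
  functionals \<open>Bop (U n)\<close> are uniformly bounded. It thus suffices to treat the dense
  sequence.\<close>

lemma galerkin:
  "\<exists>U R. (\<forall>n::nat. U n \<in> X) \<and> (\<forall>n. nX (U n) \<le> R) \<and> (\<forall>n. Bop (U n) (U n) = 0) \<and>
    (\<forall>v\<in>X. (\<lambda>n. Bop (U n) v) \<longlonglongrightarrow> 0)"
proof -
  from X_separable obtain e :: "nat \<Rightarrow> 'a \<Rightarrow> real" where
    e: "(\<forall>n. e n \<in> X) \<and> (\<forall>u\<in>X. \<forall>d>0. \<exists>n. pnorm M p (\<lambda>x. grd u x - grd (e n) x) < d)" ..
  note dense = conjunct2[OF e] and e = conjunct1[OF e, rule_format]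
  have "\<exists>u. u \<in> X \<and> Bop u u = 0 \<and> (\<forall>i<n. Bop u (prune e i) = 0)" for n
    using galerkin_step[of e, OF e, of n] unfolding Bex_def .
  then have "\<exists>U. \<forall>n. U n \<in> X \<and> Bop (U n) (U n) = 0 \<and> (\<forall>i<n. Bop (U n) (prune e i) = 0)" by (rule choice[OF allI])
  then obtain U where "\<forall>n. U n \<in> X \<and> Bop (U n) (U n) = 0 \<and> (\<forall>i<n. Bop (U n) (prune e i) = 0)" ..
  then have U: "U n \<in> X" "Bop (U n) (U n) = 0" "i < n \<Longrightarrow> Bop (U n) (prune e i) = 0" for n i by auto
  from Bop_coercive obtain \<delta> C where
    "0 < \<delta> \<and> 0 \<le> C \<and> (\<forall>u\<in>X. \<delta> * nX u powr p - C \<le> Bop u u)" by (elim exE conjE) (rule that, intro conjI)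
  then have \<delta>: "0 < \<delta>" "0 \<le> C" "u \<in> X \<Longrightarrow> \<delta> * nX u powr p - C \<le> Bop u u" for u by auto
  \<comment> \<open>Coercivity at a solution reads \<delta> t^p - C <= 0.\<close>
  define R where "R = (C / \<delta>) powr (1 / p)"
  have bound: "nX (U n) \<le> R" for n
  proof -
    have "nX (U n) powr p \<le> C / \<delta>" using \<delta>(3)[OF U(1), of n] U(2)[of n] \<delta>(1) by (simp add: field_simps)
    then have "(nX (U n) powr p) powr (1 / p) \<le> R" unfolding R_def using p_bounds by (intro powr_mono2) auto
    then show ?thesis using p_bounds by (simp add: powr_powr)
  qed
  obtain B where B: "0 \<le> B" "\<And>n v. v \<in> X \<Longrightarrow> \<bar>Bop (U n) v\<bar> \<le> B * nX v"
    using Bop_bound[of R] U(1) bound by blast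
  define V where "V v \<longleftrightarrow> v \<in> X \<and> (\<lambda>n. Bop (U n) v) \<longlonglongrightarrow> 0" for v
  have closed: "V v" if v: "v \<in> X" and near: "\<And>d. 0 < d \<Longrightarrow> \<exists>w. V w \<and> nX (\<lambda>x. v x - w x) < d" for v
    unfolding V_def
  proof (intro conjI v LIMSEQ_I)
    fix \<epsilon> :: real assume \<epsilon>: "0 < \<epsilon>"
    have "0 < \<epsilon> / (2 * (B + 1))" using \<epsilon> B(1) by simp
    then obtain w where w: "V w" "nX (\<lambda>x. v x - w x) < \<epsilon> / (2 * (B + 1))" using near by blast
    have wX: "w \<in> X" and wl: "(\<lambda>n. Bop (U n) w) \<longlonglongrightarrow> 0" using w(1) by (auto simp: V_def)
    have "B * nX (\<lambda>x. v x - w x) \<le> (B + 1) * (\<epsilon> / (2 * (B + 1)))" using w(2) B(1) by (intro mult_mono) auto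
    also have "\<dots> = \<epsilon> / 2" using B(1) by (simp add: field_simps)
    finally have small: "B * nX (\<lambda>x. v x - w x) \<le> \<epsilon> / 2" .
    obtain N where N: "\<And>n. n \<ge> N \<Longrightarrow> norm (Bop (U n) w - 0) < \<epsilon> / 2"
      using LIMSEQ_D[OF wl, of "\<epsilon> / 2"] \<epsilon> by auto
    have "norm (Bop (U n) v - 0) < \<epsilon>" if "n \<ge> N" for n
      using N[OF that] B(2)[OF X_diff(1)[OF v wX], of n] Bop_diff[OF U(1) v wX, of n] small by simp
    then show "\<exists>N. \<forall>n\<ge>N. norm (Bop (U n) v - 0) < \<epsilon>" by blast
  qed
  have span: "V (lin e n c)" if "\<And>i. i < n \<Longrightarrow> V (e i)" for n c
    unfolding V_def
  proof (intro conjI lin_X e)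
    have "(\<lambda>k. \<Sum>i<n. c i * Bop (U k) (e i)) \<longlonglongrightarrow> (\<Sum>i<n. c i * 0)"
      using that by (intro tendsto_intros) (auto simp: V_def)
    then show "(\<lambda>k. Bop (U k) (lin e n c)) \<longlonglongrightarrow> 0"
      using Bop_sum[of _ e, OF U(1) e] by (simp add: lin_def)
  qed
  \<comment> \<open>Strong induction undoes the pruning: a kept element is tested to zero by all
    later equations, and a dropped one is a limit of combinations of its predecessors.\<close>
  have Ve: "V (e i)" for i
  proof (induction i rule: less_induct)
    case (less i)
    show ?case
    proof (cases "kept e i")
      case True
      then have "Bop (U n) (e i) = 0" if "n > i" for n using U(3)[OF that] by (simp add: prune_def)
      then have "(\<lambda>n. Bop (U n) (e i)) \<longlonglongrightarrow> 0"
        by (intro tendsto_eventually eventually_mono[OF eventually_gt_at_top[of i]])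
      then show ?thesis using e by (simp add: V_def)
    next
      case False
      show ?thesis
      proof (rule closed[OF e])
        fix d :: real assume "0 < d"
        then obtain c where "nX (\<lambda>x. e i x - lin e i c x) < d" using False by (auto simp: kept_def not_le)
        then show "\<exists>w. V w \<and> nX (\<lambda>x. e i x - w x) < d" using span[of i c] less by blast
      qed
    qed
  qed
  have "V v" if v: "v \<in> X" for v
  proof (rule closed[OF v])
    fix d :: real assume "0 < d"
    then obtain n where "pnorm M p (\<lambda>x. grd v x - grd (e n) x) < d" using dense v by blast
    then show "\<exists>w. V w \<and> nX (\<lambda>x. v x - w x) < d" using Ve[of n] grad_diff_pnorm[OF v e, of n] by (intro exI[of _ "e n"]) simp
  qed
  then show ?thesis using U(1,2) bound by (intro exI[of _ U] exI[of _ R]) (auto simp: V_def)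
qed

theorem solution_exists: "\<exists>u. strong_generalized_solution \<Omega> p q T f u"
proof -
  from galerkin obtain U0 R where "(\<forall>n::nat. U0 n \<in> X) \<and> (\<forall>n. nX (U0 n) \<le> R) \<and>
    (\<forall>n. Bop (U0 n) (U0 n) = 0) \<and> (\<forall>v\<in>X. (\<lambda>n. Bop (U0 n) v) \<longlonglongrightarrow> 0)" by (elim exE) (rule that)
  then have U0: "U0 n \<in> X" "nX (U0 n) \<le> R" "Bop (U0 n) (U0 n) = 0" "v \<in> X \<Longrightarrow> (\<lambda>n. Bop (U0 n) v) \<longlonglongrightarrow> 0" for n v
    by auto
  from weak_compactness[of U0, OF U0(1,2)] obtain \<rho> u where \<rho>: "strict_mono (\<rho> :: nat \<Rightarrow> nat)" and u: "u \<in> X"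
    and wk: "\<And>g. g \<in> Lp M (conjx p) \<Longrightarrow> (\<lambda>n. \<integral>x. g x \<bullet> grd (U0 (\<rho> n)) x \<partial>M) \<longlonglongrightarrow> (\<integral>x. g x \<bullet> grd u x \<partial>M)" by (elim exE conjE) (rule that, auto)
  define U where "U n = U0 (\<rho> n)" for n
  have U: "U n \<in> X" "nX (U n) \<le> R" "Bop (U n) (U n) = 0" for n using U0 by (auto simp: U_def)
  have BU: "(\<lambda>n. Bop (U n) v) \<longlonglongrightarrow> 0" if "v \<in> X" for v
    using LIMSEQ_subseq_LIMSEQ[OF U0(4)[OF that] \<rho>] by (simp add: U_def o_def)
  have wX: "weakly_converges X (W10_norm \<Omega> p) U u"
    using wk by (intro weakly_converges_X U(1) u) (simp add: U_def)
  have wD: "weakly_converges (Wdual \<Omega> p) (Wdual_norm \<Omega> p) (\<lambda>n. Bop (U n)) (\<lambda>v. 0)"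
    by (intro weakly_converges_Wdual Bop_dual U(1) BU)
  define W where "W n = (\<lambda>x. U n x - u x)" for n
  have W: "W n \<in> X" for n unfolding W_def by (rule X_diff(1)[OF U(1) u])
  have Wb: "nX (W n) \<le> R + nX u" for n
    unfolding W_def using nX_diff[OF U(1) u, of n] U(2)[of n] by simp
  have "(\<lambda>n. l (W n)) \<longlonglongrightarrow> 0" if l: "l \<in> dual_space X (W10_norm \<Omega> p)" for l
  proof -
    have "(\<lambda>n. l (U n) - l u) \<longlonglongrightarrow> l u - l u"
      using wX l unfolding weakly_converges_def by (intro tendsto_intros) blast
    then show ?thesis using dual_diff[OF l U(1) u] by (simp add: W_def)
  qed
  \<comment> \<open>Convergence is taken in L^k because the reactions are bounded in the conjugate
    space L^m, so Hoelder turns it into the vanishing of their pairing with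
    \<open>W n\<close>.\<close>
  note strong = weak_imp_strong[where W = W, OF W Wb this k_bounds(3,2)]
  obtain A where A: "0 \<le> A" "\<And>w. w \<in> X \<Longrightarrow> nX w \<le> R \<Longrightarrow> pnorm M m (rf w) \<le> A" using rf_bound[of R] by blast
  have react: "(\<lambda>n. reaction \<Omega> f (T (U n)) (W n)) \<longlonglongrightarrow> 0"
  proof (rule Lim_null_comparison, intro always_eventually allI)
    fix n
    have "norm (reaction \<Omega> f (T (U n)) (W n)) \<le> pnorm M m (rf (U n)) * pnorm M k (W n)"
      using reaction_integrable(2)[OF U(1) W] by (simp only: reaction_eq real_norm_def)
    also have "\<dots> \<le> A * pnorm M k (W n)" using A(2)[OF U(1,2)] by (intro mult_right_mono) auto
    finally show "norm (reaction \<Omega> f (T (U n)) (W n)) \<le> A * pnorm M k (W n)" .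
    show "(\<lambda>n. A * pnorm M k (W n)) \<longlonglongrightarrow> 0" using tendsto_mult_left[OF strong, of A] by simp
  qed
  have "competing_op \<Omega> p q (U n) (W n) = reaction \<Omega> f (T (U n)) (W n) - Bop (U n) u" for n
    using Bop_diff[OF U(1) U(1) u, of n n] U(3)[of n] by (simp add: W_def Bop_def)
  then have c: "(\<lambda>n. competing_op \<Omega> p q (U n) (W n)) \<longlonglongrightarrow> 0"
    using tendsto_diff[OF react BU[OF u]] by simp
  have "Bop (U n) = (\<lambda>v. competing_op \<Omega> p q (U n) v - reaction \<Omega> f (T (U n)) v)" for n
    by (simp add: Bop_def fun_eq_iff)
  with wD have wD': "weakly_converges (Wdual \<Omega> p) (Wdual_norm \<Omega> p)
      (\<lambda>n v. competing_op \<Omega> p q (U n) v - reaction \<Omega> f (T (U n)) v) (\<lambda>v. 0)" by simp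
  show ?thesis
    unfolding strong_generalized_solution_def
    using u U(1) wX wD' c by (intro exI[of _ u] conjI exI[of _ U]) (auto simp: W_def)
qed

end

theorem theorem1:
  fixes \<Omega> :: "'a::euclidean_space set"
    and p q pstar a1 a2 \<alpha> \<beta> r K1 K2 K3 :: real
    and S :: "real \<Rightarrow> real"
    and T :: "('a \<Rightarrow> real) \<Rightarrow> 'a \<Rightarrow> real"
    and f :: "'a \<Rightarrow> real \<Rightarrow> 'a \<Rightarrow> real"
    and \<sigma> :: "'a \<Rightarrow> real"
  assumes domain: "bounded_lipschitz_domain \<Omega>"
    and exponents: "1 < q" "q < p" "p < real DIM('a)"
    and pstar: "pstar = crit_exp (real DIM('a)) p"
    and S: "sobolev_constants \<Omega> p S"
    and T_into: "\<And>u. u \<in> W10 \<Omega> p \<Longrightarrow> T u \<in> W1 \<Omega> p"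
    and T_continuous: "seminorm_continuous (W10 \<Omega> p) (W10_norm \<Omega> p) (W1_norm \<Omega> p) T"
    and f: "caratheodory \<Omega> f"
    and a: "0 \<le> a1" "0 \<le> a2"
    and \<alpha>: "0 < \<alpha>" "\<alpha> < pstar - 1"
    and \<beta>: "0 < \<beta>" "\<beta> < p / real_of_ereal (conj_exp pstar)"
    and r: "1 \<le> r" "r < pstar"
    and \<sigma>: "\<sigma> \<in> Lspace \<Omega> (conj_exp r)"
    and growth: "AE x in lebesgue_on \<Omega>. \<forall>s \<xi>.
        \<bar>f x s \<xi>\<bar> \<le> \<sigma> x + a1 * \<bar>s\<bar> powr \<alpha> + a2 * norm \<xi> powr \<beta>"
    and K: "0 \<le> K1" "0 \<le> K2" "0 \<le> K3"
    and small: "a1 * K1 * S (pstar / (pstar - \<alpha>)) + a2 * K2 * S (p / (p - \<beta>)) < 1"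
    and T_bound: "\<And>u. u \<in> W10 \<Omega> p \<Longrightarrow>
        ennreal_powr (Lnorm \<Omega> pstar (T u)) \<alpha>
          \<le> ennreal K1 * ennreal_powr (Lnorm \<Omega> p (wgrad \<Omega> u)) (p - 1) + ennreal K3"
    and grad_T_bound: "\<And>u. u \<in> W10 \<Omega> p \<Longrightarrow>
        ennreal_powr (Lnorm \<Omega> p (wgrad \<Omega> (T u))) \<beta>
          \<le> ennreal K2 * ennreal_powr (Lnorm \<Omega> p (wgrad \<Omega> u)) (p - 1) + ennreal K3"
  shows "\<exists>u. strong_generalized_solution \<Omega> p q T f u"
proof -
  have "open \<Omega>" "bounded \<Omega>" using domain by (auto simp: bounded_lipschitz_domain_def)
  then interpret dirichlet \<Omega> p pstar S q a1 a2 \<alpha> \<beta> r K1 K2 K3 T f \<sigma>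
    using assms by unfold_locales auto
  show ?thesis by (rule solution_exists)
qed

end
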